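(* Let $u^0\in L^2(\Omega)$ and $f\equiv 0$. Let $u_h(t)$ be the solution of the semidiscrete finite element problem and let $\tilde u_h^n$ be the solution of the fully discrete scheme (CN-I) with step size $\tau=T/N$ (both defined in the context). Then there is a constant $c>0$, independent of $\tau$, $n$, $h$ and $u^0$, such that for $1\le n\le N$ $$\|u_h(t_n)-\tilde u_h^n\|\le c\,\tau^2 t_n^{-2}\|u^0\|.$$
   Context: Let $0<\alpha<1$, $T>0$, and let $\Omega\subset\mathbb{R}^d$ ($d=1,2$) be a bounded domain. $A$ is a self-adjoint positive definite second-order elliptic partial differential operator in $\Omega$ with homogeneous Dirichlet boundary condition, with associated bilinear form $A(\cdot,\cdot)$. $(\cdot,\cdot)$ and $\|\cdot\|$ are the inner product and norm of $L^2(\Omega)$. The underlying problem is ${}^{C}D_t^\alpha u+Au=f$ in $\Omega\times(0,T]$, $u=0$ on $\partial\Omega\times(0,T]$, $u(0)=u^0$, where ${}^{C}D_t^{\alpha}u(t)=\frac{1}{\Gamma(1-\alpha)}\int_0^t(t-\zeta)^{-\alpha}u'(\zeta)\,d\zeta$ is the Caputo derivative. Semidiscrete problem. $X_h\subset H_0^1(\Omega)$ is the space of continuous piecewise linear finite elements on a regular triangulation of $\Omega$ of maximal diameter $h$; $P_h:L^2(\Omega)\to X_h$ is the $L^2$-projection; $A_h:X_h\to X_h$ is defined by $(A_h\varphi,\psi)=A(\varphi,\psi)$ for all $\varphi,\psi\in X_h$; $f_h=P_hf$. $u_h$ solves ${}^{C}D_t^\alpha u_h(t)+A_hu_h(t)=f_h(t)$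 for $t>0$, $u_h(0)=P_hu^0$. Scheme (CN-I). Let $N\in\mathbb{N}$, $\tau=T/N$, $t_n=n\tau$. Let $F_h(t)=\int_0^tf_h(\xi)\,d\xi$ and $F_h^n=F_h(t_n)$. Let $\sigma_0=1$, $\sigma_j=(1-\frac{\alpha+1}{j})\sigma_{j-1}$ for $j\ge1$, i.e. $\sum_{j\ge0}\sigma_jz^j=(1-z)^\alpha$. Let $D_\tau$ be the second-order BDF operator $D_\tau\varphi(t)=\frac1\tau\big(\frac32\varphi(t)-2\varphi(t-\tau)+\frac12\varphi(t-2\tau)\big)$; all functions (including $t^{2-\alpha}$, $F_h$, $\tilde U_h$) are taken to be $0$ for $t\le0$, so $\tilde U_h^{0}=\tilde U_h^{-1}=0$. For $n=1,\dots,N$ the scheme determines $\tilde U_h^n,\tilde u_h^n\in X_h$ by $$\tau^{-\alpha}\sum_{j=0}^{n}\sigma_j\tilde U_h^{n-j}+(1-\tfrac\alpha2)A_h\tilde U_h^n+\tfrac\alpha2A_h\tilde U_h^{n-1}=(1-\tfrac\alpha2)F_h^n+\tfrac\alpha2F_h^{n-1}+(1-\tfrac\alpha2)D_\tau\frac{t_n^{2-\alpha}}{\Gamma(3-\alpha)}u_h(0)+\tfrac\alpha2D_\tau\frac{t_{n-1}^{2-\alpha}}{\Gamma(3-\alpha)}u_h(0),$$ $$\tilde u_h^n=\frac1\tau\Big(\frac32\tilde U_h^n-2\tilde U_h^{n-1}+\frac12\tilde U_h^{n-2}\Big).$$ *)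

theory Defs
  imports "HOL-Analysis.Analysis"
begin

definition bounded_domain :: "(real ^ 'n) set \<Rightarrow> bool" where
  "bounded_domain \<Omega> \<longleftrightarrow> open \<Omega> \<and> connected \<Omega> \<and> bounded \<Omega> \<and> \<Omega> \<noteq> {}"

text \<open>Square-integrable functions, not identified up to null sets.\<close>

definition L2 :: "(real ^ 'n) set \<Rightarrow> (real ^ 'n \<Rightarrow> real) set" where
  "L2 \<Omega> = {v. v \<in> borel_measurable (lebesgue_on \<Omega>) \<and> integrable (lebesgue_on \<Omega>) (\<lambda>x. (v x)\<^sup>2)}"

definition l2_inner :: "(real ^ 'n) set \<Rightarrow> (real ^ 'n \<Rightarrow> real) \<Rightarrow> (real ^ 'n \<Rightarrow> real) \<Rightarrow> real" where
  "l2_inner \<Omega> u v = (\<integral>x. u x * v x \<partial>lebesgue_on \<Omega>)"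

definition l2_norm :: "(real ^ 'n) set \<Rightarrow> (real ^ 'n \<Rightarrow> real) \<Rightarrow> real" where
  "l2_norm \<Omega> u = sqrt (l2_inner \<Omega> u u)"

definition partial_deriv :: "'n \<Rightarrow> (real ^ 'n \<Rightarrow> real) \<Rightarrow> real ^ 'n \<Rightarrow> real" where
  "partial_deriv i \<phi> x = frechet_derivative \<phi> (at x) (axis i 1)"

primrec C_k :: "nat \<Rightarrow> (real ^ 'n \<Rightarrow> real) \<Rightarrow> bool" where
  "C_k 0 \<phi> \<longleftrightarrow> continuous_on UNIV \<phi>"
| "C_k (Suc k) \<phi> \<longleftrightarrow> (\<forall>x. \<phi> differentiable (at x)) \<and> (\<forall>i. C_k k (partial_deriv i \<phi>))"

definition test_function :: "(real ^ 'n) set \<Rightarrow> (real ^ 'n \<Rightarrow> real) \<Rightarrow> bool" where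
  "test_function \<Omega> \<phi> \<longleftrightarrow>
     (\<forall>k. C_k k \<phi>) \<and> compact (closure {x. \<phi> x \<noteq> 0}) \<and> closure {x. \<phi> x \<noteq> 0} \<subseteq> \<Omega>"

definition has_weak_gradient ::
    "(real ^ 'n) set \<Rightarrow> (real ^ 'n \<Rightarrow> real) \<Rightarrow> (real ^ 'n \<Rightarrow> real ^ 'n) \<Rightarrow> bool" where
  "has_weak_gradient \<Omega> v G \<longleftrightarrow>
     (\<forall>i. (\<lambda>x. G x $ i) \<in> L2 \<Omega>) \<and>
     (\<forall>\<phi> i. test_function \<Omega> \<phi> \<longrightarrow>
        l2_inner \<Omega> v (partial_deriv i \<phi>) = - l2_inner \<Omega> (\<lambda>x. G x $ i) \<phi>)"

definition H1 :: "(real ^ 'n) set \<Rightarrow> (real ^ 'n \<Rightarrow> real) set" where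
  "H1 \<Omega> = {v \<in> L2 \<Omega>. \<exists>G. has_weak_gradient \<Omega> v G}"

text \<open>The weak gradient is determined only up to null sets; it is used only under integrals.\<close>

definition weak_grad :: "(real ^ 'n) set \<Rightarrow> (real ^ 'n \<Rightarrow> real) \<Rightarrow> real ^ 'n \<Rightarrow> real ^ 'n" where
  "weak_grad \<Omega> v = (SOME G. has_weak_gradient \<Omega> v G)"

definition h1_norm :: "(real ^ 'n) set \<Rightarrow> (real ^ 'n \<Rightarrow> real) \<Rightarrow> real" where
  "h1_norm \<Omega> v = sqrt ((l2_norm \<Omega> v)\<^sup>2 + (\<Sum>i\<in>UNIV. (l2_norm \<Omega> (\<lambda>x. weak_grad \<Omega> v x $ i))\<^sup>2))"

definition H1_0 :: "(real ^ 'n) set \<Rightarrow> (real ^ 'n \<Rightarrow> real) set" where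
  "H1_0 \<Omega> = {v \<in> H1 \<Omega>. \<forall>\<epsilon>>0. \<exists>\<phi>. test_function \<Omega> \<phi> \<and> h1_norm \<Omega> (\<lambda>x. v x - \<phi> x) < \<epsilon>}"

text \<open>
  The formally self-adjoint operator \<open>A u = - div (a \<nabla>u) + q u\<close> enters through its bilinear form.
  The zeroth-order coefficient \<open>q\<close> may change sign, as long as the form stays positive definite.
\<close>

definition elliptic_form :: "(real ^ 'n) set \<Rightarrow> (real ^ 'n \<Rightarrow> real ^ 'n ^ 'n) \<Rightarrow> (real ^ 'n \<Rightarrow> real) \<Rightarrow>
    (real ^ 'n \<Rightarrow> real) \<Rightarrow> (real ^ 'n \<Rightarrow> real) \<Rightarrow> real" where
  "elliptic_form \<Omega> a q u v =
     (\<integral>x. (a x *v weak_grad \<Omega> u x) \<bullet> weak_grad \<Omega> v x + q x * u x * v x \<partial>lebesgue_on \<Omega>)"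

definition elliptic_operator ::
    "(real ^ 'n) set \<Rightarrow> (real ^ 'n \<Rightarrow> real ^ 'n ^ 'n) \<Rightarrow> (real ^ 'n \<Rightarrow> real) \<Rightarrow> bool" where
  "elliptic_operator \<Omega> a q \<longleftrightarrow>
     a \<in> borel_measurable (lebesgue_on \<Omega>) \<and> bounded (a ` \<Omega>) \<and>
     q \<in> borel_measurable (lebesgue_on \<Omega>) \<and> bounded (q ` \<Omega>) \<and>
     (\<forall>x\<in>\<Omega>. transpose (a x) = a x) \<and>
     (\<exists>\<theta>>0. \<forall>x\<in>\<Omega>. \<forall>\<xi>. \<theta> * (norm \<xi>)\<^sup>2 \<le> (a x *v \<xi>) \<bullet> \<xi>)"

definition positive_definite_operator ::
    "(real ^ 'n) set \<Rightarrow> (real ^ 'n \<Rightarrow> real ^ 'n ^ 'n) \<Rightarrow> (real ^ 'n \<Rightarrow> real) \<Rightarrow> bool" where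
  "positive_definite_operator \<Omega> a q \<longleftrightarrow>
     (\<forall>v\<in>H1_0 \<Omega>. l2_norm \<Omega> v \<noteq> 0 \<longrightarrow> 0 < elliptic_form \<Omega> a q v v)"

text \<open>
  A regular triangulation of \<open>\<Omega>\<close> of maximal diameter \<open>h\<close>: a conforming mesh of nondegenerate
  simplices, each containing a ball of diameter at least \<open>1 / \<kappa>\<close> times its own.  The elements
  either cover the closure of \<open>\<Omega>\<close> exactly (polygonal \<open>\<Omega>\<close>) or, as is usual when the
  boundary is curved, form a polygonal region inside it whose boundary vertices lie on the boundary
  of \<open>\<Omega>\<close>; the exact case satisfies the vertex condition automatically.
\<close>

definition regular_triangulation ::
    "(real ^ 'n) set \<Rightarrow> real \<Rightarrow> real \<Rightarrow> (real ^ 'n) set set \<Rightarrow> bool" where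
  "regular_triangulation \<Omega> \<kappa> h \<T> \<longleftrightarrow>
     triangulation \<T> \<and> \<T> \<noteq> {} \<and>
     (\<forall>K\<in>\<T>. int CARD('n) simplex K \<and> K \<subseteq> closure \<Omega> \<and>
        (\<exists>x r. 0 < r \<and> cball x r \<subseteq> K \<and> diameter K \<le> \<kappa> * (2 * r)) \<and>
        (\<forall>p. p extreme_point_of K \<and> p \<in> frontier (\<Union>\<T>) \<longrightarrow> p \<in> frontier \<Omega>)) \<and>
     h = Max (diameter ` \<T>)"

definition affine_fun_on :: "(real ^ 'n) set \<Rightarrow> (real ^ 'n \<Rightarrow> real) \<Rightarrow> bool" where
  "affine_fun_on K v \<longleftrightarrow> (\<exists>g b. \<forall>x\<in>K. v x = g \<bullet> x + b)"

text \<open>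
  The elements of the finite element space are genuine functions, extended by \<open>0\<close>, so equality in
  the space is pointwise equality.
\<close>

definition fe_space :: "(real ^ 'n) set \<Rightarrow> (real ^ 'n) set set \<Rightarrow> (real ^ 'n \<Rightarrow> real) set" where
  "fe_space \<Omega> \<T> = {v \<in> H1_0 \<Omega>. continuous_on UNIV v \<and> (\<forall>K\<in>\<T>. affine_fun_on K v) \<and>
     (\<forall>x. x \<notin> \<Omega> \<inter> \<Union>\<T> \<longrightarrow> v x = 0)}"

definition l2_proj ::
    "(real ^ 'n) set \<Rightarrow> (real ^ 'n) set set \<Rightarrow> (real ^ 'n \<Rightarrow> real) \<Rightarrow> real ^ 'n \<Rightarrow> real" where
  "l2_proj \<Omega> \<T> w =
     (THE \<phi>. \<phi> \<in> fe_space \<Omega> \<T> \<and> (\<forall>\<psi>\<in>fe_space \<Omega> \<T>. l2_inner \<Omega> \<phi> \<psi> = l2_inner \<Omega> w \<psi>))"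

definition discrete_op :: "(real ^ 'n) set \<Rightarrow> (real ^ 'n \<Rightarrow> real ^ 'n ^ 'n) \<Rightarrow> (real ^ 'n \<Rightarrow> real) \<Rightarrow>
    (real ^ 'n) set set \<Rightarrow> (real ^ 'n \<Rightarrow> real) \<Rightarrow> real ^ 'n \<Rightarrow> real" where
  "discrete_op \<Omega> a q \<T> \<phi> =
     (THE w. w \<in> fe_space \<Omega> \<T> \<and>
        (\<forall>\<psi>\<in>fe_space \<Omega> \<T>. l2_inner \<Omega> w \<psi> = elliptic_form \<Omega> a q \<phi> \<psi>))"

definition caputo :: "real \<Rightarrow> (real \<Rightarrow> real) \<Rightarrow> real \<Rightarrow> real" where
  "caputo \<alpha> u t =
     1 / Gamma (1 - \<alpha>) * (LINT \<zeta>:{0<..<t}|lborel. (t - \<zeta>) powr (- \<alpha>) * deriv u \<zeta>)"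

definition caputo_exists :: "real \<Rightarrow> (real \<Rightarrow> real) \<Rightarrow> real \<Rightarrow> bool" where
  "caputo_exists \<alpha> u t \<longleftrightarrow>
     set_integrable lborel {0<..<t} (\<lambda>\<zeta>. (t - \<zeta>) powr (- \<alpha>) * deriv u \<zeta>)"

text \<open>
  Time derivatives and integrals of functions with values in the finite element space are taken
  pointwise in \<open>x\<close>; since the space is finite-dimensional, this agrees with taking them in norm.
  Differentiability is required for \<open>t > 0\<close> only: the solution has a derivative of order
  \<open>t powr (\<alpha> - 1)\<close> at \<open>0\<close>.
\<close>

definition semidiscrete_solution :: "real \<Rightarrow> (real ^ 'n) set \<Rightarrow> (real ^ 'n \<Rightarrow> real ^ 'n ^ 'n) \<Rightarrow>
    (real ^ 'n \<Rightarrow> real) \<Rightarrow> (real ^ 'n) set set \<Rightarrow> (real \<Rightarrow> real ^ 'n \<Rightarrow> real) \<Rightarrow> (real ^ 'n \<Rightarrow> real) \<Rightarrow>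
    (real \<Rightarrow> real ^ 'n \<Rightarrow> real) \<Rightarrow> bool" where
  "semidiscrete_solution \<alpha> \<Omega> a q \<T> f u0 u \<longleftrightarrow>
     (\<forall>t\<ge>0. u t \<in> fe_space \<Omega> \<T>) \<and>
     u 0 = l2_proj \<Omega> \<T> u0 \<and>
     (\<forall>x. continuous_on {0..} (\<lambda>t. u t x)) \<and>
     (\<forall>x. \<forall>t>0. (\<lambda>s. u s x) differentiable (at t) \<and> caputo_exists \<alpha> (\<lambda>s. u s x) t \<and>
        caputo \<alpha> (\<lambda>s. u s x) t + discrete_op \<Omega> a q \<T> (u t) x = l2_proj \<Omega> \<T> (f t) x)"

text \<open>The Taylor coefficients of \<open>(1 - z) powr \<alpha>\<close> at \<open>0\<close>.\<close>

fun cq_weight :: "real \<Rightarrow> nat \<Rightarrow> real" where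
  "cq_weight \<alpha> 0 = 1"
| "cq_weight \<alpha> (Suc j) = (1 - (\<alpha> + 1) / real (Suc j)) * cq_weight \<alpha> j"

definition bdf2 :: "real \<Rightarrow> (real \<Rightarrow> real) \<Rightarrow> real \<Rightarrow> real" where
  "bdf2 \<tau> \<phi> t = 1 / \<tau> * (3 / 2 * \<phi> t - 2 * \<phi> (t - \<tau>) + 1 / 2 * \<phi> (t - 2 * \<tau>))"

definition frac_monomial :: "real \<Rightarrow> real \<Rightarrow> real" where
  "frac_monomial \<alpha> t = (if t \<le> 0 then 0 else t powr (2 - \<alpha>) / Gamma (3 - \<alpha>))"

definition load_integral :: "(real ^ 'n) set \<Rightarrow> (real ^ 'n) set set \<Rightarrow> (real \<Rightarrow> real ^ 'n \<Rightarrow> real) \<Rightarrow>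
    real \<Rightarrow> real ^ 'n \<Rightarrow> real" where
  "load_integral \<Omega> \<T> f t x = (LINT \<xi>:{0<..t}|lborel. l2_proj \<Omega> \<T> (f \<xi>) x)"

text \<open>The time levels are integers, as the scheme refers to the level \<open>-1\<close>.\<close>

definition CN_I_solution :: "real \<Rightarrow> (real ^ 'n) set \<Rightarrow> (real ^ 'n \<Rightarrow> real ^ 'n ^ 'n) \<Rightarrow>
    (real ^ 'n \<Rightarrow> real) \<Rightarrow> (real ^ 'n) set set \<Rightarrow> (real \<Rightarrow> real ^ 'n \<Rightarrow> real) \<Rightarrow> (real ^ 'n \<Rightarrow> real) \<Rightarrow>
    real \<Rightarrow> nat \<Rightarrow> (int \<Rightarrow> real ^ 'n \<Rightarrow> real) \<Rightarrow> (int \<Rightarrow> real ^ 'n \<Rightarrow> real) \<Rightarrow> bool" where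
  "CN_I_solution \<alpha> \<Omega> a q \<T> f u0 \<tau> N U u \<longleftrightarrow>
     (\<forall>n\<le>0. U n = (\<lambda>x. 0)) \<and>
     (\<forall>n\<in>{1..int N}. U n \<in> fe_space \<Omega> \<T> \<and> u n \<in> fe_space \<Omega> \<T> \<and>
        (\<forall>x. \<tau> powr (- \<alpha>) * (\<Sum>j=0..nat n. cq_weight \<alpha> j * U (n - int j) x)
             + (1 - \<alpha> / 2) * discrete_op \<Omega> a q \<T> (U n) x
             + \<alpha> / 2 * discrete_op \<Omega> a q \<T> (U (n - 1)) x
           = (1 - \<alpha> / 2) * load_integral \<Omega> \<T> f (of_int n * \<tau>) x
             + \<alpha> / 2 * load_integral \<Omega> \<T> f (of_int (n - 1) * \<tau>) x
             + (1 - \<alpha> / 2) * bdf2 \<tau> (frac_monomial \<alpha>) (of_int n * \<tau>) * l2_proj \<Omega> \<T> u0 x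
             + \<alpha> / 2 * bdf2 \<tau> (frac_monomial \<alpha>) (of_int (n - 1) * \<tau>) * l2_proj \<Omega> \<T> u0 x) \<and>
        (\<forall>x. u n x = 1 / \<tau> * (3 / 2 * U n x - 2 * U (n - 1) x + 1 / 2 * U (n - 2) x)))"

end

theory Submission
  imports Defs "HOL-Complex_Analysis.Complex_Analysis" "HOL-Real_Asymp.Real_Asymp"
begin

text \<open>
  In an \<open>L\<^sup>2\<close>-orthonormal eigenbasis of \<open>A\<^sub>h\<close> both problems decouple, and scaling time by \<open>\<tau>\<close> reduces
  the claim to a scalar equation with step size \<open>1\<close> and \<open>\<mu> = \<lambda> \<tau> powr \<alpha>\<close>: the error after \<open>n\<close> steps
  has to be at most \<open>C / n\<^sup>2\<close>, uniformly in \<open>\<mu> > 0\<close>.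

  The exact scalar solution is the Laplace transform at \<open>t\<close> of the Mittag-Leffler density \<open>K\<^sub>\<mu>\<close>.  The
  generating function of the discrete solution has the denominator
  \<open>(1 - z) powr \<alpha> + \<mu> (1 - \<alpha>/2 + \<alpha>/2 z)\<close>, which has no zero in a disc of radius larger than \<open>1\<close>
  slit along the real axis.  Pushing Cauchy's contour onto the cut and substituting \<open>z = exp r\<close>
  represents the discrete solution, up to an exponentially small term, as the integral of
  \<open>exp (- n r)\<close> against \<open>K\<^sub>\<mu> r\<close> perturbed by a relative error \<open>O(r\<^sup>2)\<close>.  Since \<open>K\<^sub>\<mu> r\<close> is bounded by a
  multiple of \<open>1 / r\<close> that does not depend on \<open>\<mu>\<close>, this perturbation costs \<open>O(n\<^sup>-\<^sup>2)\<close>.  The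
  starting data \<open>n powr (2 - \<alpha>)\<close> fit this scheme because they are, up to terms that are again \<open>O(n\<^sup>-\<^sup>2)\<close>,
  a combination of Taylor coefficients of powers of \<open>1 - z\<close>.
\<close>

section \<open>Asymptotic expansion of the starting data\<close>

text \<open>The eigenvalues of A_h are unbounded as the mesh is refined, so every estimate must be
  uniform in \<open>\<mu>\<close>; denominators are bounded below by multiples of
  \<open>cmod W powr \<alpha> + \<mu>\<close>, and \<open>\<mu>\<close> cancels. Second order rests
  on two first-order cancellations on the cut \<open>W = 1 - exp r\<close>: the weight
  \<open>\<alpha>/2\<close> of the scheme equals the linear coefficient of
  \<open>((exp r - 1)/r) powr \<alpha>\<close>, and the coefficient \<open>(\<alpha>-3)/2\<close> in
  the expansion of the data removes the linear terms left by the two BDF factors and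
  \<open>((exp r - 1)/r) powr (\<alpha>-1)\<close>. The exact solution is identified, not
  constructed: a solution of the Caputo equation satisfies a Volterra equation, grows at most
  exponentially and has the Laplace transform of \<open>ml_fun\<close>, and that transform is
  injective. Time derivatives are taken pointwise in \<open>x\<close>, so eigencoordinates are
  written as finite combinations of point values. Weak gradients are arbitrary choices up to null
  sets, so bilinearity of the form rests on their almost everywhere uniqueness. The resulting
  constant depends on \<open>\<alpha>\<close> alone.\<close>

text \<open>With \<open>u = 1/(n+1)\<close>, this is the residual left when the truncated expansion
  \<open>n powr g * (1 + a1/n + a2/n^2 + a3/n^3)\<close> is put into the recurrence
  \<open>(n+1) * c (n+1) = (n+1+g) * c n\<close>, since \<open>n = (n+1) * (1-u)\<close> and
  \<open>1/n = u/(1-u)\<close>. The values \<open>a1\<close>, \<open>a2\<close>, \<open>a3\<close>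
  solve the coefficient equations at \<open>u^2\<close>, \<open>u^3\<close>,
  \<open>u^4\<close>.\<close>

lemma step_poly_bigo:
  fixes g :: real
  defines "a1 \<equiv> g*(g+1)/2" and "a2 \<equiv> (g-1)*g*(g+1)*(3*g+2)/24"
    and "a3 \<equiv> g^2*(g+1)^2*(g-1)*(g-2)/48"
  shows "(\<lambda>u::real. (1 + a1*u + a2*u^2 + a3*u^3) - (1 + g*u) * ((1-u) powr g + a1*u*(1-u) powr (g-1)
            + a2*u^2*(1-u) powr (g-2) + a3*u^3*(1-u) powr (g-3))) \<in> O[at_right 0](\<lambda>u. u^5)"
proof -
  define T where "T = (\<lambda>(d::real) (u::real). 1 - d*u + d*(d-1)/2*u^2 - d*(d-1)*(d-2)/6*u^3 + d*(d-1)*(d-2)*(d-3)/24*u^4)"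
  define r where "r = (\<lambda>d (u::real). (1-u) powr d - T d u)"
  have r: "r d \<in> O[at_right 0](\<lambda>u. u^5)" for d
    unfolding r_def T_def by real_asymp
  have r': "(\<lambda>u. r d u * h u) \<in> O[at_right 0](\<lambda>u. u^5)" if "h \<in> O[at_right 0](\<lambda>_. 1)" for d h
    using landau_o.big.mult[OF r that] by simp
  define P where "P = (\<lambda>u::real. (1 + a1*u + a2*u^2 + a3*u^3) - (1 + g*u) * (T g u + a1*u*T (g-1) u
            + a2*u^2*T (g-2) u + a3*u^3*T (g-3) u))"
  \<comment> \<open>The explicit cofactor: with each power of \<open>1-u\<close> replaced by its
    Taylor polynomial \<open>T\<close>, the residual is exactly \<open>e u * u^5\<close>, because
    the lower coefficients vanish by \<open>c2\<close>, \<open>c3\<close>,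
    \<open>c4\<close>.\<close>
  define e where "e = (\<lambda>u. - ((g*(g-1)*(g-2)*(g-3)/24) * g
      + a1 * (((g-1)*(g-2)*(g-3)*(g-4)/24) * (1+g*u) + g * (- ((g-1)*(g-2)*(g-3)/6)))
      + a2 * ((1+g*u) * (- ((g-2)*(g-3)*(g-4)/6) + ((g-2)*(g-3)*(g-4)*(g-5)/24) * u) + g * ((g-2)*(g-3)/2))
      + a3 * ((1+g*u) * ((g-3)*(g-4)/2 + (- ((g-3)*(g-4)*(g-5)/6)) * u + ((g-3)*(g-4)*(g-5)*(g-6)/24) * u^2) + g * (-(g-3)))))"
  have c4: "g*(g-1)*(g-2)*(g-3)/24 + a1*(-((g-1)*(g-2)*(g-3)/6)) + a2*((g-2)*(g-3)/2) + a3*(-(g-3))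
      + g * (- (g*(g-1)*(g-2)/6) + a1*((g-1)*(g-2)/2) + a2*(-(g-2)) + a3) = 0"
    unfolding a1_def a2_def a3_def by (simp add: field_simps power2_eq_square)
  have c3: "- (g*(g-1)*(g-2)/6) + a1*((g-1)*(g-2)/2) + a2*(-(g-2))
      + g * (g*(g-1)/2 + a1*(-(g-1)) + a2) = 0"
    unfolding a1_def a2_def by (simp add: field_simps power2_eq_square)
  have c2: "g*(g-1)/2 + a1*(-(g-1)) + g * (-g + a1) = 0"
    unfolding a1_def by (simp add: field_simps power2_eq_square)
  have expand: "(1 + a1*u + a2*u^2 + a3*u^3) - (1 + g*u) * ((1 + t1*u + t2*u^2 + t3*u^3 + t4*u^4)
       + a1*u*(1 + x1*u + x2*u^2 + x3*u^3 + x4*u^4) + a2*u^2*(1 + r1*u + r2*u^2 + r3*u^3 + r4*u^4)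
       + a3*u^3*(1 + q1*u + q2*u^2 + q3*u^3 + q4*u^4))
     = - (u*(t1+g)) - (u^2*(t2+a1*x1+g*(t1+a1))) - (u^3*(t3+a1*x2+a2*r1+g*(t2+a1*x1+a2)))
       - (u^4*(t4+a1*x3+a2*r2+a3*q1+g*(t3+a1*x2+a2*r1+a3)))
       - (t4*g + a1*(x4*(1+g*u) + g*x3) + a2*((1+g*u)*(r3+r4*u) + g*r2)
          + a3*((1+g*u)*(q2+q3*u+q4*u^2) + g*q1)) * u^5"
    for u t1 t2 t3 t4 x1 x2 x3 x4 r1 r2 r3 r4 q1 q2 q3 q4 :: real
    by (simp add: algebra_simps eval_nat_numeral)
  have T_eq: "T g u = 1 + (-g)*u + (g*(g-1)/2)*u^2 + (-(g*(g-1)*(g-2)/6))*u^3 + (g*(g-1)*(g-2)*(g-3)/24)*u^4"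
    "T (g-1) u = 1 + (-(g-1))*u + ((g-1)*(g-2)/2)*u^2 + (-((g-1)*(g-2)*(g-3)/6))*u^3 + ((g-1)*(g-2)*(g-3)*(g-4)/24)*u^4"
    "T (g-2) u = 1 + (-(g-2))*u + ((g-2)*(g-3)/2)*u^2 + (-((g-2)*(g-3)*(g-4)/6))*u^3 + ((g-2)*(g-3)*(g-4)*(g-5)/24)*u^4"
    "T (g-3) u = 1 + (-(g-3))*u + ((g-3)*(g-4)/2)*u^2 + (-((g-3)*(g-4)*(g-5)/6))*u^3 + ((g-3)*(g-4)*(g-5)*(g-6)/24)*u^4" for u
    by (simp_all add: T_def) (simp_all add: algebra_simps)
  have P_eq': "P = (\<lambda>u. e u * u^5)"
    unfolding P_def T_eq by (subst expand, unfold c2 c3 c4 e_def)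
       (simp only: left_minus mult_zero_right minus_zero diff_zero diff_0 minus_mult_left)
  have "(e \<longlongrightarrow> e 0) (at_right 0)"
    unfolding e_def by (intro tendsto_intros)
  hence "e \<in> O[at_right 0](\<lambda>_. 1)"
    by (intro bigoI_tendsto[of _ _ "e 0"]) simp_all
  hence P: "P \<in> O[at_right 0](\<lambda>u. u^5)"
    unfolding P_eq' using landau_o.big.mult[of e _ "\<lambda>_. 1" "\<lambda>u. u^5" "\<lambda>u. u^5"] by simp
  have poly1: "(\<lambda>u::real. c * u^k * (1 + g*u)) \<in> O[at_right 0](\<lambda>_. 1)" for c and k :: nat
  proof -
    have "((\<lambda>u::real. c * u^k * (1 + g*u)) \<longlongrightarrow> c * 0^k * (1 + g*0)) (at_right 0)"
      by (intro tendsto_intros)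
    thus ?thesis
      by (intro bigoI_tendsto[of _ _ "c * 0^k * (1 + g*0)"]) simp_all
  qed
  have "(\<lambda>u. P u - (r g u * (1 * u^0 * (1+g*u)) + r (g-1) u * (a1 * u^1 * (1+g*u))
     + r (g-2) u * (a2 * u^2 * (1+g*u)) + r (g-3) u * (a3 * u^3 * (1+g*u)))) \<in> O[at_right 0](\<lambda>u. u^5)"
    by (intro sum_in_bigo P r' poly1)
  also have "(\<lambda>u. P u - (r g u * (1 * u^0 * (1+g*u)) + r (g-1) u * (a1 * u^1 * (1+g*u))
     + r (g-2) u * (a2 * u^2 * (1+g*u)) + r (g-3) u * (a3 * u^3 * (1+g*u)))) =
     (\<lambda>u::real. (1 + a1*u + a2*u^2 + a3*u^3) - (1 + g*u) * ((1-u) powr g + a1*u*(1-u) powr (g-1)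
            + a2*u^2*(1-u) powr (g-2) + a3*u^3*(1-u) powr (g-3)))"
    unfolding P_def r_def by (simp add: algebra_simps)
  finally show ?thesis .
qed

text \<open>The terms \<open>1/(n+1)^5\<close> are dominated by the telescoping differences of
  \<open>1/n^4\<close>. Hence \<open>t - C/n^4\<close> increases and \<open>t + C/n^4\<close>
  decreases, both towards \<open>L\<close>.\<close>

lemma telescoping_limit_bound:
  fixes t :: "nat \<Rightarrow> real"
  assumes lim: "t \<longlonglongrightarrow> L" and C: "C \<ge> 0" and N: "N \<ge> 1"
    and step: "\<And>n. n \<ge> N \<Longrightarrow> \<bar>t (Suc n) - t n\<bar> \<le> C / real (Suc n) ^ 5"
    and n: "n \<ge> N"
  shows "\<bar>t n - L\<bar> \<le> C / real n ^ 4"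
proof -
  have key: "1 / real (Suc m) ^ 5 \<le> 1 / real m ^ 4 - 1 / real (Suc m) ^ 4" if "m \<ge> N" for m
  proof -
    define x where "x = real m"
    have x: "x \<ge> 1" using that N by (simp add: x_def)
    have "x ^ 4 \<le> ((x+1)^4 - x ^ 4) * (x+1)"
      using x by (simp add: eval_nat_numeral algebra_simps)
    hence "x^4 * (x+1)^4 \<le> ((x+1)^4 - x ^ 4) * (x+1) * (x+1)^4"
      using x by (intro mult_right_mono) auto
    hence "1 / (x+1) ^ 5 \<le> 1 / x ^ 4 - 1 / (x+1) ^ 4"
      using x by (simp add: divide_simps) (simp add: eval_nat_numeral mult_ac)
    thus ?thesis by (simp add: x_def add_ac)
  qed
  have stepC: "C / real (Suc m) ^ 5 \<le> C / real m ^ 4 - C / real (Suc m) ^ 4" if "m \<ge> N" for m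
    using mult_left_mono[OF key[OF that] C] by (simp add: algebra_simps)
  have lim0: "(\<lambda>m. C / real (m + N) ^ 4) \<longlonglongrightarrow> 0"
    by real_asymp
  have limN: "(\<lambda>m. t (m + N)) \<longlonglongrightarrow> L"
    using lim by (rule LIMSEQ_ignore_initial_segment)
  have "incseq (\<lambda>m. t (m + N) - C / real (m + N) ^ 4)"
  proof (rule incseq_SucI)
    fix m show "t (m + N) - C / real (m + N) ^ 4 \<le> t (Suc m + N) - C / real (Suc m + N) ^ 4"
      using step[of "m+N"] stepC[of "m+N"] by simp
  qed
  moreover have "(\<lambda>m. t (m + N) - C / real (m + N) ^ 4) \<longlonglongrightarrow> L - 0"
    by (intro tendsto_diff limN lim0)
  ultimately have 1: "t (n - N + N) - C / real (n - N + N) ^ 4 \<le> L - 0"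
    by (rule incseq_le)
  have "decseq (\<lambda>m. t (m + N) + C / real (m + N) ^ 4)"
  proof (rule decseq_SucI)
    fix m show "t (Suc m + N) + C / real (Suc m + N) ^ 4 \<le> t (m + N) + C / real (m + N) ^ 4"
      using step[of "m+N"] stepC[of "m+N"] by simp
  qed
  moreover have "(\<lambda>m. t (m + N) + C / real (m + N) ^ 4) \<longlonglongrightarrow> L + 0"
    by (intro tendsto_add limN lim0)
  ultimately have 2: "L + 0 \<le> t (n - N + N) + C / real (n - N + N) ^ 4"
    by (rule decseq_ge)
  from 1 2 n show ?thesis by simp
qed

text \<open>Euler's limit formula for \<open>Gamma\<close>, with the last factor of the Pochhammer
  product moved out. It fixes the limit of a ratio whose rate of convergence is sharpened
  next.\<close>

lemma pochhammer_over_fact_asymp: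
  fixes d :: real
  assumes d: "d \<notin> \<int>\<^sub>\<le>\<^sub>0"
  shows "(\<lambda>n. real n powr (d-1) / (Gamma d * (pochhammer d n / fact n))) \<longlonglongrightarrow> 1"
proof -
  have G: "Gamma d \<noteq> 0" using d by (simp add: Gamma_eq_zero_iff)
  have nz: "pochhammer d n \<noteq> 0" for n
    using d by (auto simp: pochhammer_eq_0_iff)
  have "(\<lambda>n. Gamma_series d n / Gamma d * ((real n + d) / real n)) \<longlonglongrightarrow> Gamma d / Gamma d * 1"
    by (intro tendsto_mult tendsto_divide Gamma_series_LIMSEQ tendsto_const G) real_asymp
  hence "(\<lambda>n. Gamma_series d n / Gamma d * ((real n + d) / real n)) \<longlonglongrightarrow> 1" using G by simp
  moreover have "\<forall>\<^sub>F n in sequentially. Gamma_series d n / Gamma d * ((real n + d) / real n)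
       = real n powr (d-1) / (Gamma d * (pochhammer d n / fact n))"
    using eventually_gt_at_top[of 0] 
  proof eventually_elim
    case (elim n)
    have "pochhammer d (Suc n) \<noteq> 0" by (rule nz)
    hence dn: "d + real n \<noteq> 0" by (simp add: pochhammer_Suc)
    have e: "exp (d * ln (real n)) = real n powr (d-1) * real n"
      using elim by (simp add: powr_diff) (simp add: powr_def)
    have "Gamma_series d n / Gamma d * ((real n + d) / real n)
      = (fact n * real n powr (d-1) * real n) / (pochhammer d n * (d + real n)) / Gamma d * ((d + real n) / real n)"
      unfolding Gamma_series_def by (simp add: pochhammer_Suc e add_ac mult_ac)
    also have "\<dots> = real n powr (d-1) / (Gamma d * (pochhammer d n / fact n))"
      using elim dn nz[of n] G by (simp add: divide_simps)
    finally show ?case .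
  qed
  ultimately show ?thesis by (rule Lim_transform_eventually)
qed

text \<open>The ratio of the truncated expansion to the true sequence tends to \<open>1\<close>, and
  by the recurrence its increments are the residual of \<open>step_poly_bigo\<close>, of order
  \<open>n^-5\<close>. Telescoping turns this into a relative error of order
  \<open>n^-4\<close>.\<close>

lemma Gamma_ratio_expansion:
  fixes d :: real
  assumes d: "d \<notin> \<int>\<^sub>\<le>\<^sub>0"
  defines "g \<equiv> d - 1"
  shows "(\<lambda>n. real n powr g * (1 + g*(g+1)/2 / real n + (g-1)*g*(g+1)*(3*g+2)/24 / real n^2
            + g^2*(g+1)^2*(g-1)*(g-2)/48 / real n^3) - Gamma d * (pochhammer d n / fact n))
         \<in> O(\<lambda>n. real n powr (g-4))"
proof -
  define a1 where "a1 = g*(g+1)/2"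
  define a2 where "a2 = (g-1)*g*(g+1)*(3*g+2)/24"
  define a3 where "a3 = g^2*(g+1)^2*(g-1)*(g-2)/48"
  define P where "P = (\<lambda>u::real. 1 + a1*u + a2*u^2 + a3*u^3)"
  define c where "c = (\<lambda>n. Gamma d * (pochhammer d n / fact n))"
  define q where "q = (\<lambda>n. real n powr g * P (1 / real n))"
  define E where "E = (\<lambda>u::real. (1 + a1*u + a2*u^2 + a3*u^3) - (1 + g*u) * ((1-u) powr g + a1*u*(1-u) powr (g-1)
            + a2*u^2*(1-u) powr (g-2) + a3*u^3*(1-u) powr (g-3)))"
  have G: "Gamma d \<noteq> 0" using d by (simp add: Gamma_eq_zero_iff)
  have nz: "pochhammer d n \<noteq> 0" for n
    using d by (auto simp: pochhammer_eq_0_iff)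
  have c0: "c n \<noteq> 0" for n unfolding c_def using G nz[of n] by simp
  have limc: "(\<lambda>n. real n powr g / c n) \<longlonglongrightarrow> 1"
    using pochhammer_over_fact_asymp[OF d] unfolding c_def g_def by simp
  have "(\<lambda>n. P (1 / real n)) \<longlonglongrightarrow> 1"
    unfolding P_def by real_asymp
  from tendsto_mult[OF limc this] have limt: "(\<lambda>n. q n / c n) \<longlonglongrightarrow> 1"
    unfolding q_def by (simp add: mult_ac)
  have "E \<in> O[at_right 0](\<lambda>u. u^5)"
    unfolding E_def a1_def a2_def a3_def by (rule step_poly_bigo)
  hence "(\<lambda>n. E (1 / real (Suc n))) \<in> O(\<lambda>n. (1 / real (Suc n))^5)"
    by (rule landau_o.big.compose) real_asymp
  then obtain C0 where C0: "\<forall>\<^sub>F n in sequentially. norm (E (1 / real (Suc n))) \<le> C0 * norm ((1 / real (Suc n))^5)"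
    by (elim landau_o.bigE)
  have cstep: "c (Suc n) * real (Suc n) = (real (Suc n) + g) * c n" for n
  proof -
    have "c (Suc n) * real (Suc n) = Gamma d * (pochhammer d n * (d + real n) / (real (Suc n) * fact n)) * real (Suc n)"
      by (simp add: c_def pochhammer_Suc)
    also have "\<dots> = (real (Suc n) + g) * c n"
      by (simp add: c_def g_def)
    finally show ?thesis .
  qed
  have limc': "(\<lambda>n. real (Suc n) powr g / c (Suc n)) \<longlonglongrightarrow> 1"
    using LIMSEQ_Suc[OF limc] .
  have "\<forall>\<^sub>F n in sequentially. \<bar>real (Suc n) powr g / c (Suc n)\<bar> < 2"
    using order_tendstoD(2)[OF tendsto_rabs[OF limc'], of 2] by simp
  with C0 eventually_gt_at_top[of 1] have
    "\<forall>\<^sub>F n in sequentially. \<bar>q (Suc n) / c (Suc n) - q n / c n\<bar> \<le> (2 * \<bar>C0\<bar>) / real (Suc n) ^ 5"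
  proof eventually_elim
    case (elim n)
    define u where "u = 1 / real (Suc n)"
    have n0: "real n > 1" using elim by simp
    have nu: "real n = real (Suc n) * (1 - u)" unfolding u_def by (simp add: field_simps)
    have u1: "1 - u > 0" using n0 unfolding u_def by (simp add: field_simps)
    have pw: "real n powr g = real (Suc n) powr g * (1-u) powr g"
      using u1 by (subst nu) (simp add: powr_mult)
    have un: "1 / real n = u / (1 - u)" unfolding u_def using n0 by (simp add: field_simps)
    have pw1: "(1-u) powr g / (1-u)^k = (1-u) powr (g - real k)" for k
      using u1 by (simp add: powr_diff powr_realpow)
    have E_eq: "P u - (1+g*u) * ((1-u) powr g * P (u/(1-u))) = E u"
      unfolding P_def E_def using pw1[of 1, symmetric] pw1[of 2, symmetric] pw1[of 3, symmetric]
      by (simp add: distrib_left power_divide mult_ac)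
    have "q (Suc n) / c (Suc n) - q n / c n = (real (Suc n) * q (Suc n) - (real (Suc n) + g) * q n) / (real (Suc n) * c (Suc n))"
    proof -
      have nzg: "real (Suc n) + g \<noteq> 0" using cstep[of n] c0[of "Suc n"] by (auto simp del: of_nat_Suc)
      have "q n / c n = (real (Suc n) + g) * q n / ((real (Suc n) + g) * c n)"
        using nzg by (simp del: of_nat_Suc)
      also have "(real (Suc n) + g) * c n = real (Suc n) * c (Suc n)" using cstep[of n] by (simp add: mult_ac)
      finally show ?thesis by (simp add: diff_divide_distrib del: of_nat_Suc)
    qed
    also have "real (Suc n) * q (Suc n) - (real (Suc n) + g) * q n = real (Suc n) * real (Suc n) powr g * E u"
    proof -
      have 1: "real (Suc n) + g = real (Suc n) * (1 + g*u)" unfolding u_def by (simp add: field_simps)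
      have 2: "q (Suc n) = real (Suc n) powr g * P u" unfolding q_def u_def by simp
      have 3: "q n = real (Suc n) powr g * ((1-u) powr g * P (u/(1-u)))" unfolding q_def pw un by simp
      show ?thesis unfolding E_eq[symmetric] 1 2 3 by (simp only: algebra_simps)
    qed
    also have "\<bar>real (Suc n) * real (Suc n) powr g * E u / (real (Suc n) * c (Suc n))\<bar>
        = \<bar>real (Suc n) powr g / c (Suc n)\<bar> * \<bar>E u\<bar>"
      by (simp add: abs_mult del: of_nat_Suc)
    also have "\<dots> \<le> 2 * (\<bar>C0\<bar> * u^5)"
    proof (intro mult_mono)
      have "\<bar>E u\<bar> \<le> C0 * u^5" using elim(1) by (simp add: u_def)
      also have "\<dots> \<le> \<bar>C0\<bar> * u^5" by (intro mult_right_mono) (simp_all add: u_def)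
      finally show "\<bar>E u\<bar> \<le> \<bar>C0\<bar> * u^5" .
    qed (use elim in auto)
    also have "\<dots> = (2 * \<bar>C0\<bar>) / real (Suc n) ^ 5"
      unfolding u_def by (simp add: power_divide)
    finally show ?case .
  qed
  then obtain N where N: "\<And>n. n \<ge> N \<Longrightarrow> \<bar>q (Suc n) / c (Suc n) - q n / c n\<bar> \<le> (2 * \<bar>C0\<bar>) / real (Suc n) ^ 5"
    by (auto simp: eventually_sequentially)
  have "\<bar>q n / c n - 1\<bar> \<le> (2 * \<bar>C0\<bar>) / real n ^ 4" if "n \<ge> max N 1" for n
    by (rule telescoping_limit_bound[OF limt, of _ "max N 1"]) (use N that in auto)
  hence "\<forall>\<^sub>F n in sequentially. norm (q n / c n - 1) \<le> 2 * \<bar>C0\<bar> * norm (1 / real n ^ 4)"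
    by (auto intro!: eventually_sequentiallyI[of "max N 1"])
  hence "(\<lambda>n. q n / c n - 1) \<in> O(\<lambda>n. 1 / real n ^ 4)"
    by (rule bigoI)
  moreover have "c \<in> O(\<lambda>n. real n powr g)"
  proof -
    have "(\<lambda>n. inverse (real n powr g / c n)) \<longlonglongrightarrow> inverse 1"
      by (intro tendsto_intros limc) simp
    hence "(\<lambda>n. c n / real n powr g) \<longlonglongrightarrow> 1" by (simp add: field_simps)
    thus ?thesis by (rule bigoI_tendsto) (auto intro!: eventually_sequentiallyI[of 1])
  qed
  ultimately have "(\<lambda>n. c n * (q n / c n - 1)) \<in> O(\<lambda>n. real n powr g * (1 / real n ^ 4))"
    by (intro landau_o.big.mult)
  also have "(\<lambda>n. c n * (q n / c n - 1)) = (\<lambda>n. q n - c n)"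
    using c0 by (auto simp: algebra_simps)
  also have "O(\<lambda>n. real n powr g * (1 / real n ^ 4)) = O(\<lambda>n. real n powr (g - 4))"
  proof (rule landau_o.big.cong)
    show "\<forall>\<^sub>F n in sequentially. real n powr g * (1 / real n ^ 4) = real n powr (g - 4)"
      using eventually_gt_at_top[of 0] by eventually_elim (simp add: powr_diff)
  qed
  finally show ?thesis
    unfolding q_def c_def P_def a1_def a2_def a3_def
    by (simp add: power_divide)
qed


text \<open>The finitely many early terms are absorbed into the constant; \<open>n + 1\<close> in
  the denominator admits \<open>n = 0\<close>, which convolutions of such bounds require.\<close>

lemma bigo_inverse_square_bound:
  fixes f :: "nat \<Rightarrow> real"
  assumes "f \<in> O(\<lambda>n. real n powr (-2))"
  obtains C where "\<And>n. \<bar>f n\<bar> \<le> C / (real n + 1)^2"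
proof -
  have "f \<in> O(\<lambda>n. 1 / (real n + 1)^2)"
    by (rule landau_o.big_trans[OF assms]) real_asymp
  then obtain C0 where C0: "C0 > 0" "\<forall>\<^sub>F n in sequentially. \<bar>f n\<bar> \<le> C0 * \<bar>1 / (real n + 1)^2\<bar>"
    by (elim landau_o.bigE) auto
  then obtain N where N: "\<And>n. n \<ge> N \<Longrightarrow> \<bar>f n\<bar> \<le> C0 / (real n + 1)^2"
    by (auto simp: eventually_sequentially)
  define C where "C = C0 + (\<Sum>n<N. \<bar>f n\<bar> * (real n + 1)^2)"
  have nn: "(\<Sum>n<N. \<bar>f n\<bar> * (real n + 1)^2) \<ge> 0" by (intro sum_nonneg) auto
  have "\<bar>f n\<bar> \<le> C / (real n + 1)^2" for n
  proof (cases "n < N")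
    case True
    have "\<bar>f n\<bar> * (real n + 1)^2 \<le> (\<Sum>n<N. \<bar>f n\<bar> * (real n + 1)^2)"
      using True by (intro member_le_sum) auto
    hence "\<bar>f n\<bar> * (real n + 1)^2 \<le> C" using C0 by (simp add: C_def)
    moreover have "(real n + 1)^2 > 0" by (simp add: power2_eq_square add_nonneg_pos)
    ultimately show ?thesis by (simp add: pos_le_divide_eq)
  next
    case False
    hence "\<bar>f n\<bar> \<le> C0 / (real n + 1)^2" using N by simp
    also have "\<dots> \<le> C / (real n + 1)^2" using nn by (intro divide_right_mono) (simp_all add: C_def)
    finally show ?thesis .
  qed
  thus ?thesis by (rule that)
qed

text \<open>Since \<open>pochhammer (-\<gamma>) n / fact n\<close> is the \<open>n\<close>-th Taylor
  coefficient of \<open>(1-z) powr \<gamma>\<close>, the data are matched by the exponents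
  \<open>\<alpha>-3\<close>, \<open>\<alpha>-2\<close>, \<open>\<alpha>-1\<close>,
  \<open>\<alpha>\<close>. Each such coefficient expands in descending powers of \<open>n\<close>;
  four of them eliminate everything down to \<open>n powr (-1-\<alpha>)\<close>, and the next power
  is already \<open>O(n^-2)\<close>. Besides the leading \<open>1\<close>, the coefficient
  \<open>(\<alpha>-3)/2\<close> has to be explicit, because the order of the scheme depends on its
  value.\<close>

lemma power_sequence_expansion:
  fixes \<alpha> :: real
  assumes \<alpha>: "0 < \<alpha>" "\<alpha> < 1"
  obtains b2 b3 C where
    "\<And>n. \<bar>(if n = 0 then 0 else real n powr (2-\<alpha>) / Gamma (3-\<alpha>)) -
       (pochhammer (3-\<alpha>) n / fact n + (\<alpha>-3)/2 * (pochhammer (2-\<alpha>) n / fact n)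
        + b2 * (pochhammer (1-\<alpha>) n / fact n) + b3 * (pochhammer (-\<alpha>) n / fact n))\<bar> \<le> C / (real n + 1)^2"
proof -
  define c where "c = (\<lambda>(d::real) n. Gamma d * (pochhammer d n / fact n))"
  have nonint: "d \<notin> \<int>\<^sub>\<le>\<^sub>0" if "d \<in> {3-\<alpha>, 2-\<alpha>, 1-\<alpha>, -\<alpha>}" for d
  proof
    assume "d \<in> \<int>\<^sub>\<le>\<^sub>0"
    then obtain k where k: "d = - of_nat k" by (elim nonpos_Ints_cases') auto
    have "d \<noteq> 0" "d > -1" using that \<alpha> by auto
    thus False using k by (cases k) auto
  qed
  define O2 where "O2 = (O(\<lambda>n. real n powr (-2)) :: (nat \<Rightarrow> real) set)"
  have sub: "f \<in> O2" if "f \<in> O(\<lambda>n. real n powr e)" "e \<le> -2" for f e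
  proof -
    have "(\<lambda>n. real n powr e) \<in> O(\<lambda>n. real n powr (-2))"
      by (rule bigoI[of _ 1], rule eventually_sequentiallyI[of 1]) (use that(2) in \<open>auto intro: powr_mono\<close>)
    thus ?thesis unfolding O2_def using that(1) landau_o.big_trans by blast
  qed
  have pw: "(\<lambda>n. k * (real n powr e)) \<in> O2" if "e \<le> -2" for e k
    by (rule sub[OF _ that]) simp
  have lin: "(\<lambda>n. k * f n) \<in> O2" if "f \<in> O2" for k :: real and f
    using that unfolding O2_def by (cases "k = 0") simp_all
  have add: "(\<lambda>n. f n + h n) \<in> O2" "(\<lambda>n. f n - h n) \<in> O2" if "f \<in> O2" "h \<in> O2" for f h
    using that unfolding O2_def by (auto intro: sum_in_bigo)
  have ex: "\<exists>a2 a3. (\<lambda>n. real n powr (d-1) + d*(d-1)/2 * real n powr (d-2) + a2 * real n powr (d-3)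
      + a3 * real n powr (d-4) - c d n) \<in> O2" if d: "d \<in> {3-\<alpha>, 2-\<alpha>, 1-\<alpha>, -\<alpha>}" for d
  proof -
    define g where "g = d - 1"
    define a2 where "a2 = (g-1)*g*(g+1)*(3*g+2)/24"
    define a3 where "a3 = g^2*(g+1)^2*(g-1)*(g-2)/48"
    have "(\<lambda>n. real n powr g * (1 + g*(g+1)/2 / real n + a2 / real n^2 + a3 / real n^3) - c d n) \<in> O(\<lambda>n. real n powr (g-4))"
      using Gamma_ratio_expansion[OF nonint[OF d]] unfolding g_def a2_def a3_def c_def by simp
    hence "(\<lambda>n. real n powr g * (1 + g*(g+1)/2 / real n + a2 / real n^2 + a3 / real n^3) - c d n) \<in> O2"
      by (rule sub) (use d \<alpha> in \<open>auto simp: g_def\<close>)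
    note m1 = this
    have m2: "\<forall>\<^sub>F n in sequentially. real n powr g * (1 + g*(g+1)/2 / real n + a2 / real n^2 + a3 / real n^3) - c d n
       = real n powr (d-1) + d*(d-1)/2 * real n powr (d-2) + a2 * real n powr (d-3)
      + a3 * real n powr (d-4) - c d n"
      using eventually_gt_at_top[of 0]
    proof eventually_elim
      case (elim n)
      have r: "real n powr (g - real k) = real n powr g / real n ^ k" for k
        using elim by (simp add: powr_diff powr_realpow)
      have e: "d - 1 = g" "d - 2 = g - real 1" "d - 3 = g - real 2" "d - 4 = g - real 3"
          and e': "d * g / 2 = g * (g+1) / 2"
        by (simp_all add: g_def)
      show ?case unfolding e r e' by (simp add: distrib_left distrib_right mult_ac)
    qed
    show ?thesis using iffD1[OF landau_o.big.in_cong[OF m2] m1[unfolded O2_def]] unfolding O2_def by (intro exI)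
  qed
  have A: "\<exists>a2 a3. (\<lambda>n. real n powr (2-\<alpha>) + (3-\<alpha>)*(2-\<alpha>)/2 * real n powr (1-\<alpha>) + a2 * real n powr (-\<alpha>)
      + a3 * real n powr (-1-\<alpha>) - c (3-\<alpha>) n) \<in> O2"
    using ex[of "3-\<alpha>"] by (simp add: diff_right_commute)
  have B: "\<exists>a2 a3. (\<lambda>n. real n powr (1-\<alpha>) + (2-\<alpha>)*(1-\<alpha>)/2 * real n powr (-\<alpha>) + a2 * real n powr (-1-\<alpha>)
      + a3 * real n powr (-2-\<alpha>) - c (2-\<alpha>) n) \<in> O2"
    using ex[of "2-\<alpha>"] by (simp add: diff_right_commute)
  have D: "\<exists>a2 a3. (\<lambda>n. real n powr (-\<alpha>) + (1-\<alpha>)*(-\<alpha>)/2 * real n powr (-1-\<alpha>) + a2 * real n powr (-2-\<alpha>)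
      + a3 * real n powr (-3-\<alpha>) - c (1-\<alpha>) n) \<in> O2"
    using ex[of "1-\<alpha>"] by (simp add: diff_right_commute)
  have F: "\<exists>a2 a3. (\<lambda>n. real n powr (-1-\<alpha>) + (-\<alpha>)*(-\<alpha>-1)/2 * real n powr (-2-\<alpha>) + a2 * real n powr (-3-\<alpha>)
      + a3 * real n powr (-4-\<alpha>) - c (-\<alpha>) n) \<in> O2"
    using ex[of "-\<alpha>"] by (simp add: minus_diff_commute)
  from A obtain a2 a3 where A: "(\<lambda>n. real n powr (2-\<alpha>) + (3-\<alpha>)*(2-\<alpha>)/2 * real n powr (1-\<alpha>) + a2 * real n powr (-\<alpha>)
      + a3 * real n powr (-1-\<alpha>) - c (3-\<alpha>) n) \<in> O2" by blast
  from B obtain u2 u3 where B: "(\<lambda>n. real n powr (1-\<alpha>) + (2-\<alpha>)*(1-\<alpha>)/2 * real n powr (-\<alpha>) + u2 * real n powr (-1-\<alpha>)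
      + u3 * real n powr (-2-\<alpha>) - c (2-\<alpha>) n) \<in> O2" by blast
  from D obtain v2 v3 where D: "(\<lambda>n. real n powr (-\<alpha>) + (1-\<alpha>)*(-\<alpha>)/2 * real n powr (-1-\<alpha>) + v2 * real n powr (-2-\<alpha>)
      + v3 * real n powr (-3-\<alpha>) - c (1-\<alpha>) n) \<in> O2" by blast
  from F obtain w2 w3 where F: "(\<lambda>n. real n powr (-1-\<alpha>) + (-\<alpha>)*(-\<alpha>-1)/2 * real n powr (-2-\<alpha>) + w2 * real n powr (-3-\<alpha>)
      + w3 * real n powr (-4-\<alpha>) - c (-\<alpha>) n) \<in> O2" by blast
  have p: "(\<lambda>n. k * (real n powr (-2-\<alpha>))) \<in> O2" "(\<lambda>n. k * (real n powr (-3-\<alpha>))) \<in> O2" "(\<lambda>n. k * (real n powr (-4-\<alpha>))) \<in> O2" for k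
    using \<alpha> by (auto intro!: pw)
  define A1 where "A1 = (3-\<alpha>)*(2-\<alpha>)/2"
  define B1 where "B1 = (2-\<alpha>)*(1-\<alpha>)/2"
  define D1 where "D1 = (1-\<alpha>)*(-\<alpha>)/2"
  define F1 where "F1 = (-\<alpha>)*(-\<alpha>-1)/2"
  \<comment> \<open>Triangular elimination: \<open>A1\<close>, \<open>X\<close> and \<open>Y\<close>
    are the multiples of the lower sequences that cancel \<open>n powr (1-\<alpha>)\<close>,
    \<open>n powr (-\<alpha>)\<close> and \<open>n powr (-1-\<alpha>)\<close> in turn.\<close>
  define X where "X = A1 * B1 - a2"
  define Y where "Y = A1 * u2 - a3 - X * D1"
  have F': "(\<lambda>n. real n powr (-1-\<alpha>) - c (-\<alpha>) n) \<in> O2"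
  proof -
    have "(\<lambda>n. (real n powr (-1-\<alpha>) + F1 * real n powr (-2-\<alpha>) + w2 * real n powr (-3-\<alpha>)
      + w3 * real n powr (-4-\<alpha>) - c (-\<alpha>) n) - F1 * real n powr (-2-\<alpha>) - w2 * real n powr (-3-\<alpha>)
      - w3 * real n powr (-4-\<alpha>)) \<in> O2"
      by (intro add p F[folded F1_def])
    thus ?thesis by (simp add: algebra_simps)
  qed
  have D': "(\<lambda>n. real n powr (-\<alpha>) + D1 * real n powr (-1-\<alpha>) - c (1-\<alpha>) n) \<in> O2"
  proof -
    have "(\<lambda>n. (real n powr (-\<alpha>) + D1 * real n powr (-1-\<alpha>) + v2 * real n powr (-2-\<alpha>)
      + v3 * real n powr (-3-\<alpha>) - c (1-\<alpha>) n) - v2 * real n powr (-2-\<alpha>)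
      - v3 * real n powr (-3-\<alpha>)) \<in> O2"
      by (intro add p D[folded D1_def])
    thus ?thesis by (simp add: algebra_simps)
  qed
  have B': "(\<lambda>n. real n powr (1-\<alpha>) + B1 * real n powr (-\<alpha>) + u2 * real n powr (-1-\<alpha>) - c (2-\<alpha>) n) \<in> O2"
  proof -
    have "(\<lambda>n. (real n powr (1-\<alpha>) + B1 * real n powr (-\<alpha>) + u2 * real n powr (-1-\<alpha>)
      + u3 * real n powr (-2-\<alpha>) - c (2-\<alpha>) n) - u3 * real n powr (-2-\<alpha>)) \<in> O2"
      by (intro add p B[folded B1_def])
    thus ?thesis by (simp add: algebra_simps)
  qed
  have "(\<lambda>n. (real n powr (2-\<alpha>) + A1 * real n powr (1-\<alpha>) + a2 * real n powr (-\<alpha>)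
      + a3 * real n powr (-1-\<alpha>) - c (3-\<alpha>) n)
      - A1 * (real n powr (1-\<alpha>) + B1 * real n powr (-\<alpha>) + u2 * real n powr (-1-\<alpha>) - c (2-\<alpha>) n)
      + X * (real n powr (-\<alpha>) + D1 * real n powr (-1-\<alpha>) - c (1-\<alpha>) n)
      + Y * (real n powr (-1-\<alpha>) - c (-\<alpha>) n)) \<in> O2"
    by (intro add lin A[folded A1_def] B' D' F')
  hence "(\<lambda>n. real n powr (2-\<alpha>) - (c (3-\<alpha>) n - A1 * c (2-\<alpha>) n + X * c (1-\<alpha>) n + Y * c (-\<alpha>) n)) \<in> O2"
    unfolding Y_def X_def by (simp add: algebra_simps)
  hence *: "(\<lambda>n. inverse (Gamma (3-\<alpha>)) * (real n powr (2-\<alpha>) - (c (3-\<alpha>) n - A1 * c (2-\<alpha>) n + X * c (1-\<alpha>) n + Y * c (-\<alpha>) n))) \<in> O2"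
    by (rule lin)
  \<comment> \<open>Removes the factor \<open>2-\<alpha>\<close> from \<open>A1\<close>, which is
    how the explicit coefficient \<open>(3-\<alpha>)/2\<close> arises.\<close>
  have G3: "Gamma (3-\<alpha>) = (2-\<alpha>) * Gamma (2-\<alpha>)"
    using Gamma_plus1[of "2-\<alpha>"] nonint[of "2-\<alpha>"] by (simp add: algebra_simps)
  have G0: "Gamma (3-\<alpha>) > 0" "Gamma (2-\<alpha>) > 0" using \<alpha> by (auto intro!: Gamma_real_pos)
  define b2 where "b2 = X * Gamma (1-\<alpha>) / Gamma (3-\<alpha>)"
  define b3 where "b3 = Y * Gamma (-\<alpha>) / Gamma (3-\<alpha>)"
  define f where "f = (\<lambda>n. (if n = 0 then 0 else real n powr (2-\<alpha>) / Gamma (3-\<alpha>)) -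
       (pochhammer (3-\<alpha>) n / fact n + (\<alpha>-3)/2 * (pochhammer (2-\<alpha>) n / fact n)
        + b2 * (pochhammer (1-\<alpha>) n / fact n) + b3 * (pochhammer (-\<alpha>) n / fact n)))"
  have "inverse (Gamma (3-\<alpha>)) * (real n powr (2-\<alpha>) - (c (3-\<alpha>) n - A1 * c (2-\<alpha>) n + X * c (1-\<alpha>) n + Y * c (-\<alpha>) n)) = f n" for n
  proof -
    have 1: "inverse (Gamma (3-\<alpha>)) * c (3-\<alpha>) n = pochhammer (3-\<alpha>) n / fact n"
      unfolding c_def using G0 by simp
    have 2: "inverse (Gamma (3-\<alpha>)) * (A1 * c (2-\<alpha>) n) = (3-\<alpha>)/2 * (pochhammer (2-\<alpha>) n / fact n)"
    proof -
      have "inverse (b*G) * ((a*b/2)*(G*q)) = a/2*q" if "b \<noteq> 0" "G \<noteq> 0" for a b G q :: real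
        using that by (simp add: field_simps)
      from this[of "2-\<alpha>" "Gamma (2-\<alpha>)" "3-\<alpha>" "pochhammer (2-\<alpha>) n / fact n"] show ?thesis
        unfolding c_def G3 A1_def using G0 \<alpha> by simp
    qed
    have 3: "inverse (Gamma (3-\<alpha>)) * (X * c (1-\<alpha>) n) = b2 * (pochhammer (1-\<alpha>) n / fact n)"
      "inverse (Gamma (3-\<alpha>)) * (Y * c (-\<alpha>) n) = b3 * (pochhammer (-\<alpha>) n / fact n)"
      unfolding c_def b2_def b3_def by (simp_all add: field_simps)
    have 4: "inverse (Gamma (3-\<alpha>)) * (real n powr (2-\<alpha>)) = (if n = 0 then 0 else real n powr (2-\<alpha>) / Gamma (3-\<alpha>))"
      by (simp add: field_simps)
    have 5: "(\<alpha>-3)/2 * (pochhammer (2-\<alpha>) n / fact n) = - ((3-\<alpha>)/2 * (pochhammer (2-\<alpha>) n / fact n))"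
      by (simp add: field_simps)
    show ?thesis unfolding f_def 5 1[symmetric] 2[symmetric] 3[symmetric] 4[symmetric]
      by (simp only: right_diff_distrib distrib_left)
  qed
  hence "f \<in> O2" using * by simp
  hence "f \<in> O(\<lambda>n. real n powr (-2))" unfolding O2_def .
  from bigo_inverse_square_bound[OF this] obtain C where "\<And>n. \<bar>f n\<bar> \<le> C / (real n + 1)^2" by blast
  thus ?thesis unfolding f_def by (rule that)
qed

section \<open>Contour integrals\<close>

lemma integral_cos_pi:
  fixes k :: int
  shows "((\<lambda>y. cos (of_int k * y)) has_integral (if k = 0 then pi else 0)) {0..pi}"
proof (cases "k = 0")
  case True
  thus ?thesis using has_integral_const_real[of "1::real" 0 pi] by simp
next
  case False
  have "((\<lambda>y. cos (of_int k * y)) has_integral (sin (of_int k * pi) / of_int k - sin (of_int k * 0) / of_int k)) {0..pi}"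
    using False by (intro fundamental_theorem_of_calculus)
      (auto intro!: derivative_eq_intros simp flip: has_real_derivative_iff_has_vector_derivative)
  thus ?thesis using False by (simp add: sin_integer_2pi mult.commute)
qed

text \<open>Coefficient extraction on the circle of radius \<open>exp (-1)\<close>, in the variable
  \<open>z = exp (- s)\<close> with \<open>s = Complex 1 y\<close>. The coefficients are real, so by
  conjugation symmetry the real part over half a circle does the work of the full circle.\<close>

lemma half_circle_coefficient:
  fixes a :: "nat \<Rightarrow> real" and \<Phi> :: "complex \<Rightarrow> complex"
  assumes abs: "summable (\<lambda>m. \<bar>a m\<bar> * exp (- real m))"
    and sums: "\<And>y. 0 \<le> y \<Longrightarrow> y \<le> pi \<Longrightarrow> (\<lambda>m. of_real (a m) * exp (- of_nat m * Complex 1 y)) sums \<Phi> (Complex 1 y)"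
  shows "((\<lambda>y. Re (\<Phi> (Complex 1 y) * exp (of_nat n * Complex 1 y))) has_integral (pi * a n)) {0..pi}"
proof -
  define t where "t = (\<lambda>m y. a m * exp (real n - real m) * cos (of_int (int n - int m) * y))"
  define f where "f = (\<lambda>y. Re (\<Phi> (Complex 1 y) * exp (of_nat n * Complex 1 y)))"
  have t_eq: "Re (of_real (a m) * exp (- of_nat m * Complex 1 y) * exp (of_nat n * Complex 1 y)) = t m y" for m y
  proof -
    have "- of_nat m * Complex 1 y + of_nat n * Complex 1 y = Complex (real n - real m) ((real n - real m) * y)"
      by (simp add: complex_eq_iff algebra_simps)
    hence "exp (- of_nat m * Complex 1 y) * exp (of_nat n * Complex 1 y) = exp (Complex (real n - real m) ((real n - real m) * y))"
      by (simp only: exp_add[symmetric])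
    hence eq: "of_real (a m) * exp (- of_nat m * Complex 1 y) * exp (of_nat n * Complex 1 y) 
        = of_real (a m) * exp (Complex (real n - real m) ((real n - real m) * y))"
      by (simp only: mult.assoc)
    show ?thesis unfolding eq by (simp add: t_def Re_exp)
  qed
  have fs: "(\<lambda>m. t m y) sums f y" if "y \<in> {0..pi}" for y
  proof -
    have "(\<lambda>m. of_real (a m) * exp (- of_nat m * Complex 1 y) * exp (of_nat n * Complex 1 y)) sums
        (\<Phi> (Complex 1 y) * exp (of_nat n * Complex 1 y))"
      using that by (intro sums_mult2 sums) auto
    from sums_Re[OF this] show ?thesis unfolding t_eq f_def .
  qed
  have bnd: "summable (\<lambda>m. \<bar>a m\<bar> * exp (real n - real m))"
    using summable_mult[OF abs, of "exp (real n)"] by (simp add: exp_diff exp_minus field_simps)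
  define M where "M = (\<Sum>m. \<bar>a m\<bar> * exp (real n - real m))"
  have part: "((\<lambda>y. \<Sum>m<k. t m y) has_integral (\<Sum>m<k. a m * exp (real n - real m) * (if int n - int m = 0 then pi else 0))) {0..pi}" for k
    unfolding t_def by (intro has_integral_sum has_integral_mult_right integral_cos_pi) auto
  have le: "norm (\<Sum>m<k. t m y) \<le> M" for k y
  proof -
    have "norm (\<Sum>m<k. t m y) \<le> (\<Sum>m<k. \<bar>a m\<bar> * exp (real n - real m))"
      by (intro sum_norm_le) (auto simp: t_def abs_mult intro!: mult_left_le)
    also have "\<dots> \<le> M" unfolding M_def by (intro sum_le_suminf bnd) auto
    finally show ?thesis .
  qed
  have conv: "(\<lambda>k. \<Sum>m<k. t m y) \<longlonglongrightarrow> f y" if "y \<in> {0..pi}" for y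
    using fs[OF that] by (simp add: sums_def)
  have "f integrable_on {0..pi}" "(\<lambda>k. integral {0..pi} (\<lambda>y. \<Sum>m<k. t m y)) \<longlonglongrightarrow> integral {0..pi} f"
    using dominated_convergence[of "\<lambda>k y. \<Sum>m<k. t m y" "{0..pi}" "\<lambda>_. M" f] part le conv
    by (auto simp: integrable_on_def)
  moreover have "integral {0..pi} (\<lambda>y. \<Sum>m<k. t m y) = a n * pi" if "k > n" for k
  proof -
    have "(\<Sum>m<k. a m * exp (real n - real m) * (if int n - int m = 0 then pi else 0)) = (\<Sum>m<k. if m = n then a n * pi else 0)"
      by (intro sum.cong) auto
    also have "\<dots> = a n * pi" using that by simp
    finally show ?thesis using integral_unique[OF part] by simp
  qed
  hence "(\<lambda>k. integral {0..pi} (\<lambda>y. \<Sum>m<k. t m y)) \<longlonglongrightarrow> a n * pi"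
    by (intro tendsto_eventually eventually_at_top_linorderI[of "Suc n"]) auto
  ultimately show ?thesis
    unfolding f_def[symmetric] using LIMSEQ_unique by (metis has_integral_integral mult.commute)
qed

text \<open>On a convex set, continuity together with differentiability off a finite set yields a
  primitive, and each side of the rectangle becomes a difference of corner values. The exceptional
  set \<open>K\<close> makes room for a removable singularity of the integrand.\<close>

lemma rectangle_cauchy:
  fixes F :: "complex \<Rightarrow> complex"
  assumes ab: "a \<le> b" and e: "e \<le> h" and K: "finite K"
    and cont: "continuous_on {s. a \<le> Re s \<and> Re s \<le> b \<and> e \<le> Im s \<and> Im s \<le> h} F"
    and holo: "\<And>s. a \<le> Re s \<Longrightarrow> Re s \<le> b \<Longrightarrow> e \<le> Im s \<Longrightarrow> Im s \<le> h \<Longrightarrow> s \<notin> K \<Longrightarrow> F field_differentiable at s"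
  shows "integral {a..b} (\<lambda>x. F (Complex x e)) + \<i> * integral {e..h} (\<lambda>y. F (Complex b y))
       = integral {a..b} (\<lambda>x. F (Complex x h)) + \<i> * integral {e..h} (\<lambda>y. F (Complex a y))"
proof -
  define S where "S = cbox (Complex a e) (Complex b h)"
  have S: "s \<in> S \<longleftrightarrow> a \<le> Re s \<and> Re s \<le> b \<and> e \<le> Im s \<and> Im s \<le> h" for s
    by (auto simp: S_def in_cbox_complex_iff)
  have "S = {s. a \<le> Re s \<and> Re s \<le> b \<and> e \<le> Im s \<and> Im s \<le> h}" using S by auto
  hence "continuous_on S F" using cont by simp
  moreover have "convex S" by (simp add: S_def)
  moreover have "F field_differentiable at x" if "x \<in> interior S - K" for x
    using that interior_subset[of S] S[of x] by (intro holo) auto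
  ultimately obtain g where g: "\<And>x. x \<in> S \<Longrightarrow> (g has_field_derivative F x) (at x within S)"
    using holomorphic_convex_primitive[OF _ K] by metis
  have H: "integral {a..b} (\<lambda>x. F (Complex x y)) = g (Complex b y) - g (Complex a y)" if "e \<le> y" "y \<le> h" for y
  proof (rule integral_unique, rule fundamental_theorem_of_calculus[OF ab])
    fix x assume x: "x \<in> {a..b}"
    have "((g \<circ> (\<lambda>x. Complex x y)) has_vector_derivative 1 * F (Complex x y)) (at x within {a..b})"
    proof (rule field_vector_diff_chain_within)
      show "((\<lambda>x. Complex x y) has_vector_derivative 1) (at x within {a..b})"
        unfolding Complex_eq by (auto intro!: derivative_eq_intros)
      show "(g has_field_derivative F (Complex x y)) (at (Complex x y) within (\<lambda>x. Complex x y) ` {a..b})"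
        using x that by (intro DERIV_subset[OF g]) (auto simp: S)
    qed
    thus "((\<lambda>x. g (Complex x y)) has_vector_derivative F (Complex x y)) (at x within {a..b})"
      by (simp add: o_def)
  qed
  have V: "\<i> * integral {e..h} (\<lambda>y. F (Complex x y)) = g (Complex x h) - g (Complex x e)" if "a \<le> x" "x \<le> b" for x
  proof -
    have "((\<lambda>y. \<i> * F (Complex x y)) has_integral (g (Complex x h) - g (Complex x e))) {e..h}"
    proof (rule fundamental_theorem_of_calculus[OF e])
      fix y assume y: "y \<in> {e..h}"
      have "((g \<circ> (\<lambda>y. Complex x y)) has_vector_derivative \<i> * F (Complex x y)) (at y within {e..h})"
      proof (rule field_vector_diff_chain_within)
        show "((\<lambda>y. Complex x y) has_vector_derivative \<i>) (at y within {e..h})"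
          unfolding Complex_eq by (auto intro!: derivative_eq_intros)
        show "(g has_field_derivative F (Complex x y)) (at (Complex x y) within (\<lambda>y. Complex x y) ` {e..h})"
          using y that by (intro DERIV_subset[OF g]) (auto simp: S)
      qed
      thus "((\<lambda>y. g (Complex x y)) has_vector_derivative \<i> * F (Complex x y)) (at y within {e..h})"
        by (simp add: o_def)
    qed
    thus ?thesis by (simp add: integral_unique flip: integral_mult_right)
  qed
  show ?thesis
    using H[of e] H[of h] V[of a] V[of b] ab e by simp
qed

text \<open>The bottom side runs through the singularity at \<open>0\<close>. It is approached by
  sides at heights \<open>e k > 0\<close>; the majorant \<open>g\<close> depends on
  \<open>Re s\<close> only and therefore dominates all of them at once.\<close>

lemma rectangle_cauchy_singular:
  fixes F :: "complex \<Rightarrow> complex"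
  assumes ab: "a < 0" "0 < b" and h: "0 < h"
    and holo: "\<And>s. a \<le> Re s \<Longrightarrow> Re s \<le> b \<Longrightarrow> 0 < Im s \<Longrightarrow> Im s \<le> h \<Longrightarrow> F field_differentiable at s"
    and cont: "continuous_on ({s. a \<le> Re s \<and> Re s \<le> b \<and> 0 \<le> Im s \<and> Im s \<le> h} - {0}) F"
    and M: "\<And>s. a \<le> Re s \<Longrightarrow> Re s \<le> b \<Longrightarrow> 0 \<le> Im s \<Longrightarrow> Im s \<le> h \<Longrightarrow> Re s \<noteq> 0 \<Longrightarrow> cmod (F s) \<le> g (Re s)"
    and g: "g integrable_on {a..b}"
  shows "(\<lambda>x. F (Complex x 0)) integrable_on {a..b}"
    and "integral {a..b} (\<lambda>x. F (Complex x 0)) + \<i> * integral {0..h} (\<lambda>y. F (Complex b y))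
       = integral {a..b} (\<lambda>x. F (Complex x h)) + \<i> * integral {0..h} (\<lambda>y. F (Complex a y))"
proof -
  define R where "R = {s. a \<le> Re s \<and> Re s \<le> b \<and> 0 \<le> Im s \<and> Im s \<le> h}"
  define e where "e = (\<lambda>k. h / real (Suc k))"
  have e: "0 < e k" "e k \<le> h" for k using h by (auto simp: e_def field_simps)
  have e0: "e \<longlonglongrightarrow> 0" unfolding e_def by real_asymp
  define G where "G = (\<lambda>x. if x = 0 then 0 else F (Complex x 0))"
  have intk: "(\<lambda>x. if x = 0 then 0 else F (Complex x (e k))) integrable_on {a..b}" for k
  proof -
    have "continuous_on {a..b} (\<lambda>x. F (Complex x (e k)))"
      using e[of k] by (intro continuous_on_compose2[OF cont]) (auto intro!: continuous_intros simp: complex_eq_iff Complex_eq)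
    hence "(\<lambda>x. F (Complex x (e k))) integrable_on {a..b}" by (rule integrable_continuous_interval)
    thus ?thesis by (rule integrable_spike[of _ _ "{0}"]) auto
  qed
  have ptw: "(\<lambda>k. if x = 0 then 0 else F (Complex x (e k))) \<longlonglongrightarrow> G x" if "x \<in> {a..b}" for x
  proof (cases "x = 0")
    case False
    have "(\<lambda>k. F (Complex x (e k))) \<longlonglongrightarrow> F (Complex x 0)"
    proof (rule continuous_on_tendsto_compose[OF cont])
      show "(\<lambda>k. Complex x (e k)) \<longlonglongrightarrow> Complex x 0" by (intro tendsto_intros e0)
    qed (use that False e h in \<open>auto simp: complex_eq_iff less_imp_le\<close>)
    thus ?thesis using False by (simp add: G_def)
  qed (simp add: G_def)
  have bnd: "norm (if x = 0 then 0 else F (Complex x (e k))) \<le> max 0 (g x)" if "x \<in> {a..b}" for x k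
    using M[of "Complex x (e k)"] that e[of k] by (auto simp: complex_eq_iff)
  have g': "(\<lambda>x. max 0 (g x)) integrable_on {a..b}"
  proof (rule integrable_spike[of g _ "{0}"])
    fix x assume x: "x \<in> {a..b} - {0}"
    hence "cmod (F (Complex x 0)) \<le> g x" using M[of "Complex x 0"] h by (auto simp: complex_eq_iff)
    hence "0 \<le> g x" using norm_ge_zero order_trans by blast
    thus "max 0 (g x) = g x" by simp
  qed (use g in auto)
  note D = dominated_convergence[OF intk g' bnd ptw]
  show int0: "(\<lambda>x. F (Complex x 0)) integrable_on {a..b}"
    by (rule integrable_spike[OF D(1), of "{0}"]) (auto simp: G_def)
  have Geq: "integral {a..b} G = integral {a..b} (\<lambda>x. F (Complex x 0))"
    by (rule integral_spike[of "{0}"]) (auto simp: G_def)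
  have keq: "integral {a..b} (\<lambda>x. if x = 0 then 0 else F (Complex x (e k))) = integral {a..b} (\<lambda>x. F (Complex x (e k)))" for k
    by (rule integral_spike[of "{0}"]) auto
  have L1: "(\<lambda>k. integral {a..b} (\<lambda>x. F (Complex x (e k)))) \<longlonglongrightarrow> integral {a..b} (\<lambda>x. F (Complex x 0))"
    using D(2) unfolding Geq keq .
  have V: "(\<lambda>k. integral {e k..h} (\<lambda>y. F (Complex x y))) \<longlonglongrightarrow> integral {0..h} (\<lambda>y. F (Complex x y))"
    if "x = a \<or> x = b" for x
  proof -
    have "continuous_on {0..h} (\<lambda>y. F (Complex x y))"
      using that ab by (intro continuous_on_compose2[OF cont]) (auto intro!: continuous_intros simp: complex_eq_iff Complex_eq)
    hence int: "(\<lambda>y. F (Complex x y)) integrable_on {0..h}" by (rule integrable_continuous_interval)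
    have "continuous_on {0..h} (\<lambda>u. integral {u..h} (\<lambda>y. F (Complex x y)))"
      by (rule indefinite_integral_continuous_1'[OF int])
    from continuous_on_tendsto_compose[OF this e0] show ?thesis
      using e h by (auto simp: less_imp_le)
  qed
  have "integral {a..b} (\<lambda>x. F (Complex x (e k))) + \<i> * integral {e k..h} (\<lambda>y. F (Complex b y))
       = integral {a..b} (\<lambda>x. F (Complex x h)) + \<i> * integral {e k..h} (\<lambda>y. F (Complex a y))" for k
    using e[of k] ab by (intro rectangle_cauchy[of _ _ _ _ "{}"] holo continuous_on_subset[OF cont]) auto
  moreover have "(\<lambda>k. integral {a..b} (\<lambda>x. F (Complex x (e k))) + \<i> * integral {e k..h} (\<lambda>y. F (Complex b y)))
      \<longlonglongrightarrow> integral {a..b} (\<lambda>x. F (Complex x 0)) + \<i> * integral {0..h} (\<lambda>y. F (Complex b y))"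
    by (intro tendsto_intros L1 V) auto
  moreover have "(\<lambda>k. integral {a..b} (\<lambda>x. F (Complex x h)) + \<i> * integral {e k..h} (\<lambda>y. F (Complex a y)))
      \<longlonglongrightarrow> integral {a..b} (\<lambda>x. F (Complex x h)) + \<i> * integral {0..h} (\<lambda>y. F (Complex a y))"
    by (intro tendsto_intros V) auto
  ultimately show "integral {a..b} (\<lambda>x. F (Complex x 0)) + \<i> * integral {0..h} (\<lambda>y. F (Complex b y))
       = integral {a..b} (\<lambda>x. F (Complex x h)) + \<i> * integral {0..h} (\<lambda>y. F (Complex a y))"
    using LIMSEQ_unique by force
qed

section \<open>The symbol of the scheme\<close>

text \<open>With \<open>W = 1 - z\<close>, the first factor is the averaging polynomial
  \<open>1 - \<alpha>/2 + \<alpha>/2 z\<close>. The square stems from two uses of the BDF operator,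
  on the data and in passing from \<open>U\<close> to \<open>u\<close>. Each contributes
  \<open>W * (1 + W/2)\<close>; the two factors \<open>W\<close> are counted in the exponent
  \<open>\<gamma>\<close> of \<open>cn_symbol\<close>.\<close>

definition cn_num :: "real \<Rightarrow> complex \<Rightarrow> complex" where
  "cn_num \<alpha> W = (1 - of_real (\<alpha>/2) * W) * (1 + W/2)^2"

definition cn_den :: "real \<Rightarrow> real \<Rightarrow> complex \<Rightarrow> complex" where
  "cn_den \<alpha> \<mu> W = W powr of_real \<alpha> + of_real \<mu> * (1 - of_real (\<alpha>/2) * W)"

definition cn_symbol :: "real \<Rightarrow> real \<Rightarrow> real \<Rightarrow> complex \<Rightarrow> complex" where
  "cn_symbol \<alpha> \<gamma> \<mu> W = cn_num \<alpha> W * W powr of_real \<gamma> / cn_den \<alpha> \<mu> W"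

text \<open>A modulus is at least the component along the direction \<open>\<omega>\<close>. If both
  summands have a positive component along one common direction they cannot cancel, whatever their
  sizes \<open>r\<close> and \<open>\<mu>\<close>.\<close>

lemma rotation_bound:
  fixes \<alpha> \<phi> \<omega> r \<mu> :: real and p :: complex
  assumes r: "0 \<le> r" and mu: "0 \<le> \<mu>" and c: "c \<le> cos (\<phi> - \<omega>)" "c \<le> Re p * cos \<omega> + Im p * sin \<omega>"
  shows "c * (r + \<mu>) \<le> cmod (of_real r * cis \<phi> + of_real \<mu> * p)"
proof -
  have "c * (r + \<mu>) \<le> r * cos (\<phi> - \<omega>) + \<mu> * (Re p * cos \<omega> + Im p * sin \<omega>)"
    using mult_left_mono[OF c(1) r] mult_left_mono[OF c(2) mu] by (simp add: algebra_simps)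
  also have "\<dots> = Re ((of_real r * cis \<phi> + of_real \<mu> * p) * cis (- \<omega>))"
    by (simp add: cos_diff algebra_simps)
  also have "\<dots> \<le> cmod ((of_real r * cis \<phi> + of_real \<mu> * p) * cis (- \<omega>))"
    by (rule complex_Re_le_cmod)
  also have "\<dots> = cmod (of_real r * cis \<phi> + of_real \<mu> * p)"
    by (simp add: norm_mult)
  finally show ?thesis .
qed

lemma powr_upper_half:
  fixes W :: complex
  assumes "W \<noteq> 0" 
  shows "W powr of_real \<gamma> = of_real (cmod W powr \<gamma>) * cis (\<gamma> * Arg W)"
proof -
  have "W powr of_real \<gamma> = exp (of_real \<gamma> * Ln W)" using assms by (simp add: powr_def)
  also have "Ln W = of_real (ln (cmod W)) + \<i> * of_real (Arg W)"
    using assms by (simp add: Ln_Arg)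
  also have "exp (of_real \<gamma> * (of_real (ln (cmod W)) + \<i> * of_real (Arg W))) 
     = exp (of_real (\<gamma> * ln (cmod W))) * exp (\<i> * of_real (\<gamma> * Arg W))"
    by (simp add: algebra_simps flip: exp_add)
  also have "exp (of_real (\<gamma> * ln (cmod W))) = (of_real (cmod W powr \<gamma>) :: complex)"
    using assms by (simp only: exp_of_real) (simp add: powr_def)
  finally show ?thesis by (simp add: cis_conv_exp)
qed

lemma Arg_upper:
  assumes "W \<noteq> 0" "Im W \<ge> 0"
  shows "0 \<le> Arg W" "Arg W \<le> pi" "Re W \<ge> 0 \<Longrightarrow> Arg W \<le> pi/2"
  using assms Im_Ln_pos_le[of W] Re_Ln_pos_le[of W] by (auto simp: Arg_eq_Im_Ln)

text \<open>Only \<open>Im W \<ge> 0\<close> is treated: the lower half follows by conjugation, and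
  at negative \<open>W\<close> the principal power is the limit from above. The radius exceeds
  \<open>1\<close> by so little that wherever \<open>Re W < 0\<close> the imaginary part of
  \<open>W\<close> is at most \<open>\<delta>\<close>. The two signs of \<open>Re W\<close> call for
  two different directions in \<open>rotation_bound\<close>.\<close>

lemma cn_den_bound:
  assumes \<alpha>: "0 < \<alpha>" "\<alpha> < 1"
  obtains \<rho> c where "1 < \<rho>" "0 < c" 
    "\<And>W \<mu>. cmod (1 - W) \<le> \<rho> \<Longrightarrow> 0 \<le> Im W \<Longrightarrow> 0 \<le> \<mu> \<Longrightarrow> c * (cmod W powr \<alpha> + \<mu>) \<le> cmod (cn_den \<alpha> \<mu> W)"
proof -
  \<comment> \<open>One entry for each case below: \<open>1-\<alpha>\<close> keeps
    \<open>Re p\<close> positive when \<open>Re W \<ge> 0\<close>, and the cosine dominates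
    \<open>Im p\<close> when \<open>Re W < 0\<close>.\<close>
  define \<delta> where "\<delta> = min (cos (\<alpha> * pi / 2)) (1 - \<alpha>)"
  have "\<alpha> * pi / 2 < pi / 2" "0 < \<alpha> * pi / 2" using \<alpha> by auto
  hence cpos: "0 < cos (\<alpha> * pi / 2)" using pi_gt_zero by (intro cos_gt_zero_pi) linarith+
  have d: "0 < \<delta>" "\<delta> \<le> cos (\<alpha> * pi / 2)" "\<delta> \<le> 1 - \<alpha>" using cpos \<alpha> by (auto simp: \<delta>_def)
  define \<rho> where "\<rho> = sqrt (1 + \<delta>^2)"
  have rho2: "\<rho>^2 = 1 + \<delta>^2" by (simp add: \<rho>_def)
  have rho1: "1 < \<rho>" using d by (simp add: \<rho>_def)
  have rho3: "\<rho> \<le> 1 + \<delta>"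
    unfolding \<rho>_def using d by (intro real_le_lsqrt) (auto simp: power2_eq_square algebra_simps)
  \<comment> \<open>A direction slightly below the real axis: for \<open>Re W \<ge> 0\<close> one
    has \<open>Re p > 0\<close>, \<open>Im p \<le> 0\<close>, while \<open>W powr \<alpha>\<close>
    has its argument between \<open>0\<close> and \<open>\<alpha> * pi / 2\<close>; both are less
    than a right angle away.\<close>
  define \<omega>1 where "\<omega>1 = - ((1-\<alpha>) * pi / 4)"
  have a1: "0 < cos ((1+\<alpha>) * pi / 4)" 
    using \<alpha> by (intro cos_gt_zero_pi) (auto simp: field_simps intro!: add_pos_pos)
  have a2: "0 < cos \<omega>1"
    using \<alpha> by (intro cos_gt_zero_pi) (auto simp: \<omega>1_def field_simps intro!: add_pos_pos)
  have a3: "sin \<omega>1 \<le> 0"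
    using sin_ge_zero[of "(1-\<alpha>) * pi / 4"] \<alpha> unfolding \<omega>1_def by (simp add: field_simps)
  define c where "c = Min {cos ((1+\<alpha>) * pi / 4), (1-\<alpha>)/2 * cos \<omega>1, cos (\<alpha> * pi / 2) / 2, 1}"
  have c: "c \<le> cos ((1+\<alpha>) * pi / 4)" "c \<le> (1-\<alpha>)/2 * cos \<omega>1" "c \<le> cos (\<alpha> * pi / 2) / 2" "c \<le> 1"
    by (auto simp: c_def)
  have c0: "0 < c" using a1 a2 cpos \<alpha> by (auto simp: c_def)
  have "c * (cmod W powr \<alpha> + \<mu>) \<le> cmod (cn_den \<alpha> \<mu> W)"
    if W: "cmod (1 - W) \<le> \<rho>" "0 \<le> Im W" "0 \<le> \<mu>" for W \<mu>
  proof (cases "W = 0")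
    case True
    thus ?thesis using c W by (simp add: cn_den_def mult_left_le_one_le c0 less_imp_le)
  next
    case False
    define p where "p = 1 - of_real (\<alpha>/2) * W"
    have Rep: "Re p = 1 - \<alpha>/2 * Re W" and Imp: "Im p = - (\<alpha>/2 * Im W)" by (auto simp: p_def)
    have "\<bar>Re (1 - W)\<bar> \<le> \<rho>" using W(1) abs_Re_le_cmod order_trans by blast
    hence ReW: "Re W \<le> 1 + \<rho>" "1 - \<rho> \<le> Re W" by auto
    note A = Arg_upper[OF False W(2)]
    have "c * (cmod W powr \<alpha> + \<mu>) \<le> cmod (of_real (cmod W powr \<alpha>) * cis (\<alpha> * Arg W) + of_real \<mu> * p)"
    proof (cases "Re W \<ge> 0")
      case True
      show ?thesis
      proof (rule rotation_bound[where \<omega> = \<omega>1])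
        have "\<alpha> * Arg W \<le> \<alpha> * (pi/2)" using A(3)[OF True] \<alpha> by (intro mult_left_mono) auto
        hence "\<alpha> * Arg W - \<omega>1 \<le> (1+\<alpha>) * pi / 4" by (simp add: \<omega>1_def field_simps)
        moreover have "0 \<le> \<alpha> * Arg W - \<omega>1" using A \<alpha> by (simp add: \<omega>1_def)
        moreover have "(1+\<alpha>) * pi / 4 \<le> pi" using \<alpha> by (simp add: field_simps)
        ultimately have "cos ((1+\<alpha>) * pi / 4) \<le> cos (\<alpha> * Arg W - \<omega>1)" by (intro cos_monotone_0_pi_le) auto
        thus "c \<le> cos (\<alpha> * Arg W - \<omega>1)" using c by simp
        have "\<alpha> * Re W \<le> \<alpha> * (2 + \<delta>)" using ReW rho3 \<alpha> by (intro mult_left_mono) auto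
        moreover have "\<alpha> * \<delta> \<le> \<delta>" using \<alpha> d by (simp add: mult_left_le_one_le)
        ultimately have "\<alpha> * Re W \<le> \<delta> + 2 * \<alpha>" by (simp add: distrib_left)
        moreover have "Re p = 1 - (\<alpha> * Re W) / 2" using Rep by simp
        ultimately have "(1-\<alpha>)/2 \<le> Re p" using d by simp
        hence "(1-\<alpha>)/2 * cos \<omega>1 \<le> Re p * cos \<omega>1" using a2 by (intro mult_right_mono) auto
        moreover have "0 \<le> Im p * sin \<omega>1" using W \<alpha> a3 unfolding Imp by (simp add: mult_nonneg_nonpos)
        ultimately show "c \<le> Re p * cos \<omega>1 + Im p * sin \<omega>1" using c by linarith
      qed (use W in auto)
    next
      case False
      show ?thesis
      proof (rule rotation_bound[where \<omega> = "\<alpha> * pi / 2"])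
        have "\<alpha> * Arg W \<le> \<alpha> * pi" "0 \<le> \<alpha> * Arg W" using A \<alpha> by auto
        hence "\<bar>\<alpha> * Arg W - \<alpha> * pi / 2\<bar> \<le> \<alpha> * pi / 2" by (auto simp: abs_if field_simps)
        moreover have "\<alpha> * pi / 2 \<le> pi" using \<alpha> by (simp add: field_simps)
        ultimately have "cos (\<alpha> * pi / 2) \<le> cos \<bar>\<alpha> * Arg W - \<alpha> * pi / 2\<bar>" by (intro cos_monotone_0_pi_le) auto
        thus "c \<le> cos (\<alpha> * Arg W - \<alpha> * pi / 2)" using c cpos by simp
        have "(Re (1-W))^2 + (Im W)^2 \<le> \<rho>^2"
          using power_mono[OF W(1), of 2] by (simp add: cmod_power2)
        moreover have "1 \<le> (Re (1-W))^2" using False by (simp add: one_le_power)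
        ultimately have "(Im W)^2 \<le> \<delta>^2" unfolding rho2 by simp
        hence ImW: "Im W \<le> \<delta>" using d W by (simp add: power2_le_iff_abs_le)
        have "1 \<le> Re p" using False \<alpha> unfolding Rep by (simp add: mult_nonneg_nonpos)
        hence "1 * cos (\<alpha> * pi / 2) \<le> Re p * cos (\<alpha> * pi / 2)" using cpos by (intro mult_right_mono) auto
        moreover have "\<alpha>/2 * Im W * sin (\<alpha> * pi / 2) \<le> 1/2 * \<delta> * 1"
          using \<alpha> ImW W d by (intro mult_mono sin_le_one) (auto intro!: sin_ge_zero simp: field_simps)
        ultimately show "c \<le> Re p * cos (\<alpha> * pi / 2) + Im p * sin (\<alpha> * pi / 2)"
          using c d unfolding Imp by (simp only: mult_minus_left mult_1_left)
      qed (use W in auto)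
    qed
    thus ?thesis unfolding cn_den_def powr_upper_half[OF False] p_def .
  qed
  thus ?thesis using that rho1 c0 by blast
qed

text \<open>The order of the scheme is decided here. In the first product the linear coefficients in
  \<open>r\<close> are \<open>-1\<close> from the square, \<open>-(\<alpha>-3)/2\<close> from the
  second factor and \<open>(\<alpha>-1)/2\<close> from the power, with sum \<open>0\<close>. In the
  second expression the weight \<open>\<alpha>/2\<close> meets the linear coefficient of
  \<open>((exp r - 1)/r) powr \<alpha>\<close>.\<close>

lemma cut_asymptotics:
  fixes \<alpha> :: real
  assumes \<alpha>: "0 < \<alpha>" "\<alpha> < 1"
  obtains \<delta> C where "0 < \<delta>" "0 < C"
    "\<And>r. 0 < r \<Longrightarrow> r \<le> \<delta> \<Longrightarrow> \<bar>(1 - (exp r - 1)/2)^2 * (1 - (\<alpha>-3)/2 * (exp r - 1)) * ((exp r - 1)/r) powr (\<alpha>-1) - 1\<bar> \<le> C * r^2"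
    "\<And>r. 0 < r \<Longrightarrow> r \<le> \<delta> \<Longrightarrow> \<bar>1 + \<alpha>/2 * (exp r - 1) - ((exp r - 1)/r) powr \<alpha>\<bar> \<le> C * r^2"
proof -
  define w where "w = (\<lambda>r::real. exp r - 1)"
  define k where "k = (\<alpha>-1)/2"
  define b where "b = (\<alpha>-3)/2"
  define A where "A = (\<lambda>r. (1 - w r/2)^2 * (1 - b * w r))"
  have 0: "(\<lambda>r::real. (w r / r) powr (\<alpha>-1) - 1 - k*r) \<in> O[at_right 0](\<lambda>r. r^2)"
    unfolding k_def w_def by real_asymp
  have w1: "(\<lambda>r. w r - r) \<in> O[at_right 0](\<lambda>r. r^2)" "(\<lambda>r. w r ^ 2) \<in> O[at_right 0](\<lambda>r. r^2)"
      "(\<lambda>r. w r * r) \<in> O[at_right 0](\<lambda>r. r^2)"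
    unfolding w_def by real_asymp+
  have w0: "(w \<longlongrightarrow> 0) (at_right 0)" unfolding w_def by real_asymp
  have O1: "f \<in> O[at_right 0](\<lambda>_. 1)" if "(f \<longlongrightarrow> c) (at_right 0)" for f :: "real \<Rightarrow> real" and c
    using that by (intro bigoI_tendsto[of _ _ c]) auto
  have r0: "((\<lambda>r::real. r) \<longlongrightarrow> 0) (at_right 0)" by real_asymp
  have "A \<in> O[at_right 0](\<lambda>_. 1)"
    unfolding A_def by (rule O1[of _ "(1 - 0/2)^2 * (1 - b * 0)"], intro tendsto_intros w0) simp
  from landau_o.big.mult[OF this 0]
  have A0: "(\<lambda>r. A r * ((w r / r) powr (\<alpha>-1) - 1 - k*r)) \<in> O[at_right 0](\<lambda>r. r^2)" by simp
  have "(\<lambda>r. (1/4 + b - b/4 * w r) * (1 + k * r)) \<in> O[at_right 0](\<lambda>_. 1)"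
    by (rule O1[of _ "(1/4 + b - b/4 * 0) * (1 + k * 0)"], intro tendsto_intros w0 r0) simp
  from landau_o.big.mult[OF w1(2) this]
  have A1: "(\<lambda>r. w r ^ 2 * ((1/4 + b - b/4 * w r) * (1 + k * r))) \<in> O[at_right 0](\<lambda>r. r^2)" by simp
  have cm: "(\<lambda>r. c * f r) \<in> O[at_right 0](\<lambda>r. r^2)" if "f \<in> O[at_right 0](\<lambda>r. r^2)" for c :: real and f
    using that by (cases "c = 0") simp_all
  have "(\<lambda>r. A r * ((w r / r) powr (\<alpha>-1) - 1 - k*r) + (w r ^ 2 * ((1/4 + b - b/4 * w r) * (1 + k * r))
           - k * (w r - r) - k^2 * (w r * r))) \<in> O[at_right 0](\<lambda>r. r^2)"
    by (intro sum_in_bigo A0 A1 cm w1)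
  also have "(\<lambda>r. A r * ((w r / r) powr (\<alpha>-1) - 1 - k*r) + (w r ^ 2 * ((1/4 + b - b/4 * w r) * (1 + k * r))
           - k * (w r - r) - k^2 * (w r * r))) = (\<lambda>r. A r * (w r / r) powr (\<alpha>-1) - 1)"
  proof
    fix r
    \<comment> \<open>This identity is the cancellation of the linear terms.\<close>
    have kb: "k = 1 + b" by (simp add: k_def b_def field_simps)
    have "A r * (1 + k*r) - 1 = w r ^ 2 * ((1/4 + b - b/4 * w r) * (1 + k * r)) - k * (w r - r) - k^2 * (w r * r)"
      unfolding A_def kb by (simp add: power2_eq_square field_simps)
    thus "A r * ((w r / r) powr (\<alpha>-1) - 1 - k*r) + (w r ^ 2 * ((1/4 + b - b/4 * w r) * (1 + k * r))
           - k * (w r - r) - k^2 * (w r * r)) = A r * (w r / r) powr (\<alpha>-1) - 1"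
      by (simp add: algebra_simps)
  qed
  finally have 1: "(\<lambda>r. A r * (w r / r) powr (\<alpha>-1) - 1) \<in> O[at_right 0](\<lambda>r. r^2)" .
  have 2: "(\<lambda>r::real. 1 + \<alpha>/2 * w r - (w r/r) powr \<alpha>) \<in> O[at_right 0](\<lambda>r. r^2)"
    unfolding w_def by real_asymp
  obtain C1 where C1: "C1 > 0" "\<forall>\<^sub>F r in at_right 0. \<bar>A r * (w r / r) powr (\<alpha>-1) - 1\<bar> \<le> C1 * r^2"
    using landau_o.bigE[OF 1] by auto
  obtain C2 where C2: "C2 > 0" "\<forall>\<^sub>F r in at_right 0. \<bar>1 + \<alpha>/2 * w r - (w r/r) powr \<alpha>\<bar> \<le> C2 * r^2"
    using landau_o.bigE[OF 2] by auto
  from eventually_conj[OF C1(2) C2(2)] obtain \<delta> where \<delta>: "\<delta> > 0"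
    "\<And>r. 0 < r \<Longrightarrow> r < \<delta> \<Longrightarrow> \<bar>A r * (w r / r) powr (\<alpha>-1) - 1\<bar> \<le> C1 * r^2 \<and> \<bar>1 + \<alpha>/2 * w r - (w r/r) powr \<alpha>\<bar> \<le> C2 * r^2"
    unfolding eventually_at_right_field by auto
  show ?thesis
  proof (rule that[of "\<delta>/2" "max C1 C2"])
    fix r :: real assume r: "0 < r" "r \<le> \<delta>/2"
    have m: "C1 * r^2 \<le> max C1 C2 * r^2" "C2 * r^2 \<le> max C1 C2 * r^2" by (intro mult_right_mono; simp)+
    have h: "\<bar>A r * (w r / r) powr (\<alpha>-1) - 1\<bar> \<le> C1 * r^2" "\<bar>1 + \<alpha>/2 * w r - (w r/r) powr \<alpha>\<bar> \<le> C2 * r^2"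
      using \<delta>(2)[of r] r \<delta>(1) by simp_all
    show "\<bar>(1 - (exp r - 1)/2)^2 * (1 - (\<alpha>-3)/2 * (exp r - 1)) * ((exp r - 1)/r) powr (\<alpha>-1) - 1\<bar> \<le> max C1 C2 * r^2"
      by (rule order_trans[OF h(1) m(1), unfolded A_def w_def b_def])
    show "\<bar>1 + \<alpha>/2 * (exp r - 1) - ((exp r - 1)/r) powr \<alpha>\<bar> \<le> max C1 C2 * r^2"
      by (rule order_trans[OF h(2) m(2), unfolded w_def])
  qed (use \<delta>(1) C1 in auto)
qed

section \<open>The Mittag-Leffler function\<close>

definition ml_density :: "real \<Rightarrow> real \<Rightarrow> real \<Rightarrow> real" where
  "ml_density \<alpha> \<mu> r = sin (pi * \<alpha>) / pi * (\<mu> * r powr (\<alpha> - 1)) / (r powr (2 * \<alpha>) + 2 * \<mu> * r powr \<alpha> * cos (pi * \<alpha>) + \<mu>\<^sup>2)"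

text \<open>The boundary value from above of
  \<open>s powr (\<alpha>-1) / (s powr \<alpha> + \<mu>)\<close> at \<open>s = - r\<close>; the
  leading minus sign is the factor \<open>cis (- pi)\<close>.\<close>

definition ml_symbol :: "real \<Rightarrow> real \<Rightarrow> real \<Rightarrow> complex" where
  "ml_symbol \<alpha> \<mu> r = - of_real (r powr (\<alpha> - 1)) * cis (pi * \<alpha>) / (of_real (r powr \<alpha>) * cis (pi * \<alpha>) + of_real \<mu>)"

lemma ml_den_norm:
  "(cmod (of_real (r powr \<alpha>) * cis (pi * \<alpha>) + of_real \<mu>))\<^sup>2 = r powr (2 * \<alpha>) + 2 * \<mu> * r powr \<alpha> * cos (pi * \<alpha>) + \<mu>\<^sup>2"
proof -
  define x where "x = r powr \<alpha>"
  have "(cmod (of_real x * cis (pi * \<alpha>) + of_real \<mu>))^2 = (x * cos (pi * \<alpha>) + \<mu>)^2 + (x * sin (pi * \<alpha>))^2"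
    unfolding cmod_power2 by simp
  also have "\<dots> = x^2 * ((sin (pi * \<alpha>))^2 + (cos (pi * \<alpha>))^2) + 2 * \<mu> * x * cos (pi * \<alpha>) + \<mu>\<^sup>2"
    by (simp only: power2_eq_square algebra_simps)
  also have "\<dots> = x^2 + 2 * \<mu> * x * cos (pi * \<alpha>) + \<mu>\<^sup>2"
    by (simp only: sin_cos_squared_add mult_1_right)
  also have "x^2 = r powr (2 * \<alpha>)" by (simp add: x_def power2_eq_square flip: powr_add)
  finally show ?thesis by (simp add: x_def)
qed

lemma ml_density_symbol:
  "ml_density \<alpha> \<mu> r = - Im (ml_symbol \<alpha> \<mu> r) / pi"
proof -
  define E where "E = cis (pi * \<alpha>)"
  define D where "D = of_real (r powr \<alpha>) * E + of_real \<mu>"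
  have "ml_symbol \<alpha> \<mu> r = - of_real (r powr (\<alpha> - 1)) * E / D" by (simp add: ml_symbol_def E_def D_def)
  also have "\<dots> = of_real (- (r powr (\<alpha> - 1)) / (cmod D)^2) * (E * cnj D)"
    by (simp add: complex_div_cnj[of _ D] mult_ac)
  finally have "Im (ml_symbol \<alpha> \<mu> r) = - (r powr (\<alpha> - 1)) / (cmod D)^2 * Im (E * cnj D)"
    by (simp only: Im_complex_of_real Re_complex_of_real times_complex.simps)
  also have "Im (E * cnj D) = \<mu> * sin (pi * \<alpha>)" by (simp add: D_def E_def algebra_simps)
  finally show ?thesis unfolding ml_density_def ml_den_norm[symmetric] D_def E_def by (simp add: field_simps)
qed

text \<open>The angle \<open>\<alpha> * pi / 2\<close> bisects the directions
  \<open>cis (pi * \<alpha>)\<close> and \<open>1\<close> of the two summands, so each has the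
  component \<open>cos (\<alpha> * pi / 2)\<close> along it.\<close>

lemma ml_den_bound:
  assumes "0 < \<alpha>" "\<alpha> < 1" "0 < r" "0 \<le> \<mu>"
  shows "cos (\<alpha> * pi / 2) * (r powr \<alpha> + \<mu>) \<le> cmod (of_real (r powr \<alpha>) * cis (pi * \<alpha>) + of_real \<mu>)"
  using rotation_bound[of "r powr \<alpha>" \<mu> "cos (\<alpha> * pi / 2)" "pi * \<alpha>" "\<alpha> * pi / 2" 1] assms by (simp add: mult.commute)

lemma cos_half_pos:
  assumes "0 < \<alpha>" "\<alpha> < (1::real)"
  shows "0 < cos (\<alpha> * pi / 2)"
proof -
  have "\<alpha> * pi / 2 < pi / 2" "0 < \<alpha> * pi / 2" using assms by auto
  thus ?thesis using pi_gt_zero by (intro cos_gt_zero_pi) linarith+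
qed

text \<open>The upper bounds come from bounding \<open>(x + \<mu>)^2\<close>, with
  \<open>x = r powr \<alpha>\<close>, below by \<open>\<mu>^2\<close>, by \<open>x^2\<close> or by
  \<open>x * \<mu>\<close>. The first two give integrability at \<open>0\<close> and at infinity;
  the third is the one free of \<open>\<mu>\<close>.\<close>

lemma ml_density_bounds:
  assumes a: "0 < \<alpha>" "\<alpha> < 1" "0 < r" "0 < \<mu>"
  shows "0 \<le> ml_density \<alpha> \<mu> r"
    and "ml_density \<alpha> \<mu> r \<le> r powr (\<alpha>-1) / ((cos (\<alpha> * pi / 2))\<^sup>2 * \<mu>)"
    and "ml_density \<alpha> \<mu> r \<le> \<mu> * r powr (-\<alpha>-1) / (cos (\<alpha> * pi / 2))\<^sup>2"
    and "ml_density \<alpha> \<mu> r \<le> 1 / ((cos (\<alpha> * pi / 2))\<^sup>2 * r)"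
proof -
  define k where "k = cos (\<alpha> * pi / 2)"
  define x where "x = r powr \<alpha>"
  define y where "y = r powr (\<alpha> - 1)"
  define N where "N = cmod (of_real (r powr \<alpha>) * cis (pi * \<alpha>) + of_real \<mu>)"
  have k: "0 < k" unfolding k_def by (rule cos_half_pos[OF a(1,2)])
  have x: "0 < x" and y: "0 < y" using a by (auto simp: x_def y_def)
  have N: "k * (x + \<mu>) \<le> N" unfolding k_def N_def x_def using a by (intro ml_den_bound) auto
  have sn: "0 \<le> sin (pi * \<alpha>) / pi" using a by (intro divide_nonneg_pos sin_ge_zero) (auto simp: mult_left_le)
  have "sin (pi * \<alpha>) \<le> pi" using sin_le_one[of "pi * \<alpha>"] pi_gt3 by linarith
  hence sn1: "sin (pi * \<alpha>) / pi \<le> 1" by simp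
  have K: "ml_density \<alpha> \<mu> r = sin (pi * \<alpha>) / pi * (\<mu> * y) / N^2"
    unfolding ml_density_def N_def ml_den_norm y_def ..
  show "0 \<le> ml_density \<alpha> \<mu> r" unfolding K using y a by (intro divide_nonneg_nonneg[of "sin (pi * \<alpha>) / pi * (\<mu> * y)"] mult_nonneg_nonneg[OF sn]) auto
  have *: "ml_density \<alpha> \<mu> r \<le> \<mu> * y / (k^2 * d)" if d: "0 < d" "d \<le> (x + \<mu>)^2" for d
  proof -
    have "k^2 * d \<le> (k * (x + \<mu>))^2" using d k by (simp add: power_mult_distrib)
    also have "\<dots> \<le> N^2" using N k x a by (intro power_mono) auto
    finally have "k^2 * d \<le> N^2" .
    moreover have "sin (pi * \<alpha>) / pi * (\<mu> * y) \<le> 1 * (\<mu> * y)" using sn1 y a by (intro mult_right_mono) auto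
    ultimately show ?thesis unfolding K using d k y a sn by (intro frac_le) auto
  qed
  have "ml_density \<alpha> \<mu> r \<le> \<mu> * y / (k^2 * \<mu>^2)"
    by (rule *) (use x a in \<open>auto intro: power_mono\<close>)
  thus "ml_density \<alpha> \<mu> r \<le> r powr (\<alpha>-1) / ((cos (\<alpha> * pi / 2))\<^sup>2 * \<mu>)"
    using a unfolding k_def[symmetric] y_def[symmetric] by (simp add: power2_eq_square)
  have "ml_density \<alpha> \<mu> r \<le> \<mu> * y / (k^2 * x^2)"
    by (rule *) (use x a in \<open>auto intro: power_mono\<close>)
  also have "y / x^2 = r powr (-\<alpha>-1)" unfolding x_def y_def using a
    by (simp add: power2_eq_square flip: powr_add powr_diff)
  hence "\<mu> * y / (k^2 * x^2) = \<mu> * r powr (-\<alpha>-1) / k^2" by (metis (no_types) times_divide_eq_right divide_divide_eq_left mult.commute)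
  finally show "ml_density \<alpha> \<mu> r \<le> \<mu> * r powr (-\<alpha>-1) / (cos (\<alpha> * pi / 2))\<^sup>2" unfolding k_def .
  have "ml_density \<alpha> \<mu> r \<le> \<mu> * y / (k^2 * (x * \<mu>))"
    by (rule *) (use x a in \<open>auto simp: power2_eq_square algebra_simps add_increasing\<close>)
  also have "\<dots> = y / x / k^2" using a by (simp add: field_simps)
  also have "y / x = 1 / r" unfolding x_def y_def using a by (simp add: powr_diff)
  finally show "ml_density \<alpha> \<mu> r \<le> 1 / ((cos (\<alpha> * pi / 2))\<^sup>2 * r)" unfolding k_def by (simp add: mult.commute)
qed

text \<open>The Mittag-Leffler value \<open>E_\<alpha>(- \<mu> t^\<alpha>)\<close> in its spectral
  form, the one that can be compared with the cut integral of the scheme under a single integral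
  sign.\<close>

definition ml_fun :: "real \<Rightarrow> real \<Rightarrow> real \<Rightarrow> real" where
  "ml_fun \<alpha> \<mu> t = (LINT r:{0..}|lborel. exp (- (r * t)) * ml_density \<alpha> \<mu> r)"

text \<open>For nonnegative functions, gauge integrability already gives absolute integrability,
  which makes the known gauge integrals of powers available; Borel measurability then passes from
  the completed measure back to \<open>lborel\<close>.\<close>

lemma set_integrable_lborelI:
  fixes f :: "real \<Rightarrow> real"
  assumes "f \<in> borel_measurable borel" "S \<in> sets borel" "\<And>x. x \<in> S \<Longrightarrow> 0 \<le> f x" "f integrable_on S"
  shows "set_integrable lborel S f"
proof -
  have "f absolutely_integrable_on S" using assms(3,4) by (intro nonnegative_absolutely_integrable_1)
  hence "integrable (completion lborel) (\<lambda>x. indicator S x *\<^sub>R f x)" by (simp add: set_integrable_def)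
  moreover have "(\<lambda>x. indicator S x *\<^sub>R f x) \<in> borel_measurable lborel" using assms(1,2) by measurable
  ultimately show ?thesis unfolding set_integrable_def using integrable_completion by blast
qed

lemma ml_density_measurable [measurable]: "ml_density \<alpha> \<mu> \<in> borel_measurable borel"
  unfolding ml_density_def[abs_def] by measurable

lemma ml_density_integrable:
  assumes a: "0 < \<alpha>" "\<alpha> < 1" "0 < \<mu>"
  shows "set_integrable lborel {0..} (ml_density \<alpha> \<mu>)"
proof -
  define k where "k = (cos (\<alpha> * pi / 2))\<^sup>2"
  have k: "0 < k" unfolding k_def using cos_half_pos[OF a(1,2)] by simp
  define h1 where "h1 = (\<lambda>r::real. r powr (\<alpha>-1) / (k * \<mu>))"
  define h2 where "h2 = (\<lambda>r::real. \<mu> * r powr (-\<alpha>-1) / k)"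
  have z: "ml_density \<alpha> \<mu> 0 = 0" by (simp add: ml_density_def)
  have nn: "0 \<le> ml_density \<alpha> \<mu> r" if "0 \<le> r" for r
    using ml_density_bounds(1)[OF a(1,2) _ a(3), of r] that z by (cases "r = 0") auto
  have "(\<lambda>r::real. r powr (\<alpha>-1)) integrable_on {0..1}"
    using has_integral_powr_from_0[of "\<alpha>-1" 1] a by (auto simp: integrable_on_def)
  hence "(\<lambda>r::real. 1 / (k * \<mu>) * r powr (\<alpha>-1)) integrable_on {0..1}" by (rule integrable_on_mult_right)
  hence i1: "h1 integrable_on {0..1}" unfolding h1_def by simp
  have "(\<lambda>r::real. r powr (-\<alpha>-1)) integrable_on {1..}"
    using has_integral_powr_to_inf[of "-\<alpha>-1" 1] a by (auto simp: integrable_on_def)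
  hence "(\<lambda>r::real. \<mu> / k * r powr (-\<alpha>-1)) integrable_on {1..}" by (rule integrable_on_mult_right)
  hence i2: "h2 integrable_on {1..}" unfolding h2_def by simp
  have s1: "set_integrable lborel {0..1} h1"
    by (rule set_integrable_lborelI[OF _ _ _ i1]) (use k a in \<open>auto simp: h1_def\<close>)
  have s2: "set_integrable lborel {1..} h2"
    by (rule set_integrable_lborelI[OF _ _ _ i2]) (use k a in \<open>auto simp: h2_def\<close>)
  have "set_integrable lborel {0..1} (ml_density \<alpha> \<mu>)"
  proof (rule set_integrable_bound[OF s1])
    show "AE x in lborel. x \<in> {0..1} \<longrightarrow> norm (ml_density \<alpha> \<mu> x) \<le> norm (h1 x)"
      using nn ml_density_bounds(2)[OF a(1,2) _ a(3)] k a z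
      by (intro AE_I2 impI) (case_tac "x = 0"; force simp: h1_def k_def)
  qed (auto simp: set_borel_measurable_def)
  moreover have "set_integrable lborel {1..} (ml_density \<alpha> \<mu>)"
  proof (rule set_integrable_bound[OF s2])
    show "AE x in lborel. x \<in> {1..} \<longrightarrow> norm (ml_density \<alpha> \<mu> x) \<le> norm (h2 x)"
      using nn ml_density_bounds(3)[OF a(1,2) _ a(3)] k a
      by (intro AE_I2 impI) (force simp: h2_def k_def)
  qed (auto simp: set_borel_measurable_def)
  ultimately have "set_integrable lborel ({0..1} \<union> {1..}) (ml_density \<alpha> \<mu>)"
    by (rule set_integrable_Un) auto
  moreover have "{0..1} \<union> {1..} = {0::real..}" by auto
  ultimately show ?thesis by simp
qed

lemma ml_fun_integrable:
  assumes "0 < \<alpha>" "\<alpha> < 1" "0 < \<mu>" "0 \<le> t"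
  shows "set_integrable lborel {0..} (\<lambda>r. exp (- (r * t)) * ml_density \<alpha> \<mu> r)"
proof (rule set_integrable_bound[OF ml_density_integrable[OF assms(1-3)]])
  show "AE x in lborel. x \<in> {0..} \<longrightarrow> norm (exp (- (x * t)) * ml_density \<alpha> \<mu> x) \<le> norm (ml_density \<alpha> \<mu> x)"
    using assms(4) by (intro AE_I2 impI) (auto simp: abs_mult intro!: mult_left_le_one_le)
qed (auto simp: set_borel_measurable_def)

section \<open>Coefficients of the symbol as integrals over the cut\<close>

text \<open>The Taylor series of \<open>(1-z) powr \<gamma>\<close>, generic over the field because
  the scheme is real while its analysis takes place in the complex plane.\<close>

definition opm :: "'a :: field_char_0 \<Rightarrow> 'a fps" where
  "opm \<gamma> = Abs_fps (\<lambda>n. pochhammer (- \<gamma>) n / fact n)"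

definition fps_cplx :: "real fps \<Rightarrow> complex fps" where
  "fps_cplx F = Abs_fps (\<lambda>n. of_real (fps_nth F n))"

definition cn_fps_num :: "real \<Rightarrow> real fps" where
  "cn_fps_num \<alpha> = (1 - fps_const (\<alpha>/2) * (1 - fps_X)) * (1 + fps_const (1/2) * (1 - fps_X))^2"

definition cn_fps_den :: "real \<Rightarrow> real \<Rightarrow> real fps" where
  "cn_fps_den \<alpha> \<mu> = opm \<alpha> + fps_const \<mu> * (1 - fps_const (\<alpha>/2) * (1 - fps_X))"

text \<open>The expansion in \<open>z\<close> of \<open>cn_symbol\<close> at
  \<open>W = 1 - z\<close>, kept as a real formal series so that it can be matched with the
  recurrence of the scheme by pure algebra.\<close>

definition cn_fps :: "real \<Rightarrow> real \<Rightarrow> real \<Rightarrow> real fps" where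
  "cn_fps \<alpha> \<gamma> \<mu> = cn_fps_num \<alpha> * opm \<gamma> * inverse (cn_fps_den \<alpha> \<mu>)"

lemma fps_cplx_mult: "fps_cplx (F * G) = fps_cplx F * fps_cplx G"
  by (rule fps_ext) (simp add: fps_cplx_def fps_mult_nth)

lemma fps_cplx_add: "fps_cplx (F + G) = fps_cplx F + fps_cplx G"
  by (rule fps_ext) (simp add: fps_cplx_def)

lemma fps_cplx_diff: "fps_cplx (F - G) = fps_cplx F - fps_cplx G"
  by (rule fps_ext) (simp add: fps_cplx_def)

lemma fps_cplx_const: "fps_cplx (fps_const c) = fps_const (of_real c)"
  by (rule fps_ext) (simp add: fps_cplx_def)

lemma fps_cplx_1: "fps_cplx 1 = 1"
  by (rule fps_ext) (simp add: fps_cplx_def)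

lemma fps_cplx_X: "fps_cplx fps_X = fps_X"
  by (rule fps_ext) (simp add: fps_cplx_def)

lemma fps_cplx_power: "fps_cplx (F ^ n) = fps_cplx F ^ n"
  by (induction n) (simp_all add: fps_cplx_1 fps_cplx_mult)

lemma fps_cplx_inverse:
  assumes "fps_nth F 0 \<noteq> 0"
  shows "fps_cplx (inverse F) = inverse (fps_cplx F)"
proof -
  have "fps_cplx F * fps_cplx (inverse F) = 1"
    using assms by (simp add: inverse_mult_eq_1' fps_cplx_1 flip: fps_cplx_mult)
  moreover have "fps_nth (fps_cplx F) 0 \<noteq> 0" using assms by (simp add: fps_cplx_def)
  ultimately show ?thesis by (metis fps_inverse_unique)
qed

lemma pochhammer_of_real: "pochhammer (of_real x) n = (of_real (pochhammer x n) :: complex)"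
  by (simp add: pochhammer_prod)

lemma fps_cplx_opm: "fps_cplx (opm \<gamma>) = opm (of_real \<gamma>)"
  by (rule fps_ext) (simp add: fps_cplx_def opm_def flip: pochhammer_of_real)

lemma opm_nth: "fps_nth (opm \<gamma>) n = (-1)^n * (\<gamma> gchoose n)"
  by (simp add: opm_def gbinomial_pochhammer)

lemma opm_compose: "opm \<gamma> = fps_binomial \<gamma> oo (- fps_X)"
  by (rule fps_ext) (simp add: opm_nth fps_compose_uminus')

lemma opm_mult: "opm \<gamma> * opm \<delta> = opm (\<gamma> + \<delta>)"
  unfolding opm_compose by (simp add: fps_binomial_add_mult fps_compose_mult_distrib)

lemma opm_1: "opm (1 :: 'a :: field_char_0) = 1 - fps_X"
  unfolding opm_compose by (simp add: fps_binomial_1 fps_compose_add_distrib)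

lemma opm_has_fps_expansion: "(\<lambda>z. (1 - z) powr of_real \<gamma>) has_fps_expansion (opm (of_real \<gamma>) :: complex fps)"
proof (rule has_fps_expansionI)
  have "(\<lambda>n. fps_nth (opm (of_real \<gamma>)) n * z ^ n) sums (1 - z) powr of_real \<gamma>" if "cmod z < 1" for z :: complex
    using gen_binomial_complex[of "-z" "of_real \<gamma>"] that
    by (simp add: opm_nth power_minus[of z] mult_ac)
  moreover have "\<forall>\<^sub>F z in nhds (0::complex). cmod z < 1"
    using eventually_nhds_in_open[of "ball 0 1" "0::complex"] by simp
  ultimately show "\<forall>\<^sub>F u in nhds 0. (\<lambda>n. fps_nth (opm (of_real \<gamma>)) n * u ^ n) sums (1 - u) powr complex_of_real \<gamma>"
    by (auto elim: eventually_mono)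
qed

lemma cn_den_conj: "W \<notin> \<real>\<^sub>\<le>\<^sub>0 \<Longrightarrow> cn_den \<alpha> \<mu> (cnj W) = cnj (cn_den \<alpha> \<mu> W)"
  using cnj_powr[of W "of_real \<alpha>"] by (auto simp: cn_den_def complex_nonpos_Reals_iff)

lemma cn_symbol_analytic:
  assumes "W \<notin> \<real>\<^sub>\<le>\<^sub>0" "cn_den \<alpha> \<mu> W \<noteq> 0"
  shows "cn_symbol \<alpha> \<gamma> \<mu> analytic_on {W}"
proof -
  have p: "(\<lambda>W. W powr of_real e) analytic_on {W}" for e :: real
    using assms(1) by (intro analytic_intros) auto
  have "(\<lambda>W. cn_den \<alpha> \<mu> W) analytic_on {W}"
    unfolding cn_den_def by (intro analytic_intros p)
  moreover have "(\<lambda>W. cn_num \<alpha> W) analytic_on {W}"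
    unfolding cn_num_def by (intro analytic_intros) auto
  ultimately have "(\<lambda>W. cn_num \<alpha> W * W powr of_real \<gamma> / cn_den \<alpha> \<mu> W) analytic_on {W}"
    using assms(2) by (intro analytic_intros p) auto
  thus ?thesis by (simp add: cn_symbol_def[abs_def])
qed

text \<open>\<open>Ln\<close> jumps across the negative real axis. Multiplication by
  \<open>- \<i>\<close> turns the closed upper half-plane into the closed right one, away from the
  cut, so the principal power is continuous up to the boundary.\<close>

lemma continuous_powr_upper:
  "continuous_on {W. 0 \<le> Im W \<and> W \<noteq> 0} (\<lambda>W. W powr of_real \<gamma>)"
proof -
  have "continuous_on {W. 0 \<le> Im W \<and> W \<noteq> 0} (\<lambda>W. exp (of_real \<gamma> * (Ln (- \<i> * W) + \<i> * pi / 2)))"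
    by (intro continuous_intros) (auto simp: complex_nonpos_Reals_iff complex_eq_iff)
  moreover have "exp (of_real \<gamma> * (Ln (- \<i> * W) + \<i> * pi / 2)) = W powr of_real \<gamma>"
    if "W \<in> {W. 0 \<le> Im W \<and> W \<noteq> 0}" for W
    using Ln_times_ii[of "- \<i> * W"] that by (simp add: powr_def)
  ultimately show ?thesis by (subst continuous_on_cong[OF refl]) (auto)
qed

context
  fixes \<alpha> \<rho> c :: real
  assumes \<alpha>: "0 < \<alpha>" "\<alpha> < 1" and \<rho>: "1 < \<rho>" and c: "0 < c"
    and den: "\<And>W \<mu>. cmod (1 - W) \<le> \<rho> \<Longrightarrow> 0 \<le> Im W \<Longrightarrow> 0 \<le> \<mu> \<Longrightarrow> c * (cmod W powr \<alpha> + \<mu>) \<le> cmod (cn_den \<alpha> \<mu> W)"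
begin

lemma den_nz:
  assumes "cmod (1 - W) \<le> \<rho>" "0 \<le> Im W" "0 < \<mu>"
  shows "cn_den \<alpha> \<mu> W \<noteq> 0"
proof -
  have "0 < c * (cmod W powr \<alpha> + \<mu>)" using c assms by (intro mult_pos_pos add_nonneg_pos) auto
  thus ?thesis using den[of W \<mu>] assms by auto
qed

text \<open>Inside the unit disc \<open>1 - z\<close> avoids the cut, so conjugation carries the
  lower bound from the upper half-plane to the lower one.\<close>

lemma disc_nz:
  assumes "cmod z < 1" "0 < \<mu>"
  shows "1 - z \<notin> \<real>\<^sub>\<le>\<^sub>0" "cn_den \<alpha> \<mu> (1 - z) \<noteq> 0"
proof -
  have "Re z < 1" using assms complex_Re_le_cmod[of z] by linarith
  thus 1: "1 - z \<notin> \<real>\<^sub>\<le>\<^sub>0" by (auto simp: complex_nonpos_Reals_iff)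
  show "cn_den \<alpha> \<mu> (1 - z) \<noteq> 0"
  proof (cases "Im z \<le> 0")
    case True
    thus ?thesis using assms \<rho> by (intro den_nz) auto
  next
    case False
    moreover have "1 - cnj (1 - z) = cnj z" by simp
    ultimately have "cn_den \<alpha> \<mu> (cnj (1 - z)) \<noteq> 0" using assms \<rho> by (intro den_nz) (simp_all only: complex_mod_cnj, auto)
    thus ?thesis using cn_den_conj[OF 1] by simp
  qed
qed

lemma cn_fps_den_0: "0 \<le> \<mu> \<Longrightarrow> fps_nth (cn_fps_den \<alpha> \<mu>) 0 \<noteq> 0"
proof -
  assume "0 \<le> \<mu>"
  hence "0 \<le> \<mu> * (1 - \<alpha>/2)" using \<alpha> by simp
  thus ?thesis unfolding cn_fps_den_def by (simp add: opm_nth)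
qed

text \<open>Formal and analytic expansion agree near \<open>0\<close>, and since the symbol is
  holomorphic in the unit disc its Taylor series converges to it in the whole disc.\<close>

lemma cn_fps_sums:
  assumes z: "cmod z < 1" and mu: "0 < \<mu>"
  shows "(\<lambda>n. of_real (fps_nth (cn_fps \<alpha> \<gamma> \<mu>) n) * z ^ n) sums cn_symbol \<alpha> \<gamma> \<mu> (1 - z)"
proof -
  define f where "f = (\<lambda>z. cn_symbol \<alpha> \<gamma> \<mu> (1 - z))"
  have "f analytic_on {z}" if "cmod z < 1" for z
    unfolding f_def 
    by (rule analytic_on_compose[of "\<lambda>z. 1 - z" "{z}" "cn_symbol \<alpha> \<gamma> \<mu>", unfolded o_def])
       (use disc_nz[OF that mu] in \<open>auto intro!: analytic_intros cn_symbol_analytic\<close>)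
  hence "f analytic_on ball 0 1" by (subst analytic_on_analytic_at) auto
  hence holo: "f holomorphic_on ball 0 1" by (rule analytic_imp_holomorphic)
  have X: "(\<lambda>z. z) has_fps_expansion (fps_X :: complex fps)" by (rule has_fps_expansion_fps_X)
  have p: "(\<lambda>z. 1 - of_real (\<alpha>/2) * (1 - z)) has_fps_expansion fps_cplx (1 - fps_const (\<alpha>/2) * (1 - fps_X))"
    unfolding fps_cplx_diff fps_cplx_mult fps_cplx_1 fps_cplx_const fps_cplx_X
    by (intro fps_expansion_intros)
  have num: "(\<lambda>z. cn_num \<alpha> (1 - z)) has_fps_expansion fps_cplx (cn_fps_num \<alpha>)"
  proof -
    have "(\<lambda>z. 1 + of_real (1/2) * (1 - z)) has_fps_expansion fps_cplx (1 + fps_const (1/2) * (1 - fps_X))"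
      unfolding fps_cplx_diff fps_cplx_add fps_cplx_mult fps_cplx_1 fps_cplx_const fps_cplx_X
      by (intro fps_expansion_intros)
    hence "(\<lambda>z. (1 - of_real (\<alpha>/2) * (1 - z)) * (1 + of_real (1/2) * (1 - z))^2) has_fps_expansion fps_cplx (cn_fps_num \<alpha>)"
      unfolding cn_fps_num_def fps_cplx_mult[of "1 - fps_const (\<alpha>/2) * (1 - fps_X)"] fps_cplx_power
      by (intro has_fps_expansion_mult has_fps_expansion_power p)
    thus ?thesis by (simp add: cn_num_def)
  qed
  have dn: "(\<lambda>z. cn_den \<alpha> \<mu> (1 - z)) has_fps_expansion fps_cplx (cn_fps_den \<alpha> \<mu>)"
    unfolding cn_fps_den_def cn_den_def fps_cplx_add fps_cplx_mult[of "fps_const \<mu>"] fps_cplx_const fps_cplx_opm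
    by (intro has_fps_expansion_add has_fps_expansion_mult opm_has_fps_expansion p has_fps_expansion_const)
  have "(\<lambda>z. inverse (cn_den \<alpha> \<mu> (1 - z))) has_fps_expansion inverse (fps_cplx (cn_fps_den \<alpha> \<mu>))"
    using cn_fps_den_0[of \<mu>] mu by (intro has_fps_expansion_inverse dn) (auto simp: fps_cplx_def)
  hence "(\<lambda>z. cn_num \<alpha> (1 - z) * (1 - z) powr of_real \<gamma> * inverse (cn_den \<alpha> \<mu> (1 - z))) has_fps_expansion 
      fps_cplx (cn_fps_num \<alpha>) * opm (of_real \<gamma>) * inverse (fps_cplx (cn_fps_den \<alpha> \<mu>))"
    by (intro has_fps_expansion_mult num opm_has_fps_expansion)
  also have "fps_cplx (cn_fps_num \<alpha>) * opm (of_real \<gamma>) * inverse (fps_cplx (cn_fps_den \<alpha> \<mu>)) = fps_cplx (cn_fps \<alpha> \<gamma> \<mu>)"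
    using cn_fps_den_0[of \<mu>] mu by (simp add: cn_fps_def fps_cplx_mult fps_cplx_opm fps_cplx_inverse)
  also have "(\<lambda>z. cn_num \<alpha> (1 - z) * (1 - z) powr of_real \<gamma> * inverse (cn_den \<alpha> \<mu> (1 - z))) = f"
    by (simp add: f_def cn_symbol_def divide_inverse)
  finally have F: "f has_fps_expansion fps_cplx (cn_fps \<alpha> \<gamma> \<mu>)" .
  have "(deriv ^^ n) f 0 / fact n = of_real (fps_nth (cn_fps \<alpha> \<gamma> \<mu>) n)" for n
    using fps_nth_fps_expansion[OF F, of n] by (simp add: fps_cplx_def)
  thus ?thesis using holomorphic_power_series[OF holo, of z] z by (simp add: f_def)
qed

lemma cn_fps_summable:
  assumes "0 < \<mu>" "0 \<le> r" "r < 1"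
  shows "summable (\<lambda>n. \<bar>fps_nth (cn_fps \<alpha> \<gamma> \<mu>) n\<bar> * r ^ n)"
proof -
  define R where "R = (1 + r) / 2"
  have R: "0 \<le> R" "R < 1" "r < R" using assms by (auto simp: R_def)
  have "summable (\<lambda>n. of_real (fps_nth (cn_fps \<alpha> \<gamma> \<mu>) n) * (of_real R :: complex) ^ n)"
    by (rule sums_summable[OF cn_fps_sums]) (use R assms in auto)
  hence "summable (\<lambda>n. norm (of_real (fps_nth (cn_fps \<alpha> \<gamma> \<mu>) n) * (of_real r :: complex) ^ n))"
    by (rule powser_insidea) (use assms R in auto)
  thus ?thesis using assms by (simp add: norm_mult norm_power)
qed


text \<open>The substitution \<open>z = exp (- s)\<close> in \<open>W = 1 - z\<close>. The strip
  \<open>0 \<le> Im s \<le> pi\<close> corresponds to \<open>Im W \<ge> 0\<close>, its lower edge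
  with \<open>Re s < 0\<close> to the cut \<open>z > 1\<close>, and its upper edge to negative
  \<open>z\<close>.\<close>

definition sW :: "complex \<Rightarrow> complex" where "sW s = 1 - exp (- s)"

lemma sW_region:
  assumes "- \<kappa> \<le> Re s" "0 \<le> Im s" "Im s \<le> pi" "exp \<kappa> \<le> \<rho>"
  shows "cmod (1 - sW s) \<le> \<rho>" "0 \<le> Im (sW s)" "cmod (sW s) \<le> 1 + \<rho>"
    and "s \<noteq> 0 \<Longrightarrow> sW s \<noteq> 0" "0 < Im s \<Longrightarrow> sW s \<notin> \<real>\<^sub>\<le>\<^sub>0"
proof -
  have "exp (- Re s) \<le> exp \<kappa>" using assms by simp
  from order_trans[OF this assms(4)] show 1: "cmod (1 - sW s) \<le> \<rho>" by (simp add: sW_def)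
  have "cmod (sW s) \<le> cmod 1 + cmod (1 - sW s)" by norm
  thus "cmod (sW s) \<le> 1 + \<rho>" using 1 by simp
  have im: "Im (sW s) = exp (- Re s) * sin (Im s)" by (simp add: sW_def Im_exp)
  show "0 \<le> Im (sW s)" using assms unfolding im by (simp add: sin_ge_zero)
  show "sW s \<noteq> 0" if "s \<noteq> 0"
  proof
    assume "sW s = 0"
    hence "exp (- s) = 1" by (simp add: sW_def)
    then obtain n :: int where n: "Re s = 0" "Im (- s) = of_int (2 * n) * pi" by (auto simp: exp_eq_1)
    hence "real_of_int (- 2 * n) = Im s / pi" by (simp add: field_simps)
    moreover have "0 \<le> Im s / pi" "Im s / pi \<le> 1" using assms by auto
    ultimately have "0 \<le> real_of_int (- 2 * n)" "real_of_int (- 2 * n) \<le> 1" by auto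
    hence "n = 0" by linarith
    thus False using n that by (simp add: complex_eq_iff)
  qed
  show "sW s \<notin> \<real>\<^sub>\<le>\<^sub>0" if "0 < Im s"
  proof
    assume "sW s \<in> \<real>\<^sub>\<le>\<^sub>0"
    hence h: "Re (sW s) \<le> 0" "Im (sW s) = 0" by (auto simp: complex_nonpos_Reals_iff)
    hence "sin (Im s) = 0" using im by simp
    hence "Im s = pi" using that assms sin_gt_zero[of "Im s"] by (cases "Im s < pi") auto
    hence "Re (sW s) = 1 + exp (- Re s)" by (simp add: sW_def Re_exp)
    thus False using h exp_gt_zero[of "- Re s"] by linarith
  qed
qed

text \<open>Supplies a majorant in \<open>Re s\<close> alone near the branch point: the modulus of
  \<open>1 - exp (- s)\<close> is at least \<open>\<bar>1 - exp (- Re s)\<bar>\<close>.\<close>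

lemma cmod_sW_ge:
  assumes "Re s \<le> 1"
  shows "\<bar>Re s\<bar> / 2 \<le> cmod (sW s)"
proof -
  define x where "x = Re s"
  have "\<bar>x\<bar> / 2 \<le> \<bar>1 - exp (- x)\<bar>"
  proof (cases "x \<ge> 0")
    case True
    have "exp (- x) \<le> inverse (1 + x)" using exp_ge_add_one_self[of x] True
      by (simp add: exp_minus le_imp_inverse_le)
    also have "\<dots> \<le> 1 - x / 2" using True assms by (simp add: field_simps x_def mult_left_le)
    finally show ?thesis using True by simp
  next
    case False
    thus ?thesis using exp_ge_add_one_self[of "-x"] by simp
  qed
  also have "\<bar>1 - exp (- x)\<bar> \<le> cmod (sW s)"
    using norm_triangle_ineq3[of 1 "exp (- s)"] by (simp add: sW_def x_def)
  finally show ?thesis by (simp add: x_def)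
qed

definition K0 :: real where "K0 = (2 + \<rho>)^3"

lemma cn_num_le:
  assumes "cmod W \<le> 1 + \<rho>"
  shows "cmod (cn_num \<alpha> W) \<le> K0"
proof -
  have "cmod (1 - of_real (\<alpha>/2) * W) \<le> 1 + \<alpha>/2 * cmod W"
    using norm_triangle_ineq4[of 1 "of_real (\<alpha>/2) * W"] \<alpha> by (simp add: norm_mult)
  also have "\<dots> \<le> 1 + 1 * cmod W" using \<alpha> by (intro add_left_mono mult_right_mono) auto
  finally have 1: "cmod (1 - of_real (\<alpha>/2) * W) \<le> 2 + \<rho>" using assms by simp
  have "cmod (1 + W/2) \<le> 1 + cmod (W/2)"
    using norm_triangle_ineq[of 1 "W/2"] by simp
  also have "\<dots> \<le> 2 + \<rho>" using assms norm_ge_zero[of W] \<rho> by (simp add: norm_divide)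
  finally have 2: "cmod (1 + W/2) \<le> 2 + \<rho>" .
  have "cmod (cn_num \<alpha> W) \<le> (2 + \<rho>) * (2 + \<rho>)^2"
    unfolding cn_num_def norm_mult norm_power using 1 2 \<rho> by (intro mult_mono power_mono) auto
  thus ?thesis by (simp add: K0_def power2_eq_square power3_eq_cube)
qed

lemma K0_pos: "0 < K0" using \<rho> by (simp add: K0_def)

text \<open>Two bounds for two purposes. The first depends on \<open>\<mu>\<close>, but its power is
  integrable at the branch point as soon as \<open>\<gamma> > -1\<close>; the second loses
  \<open>\<alpha>\<close> in the exponent, but is uniform in \<open>\<mu>\<close>.\<close>

lemma cn_symbol_le:
  assumes W: "cmod (1 - W) \<le> \<rho>" "0 \<le> Im W" "W \<noteq> 0" and mu: "0 < \<mu>"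
  shows "cmod (cn_symbol \<alpha> \<gamma> \<mu> W) \<le> K0 / (c * \<mu>) * cmod W powr \<gamma>"
    and "cmod (cn_symbol \<alpha> \<gamma> \<mu> W) \<le> K0 / c * cmod W powr (\<gamma> - \<alpha>)"
proof -
  have "cmod W \<le> cmod 1 + cmod (1 - W)" by norm
  hence W1: "cmod W \<le> 1 + \<rho>" using W by simp
  have pw: "0 < cmod W powr \<alpha>" using W by simp
  have *: "cmod (cn_symbol \<alpha> \<gamma> \<mu> W) \<le> K0 * cmod W powr \<gamma> / d" if d: "0 < d" "d \<le> c * (cmod W powr \<alpha> + \<mu>)" for d
  proof -
    have "d \<le> cmod (cn_den \<alpha> \<mu> W)" using den[of W \<mu>] W mu d by simp
    thus ?thesis unfolding cn_symbol_def norm_divide norm_mult 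
      using cn_num_le[OF W1] d W K0_pos by (intro frac_le mult_mono) (auto simp: norm_powr_real_powr' powr_upper_half norm_mult)
  qed
  show "cmod (cn_symbol \<alpha> \<gamma> \<mu> W) \<le> K0 / (c * \<mu>) * cmod W powr \<gamma>"
    using *[of "c * \<mu>"] c mu by simp
  show "cmod (cn_symbol \<alpha> \<gamma> \<mu> W) \<le> K0 / c * cmod W powr (\<gamma> - \<alpha>)"
    using *[of "c * cmod W powr \<alpha>"] c mu pw by (simp add: powr_diff)
qed

lemma cn_symbol_real:
  assumes "0 < w"
  shows "cn_symbol \<alpha> \<gamma> \<mu> (of_real w) \<in> \<real>"
proof -
  have "(of_real w :: complex) powr of_real e \<in> \<real>" for e
    using powr_of_real[of w e] assms by (metis Reals_of_real less_imp_le)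
  thus ?thesis unfolding cn_symbol_def cn_num_def cn_den_def by (intro Reals_divide Reals_mult Reals_add Reals_diff Reals_power) auto
qed

text \<open>The imaginary part of Cauchy's theorem on the rectangle with
  \<open>-\<kappa> \<le> Re s \<le> 1\<close> and \<open>0 \<le> Im s \<le> pi\<close>. The right
  side yields the coefficient, the integrand is real on the top and on the part \<open>x > 0\<close>
  of the bottom, the part \<open>x < 0\<close> is the cut integral, and the left side carries the
  factor \<open>exp (- n \<kappa>)\<close>.\<close>

lemma cn_fps_cut_formula:
  fixes n :: nat
  assumes mu: "0 < \<mu>" and g: "-1 < \<gamma>" and k: "0 < \<kappa>" "exp \<kappa> \<le> \<rho>"
  defines "S \<equiv> \<lambda>x. Im (cn_symbol \<alpha> \<gamma> \<mu> (of_real (1 - exp (- x)))) * exp (real n * x)"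
  shows "S integrable_on {-\<kappa>..0}"
    and "\<bar>fps_nth (cn_fps \<alpha> \<gamma> \<mu>) n + integral {-\<kappa>..0} S / pi\<bar>
            \<le> K0 / c * ((\<kappa>/2) powr (\<gamma> - \<alpha>) + (1 + \<rho>) powr (\<gamma> - \<alpha>)) * exp (- (real n * \<kappa>))"
proof -
  define F where "F = (\<lambda>s. cn_symbol \<alpha> \<gamma> \<mu> (sW s) * exp (of_nat n * s))"
  \<comment> \<open>A majorant in \<open>Re s\<close> alone. Two powers are added because the sign
    of \<open>\<gamma>\<close> decides whether the lower or the upper bound on
    \<open>cmod (sW s)\<close> is the relevant one.\<close>
  define M where "M = (\<lambda>x. K0 / (c * \<mu>) * ((\<bar>x\<bar>/2) powr \<gamma> + (1 + \<rho>) powr \<gamma>) * exp (real n))"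
  note R = sW_region[OF _ _ _ k(2)]
  have exp_n: "cmod (exp (of_nat n * s)) = exp (real n * Re s)" for s :: complex by simp
  have pw_le: "cmod (sW s) powr e \<le> (d/2) powr e + (1 + \<rho>) powr e"
    if "- \<kappa> \<le> Re s" "Re s \<le> 1" "0 \<le> Im s" "Im s \<le> pi" "0 < d" "d \<le> \<bar>Re s\<bar>" for s e d
  proof -
    have w: "d/2 \<le> cmod (sW s)" using cmod_sW_ge[of s] that by linarith
    have w': "cmod (sW s) \<le> 1 + \<rho>" using R(3)[of s] that by simp
    show ?thesis
    proof (cases "e \<ge> 0")
      case True
      have "cmod (sW s) powr e \<le> (1 + \<rho>) powr e" using w' True by (intro powr_mono2) auto
      thus ?thesis by (simp add: add_increasing)
    next
      case False
      have "cmod (sW s) powr e \<le> (d/2) powr e" using w that False by (intro powr_mono2') auto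
      thus ?thesis by (simp add: add_increasing2)
    qed
  qed
  have int: "M integrable_on {-\<kappa>..1}"
  proof -
    have p: "(\<lambda>x::real. x powr \<gamma>) integrable_on {0..b}" if "0 \<le> b" for b
      using has_integral_powr_from_0[OF g that] by (auto simp: integrable_on_def)
    have p1: "(\<lambda>x::real. \<bar>x\<bar> powr \<gamma>) integrable_on {0..b}" if "0 \<le> b" for b
      using p[OF that] by (rule integrable_eq) auto
    have p2: "(\<lambda>x::real. \<bar>x\<bar> powr \<gamma>) integrable_on {-\<kappa>..0}"
      using p1[of \<kappa>] k Henstock_Kurzweil_Integration.integrable_reflect_real[where f = "\<lambda>x. \<bar>x\<bar> powr \<gamma>" and a = 0 and b = \<kappa>] by simp
    have "(\<lambda>x::real. \<bar>x\<bar> powr \<gamma>) integrable_on {-\<kappa>..1}"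
      using k by (intro Henstock_Kurzweil_Integration.integrable_combine[OF _ _ p2 p1]) auto
    hence "(\<lambda>x::real. (K0 / (c * \<mu>) * exp (real n)) * (\<bar>x\<bar> powr \<gamma> * inverse (2 powr \<gamma>) + (1+\<rho>) powr \<gamma>)) integrable_on {-\<kappa>..1}"
      by (intro integrable_on_mult_right integrable_add integrable_on_mult_left integrable_const_ivl)
    thus ?thesis by (rule integrable_eq) (simp add: M_def powr_divide field_simps)
  qed
  have cont: "continuous_on ({s. -\<kappa> \<le> Re s \<and> Re s \<le> 1 \<and> 0 \<le> Im s \<and> Im s \<le> pi} - {0}) F"
  proof -
    define A where "A = {s. -\<kappa> \<le> Re s \<and> Re s \<le> 1 \<and> 0 \<le> Im s \<and> Im s \<le> pi} - {0}"
    have sWc: "continuous_on A sW" unfolding sW_def by (intro continuous_intros)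
    have "sW ` A \<subseteq> {W. 0 \<le> Im W \<and> W \<noteq> 0}" using R by (auto simp: A_def)
    from continuous_on_compose2[OF continuous_powr_upper sWc this]
    have pw: "continuous_on A (\<lambda>s. sW s powr of_real e)" for e .
    have 1: "continuous_on A (\<lambda>s. cn_num \<alpha> (sW s))" 
      unfolding cn_num_def by (intro continuous_on_mult continuous_on_diff continuous_on_add continuous_on_power 
          continuous_on_divide continuous_on_const sWc) auto
    have 2: "continuous_on A (\<lambda>s. cn_den \<alpha> \<mu> (sW s))" 
      unfolding cn_den_def by (intro continuous_on_mult continuous_on_diff continuous_on_add pw continuous_on_const sWc)
    have 3: "continuous_on A (\<lambda>s. exp (of_nat n * s))" by (intro continuous_intros)
    have "continuous_on A F" unfolding F_def cn_symbol_def
    proof (intro continuous_on_mult continuous_on_divide 1 2 3 pw ballI)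
      fix s assume "s \<in> A"
      thus "cn_den \<alpha> \<mu> (sW s) \<noteq> 0" using R[of s] by (intro den_nz mu) (auto simp: A_def)
    qed
    thus ?thesis unfolding A_def .
  qed
  have holo: "F field_differentiable at s" if "-\<kappa> \<le> Re s" "Re s \<le> 1" "0 < Im s" "Im s \<le> pi" for s
  proof -
    have s: "sW s \<notin> \<real>\<^sub>\<le>\<^sub>0" "cn_den \<alpha> \<mu> (sW s) \<noteq> 0" using that R[of s] den_nz[OF _ _ mu, of "sW s"] by auto
    have "(\<lambda>s. cn_symbol \<alpha> \<gamma> \<mu> (sW s)) analytic_on {s}"
      by (rule analytic_on_compose[of sW "{s}" "cn_symbol \<alpha> \<gamma> \<mu>", unfolded o_def])
         (use cn_symbol_analytic[OF s] in \<open>auto simp: sW_def[abs_def] intro!: analytic_intros\<close>)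
    hence "F analytic_on {s}" unfolding F_def by (intro analytic_intros)
    thus ?thesis by (rule analytic_on_imp_differentiable_at) auto
  qed
  have bnd: "cmod (F s) \<le> M (Re s)" 
    if s: "-\<kappa> \<le> Re s" "Re s \<le> 1" "0 \<le> Im s" "Im s \<le> pi" "Re s \<noteq> 0" for s
  proof -
    have "cmod (cn_symbol \<alpha> \<gamma> \<mu> (sW s)) \<le> K0 / (c * \<mu>) * cmod (sW s) powr \<gamma>"
      using s by (intro cn_symbol_le(1) mu R) auto
    also have "\<dots> \<le> K0 / (c * \<mu>) * ((\<bar>Re s\<bar>/2) powr \<gamma> + (1 + \<rho>) powr \<gamma>)"
      using s c mu K0_pos by (intro mult_left_mono pw_le) auto
    finally have 1: "cmod (cn_symbol \<alpha> \<gamma> \<mu> (sW s)) \<le> K0 / (c * \<mu>) * ((\<bar>Re s\<bar>/2) powr \<gamma> + (1 + \<rho>) powr \<gamma>)" .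
    have "exp (real n * Re s) \<le> exp (real n)" using s by (simp add: mult_left_le)
    moreover have "0 \<le> K0 / (c * \<mu>) * ((\<bar>Re s\<bar>/2) powr \<gamma> + (1 + \<rho>) powr \<gamma>)"
      using c mu K0_pos by (intro mult_nonneg_nonneg) auto
    ultimately show ?thesis unfolding F_def M_def norm_mult exp_n using 1 by (intro mult_mono) auto
  qed
  have "- \<kappa> < 0" using k by simp
  note C = rectangle_cauchy_singular[OF this zero_less_one pi_gt_zero holo cont bnd int, simplified]
  have Im_bot: "Im (F (Complex x 0)) = S x" if "x \<le> 0" for x
  proof -
    have e: "exp (of_nat n * Complex x 0) = of_real (exp (real n * x))"
    proof -
      have "of_nat n * Complex x 0 = of_real (real n * x)" by (simp add: complex_eq_iff)
      thus ?thesis by (simp only: exp_of_real)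
    qed
    have w: "sW (Complex x 0) = of_real (1 - exp (- x))"
    proof -
      have "- Complex x 0 = of_real (- x)" by (simp add: complex_eq_iff)
      thus ?thesis unfolding sW_def by (simp only: exp_of_real of_real_diff of_real_1)
    qed
    show ?thesis unfolding F_def S_def e w by simp
  qed
  have Im_bot0: "Im (F (Complex x 0)) = 0" if "x > 0" for x
  proof -
    have e: "exp (of_nat n * Complex x 0) = of_real (exp (real n * x))"
    proof -
      have "of_nat n * Complex x 0 = of_real (real n * x)" by (simp add: complex_eq_iff)
      thus ?thesis by (simp only: exp_of_real)
    qed
    have w: "sW (Complex x 0) = of_real (1 - exp (- x))"
    proof -
      have "- Complex x 0 = of_real (- x)" by (simp add: complex_eq_iff)
      thus ?thesis unfolding sW_def by (simp only: exp_of_real of_real_diff of_real_1)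
    qed
    have "cn_symbol \<alpha> \<gamma> \<mu> (of_real (1 - exp (- x))) \<in> \<real>" using that by (intro cn_symbol_real) simp
    thus ?thesis unfolding F_def e w by (simp add: complex_is_Real_iff)
  qed
  have Im_top: "Im (F (Complex x pi)) = 0" for x
  proof -
    have "exp (of_nat n * Complex x pi) = exp (Complex x pi) ^ n" by (simp add: exp_of_nat_mult)
    moreover have "exp (Complex x pi) = of_real (- exp x)" by (simp add: complex_eq_iff Re_exp Im_exp)
    ultimately have e: "exp (of_nat n * Complex x pi) = of_real ((- exp x) ^ n)" by simp
    have w: "sW (Complex x pi) = of_real (1 + exp (- x))"
      by (simp add: sW_def complex_eq_iff Re_exp Im_exp)
    have "cn_symbol \<alpha> \<gamma> \<mu> (of_real (1 + exp (- x))) \<in> \<real>" by (intro cn_symbol_real) (simp add: add_pos_pos)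
    thus ?thesis unfolding F_def e w by (simp add: complex_is_Real_iff)
  qed
  have contF: "continuous_on A (\<lambda>y. F (h y))"
    if "continuous_on A h" "h ` A \<subseteq> {s. -\<kappa> \<le> Re s \<and> Re s \<le> 1 \<and> 0 \<le> Im s \<and> Im s \<le> pi} - {0}" for h and A :: "real set"
    using continuous_on_compose2[OF cont that] .
  have iF: "(\<lambda>y. F (Complex x y)) integrable_on {0..pi}" if "x = 1 \<or> x = -\<kappa>" for x
    using that k by (intro integrable_continuous_interval contF) (auto simp: Complex_eq complex_eq_iff intro!: continuous_intros)
  have iT: "(\<lambda>x. F (Complex x pi)) integrable_on {-\<kappa>..1}"
    using k by (intro integrable_continuous_interval contF) (auto simp: Complex_eq complex_eq_iff intro!: continuous_intros)
  have ImI: "(\<lambda>x. Im (f x)) integrable_on A" "integral A (\<lambda>x. Im (f x)) = Im (integral A f)" 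
    and ReI: "integral A (\<lambda>x. Re (f x)) = Re (integral A f)"
    if "f integrable_on A" for f :: "real \<Rightarrow> complex" and A
    using integrable_linear[OF that bounded_linear_Im] integral_linear[OF that bounded_linear_Im] 
      integral_linear[OF that bounded_linear_Re] by (simp_all add: o_def)
  have imint: "(\<lambda>x. Im (F (Complex x 0))) integrable_on {-\<kappa>..1}" by (rule ImI(1)[OF C(1)])
  have "(\<lambda>x. Im (F (Complex x 0))) integrable_on {-\<kappa>..0}"
    by (rule integrable_subinterval_real[OF imint]) (use k in auto)
  thus intS: "S integrable_on {-\<kappa>..0}" by (rule integrable_eq) (simp add: Im_bot)
  have "integral {-\<kappa>..1} (\<lambda>x. Im (F (Complex x 0))) = integral {-\<kappa>..0} (\<lambda>x. Im (F (Complex x 0))) + integral {0..1} (\<lambda>x. Im (F (Complex x 0)))"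
    using k by (intro Henstock_Kurzweil_Integration.integral_combine[symmetric] imint) auto
  also have "integral {-\<kappa>..0} (\<lambda>x. Im (F (Complex x 0))) = integral {-\<kappa>..0} S"
    by (intro integral_cong) (simp add: Im_bot)
  also have "integral {0..1} (\<lambda>x. Im (F (Complex x 0))) = integral {0..1} (\<lambda>x::real. 0)"
    by (rule integral_spike[of "{0}"]) (auto simp: Im_bot0)
  finally have bot: "Im (integral {-\<kappa>..1} (\<lambda>x. F (Complex x 0))) = integral {-\<kappa>..0} S"
    using ImI(2)[OF C(1)] by simp
  have top: "Im (integral {-\<kappa>..1} (\<lambda>x. F (Complex x pi))) = 0"
    using ImI(2)[OF iT] by (simp add: Im_top)
  have right: "Re (integral {0..pi} (\<lambda>y. F (Complex 1 y))) = pi * fps_nth (cn_fps \<alpha> \<gamma> \<mu>) n"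
  proof -
    have "((\<lambda>y. Re (cn_symbol \<alpha> \<gamma> \<mu> (sW (Complex 1 y)) * exp (of_nat n * Complex 1 y))) has_integral (pi * fps_nth (cn_fps \<alpha> \<gamma> \<mu>) n)) {0..pi}"
    proof (rule half_circle_coefficient)
      have "summable (\<lambda>m. \<bar>fps_nth (cn_fps \<alpha> \<gamma> \<mu>) m\<bar> * exp (-1) ^ m)" by (rule cn_fps_summable[OF mu]) auto
      thus "summable (\<lambda>m. \<bar>fps_nth (cn_fps \<alpha> \<gamma> \<mu>) m\<bar> * exp (- real m))"
        by (simp flip: exp_of_nat_mult)
      fix y
      have "(\<lambda>m. of_real (fps_nth (cn_fps \<alpha> \<gamma> \<mu>) m) * exp (- Complex 1 y) ^ m) sums cn_symbol \<alpha> \<gamma> \<mu> (1 - exp (- Complex 1 y))"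
        by (rule cn_fps_sums[OF _ mu]) simp
      thus "(\<lambda>m. of_real (fps_nth (cn_fps \<alpha> \<gamma> \<mu>) m) * exp (- of_nat m * Complex 1 y)) sums cn_symbol \<alpha> \<gamma> \<mu> (sW (Complex 1 y))"
        by (simp add: sW_def flip: exp_of_nat_mult)
    qed
    hence "integral {0..pi} (\<lambda>y. Re (F (Complex 1 y))) = pi * fps_nth (cn_fps \<alpha> \<gamma> \<mu>) n"
      unfolding F_def by (rule integral_unique)
    thus ?thesis using ReI[OF iF[of 1]] by simp
  qed
  \<comment> \<open>The left side stays in the final estimate, so it needs the bound of
    \<open>cn_symbol_le\<close> that is uniform in \<open>\<mu>\<close>; the bottom side only needed
    some integrable majorant.\<close>
  define B where "B = K0 / c * ((\<kappa>/2) powr (\<gamma> - \<alpha>) + (1 + \<rho>) powr (\<gamma> - \<alpha>)) * exp (- (real n * \<kappa>))"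
  have left: "\<bar>Re (integral {0..pi} (\<lambda>y. F (Complex (-\<kappa>) y)))\<bar> \<le> pi * B"
  proof -
    have "cmod (F (Complex (-\<kappa>) y)) \<le> B" if "y \<in> {0..pi}" for y
    proof -
      have "cmod (cn_symbol \<alpha> \<gamma> \<mu> (sW (Complex (-\<kappa>) y))) \<le> K0 / c * cmod (sW (Complex (-\<kappa>) y)) powr (\<gamma> - \<alpha>)"
        using that k by (intro cn_symbol_le(2) mu R) (auto simp: complex_eq_iff)
      also have "\<dots> \<le> K0 / c * ((\<kappa>/2) powr (\<gamma> - \<alpha>) + (1 + \<rho>) powr (\<gamma> - \<alpha>))"
        using that k c K0_pos by (intro mult_left_mono pw_le) auto
      finally have "cmod (cn_symbol \<alpha> \<gamma> \<mu> (sW (Complex (-\<kappa>) y))) \<le> K0 / c * ((\<kappa>/2) powr (\<gamma> - \<alpha>) + (1 + \<rho>) powr (\<gamma> - \<alpha>))" .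
      from mult_right_mono[OF this, of "exp (- (real n * \<kappa>))"] show ?thesis
        unfolding F_def norm_mult exp_n B_def by simp
    qed
    hence "norm (integral {0..pi} (\<lambda>y. F (Complex (-\<kappa>) y))) \<le> integral {0..pi} (\<lambda>y. B)"
      by (intro Henstock_Kurzweil_Integration.integral_norm_bound_integral iF integrable_const_ivl) auto
    hence "norm (integral {0..pi} (\<lambda>y. F (Complex (-\<kappa>) y))) \<le> pi * B" by simp
    thus ?thesis using abs_Re_le_cmod order_trans by blast
  qed
  have "Im (integral {-\<kappa>..1} (\<lambda>x. F (Complex x 0)) + \<i> * integral {0..pi} (\<lambda>y. F (Complex 1 y)))
    = Im (integral {-\<kappa>..1} (\<lambda>x. F (Complex x pi)) + \<i> * integral {0..pi} (\<lambda>y. F (Complex (-\<kappa>) y)))"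
    using C(2) by simp
  hence eq: "integral {-\<kappa>..0} S + pi * fps_nth (cn_fps \<alpha> \<gamma> \<mu>) n = Re (integral {0..pi} (\<lambda>y. F (Complex (-\<kappa>) y)))"
    using bot top right by simp
  have "fps_nth (cn_fps \<alpha> \<gamma> \<mu>) n + integral {-\<kappa>..0} S / pi = Re (integral {0..pi} (\<lambda>y. F (Complex (-\<kappa>) y))) / pi"
    using eq by (simp add: field_simps)
  also have "\<bar>\<dots>\<bar> \<le> B" using left by (simp add: field_simps)
  finally show "\<bar>fps_nth (cn_fps \<alpha> \<gamma> \<mu>) n + integral {-\<kappa>..0} S / pi\<bar>
            \<le> K0 / c * ((\<kappa>/2) powr (\<gamma> - \<alpha>) + (1 + \<rho>) powr (\<gamma> - \<alpha>)) * exp (- (real n * \<kappa>))"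
    unfolding B_def .
qed
end

lemma exp_decay_inverse_square:
  assumes "0 < \<kappa>"
  obtains E where "0 < E" "\<And>n::nat. exp (- (real n * \<kappa>)) \<le> E / (real n + 1)^2"
proof -
  have "(\<lambda>n. exp (- (real n * \<kappa>))) \<in> O(\<lambda>n. real n powr (-2))" using assms by real_asymp
  from bigo_inverse_square_bound[OF this] obtain E where E: "\<And>n. \<bar>exp (- (real n * \<kappa>))\<bar> \<le> E / (real n + 1)^2" by blast
  have "0 < E" using E[of 0] by simp
  thus ?thesis using that E by simp
qed

text \<open>The factor \<open>- x\<close> at the branch point produces the second power of
  \<open>1/n\<close>. Passing from \<open>n\<close> to \<open>m = n + 1\<close> costs a factor
  \<open>exp \<kappa>\<close> and admits \<open>n = 0\<close>.\<close>

lemma cut_integral_bound: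
  assumes int: "f integrable_on {-\<kappa>..0}" and k: "0 \<le> \<kappa>" and D: "0 \<le> D"
    and f: "\<And>x. -\<kappa> \<le> x \<Longrightarrow> x \<le> 0 \<Longrightarrow> \<bar>f x\<bar> \<le> D * (- x) * exp (real n * x)"
  shows "\<bar>integral {-\<kappa>..0} f\<bar> \<le> D * exp \<kappa> / (real n + 1)^2"
proof -
  define m where "m = real n + 1"
  have m: "0 < m" by (simp add: m_def)
  define G where "G = (\<lambda>x. (1/m^2 - x/m) * exp (m * x))"
  have G: "((\<lambda>x. (- x) * exp (m * x)) has_integral (G 0 - G (-\<kappa>))) {-\<kappa>..0}"
  proof (rule fundamental_theorem_of_calculus)
    fix x show "(G has_vector_derivative - x * exp (m * x)) (at x within {-\<kappa>..0})"
      unfolding G_def has_real_derivative_iff_has_vector_derivative[symmetric]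
      using m by (auto intro!: derivative_eq_intros simp: field_simps power2_eq_square)
  qed (use k in auto)
  have "0 \<le> G (-\<kappa>)" unfolding G_def using m k by (intro mult_nonneg_nonneg) auto
  hence Gle: "G 0 - G (-\<kappa>) \<le> 1 / m^2" by (simp add: G_def)
  have "norm (integral {-\<kappa>..0} f) \<le> integral {-\<kappa>..0} (\<lambda>x. (D * exp \<kappa>) * ((- x) * exp (m * x)))"
  proof (rule Henstock_Kurzweil_Integration.integral_norm_bound_integral[OF int])
    show "(\<lambda>x. (D * exp \<kappa>) * ((- x) * exp (m * x))) integrable_on {-\<kappa>..0}"
      using G by (intro integrable_on_mult_right) (auto simp: integrable_on_def)
    fix x assume x: "x \<in> {-\<kappa>..0}"
    have "exp (real n * x) = exp (m * x) * exp (- x)" by (simp add: m_def algebra_simps flip: exp_add)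
    also have "\<dots> \<le> exp (m * x) * exp \<kappa>" using x by (intro mult_left_mono) auto
    finally have "D * (- x) * exp (real n * x) \<le> D * (- x) * (exp (m * x) * exp \<kappa>)"
      using D x by (intro mult_left_mono mult_nonneg_nonneg) auto
    thus "norm (f x) \<le> (D * exp \<kappa>) * ((- x) * exp (m * x))" using f[of x] x by (simp add: mult_ac)
  qed
  also have "\<dots> = (D * exp \<kappa>) * (G 0 - G (-\<kappa>))" using integral_unique[OF has_integral_mult_right[OF G]] by simp
  also have "\<dots> \<le> (D * exp \<kappa>) * (1 / m^2)" using D by (intro mult_left_mono Gle) auto
  finally show ?thesis by (simp add: m_def)
qed

context
  fixes \<alpha> \<rho> c :: real
  assumes \<alpha>: "0 < \<alpha>" "\<alpha> < 1" and \<rho>: "1 < \<rho>" and c: "0 < c"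
    and den: "\<And>W \<mu>. cmod (1 - W) \<le> \<rho> \<Longrightarrow> 0 \<le> Im W \<Longrightarrow> 0 \<le> \<mu> \<Longrightarrow> c * (cmod W powr \<alpha> + \<mu>) \<le> cmod (cn_den \<alpha> \<mu> W)"
begin

text \<open>The fractions \<open>X / D1\<close> of the scheme and \<open>Y / D2\<close> of the exact
  solution are compared by cross multiplication. The cross difference is at most a multiple of
  \<open>r^2 * Y * (r powr \<alpha> + \<mu>)\<close>; its last factor cancels against the bound for
  \<open>D2\<close>, and \<open>r powr \<alpha>\<close> from \<open>D1\<close> turns
  \<open>r^2 * Y\<close> into \<open>r\<close>. This is why no \<open>\<mu>\<close>
  survives.\<close>

lemma cn_symbol_cut_difference:
  assumes r: "0 < r" "exp r \<le> \<rho>" and mu: "0 < \<mu>" and C: "0 < C"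
    and f1: "\<bar>(1 - (exp r - 1)/2)^2 * (1 - (\<alpha>-3)/2 * (exp r - 1)) * ((exp r - 1)/r) powr (\<alpha>-1) - 1\<bar> \<le> C * r^2"
    and f2: "\<bar>1 + \<alpha>/2 * (exp r - 1) - ((exp r - 1)/r) powr \<alpha>\<bar> \<le> C * r^2"
  shows "cmod (cn_symbol \<alpha> (\<alpha>-1) \<mu> (of_real (1 - exp r)) + of_real ((\<alpha>-3)/2) * cn_symbol \<alpha> \<alpha> \<mu> (of_real (1 - exp r))
           - ml_symbol \<alpha> \<mu> r) \<le> (\<rho> + 1) * C / (c * cos (\<alpha> * pi / 2)) * r"
proof -
  define w where "w = exp r - 1"
  define b where "b = (\<alpha>-3)/2"
  define E where "E = cis (pi * \<alpha>)"
  define p where "p = 1 + \<alpha>/2 * w"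
  define k where "k = cos (\<alpha> * pi / 2)"
  define Y where "Y = r powr (\<alpha>-1)"
  define X where "X = p * (1 - w/2)^2 * (1 - b * w) * w powr (\<alpha>-1)"
  define D1 where "D1 = of_real (w powr \<alpha>) * E + of_real (\<mu> * p)"
  define D2 where "D2 = of_real (r powr \<alpha>) * E + of_real \<mu>"
  have wr: "r \<le> w" unfolding w_def using exp_ge_add_one_self[of r] by linarith
  hence w: "0 < w" using r by simp
  have k: "0 < k" unfolding k_def by (rule cos_half_pos[OF \<alpha>])
  have W: "(of_real (1 - exp r) :: complex) = of_real (- w)" by (simp add: w_def)
  have pw: "(of_real (- w) :: complex) powr of_real e = of_real (w powr e) * cis (e * pi)" for e
  proof -
    have "(of_real (- w) :: complex) \<noteq> 0" "cmod (of_real (- w)) = w" "Arg (of_real (- w)) = pi"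
      using w by (simp_all only: Arg_of_real norm_of_real of_real_eq_0_iff) auto
    thus ?thesis using powr_upper_half[of "of_real (- w)" e] by simp
  qed
  have pwa: "(of_real (- w) :: complex) powr of_real \<alpha> = of_real (w powr \<alpha>) * E"
    by (simp only: pw E_def mult.commute)
  have "cis ((\<alpha> - 1) * pi) = E * cis (- pi)" by (simp add: E_def cis_mult algebra_simps)
  hence "cis ((\<alpha> - 1) * pi) = - E" by (simp add: complex_eq_iff)
  hence pwa1: "(of_real (- w) :: complex) powr of_real (\<alpha> - 1) = - of_real (w powr (\<alpha> - 1)) * E"
    by (simp only: pw) simp
  have den_eq: "cn_den \<alpha> \<mu> (of_real (- w)) = D1"
    unfolding cn_den_def pwa D1_def p_def by simp
  have num_eq: "cn_num \<alpha> (of_real (- w)) = of_real (p * (1 - w/2)^2)"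
    unfolding cn_num_def p_def by simp
  have wa: "w powr \<alpha> = w * w powr (\<alpha>-1)" using w by (simp add: powr_diff)
  have sum_eq: "cn_symbol \<alpha> (\<alpha>-1) \<mu> (of_real (- w)) + of_real b * cn_symbol \<alpha> \<alpha> \<mu> (of_real (- w)) = - E * of_real X / D1"
    unfolding cn_symbol_def den_eq num_eq pwa pwa1 X_def wa by (simp add: field_simps flip: add_divide_distrib)
  have nD1: "c * (w powr \<alpha> + \<mu>) \<le> cmod D1"
  proof -
    have "cmod (of_real (- w)) = w" using w by (simp only: norm_of_real)
    moreover have "1 - of_real (- w) = (of_real (exp r) :: complex)" by (simp add: w_def)
    ultimately show ?thesis unfolding den_eq[symmetric] using den[of "of_real (- w)" \<mu>] r mu by simp
  qed
  have nD2: "k * (r powr \<alpha> + \<mu>) \<le> cmod D2"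
    unfolding k_def D2_def E_def using r mu \<alpha> by (intro ml_den_bound) auto
  have ra: "0 < r powr \<alpha>" "0 < w powr \<alpha>" using r w by auto
  have D0: "D1 \<noteq> 0" "D2 \<noteq> 0" 
    using nD1 nD2 mult_pos_pos[OF c, of "w powr \<alpha> + \<mu>"] mult_pos_pos[OF k, of "r powr \<alpha> + \<mu>"] ra mu by auto
  have ex_eq: "ml_symbol \<alpha> \<mu> r = - E * of_real Y / D2"
    by (simp add: ml_symbol_def E_def Y_def D2_def)
  define f where "f = (1 - w/2)^2 * (1 - b * w) * (w/r) powr (\<alpha>-1) - 1"
  define g where "g = p - (w/r) powr \<alpha>"
  have f: "\<bar>f\<bar> \<le> C * r^2" using f1 by (simp add: f_def w_def b_def)
  have g: "\<bar>g\<bar> \<le> C * r^2" using f2 by (simp add: g_def w_def p_def)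
  have w1: "w powr (\<alpha>-1) = Y * (w/r) powr (\<alpha>-1)" and w2: "w powr \<alpha> = r powr \<alpha> * (w/r) powr \<alpha>"
    using w r by (simp_all add: Y_def powr_divide)
  \<comment> \<open>Factoring out \<open>Y\<close> leaves only \<open>f\<close> and
    \<open>g\<close>, the two quantities of order \<open>r^2\<close> from
    \<open>cut_asymptotics\<close>.\<close>
  have e1: "X - p * Y = p * Y * f" unfolding X_def w1 f_def by (simp add: algebra_simps)
  have e2: "X * r powr \<alpha> - Y * w powr \<alpha> = Y * r powr \<alpha> * (p * f + g)"
    unfolding X_def w1 w2 f_def g_def by (simp add: algebra_simps)
  have "\<alpha>/2 * w \<le> 1 * w" using \<alpha> w by (intro mult_right_mono) auto
  hence p: "0 < p" "p \<le> \<rho>" using \<alpha> w r unfolding p_def by (auto simp: w_def intro!: add_pos_nonneg)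
  have Y: "0 < Y" using r by (simp add: Y_def)
  have pf: "\<bar>p * f\<bar> \<le> \<rho> * (C * r^2)" unfolding abs_mult using p f \<rho> by (intro mult_mono) auto
  have n1: "\<bar>X - p * Y\<bar> \<le> Y * ((\<rho> + 1) * C * r^2)"
  proof -
    have "\<bar>X - p * Y\<bar> = Y * \<bar>p * f\<bar>" unfolding e1 using Y p by (simp add: abs_mult)
    moreover have "0 \<le> C * r^2" using C by simp
    hence "Y * \<bar>p * f\<bar> \<le> Y * ((\<rho> + 1) * C * r^2)" using pf Y by (intro mult_left_mono) (simp_all add: algebra_simps)
    ultimately show ?thesis by simp
  qed
  have n2: "\<bar>X * r powr \<alpha> - Y * w powr \<alpha>\<bar> \<le> Y * r powr \<alpha> * ((\<rho> + 1) * C * r^2)"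
  proof -
    have "\<bar>X * r powr \<alpha> - Y * w powr \<alpha>\<bar> = Y * r powr \<alpha> * \<bar>p * f + g\<bar>" unfolding e2 using Y ra by (simp add: abs_mult)
    also have "\<dots> \<le> Y * r powr \<alpha> * ((\<rho> + 1) * C * r^2)" 
      using pf g abs_triangle_ineq[of "p * f" g] Y ra by (intro mult_left_mono) (auto simp: algebra_simps)
    finally show ?thesis .
  qed
  have "cn_symbol \<alpha> (\<alpha>-1) \<mu> (of_real (- w)) + of_real b * cn_symbol \<alpha> \<alpha> \<mu> (of_real (- w)) - ml_symbol \<alpha> \<mu> r
      = - E * (of_real X * D2 - of_real Y * D1) / (D1 * D2)"
    unfolding sum_eq ex_eq using D0 by (simp add: field_simps)
  also have "of_real X * D2 - of_real Y * D1 = of_real (X * r powr \<alpha> - Y * w powr \<alpha>) * E + of_real (\<mu> * (X - p * Y))"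
    by (simp add: D1_def D2_def algebra_simps)
  finally have "cmod (cn_symbol \<alpha> (\<alpha>-1) \<mu> (of_real (- w)) + of_real b * cn_symbol \<alpha> \<alpha> \<mu> (of_real (- w)) - ml_symbol \<alpha> \<mu> r)
      = cmod (of_real (X * r powr \<alpha> - Y * w powr \<alpha>) * E + of_real (\<mu> * (X - p * Y))) / (cmod D1 * cmod D2)"
    by (simp only: norm_divide norm_mult norm_minus_cancel) (simp add: E_def)
  also have "cmod (of_real (X * r powr \<alpha> - Y * w powr \<alpha>) * E + of_real (\<mu> * (X - p * Y)))
      \<le> \<bar>X * r powr \<alpha> - Y * w powr \<alpha>\<bar> * cmod E + \<mu> * \<bar>X - p * Y\<bar>"
    using mu norm_triangle_ineq[of "of_real (X * r powr \<alpha> - Y * w powr \<alpha>) * E" "of_real (\<mu> * (X - p * Y))"]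
    by (simp only: norm_mult norm_of_real abs_mult)
  also have "\<dots> \<le> Y * r powr \<alpha> * ((\<rho> + 1) * C * r^2) + \<mu> * (Y * ((\<rho> + 1) * C * r^2))"
    using n1 n2 mu by (intro add_mono mult_left_mono) (auto simp: E_def)
  also have "\<dots> = (\<rho> + 1) * C * r^2 * Y * (r powr \<alpha> + \<mu>)" by (simp add: algebra_simps)
  also have "\<dots> / (cmod D1 * cmod D2) \<le> (\<rho> + 1) * C * r^2 * Y * (r powr \<alpha> + \<mu>) / (c * r powr \<alpha> * (k * (r powr \<alpha> + \<mu>)))"
  proof (intro divide_left_mono mult_mono nD2)
    have "c * r powr \<alpha> \<le> c * (w powr \<alpha> + \<mu>)" using c mu wr r \<alpha> by (intro mult_left_mono add_increasing2 powr_mono2) auto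
    thus "c * r powr \<alpha> \<le> cmod D1" using nD1 by simp
  qed (use c k ra mu r \<rho> C Y D0 in \<open>auto intro!: mult_pos_pos add_pos_pos mult_nonneg_nonneg add_nonneg_nonneg\<close>)
  also have "\<dots> = (\<rho> + 1) * C / (c * k) * (r^2 * Y / r powr \<alpha>)"
  proof -
    have "x * y * z * S / (d * R * (l * S)) = x / (d * l) * (y * z / R)" if "S \<noteq> 0" for x y z S d R l :: real
      using that by (simp add: field_simps)
    moreover have "r powr \<alpha> + \<mu> \<noteq> 0" using ra mu by linarith
    ultimately show ?thesis by blast
  qed
  also have "r^2 * Y / r powr \<alpha> = r" using r by (simp add: Y_def powr_diff power2_eq_square)
  finally show ?thesis unfolding W b_def k_def by (simp add: divide_right_mono)
qed


text \<open>With \<open>\<gamma> \<ge> \<alpha> + 1\<close> the numerator wins at least one power of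
  \<open>w = exp (- x) - 1\<close> over the denominator, and \<open>w\<close> is at most
  \<open>\<rho> * (- x)\<close>.\<close>

lemma cn_symbol_cut_le:
  assumes x: "x \<le> 0" "exp (- x) \<le> \<rho>" and mu: "0 < \<mu>" and g: "\<alpha> + 1 \<le> \<gamma>"
  shows "cmod (cn_symbol \<alpha> \<gamma> \<mu> (of_real (1 - exp (- x)))) \<le> K0 \<rho> / c * (\<rho> * (1 + \<rho>) powr (\<gamma> - \<alpha> - 1)) * (- x)"
proof (cases "x = 0")
  case True
  thus ?thesis by (simp add: cn_symbol_def)
next
  case False
  define w where "w = exp (- x) - 1"
  have w: "0 < w" "w \<le> 1 + \<rho>" using False x \<rho> by (auto simp: w_def)
  have W: "cmod (of_real (1 - exp (- x))) = w" using w by (simp only: norm_of_real) (simp add: w_def)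
  have wx: "w \<le> \<rho> * (- x)"
  proof -
    have "1 + x \<le> exp x" by (rule exp_ge_add_one_self)
    hence "exp (- x) * (1 + x) \<le> exp (- x) * exp x" by (intro mult_left_mono) auto
    also have "\<dots> = 1" by (simp flip: exp_add)
    finally have "w \<le> exp (- x) * (- x)" by (simp add: w_def algebra_simps)
    also have "\<dots> \<le> \<rho> * (- x)" using x by (intro mult_right_mono) auto
    finally show ?thesis .
  qed
  have "cmod (cn_symbol \<alpha> \<gamma> \<mu> (of_real (1 - exp (- x)))) \<le> K0 \<rho> / c * cmod (of_real (1 - exp (- x))) powr (\<gamma> - \<alpha>)"
    using x w \<rho> by (intro cn_symbol_le(2)[OF \<alpha> \<rho> c den] mu) (auto simp: w_def)
  also have "cmod (of_real (1 - exp (- x))) powr (\<gamma> - \<alpha>) = w * w powr (\<gamma> - \<alpha> - 1)"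
    unfolding W using w by (simp add: powr_diff)
  also have "w * w powr (\<gamma> - \<alpha> - 1) \<le> (\<rho> * (- x)) * (1 + \<rho>) powr (\<gamma> - \<alpha> - 1)"
    using w wx g by (intro mult_mono powr_mono2) auto
  finally show ?thesis using K0_pos[OF \<alpha> \<rho> c den] c by (simp add: mult_ac divide_right_mono mult_left_mono)
qed

text \<open>These coefficients are of size \<open>n^-2\<close> by themselves, uniformly in
  \<open>\<mu>\<close>, so the corresponding parts of the data enter the estimate as pure error
  terms.\<close>

lemma cn_fps_smooth_bound:
  assumes k: "0 < \<kappa>" "exp \<kappa> \<le> \<rho>" and g: "\<alpha> + 1 \<le> \<gamma>"
  obtains C where "\<And>\<mu> n. 0 < \<mu> \<Longrightarrow> \<bar>fps_nth (cn_fps \<alpha> \<gamma> \<mu>) n\<bar> \<le> C / (real n + 1)^2"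
proof -
  define D where "D = K0 \<rho> / c * (\<rho> * (1 + \<rho>) powr (\<gamma> - \<alpha> - 1))"
  define B where "B = K0 \<rho> / c * ((\<kappa>/2) powr (\<gamma> - \<alpha>) + (1 + \<rho>) powr (\<gamma> - \<alpha>))"
  have D: "0 \<le> D" and B: "0 \<le> B" using K0_pos[OF \<alpha> \<rho> c den] c \<rho> by (auto simp: D_def B_def intro!: mult_nonneg_nonneg)
  obtain E where E: "0 < E" "\<And>n::nat. exp (- (real n * \<kappa>)) \<le> E / (real n + 1)^2"
    using exp_decay_inverse_square[OF k(1)] by blast
  have "\<bar>fps_nth (cn_fps \<alpha> \<gamma> \<mu>) n\<bar> \<le> (B * E + D * exp \<kappa> / pi) / (real n + 1)^2" if mu: "0 < \<mu>" for \<mu> n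
  proof -
    define S where "S = (\<lambda>x. Im (cn_symbol \<alpha> \<gamma> \<mu> (of_real (1 - exp (- x)))) * exp (real n * x))"
    have g1: "-1 < \<gamma>" using g \<alpha> by simp
    note F = cn_fps_cut_formula[OF \<alpha> \<rho> c den mu g1 k, of n, folded S_def]
    have "\<bar>integral {-\<kappa>..0} S\<bar> \<le> D * exp \<kappa> / (real n + 1)^2"
    proof (rule cut_integral_bound[OF F(1)])
      fix x assume x: "-\<kappa> \<le> x" "x \<le> 0"
      have "exp (- x) \<le> exp \<kappa>" using x by simp
      hence ex: "exp (- x) \<le> \<rho>" using k by linarith
      have "\<bar>Im (cn_symbol \<alpha> \<gamma> \<mu> (of_real (1 - exp (- x))))\<bar> \<le> D * (- x)"
        using cn_symbol_cut_le[OF x(2) ex mu g] abs_Im_le_cmod order_trans unfolding D_def by blast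
      thus "\<bar>S x\<bar> \<le> D * (- x) * exp (real n * x)" unfolding S_def abs_mult by (intro mult_mono) auto
    qed (use k D in auto)
    from divide_right_mono[OF this, of pi]
    have "\<bar>integral {-\<kappa>..0} S / pi\<bar> \<le> D * exp \<kappa> / (real n + 1)^2 / pi" by (simp add: abs_divide)
    moreover have "B * exp (- (real n * \<kappa>)) \<le> B * (E / (real n + 1)^2)" using B E by (intro mult_left_mono) auto
    moreover have "(B * E + D * exp \<kappa> / pi) / (real n + 1)^2 = B * (E / (real n + 1)^2) + D * exp \<kappa> / (real n + 1)^2 / pi"
      by (simp add: add_divide_distrib)
    ultimately show ?thesis using F(2) unfolding B_def[symmetric] by linarith
  qed
  thus ?thesis by (rule that)
qed

text \<open>The two leading parts have to be estimated together, since the linear terms on the cut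
  cancel only in this combination. The integral for the exact solution is split at
  \<open>\<kappa>\<close>; its tail is exponentially small by the bound \<open>1/r\<close> on the
  density.\<close>

lemma cn_fps_main_bound:
  assumes k: "0 < \<kappa>" "exp \<kappa> \<le> \<rho>" and C: "0 < C"
    and f1: "\<And>r. 0 < r \<Longrightarrow> r \<le> \<kappa> \<Longrightarrow> \<bar>(1 - (exp r - 1)/2)^2 * (1 - (\<alpha>-3)/2 * (exp r - 1)) * ((exp r - 1)/r) powr (\<alpha>-1) - 1\<bar> \<le> C * r^2"
    and f2: "\<And>r. 0 < r \<Longrightarrow> r \<le> \<kappa> \<Longrightarrow> \<bar>1 + \<alpha>/2 * (exp r - 1) - ((exp r - 1)/r) powr \<alpha>\<bar> \<le> C * r^2"
  obtains C' where "\<And>\<mu> n. 0 < \<mu> \<Longrightarrow> 1 \<le> n \<Longrightarrow>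
     \<bar>fps_nth (cn_fps \<alpha> (\<alpha>-1) \<mu>) n + (\<alpha>-3)/2 * fps_nth (cn_fps \<alpha> \<alpha> \<mu>) n - ml_fun \<alpha> \<mu> (real n)\<bar> \<le> C' / (real n + 1)^2"
proof -
  define b where "b = (\<alpha>-3)/2"
  define kk where "kk = (cos (\<alpha> * pi / 2))\<^sup>2"
  have kk: "0 < kk" unfolding kk_def using cos_half_pos[OF \<alpha>] by simp
  define D where "D = (\<rho> + 1) * C / (c * cos (\<alpha> * pi / 2))"
  have D: "0 \<le> D" using \<rho> C c cos_half_pos[OF \<alpha>] by (simp add: D_def)
  define B where "B = (\<lambda>\<gamma>. K0 \<rho> / c * ((\<kappa>/2) powr (\<gamma> - \<alpha>) + (1 + \<rho>) powr (\<gamma> - \<alpha>)))"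
  have B: "0 \<le> B \<gamma>" for \<gamma> using K0_pos[OF \<alpha> \<rho> c den] c \<rho> by (auto simp: B_def intro!: mult_nonneg_nonneg)
  obtain E where E: "0 < E" "\<And>n::nat. exp (- (real n * \<kappa>)) \<le> E / (real n + 1)^2"
    using exp_decay_inverse_square[OF k(1)] by blast
  define C' where "C' = (B (\<alpha>-1) + \<bar>b\<bar> * B \<alpha> + 1 / (kk * \<kappa>)) * E + D * exp \<kappa>"
  show ?thesis
  proof (rule that[of C'])
    fix \<mu> :: real and n :: nat assume mu: "0 < \<mu>" and n: "1 \<le> n"
    define S where "S = (\<lambda>\<gamma> x. Im (cn_symbol \<alpha> \<gamma> \<mu> (of_real (1 - exp (- x)))) * exp (real n * x))"
    define a where "a = (\<lambda>\<gamma>. fps_nth (cn_fps \<alpha> \<gamma> \<mu>) n)"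
    define f where "f = (\<lambda>r. exp (- (r * real n)) * ml_density \<alpha> \<mu> r)"
    have F: "S \<gamma> integrable_on {-\<kappa>..0}" "\<bar>a \<gamma> + integral {-\<kappa>..0} (S \<gamma>) / pi\<bar> \<le> B \<gamma> * exp (- (real n * \<kappa>))" if "-1 < \<gamma>" for \<gamma>
      using cn_fps_cut_formula[OF \<alpha> \<rho> c den mu that k, of n] unfolding S_def a_def B_def by auto
    have g: "-1 < \<alpha> - 1" "-1 < \<alpha>" using \<alpha> by auto
    have fint: "set_integrable lborel {0..} f" unfolding f_def using ml_fun_integrable[OF \<alpha> mu] by simp
    have fA: "set_integrable lborel {0..\<kappa>} f" "set_integrable lborel {\<kappa>..} f"
      using k by (auto intro: set_integrable_subset[OF fint])
    have Y: "ml_fun \<alpha> \<mu> (real n) = integral {0..} f"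
      unfolding ml_fun_def f_def[symmetric] by (rule set_borel_integral_eq_integral(2)[OF fint])
    have i1: "f integrable_on {0..\<kappa>}" and i2: "f integrable_on {\<kappa>..}"
      using set_borel_integral_eq_integral(1) fA by auto
    have Ysplit: "integral {0..} f = integral {0..\<kappa>} f + integral {\<kappa>..} f"
    proof -
      have "{0..\<kappa>} \<union> {\<kappa>..} = {0..}" "{0..\<kappa>} \<inter> {\<kappa>..} = {\<kappa>}" using k by auto
      thus ?thesis using has_integral_Un[OF integrable_integral[OF i1] integrable_integral[OF i2]] by (simp add: integral_unique)
    qed
    have tail: "\<bar>integral {\<kappa>..} f\<bar> \<le> 1 / (kk * \<kappa>) * exp (- (real n * \<kappa>))"
    proof -
      have e: "((\<lambda>r. 1 / (kk * \<kappa>) * exp (- real n * r)) has_integral 1 / (kk * \<kappa>) * (exp (- real n * \<kappa>) / real n)) {\<kappa>..}"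
        using n by (intro has_integral_mult_right has_integral_exp_minus_to_infinity) auto
      have "norm (integral {\<kappa>..} f) \<le> integral {\<kappa>..} (\<lambda>r. 1 / (kk * \<kappa>) * exp (- real n * r))"
      proof (rule Henstock_Kurzweil_Integration.integral_norm_bound_integral[OF i2])
        show "(\<lambda>r. 1 / (kk * \<kappa>) * exp (- real n * r)) integrable_on {\<kappa>..}" using e by (auto simp: integrable_on_def)
        fix r assume r: "r \<in> {\<kappa>..}"
        hence r0: "0 < r" using k by simp
        have "ml_density \<alpha> \<mu> r \<le> 1 / (kk * r)" unfolding kk_def by (rule ml_density_bounds(4)[OF \<alpha> r0 mu])
        also have "\<dots> \<le> 1 / (kk * \<kappa>)" using r k kk by (intro divide_left_mono mult_left_mono mult_pos_pos) auto
        finally have "ml_density \<alpha> \<mu> r * exp (- (r * real n)) \<le> 1 / (kk * \<kappa>) * exp (- (r * real n))" by (intro mult_right_mono) auto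
        thus "norm (f r) \<le> 1 / (kk * \<kappa>) * exp (- real n * r)"
          using ml_density_bounds(1)[OF \<alpha> r0 mu] by (simp add: f_def abs_mult mult_ac)
      qed
      also have "\<dots> = 1 / (kk * \<kappa>) * (exp (- real n * \<kappa>) / real n)" using e by (rule integral_unique)
      also have "\<dots> \<le> 1 / (kk * \<kappa>) * (exp (- real n * \<kappa>) / 1)" using kk k n by (intro mult_left_mono divide_left_mono) auto
      finally show ?thesis by simp
    qed
    \<comment> \<open>The pointwise error on the cut; the reflection \<open>r = - x\<close> brings
      the exact density to the interval of the contour integral.\<close>
    define T where "T = (\<lambda>x. - (S (\<alpha>-1) x + b * S \<alpha> x) / pi - f (- x))"
    have i3: "(\<lambda>x. f (- x)) integrable_on {-\<kappa>..0}" 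
      using Henstock_Kurzweil_Integration.integrable_reflect_real[where f = f and a = 0 and b = \<kappa>] i1 by simp
    have i4: "integral {-\<kappa>..0} (\<lambda>x. f (- x)) = integral {0..\<kappa>} f"
      using Henstock_Kurzweil_Integration.integral_reflect_real[where f = f and a = 0 and b = \<kappa>] by simp
    have Tint: "(T has_integral (- (integral {-\<kappa>..0} (S (\<alpha>-1)) + b * integral {-\<kappa>..0} (S \<alpha>)) / pi - integral {0..\<kappa>} f)) {-\<kappa>..0}"
      unfolding T_def i4[symmetric]
      by (intro has_integral_diff has_integral_divide has_integral_neg has_integral_add has_integral_mult_right integrable_integral F i3 g)
    have Tb: "\<bar>integral {-\<kappa>..0} T\<bar> \<le> D * exp \<kappa> / (real n + 1)^2"
    proof (rule cut_integral_bound)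
      show "T integrable_on {-\<kappa>..0}" using Tint by (auto simp: integrable_on_def)
      fix x assume x: "-\<kappa> \<le> x" "x \<le> 0"
      show "\<bar>T x\<bar> \<le> D * (- x) * exp (real n * x)"
      proof (cases "x = 0")
        case True
        thus ?thesis by (simp add: T_def S_def f_def cn_symbol_def ml_density_def)
      next
        case False
        hence r: "0 < - x" "- x \<le> \<kappa>" using x by auto
        have "exp (- x) \<le> exp \<kappa>" using x by simp
        hence ex: "exp (- x) \<le> \<rho>" using k by linarith
        define Z where "Z = cn_symbol \<alpha> (\<alpha>-1) \<mu> (of_real (1 - exp (- x))) + of_real b * cn_symbol \<alpha> \<alpha> \<mu> (of_real (1 - exp (- x))) - ml_symbol \<alpha> \<mu> (- x)"
        have "cmod Z \<le> D * (- x)" unfolding Z_def D_def b_def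
          by (rule cn_symbol_cut_difference[OF r(1) ex mu C f1[OF r] f2[OF r]])
        hence "\<bar>Im Z\<bar> \<le> D * (- x)" using abs_Im_le_cmod order_trans by blast
        moreover have "\<bar>Im Z\<bar> / pi \<le> \<bar>Im Z\<bar> / 1" using pi_gt3 by (intro divide_left_mono) auto
        ultimately have Z: "\<bar>Im Z\<bar> / pi \<le> D * (- x)" by linarith
        have "T x = - (Im Z / pi) * exp (real n * x)"
          unfolding T_def S_def f_def Z_def ml_density_symbol by (simp add: field_simps)
        thus ?thesis using mult_right_mono[OF Z, of "exp (real n * x)"] by (simp add: abs_mult abs_divide)
      qed
    qed (use k D in auto)
    have b2: "\<bar>b * (a \<alpha> + integral {-\<kappa>..0} (S \<alpha>) / pi)\<bar> \<le> \<bar>b\<bar> * (B \<alpha> * exp (- (real n * \<kappa>)))"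
      unfolding abs_mult using F(2)[OF g(2)] by (intro mult_left_mono) auto
    have "a (\<alpha>-1) + b * a \<alpha> - ml_fun \<alpha> \<mu> (real n) = (a (\<alpha>-1) + integral {-\<kappa>..0} (S (\<alpha>-1)) / pi)
        + b * (a \<alpha> + integral {-\<kappa>..0} (S \<alpha>) / pi) + integral {-\<kappa>..0} T - integral {\<kappa>..} f"
      unfolding integral_unique[OF Tint] Y Ysplit by (simp add: field_simps)
    also have "\<bar>\<dots>\<bar> \<le> (B (\<alpha>-1) + \<bar>b\<bar> * B \<alpha> + 1 / (kk * \<kappa>)) * exp (- (real n * \<kappa>)) + D * exp \<kappa> / (real n + 1)^2"
      using F(2)[OF g(1)] b2 Tb tail unfolding distrib_right by linarith
    also have "(B (\<alpha>-1) + \<bar>b\<bar> * B \<alpha> + 1 / (kk * \<kappa>)) * exp (- (real n * \<kappa>)) \<le> (B (\<alpha>-1) + \<bar>b\<bar> * B \<alpha> + 1 / (kk * \<kappa>)) * (E / (real n + 1)^2)"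
      using B kk k E by (intro mult_left_mono add_nonneg_nonneg mult_nonneg_nonneg) auto
    finally show "\<bar>fps_nth (cn_fps \<alpha> (\<alpha>-1) \<mu>) n + (\<alpha>-3)/2 * fps_nth (cn_fps \<alpha> \<alpha> \<mu>) n - ml_fun \<alpha> \<mu> (real n)\<bar> \<le> C' / (real n + 1)^2"
      unfolding a_def b_def C'_def by (simp add: add_divide_distrib)
  qed
qed

end

section \<open>The scalar scheme\<close>

text \<open>With \<open>a = i + 1\<close>, \<open>b = n - i + 1\<close> and \<open>s = a + b\<close>
  one has \<open>1/(a * b) = (1/a + 1/b)/s\<close>. So the product of the inverse squares is at most
  \<open>2/s^2\<close> times their sum, which is summable in \<open>i\<close>.\<close>

lemma inverse_square_convolution:
  fixes x y :: "nat \<Rightarrow> real"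
  assumes x: "\<And>n. \<bar>x n\<bar> \<le> A / (real n + 1)^2" and y: "\<And>n. \<bar>y n\<bar> \<le> B / (real n + 1)^2"
  shows "\<bar>\<Sum>i=0..n. x i * y (n - i)\<bar> \<le> 8 * A * B / (real n + 1)^2"
proof -
  have A: "0 \<le> A" and B: "0 \<le> B" using x[of 0] y[of 0] by auto
  define s where "s = real n + 2"
  have sum2: "(\<Sum>i=0..n. 1 / (real i + 1)^2) \<le> 2 - 1 / (real n + 1)" for n
  proof (induction n)
    case (Suc n)
    have "1 / (real n + 2)^2 \<le> 1 / ((real n + 1) * (real n + 2))"
      by (intro divide_left_mono) (auto simp: power2_eq_square intro!: mult_right_mono mult_pos_pos)
    also have "\<dots> = 1 / (real n + 1) - 1 / (real n + 2)" by (simp add: field_simps)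
    finally show ?case using Suc by (simp add: add_ac)
  qed simp
  have "\<bar>\<Sum>i=0..n. x i * y (n - i)\<bar> \<le> (\<Sum>i=0..n. (2 * A * B / s^2) * (1 / (real i + 1)^2 + 1 / (real (n - i) + 1)^2))"
  proof (rule order_trans[OF sum_abs sum_mono])
    fix i assume i: "i \<in> {0..n}"
    define a b where "a = real i + 1" and "b = real (n - i) + 1"
    have ab: "0 < a" "0 < b" "s = a + b" using i by (auto simp: a_def b_def s_def of_nat_diff)
    have "(u + v)^2 \<le> 2 * (u^2 + v^2)" for u v :: real
      using zero_le_power2[of "u - v"] by (simp add: power2_eq_square algebra_simps)
    from this[of "1/a" "1/b"] have "(1/a + 1/b)^2 \<le> 2 * (1/a^2 + 1/b^2)" by (simp add: power_divide)
    moreover have "(1/a + 1/b)^2 = s^2 / (a^2 * b^2)" using ab by (simp add: power2_eq_square field_simps)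
    ultimately have "s^2 / (a^2 * b^2) \<le> 2 * (1/a^2 + 1/b^2)" by simp
    hence "1 / (a^2 * b^2) \<le> 2 / s^2 * (1/a^2 + 1/b^2)" using ab by (simp add: field_simps)
    hence "(A * B) * (1 / (a^2 * b^2)) \<le> (A * B) * (2 / s^2 * (1/a^2 + 1/b^2))" using A B by (intro mult_left_mono) auto
    moreover have "\<bar>x i * y (n - i)\<bar> \<le> (A / a^2) * (B / b^2)"
      unfolding abs_mult a_def b_def using x y A by (intro mult_mono) auto
    ultimately have "\<bar>x i * y (n - i)\<bar> \<le> (2 * A * B / s^2) * (1 / a^2 + 1 / b^2)" by (simp add: mult_ac)
    thus "\<bar>x i * y (n - i)\<bar> \<le> (2 * A * B / s^2) * (1 / (real i + 1)^2 + 1 / (real (n - i) + 1)^2)"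
      unfolding a_def b_def .
  qed
  also have "\<dots> = (2 * A * B / s^2) * ((\<Sum>i=0..n. 1 / (real i + 1)^2) + (\<Sum>i=0..n. 1 / (real (n - i) + 1)^2))"
    by (simp only: sum_distrib_left[symmetric] sum.distrib)
  also have "(\<Sum>i=0..n. 1 / (real (n - i) + 1)^2) = (\<Sum>i=0..n. 1 / (real i + 1)^2)"
    using sum.atLeastAtMost_rev[of "\<lambda>i. 1 / (real i + 1)^2" 0 n] by simp
  also have "(2 * A * B / s^2) * ((\<Sum>i=0..n. 1 / (real i + 1)^2) + (\<Sum>i=0..n. 1 / (real i + 1)^2)) \<le> (2 * A * B / s^2) * (2 + 2)"
    using A B sum2[of n] by (intro mult_left_mono add_mono) (auto intro: order_trans)
  also have "\<dots> = 8 * A * B / s^2" by simp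
  also have "\<dots> \<le> 8 * A * B / (real n + 1)^2"
    using A B by (intro divide_left_mono power_mono mult_pos_pos) (auto simp: s_def)
  finally show ?thesis .
qed

lemma cq_weight_opm: "cq_weight \<alpha> n = fps_nth (opm \<alpha>) n"
proof (induction n)
  case (Suc n)
  have "fps_nth (opm \<alpha>) (Suc n) = fps_nth (opm \<alpha>) n * ((real n - \<alpha>) / real (Suc n))"
    by (simp add: opm_def pochhammer_Suc)
  also have "(real n - \<alpha>) / real (Suc n) = 1 - (\<alpha> + 1) / real (Suc n)" by (simp add: field_simps)
  finally show ?case using Suc by simp
qed (simp add: opm_def)

definition bdf_fps :: "real fps" where
  "bdf_fps = fps_const (3/2) - fps_const 2 * fps_X + fps_const (1/2) * fps_X^2"

lemma bdf_fps_nth: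
  "fps_nth (bdf_fps * F) n = 3/2 * fps_nth F n - 2 * (if n \<ge> 1 then fps_nth F (n-1) else 0) + 1/2 * (if n \<ge> 2 then fps_nth F (n-2) else 0)"
proof -
  have "bdf_fps * F = fps_const (3/2) * F - fps_const 2 * (fps_X * F) + fps_const (1/2) * (fps_X^2 * F)"
    unfolding bdf_fps_def by (simp only: distrib_right left_diff_distrib mult.assoc)
  thus ?thesis by (simp add: fps_X_power_mult_nth)
qed

lemma bdf_fps_eq: "bdf_fps = opm 1 * (1 + fps_const (1/2) * (1 - fps_X))"
proof -
  define h :: "real fps" where "h = fps_const (1/2)"
  have hh: "h + h = 1" by (simp add: h_def flip: fps_const_1_eq_1)
  have "fps_const (3/2) = 1 + h" by (simp add: h_def flip: fps_const_1_eq_1)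
  moreover have "fps_const 2 = (1 + 1 :: real fps)" by (simp flip: numeral_fps_const)
  ultimately have 1: "bdf_fps = 1 + h - (1 + 1) * fps_X + h * fps_X^2" by (simp only: bdf_fps_def h_def)
  have "(1 - fps_X) * (1 + h * (1 - fps_X)) = 1 + h - fps_X - (h + h) * fps_X + h * fps_X^2"
    by (simp add: algebra_simps power2_eq_square)
  also have "\<dots> = bdf_fps" unfolding hh 1 by (simp add: algebra_simps)
  finally show ?thesis by (simp add: opm_1 h_def)
qed

text \<open>The scheme holds for finitely many indices, but a coefficient of a product involves only
  coefficients of at most the same index; so division by \<open>F\<close> is legitimate up to index
  \<open>N\<close>.\<close>

lemma fps_eq_up_to:
  fixes F U R :: "'a :: field fps"
  assumes F: "fps_nth F 0 \<noteq> 0" and eq: "\<And>m. m \<le> N \<Longrightarrow> fps_nth (F * U) m = fps_nth R m" and n: "n \<le> N"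
  shows "fps_nth (H * U) n = fps_nth (H * inverse F * R) n"
proof -
  have "H * U = H * (inverse F * F) * U" using inverse_mult_eq_1[OF F] by simp
  hence "H * U = (H * inverse F) * (F * U)" by (simp only: mult.assoc)
  hence "fps_nth (H * U) n = (\<Sum>i=0..n. fps_nth (H * inverse F) i * fps_nth (F * U) (n - i))"
    by (simp only: fps_mult_nth[of "H * inverse F"])
  also have "\<dots> = (\<Sum>i=0..n. fps_nth (H * inverse F) i * fps_nth R (n - i))"
    using n by (intro sum.cong refl) (simp add: eq)
  finally show ?thesis by (simp only: fps_mult_nth[of "H * inverse F" R])
qed

text \<open>The scheme (CN-I) with step size \<open>1\<close>, initial value \<open>1\<close> and \<open>A\<^sub>h\<close> replaced by the number \<open>\<mu>\<close>.\<close>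

definition frac_grid :: "real \<Rightarrow> nat \<Rightarrow> real" where
  "frac_grid \<alpha> n = (if n = 0 then 0 else real n powr (2-\<alpha>) / Gamma (3-\<alpha>))"

definition scalar_CN :: "real \<Rightarrow> real \<Rightarrow> nat \<Rightarrow> (nat \<Rightarrow> real) \<Rightarrow> bool" where
  "scalar_CN \<alpha> \<mu> N U \<longleftrightarrow> U 0 = 0 \<and>
     (\<forall>m. 1 \<le> m \<longrightarrow> m \<le> N \<longrightarrow> (\<Sum>j=0..m. cq_weight \<alpha> j * U (m - j)) + \<mu> * ((1 - \<alpha>/2) * U m + \<alpha>/2 * U (m - 1))
       = (1 - \<alpha>/2) * fps_nth (bdf_fps * Abs_fps (frac_grid \<alpha>)) m + \<alpha>/2 * fps_nth (bdf_fps * Abs_fps (frac_grid \<alpha>)) (m - 1))"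

text \<open>Generating functions turn the recurrence into division by \<open>cn_fps_den\<close>. The
  expansion of the data then splits the result into the two leading parts, which are compared with
  \<open>ml_fun\<close>, two parts covered by \<open>cn_fps_smooth_bound\<close>, and a convolution
  of the remainder of the data with \<open>cn_fps \<alpha> 2 \<mu>\<close>.\<close>

lemma scalar_CN_estimate:
  fixes \<alpha> :: real
  assumes \<alpha>: "0 < \<alpha>" "\<alpha> < 1"
  obtains C where "0 < C"
    "\<And>\<mu> N U n. 0 < \<mu> \<Longrightarrow> scalar_CN \<alpha> \<mu> N U \<Longrightarrow> 1 \<le> n \<Longrightarrow> n \<le> N \<Longrightarrow>
      \<bar>fps_nth (bdf_fps * Abs_fps U) n - ml_fun \<alpha> \<mu> (real n)\<bar> \<le> C / (real n)^2"
proof -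
  define g where "g = (\<lambda>n::nat. if n = 0 then 0 else real n powr (2-\<alpha>) / Gamma (3-\<alpha>))"
  have gg: "frac_grid \<alpha> = g" by (auto simp: g_def frac_grid_def)
  obtain \<rho> c where \<rho>: "1 < \<rho>" and c: "0 < c" and den: "\<And>W \<mu>. cmod (1 - W) \<le> \<rho> \<Longrightarrow> 0 \<le> Im W \<Longrightarrow> 0 \<le> \<mu> \<Longrightarrow> c * (cmod W powr \<alpha> + \<mu>) \<le> cmod (cn_den \<alpha> \<mu> W)"
    using cn_den_bound[OF \<alpha>] by metis
  obtain \<delta> C1 where \<delta>: "0 < \<delta>" "0 < C1"
    "\<And>r. 0 < r \<Longrightarrow> r \<le> \<delta> \<Longrightarrow> \<bar>(1 - (exp r - 1)/2)^2 * (1 - (\<alpha>-3)/2 * (exp r - 1)) * ((exp r - 1)/r) powr (\<alpha>-1) - 1\<bar> \<le> C1 * r^2"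
    "\<And>r. 0 < r \<Longrightarrow> r \<le> \<delta> \<Longrightarrow> \<bar>1 + \<alpha>/2 * (exp r - 1) - ((exp r - 1)/r) powr \<alpha>\<bar> \<le> C1 * r^2"
    using cut_asymptotics[OF \<alpha>] by metis
  \<comment> \<open>Small enough for the expansions on the cut and for the contour to stay within
    the disc of radius \<open>\<rho>\<close>.\<close>
  define \<kappa> where "\<kappa> = min \<delta> (ln \<rho>)"
  have k: "0 < \<kappa>" using \<delta> \<rho> by (simp add: \<kappa>_def)
  have "exp \<kappa> \<le> exp (ln \<rho>)" by (simp add: \<kappa>_def)
  hence k2: "exp \<kappa> \<le> \<rho>" using \<rho> by simp
  note ctx = \<alpha> \<rho> c den
  obtain M0 where M0: "\<And>\<mu> n. 0 < \<mu> \<Longrightarrow> 1 \<le> n \<Longrightarrow>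
     \<bar>fps_nth (cn_fps \<alpha> (\<alpha>-1) \<mu>) n + (\<alpha>-3)/2 * fps_nth (cn_fps \<alpha> \<alpha> \<mu>) n - ml_fun \<alpha> \<mu> (real n)\<bar> \<le> M0 / (real n + 1)^2"
    by (rule cn_fps_main_bound[OF ctx k k2 \<delta>(2) \<delta>(3) \<delta>(4)]) (auto simp: \<kappa>_def)
  obtain M1 where M1: "\<And>\<mu> n. 0 < \<mu> \<Longrightarrow> \<bar>fps_nth (cn_fps \<alpha> (\<alpha>+1) \<mu>) n\<bar> \<le> M1 / (real n + 1)^2"
    by (rule cn_fps_smooth_bound[OF ctx k k2, of "\<alpha>+1"]) auto
  obtain M2 where M2: "\<And>\<mu> n. 0 < \<mu> \<Longrightarrow> \<bar>fps_nth (cn_fps \<alpha> (\<alpha>+2) \<mu>) n\<bar> \<le> M2 / (real n + 1)^2"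
    by (rule cn_fps_smooth_bound[OF ctx k k2, of "\<alpha>+2"]) auto
  obtain M3 where M3: "\<And>\<mu> n. 0 < \<mu> \<Longrightarrow> \<bar>fps_nth (cn_fps \<alpha> 2 \<mu>) n\<bar> \<le> M3 / (real n + 1)^2"
    by (rule cn_fps_smooth_bound[OF ctx k k2, of 2]) (use \<alpha> in auto)
  obtain b2 b3 M4 where M4: "\<And>n. \<bar>g n -
       (pochhammer (3-\<alpha>) n / fact n + (\<alpha>-3)/2 * (pochhammer (2-\<alpha>) n / fact n)
        + b2 * (pochhammer (1-\<alpha>) n / fact n) + b3 * (pochhammer (-\<alpha>) n / fact n))\<bar> \<le> M4 / (real n + 1)^2"
    unfolding g_def by (rule power_sequence_expansion[OF \<alpha>]) auto
  define b where "b = (\<alpha>-3)/2"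
  define R where "R = Abs_fps g - (opm (\<alpha>-3) + fps_const b * opm (\<alpha>-2) + fps_const b2 * opm (\<alpha>-1) + fps_const b3 * opm \<alpha>)"
  have R: "\<bar>fps_nth R n\<bar> \<le> M4 / (real n + 1)^2" for n
    using M4[of n] by (simp add: R_def opm_def b_def)
  define M where "M = M0 + \<bar>b2\<bar> * M1 + \<bar>b3\<bar> * M2 + 8 * M3 * M4"
  define p :: "real fps" where "p = 1 - fps_const (\<alpha>/2) * (1 - fps_X)"
  have p_nth: "fps_nth (p * F) m = (1 - \<alpha>/2) * fps_nth F m + \<alpha>/2 * (if m \<ge> 1 then fps_nth F (m-1) else 0)" for F m
  proof -
    have "p = fps_const (1 - \<alpha>/2) + fps_const (\<alpha>/2) * fps_X"
      by (simp add: p_def algebra_simps flip: fps_const_1_eq_1)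
    hence "p * F = fps_const (1 - \<alpha>/2) * F + fps_const (\<alpha>/2) * (fps_X * F)"
      by (simp only: distrib_right mult.assoc)
    thus ?thesis by simp
  qed
  show ?thesis
  proof (rule that[of "\<bar>M\<bar> + 1"])
    fix \<mu> :: real and N n :: nat and U :: "nat \<Rightarrow> real"
    assume mu: "0 < \<mu>" and sc: "scalar_CN \<alpha> \<mu> N U" and n: "1 \<le> n" "n \<le> N"
    have U0: "U 0 = 0" and rec: "\<And>m. 1 \<le> m \<Longrightarrow> m \<le> N \<Longrightarrow> (\<Sum>j=0..m. cq_weight \<alpha> j * U (m - j)) + \<mu> * ((1 - \<alpha>/2) * U m + \<alpha>/2 * U (m - 1))
         = (1 - \<alpha>/2) * fps_nth (bdf_fps * Abs_fps g) m + \<alpha>/2 * fps_nth (bdf_fps * Abs_fps g) (m - 1)"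
      using sc by (auto simp: scalar_CN_def gg)
    define V where "V = Abs_fps U"
    have den_eq: "cn_fps_den \<alpha> \<mu> = opm \<alpha> + fps_const \<mu> * p" by (simp add: cn_fps_den_def p_def)
    have F0: "fps_nth (cn_fps_den \<alpha> \<mu>) 0 \<noteq> 0" using cn_fps_den_0[OF ctx] mu by simp
    have "fps_nth (cn_fps_den \<alpha> \<mu> * V) m = fps_nth (p * (bdf_fps * Abs_fps g)) m" if m: "m \<le> N" for m
    proof (cases "m = 0")
      case True
      thus ?thesis by (simp add: V_def U0 g_def fps_mult_nth)
    next
      case False
      have "fps_nth (cn_fps_den \<alpha> \<mu> * V) m = (\<Sum>j=0..m. cq_weight \<alpha> j * U (m - j)) + \<mu> * fps_nth (p * V) m"
        unfolding den_eq distrib_right by (simp add: fps_mult_nth[of "opm \<alpha>"] cq_weight_opm V_def mult.assoc)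
      thus ?thesis using rec[of m] m False by (simp only: p_nth) (simp add: V_def)
    qed
    from fps_eq_up_to[OF F0 this n(2), of bdf_fps]
    have "fps_nth (bdf_fps * V) n = fps_nth (bdf_fps * inverse (cn_fps_den \<alpha> \<mu>) * (p * (bdf_fps * Abs_fps g))) n" by simp
    also have "bdf_fps * inverse (cn_fps_den \<alpha> \<mu>) * (p * (bdf_fps * Abs_fps g)) 
        = cn_fps \<alpha> (\<alpha>-1) \<mu> + fps_const b * cn_fps \<alpha> \<alpha> \<mu> + fps_const b2 * cn_fps \<alpha> (\<alpha>+1) \<mu> + fps_const b3 * cn_fps \<alpha> (\<alpha>+2) \<mu> + cn_fps \<alpha> 2 \<mu> * R"
    proof -
      define I where "I = inverse (cn_fps_den \<alpha> \<mu>)"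
      define q :: "real fps" where "q = 1 + fps_const (1/2) * (1 - fps_X)"
      have cf: "cn_fps \<alpha> \<gamma> \<mu> = p * q^2 * opm \<gamma> * I" for \<gamma> by (simp add: cn_fps_def cn_fps_num_def p_def q_def I_def)
      have o2: "opm 1 * opm 1 = (opm 2 :: real fps)" by (simp add: opm_mult)
      \<comment> \<open>The factor \<open>1 - z\<close> of each BDF operator raises every exponent
        of the data by \<open>2\<close> in total; in front of the remainder the bare
        \<open>opm 2\<close> is left, hence the exponent \<open>\<gamma> = 2\<close>.\<close>
      have os: "opm 2 * opm (\<alpha>-3) = opm (\<alpha>-1)" "opm 2 * opm (\<alpha>-2) = opm \<alpha>" "opm 2 * opm (\<alpha>-1) = opm (\<alpha>+1)" "opm 2 * opm \<alpha> = opm (\<alpha>+2)"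
        by (simp_all add: opm_mult add.commute)
      have G: "Abs_fps g = opm (\<alpha>-3) + fps_const b * opm (\<alpha>-2) + fps_const b2 * opm (\<alpha>-1) + fps_const b3 * opm \<alpha> + R"
        by (simp add: R_def)
      have "bdf_fps * I * (p * (bdf_fps * Abs_fps g)) = p * q^2 * I * ((opm 1 * opm 1) * Abs_fps g)"
        unfolding bdf_fps_eq q_def[symmetric] by (simp add: power2_eq_square mult_ac)
      also have "\<dots> = p * q^2 * I * (opm 2 * opm (\<alpha>-3) + fps_const b * (opm 2 * opm (\<alpha>-2)) + fps_const b2 * (opm 2 * opm (\<alpha>-1)) + fps_const b3 * (opm 2 * opm \<alpha>) + opm 2 * R)"
        unfolding o2 G by (simp add: distrib_left mult_ac)
      also have "\<dots> = cn_fps \<alpha> (\<alpha>-1) \<mu> + fps_const b * cn_fps \<alpha> \<alpha> \<mu> + fps_const b2 * cn_fps \<alpha> (\<alpha>+1) \<mu> + fps_const b3 * cn_fps \<alpha> (\<alpha>+2) \<mu> + cn_fps \<alpha> 2 \<mu> * R"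
        unfolding os cf by (simp add: distrib_left mult_ac)
      finally show ?thesis by (simp add: I_def)
    qed
    finally have w: "fps_nth (bdf_fps * V) n = fps_nth (cn_fps \<alpha> (\<alpha>-1) \<mu>) n + b * fps_nth (cn_fps \<alpha> \<alpha> \<mu>) n
       + b2 * fps_nth (cn_fps \<alpha> (\<alpha>+1) \<mu>) n + b3 * fps_nth (cn_fps \<alpha> (\<alpha>+2) \<mu>) n + fps_nth (cn_fps \<alpha> 2 \<mu> * R) n"
      by simp
    have e1: "\<bar>b2 * fps_nth (cn_fps \<alpha> (\<alpha>+1) \<mu>) n\<bar> \<le> \<bar>b2\<bar> * (M1 / (real n + 1)^2)"
      unfolding abs_mult using M1[OF mu] by (intro mult_left_mono) auto
    have e2: "\<bar>b3 * fps_nth (cn_fps \<alpha> (\<alpha>+2) \<mu>) n\<bar> \<le> \<bar>b3\<bar> * (M2 / (real n + 1)^2)"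
      unfolding abs_mult using M2[OF mu] by (intro mult_left_mono) auto
    have e3: "\<bar>fps_nth (cn_fps \<alpha> 2 \<mu> * R) n\<bar> \<le> 8 * M3 * M4 / (real n + 1)^2"
      unfolding fps_mult_nth by (rule inverse_square_convolution[OF M3[OF mu] R])
    have "\<bar>fps_nth (bdf_fps * V) n - ml_fun \<alpha> \<mu> (real n)\<bar> \<le> M0 / (real n + 1)^2 + \<bar>b2\<bar> * (M1 / (real n + 1)^2) + \<bar>b3\<bar> * (M2 / (real n + 1)^2) + 8 * M3 * M4 / (real n + 1)^2"
      unfolding w using M0[OF mu n(1)] e1 e2 e3 unfolding b_def[symmetric] by linarith
    also have "\<dots> = M / (real n + 1)^2" by (simp add: M_def add_divide_distrib)
    also have "\<dots> \<le> (\<bar>M\<bar> + 1) / (real n + 1)^2" by (intro divide_right_mono) auto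
    also have "\<dots> \<le> (\<bar>M\<bar> + 1) / (real n)^2" using n by (intro divide_left_mono power_mono mult_pos_pos) auto
    finally show "\<bar>fps_nth (bdf_fps * Abs_fps U) n - ml_fun \<alpha> \<mu> (real n)\<bar> \<le> (\<bar>M\<bar> + 1) / (real n)^2" unfolding V_def .
  qed simp
qed

section \<open>The scalar Caputo equation\<close>

text \<open>Under \<open>t = \<zeta> + c * x\<close> all powers of \<open>c\<close> cancel and the
  Beta integral with parameters \<open>1-\<alpha>\<close> and \<open>\<alpha>\<close> remains. That
  the value does not depend on \<open>\<zeta>\<close> is what makes the fractional integral of order
  \<open>\<alpha>\<close> undo the Caputo derivative.\<close>

lemma Beta_kernel_integral:
  fixes \<alpha> :: real
  assumes \<alpha>: "0 < \<alpha>" "\<alpha> < 1" and zT: "\<zeta> < T"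
  shows "has_bochner_integral lborel (\<lambda>t. if \<zeta> < t \<and> t < T then (T - t) powr (\<alpha>-1) * (t - \<zeta>) powr (-\<alpha>) else 0) (Gamma (1-\<alpha>) * Gamma \<alpha>)"
proof -
  define c where "c = T - \<zeta>"
  have c: "0 < c" using zT by (simp add: c_def)
  define f where "f = (\<lambda>t. if \<zeta> < t \<and> t < T then (T - t) powr (\<alpha>-1) * (t - \<zeta>) powr (-\<alpha>) else 0)"
  have i: "set_integrable lborel {0..1} (\<lambda>t. t powr ((1-\<alpha>) - 1) * (1 - t) powr (\<alpha> - 1))"
    using \<alpha> by (intro integrable_Beta) auto
  have "(LINT t:{0..1}|lborel. t powr ((1-\<alpha>) - 1) * (1 - t) powr (\<alpha> - 1)) = Beta (1-\<alpha>) \<alpha>"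
    using set_borel_integral_eq_integral(2)[OF i] has_integral_Beta_real[of "1-\<alpha>" \<alpha>] \<alpha> by (simp add: integral_unique)
  hence h: "has_bochner_integral lborel (\<lambda>t. indicator {0..1} t *\<^sub>R (t powr ((1-\<alpha>) - 1) * (1 - t) powr (\<alpha> - 1))) (Gamma (1-\<alpha>) * Gamma \<alpha>)"
    using i unfolding has_bochner_integral_iff set_integrable_def set_lebesgue_integral_def by (simp add: Beta_def)
  have "f (\<zeta> + c * x) = inverse c * (indicator {0..1} x *\<^sub>R (x powr ((1-\<alpha>) - 1) * (1 - x) powr (\<alpha> - 1)))" for x
  proof (cases "0 < x \<and> x < 1")
    case True
    have "T - (\<zeta> + c * x) = c * (1 - x)" "\<zeta> + c * x - \<zeta> = c * x" by (simp_all add: c_def algebra_simps)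
    moreover have "\<zeta> < \<zeta> + c * x" using True c by simp
    moreover have "\<zeta> + c * x < T" using mult_strict_left_mono[of x 1 c] True c c_def by linarith
    ultimately have "f (\<zeta> + c * x) = (c * (1 - x)) powr (\<alpha>-1) * (c * x) powr (-\<alpha>)" by (simp add: f_def)
    also have "\<dots> = (c powr (\<alpha>-1) * c powr (-\<alpha>)) * (x powr (-\<alpha>) * (1 - x) powr (\<alpha>-1))"
      using True c by (simp add: powr_mult)
    also have "c powr (\<alpha>-1) * c powr (-\<alpha>) = inverse c" using c by (simp add: powr_minus powr_diff field_simps)
    finally show ?thesis using True by simp
  next
    case False
    hence "x \<le> 0 \<or> 1 \<le> x" by auto
    moreover have "\<not> (\<zeta> < \<zeta> + c * x)" if "x \<le> 0" using that c by (simp add: mult_le_0_iff not_less)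
    moreover have "\<not> (\<zeta> + c * x < T)" if "1 \<le> x" using mult_left_mono[OF that, of c] c c_def by linarith
    ultimately have "f (\<zeta> + c * x) = 0" by (auto simp: f_def)
    thus ?thesis using False by (cases "x = 0 \<or> x = 1") (auto simp: indicator_def)
  qed
  hence "has_bochner_integral lborel (\<lambda>x. f (\<zeta> + c * x)) (inverse c * (Gamma (1-\<alpha>) * Gamma \<alpha>))"
    using has_bochner_integral_mult_right[OF h, of "inverse c"] by simp
  hence "has_bochner_integral lborel f (Gamma (1-\<alpha>) * Gamma \<alpha>)"
    using lborel_has_bochner_integral_real_affine_iff[of c f "Gamma (1-\<alpha>) * Gamma \<alpha>" \<zeta>] c by simp
  thus ?thesis unfolding f_def .
qed

text \<open>Applying the fractional integral of order \<open>\<alpha>\<close> to the equation.\<close>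

lemma caputo_volterra:
  fixes u :: "real \<Rightarrow> real"
  assumes \<alpha>: "0 < \<alpha>" "\<alpha> < 1" and cont: "continuous_on {0..} u"
    and diff: "\<And>t. 0 < t \<Longrightarrow> u differentiable (at t)"
    and ex: "\<And>t. 0 < t \<Longrightarrow> caputo_exists \<alpha> u t"
    and eq: "\<And>t. 0 < t \<Longrightarrow> caputo \<alpha> u t = - l * u t" and T: "0 < T"
  shows "u T = u 0 - l / Gamma \<alpha> * (\<integral>t. (if 0 < t \<and> t < T then (T - t) powr (\<alpha>-1) * u t else 0) \<partial>lborel)"
proof -
  define v where "v = deriv u"
  define w where "w = (\<lambda>\<zeta>. if 0 < \<zeta> \<and> \<zeta> < T then v \<zeta> else 0)"
  define \<phi> where "\<phi> = (\<lambda>\<zeta>. indicator {0<..<T} \<zeta> *\<^sub>R ((T - \<zeta>) powr (-\<alpha>) * v \<zeta>))"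
  have \<phi>: "integrable lborel \<phi>" using ex[OF T] unfolding caputo_exists_def set_integrable_def \<phi>_def v_def .
  have w_eq: "w \<zeta> = (T - \<zeta>) powr \<alpha> * \<phi> \<zeta>" for \<zeta>
    by (auto simp: w_def \<phi>_def powr_minus field_simps)
  have w_meas [measurable]: "w \<in> borel_measurable borel"
    using borel_measurable_integrable[OF \<phi>] unfolding w_eq[abs_def] by measurable
  \<comment> \<open>Existence of the Caputo integral at the one time \<open>T\<close> makes the
    derivative integrable on the interval, because the kernel is bounded below there by
    \<open>T powr (-\<alpha>)\<close>.\<close>
  have wint: "integrable lborel w"
  proof (rule Bochner_Integration.integrable_bound[OF integrable_mult_right[OF \<phi>, of "T powr \<alpha>"]])
    show "AE \<zeta> in lborel. norm (w \<zeta>) \<le> norm (T powr \<alpha> * \<phi> \<zeta>)"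
    proof (rule AE_I2)
      fix \<zeta> :: real
      show "norm (w \<zeta>) \<le> norm (T powr \<alpha> * \<phi> \<zeta>)"
      proof (cases "0 < \<zeta> \<and> \<zeta> < T")
        case True
        hence "(T - \<zeta>) powr \<alpha> \<le> T powr \<alpha>" using \<alpha> by (intro powr_mono2) auto
        thus ?thesis unfolding w_eq by (simp add: abs_mult mult_right_mono)
      qed (auto simp: w_def)
    qed
  qed simp
  \<comment> \<open>The derivative may blow up at \<open>0\<close>, so the version of the
    fundamental theorem with continuity on the closed interval and differentiability inside is
    used.\<close>
  have wval: "integral\<^sup>L lborel w = u T - u 0"
  proof -
    have "(v has_integral (u T - u 0)) {0..T}"
      using T diff DERIV_deriv_iff_real_differentiable unfolding v_def
      by (intro fundamental_theorem_of_calculus_interior continuous_on_subset[OF cont])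
         (auto simp flip: has_real_derivative_iff_has_vector_derivative)
    hence "(w has_integral (u T - u 0)) {0..T}"
      by (rule has_integral_spike[of "{0,T}", rotated 2]) (auto simp: w_def)
    hence h: "(w has_integral (u T - u 0)) UNIV"
      by (rule has_integral_on_superset) (auto simp: w_def)
    show ?thesis using has_integral_integral_lborel[OF wint] h has_integral_unique by blast
  qed
  define k where "k = (\<lambda>\<zeta> t. if \<zeta> < t \<and> t < T then (T - t) powr (\<alpha>-1) * (t - \<zeta>) powr (-\<alpha>) else 0)"
  define B where "B = Gamma (1-\<alpha>) * Gamma \<alpha>"
  have k: "has_bochner_integral lborel (k \<zeta>) B" if "\<zeta> < T" for \<zeta>
    unfolding k_def B_def by (rule Beta_kernel_integral[OF \<alpha> that])
  have k0: "0 \<le> k \<zeta> t" for \<zeta> t by (simp add: k_def)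
  have G: "0 < Gamma (1-\<alpha>)" "0 < Gamma \<alpha>" using \<alpha> by (auto intro!: Gamma_real_pos)
  \<comment> \<open>The free constant \<open>c\<close> is \<open>sgn (w \<zeta>)\<close> when
    absolute integrability is checked, and \<open>1\<close> when the integral itself is
    evaluated.\<close>
  have kw: "(\<integral>t. k \<zeta> t * c * w \<zeta> \<partial>lborel) = B * c * w \<zeta>" for \<zeta> and c :: real
  proof (cases "\<zeta> < T")
    case True
    have "has_bochner_integral lborel (\<lambda>t. k \<zeta> t * (c * w \<zeta>)) (B * (c * w \<zeta>))"
      by (rule has_bochner_integral_mult_left[OF k[OF True]])
    from has_bochner_integral_integral_eq[OF this] show ?thesis by (simp only: mult.assoc)
  qed (simp add: w_def)
  define F where "F = (\<lambda>\<zeta> t. k \<zeta> t * w \<zeta>)"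
  have Fm: "case_prod F \<in> borel_measurable (lborel \<Otimes>\<^sub>M lborel)"
    unfolding F_def k_def by measurable
  have Fi: "integrable (lborel \<Otimes>\<^sub>M lborel) (case_prod F)"
  proof (rule lborel_pair.Fubini_integrable[OF Fm])
    have "(\<integral>t. norm (case_prod F (\<zeta>, t)) \<partial>lborel) = B * \<bar>w \<zeta>\<bar>" for \<zeta>
    proof -
      have "norm (case_prod F (\<zeta>, t)) = k \<zeta> t * sgn (w \<zeta>) * w \<zeta>" for t
      proof -
        have "norm (case_prod F (\<zeta>, t)) = k \<zeta> t * \<bar>w \<zeta>\<bar>" using k0 by (simp add: F_def abs_mult)
        also have "\<bar>w \<zeta>\<bar> = sgn (w \<zeta>) * w \<zeta>" by (simp add: sgn_if)
        finally show ?thesis by (simp only: mult.assoc)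
      qed
      thus ?thesis using kw[of \<zeta> "sgn (w \<zeta>)"] by (simp add: abs_sgn mult_ac)
    qed
    thus "integrable lborel (\<lambda>x. \<integral>y. norm (case_prod F (x, y)) \<partial>lborel)"
      using wint by simp
    show "AE x in lborel. integrable lborel (\<lambda>y. case_prod F (x, y))"
    proof (rule AE_I2)
      fix \<zeta> :: real
      show "integrable lborel (\<lambda>y. case_prod F (\<zeta>, y))"
        using k[of \<zeta>] by (cases "\<zeta> < T") (auto simp: F_def w_def has_bochner_integral_iff)
    qed
  qed
  have "(\<integral>t. (\<integral>\<zeta>. F \<zeta> t \<partial>lborel) \<partial>lborel) = (\<integral>\<zeta>. (\<integral>t. F \<zeta> t \<partial>lborel) \<partial>lborel)"
    by (rule lborel_pair.Fubini_integral[OF Fi])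
  also have "\<dots> = B * (u T - u 0)"
  proof -
    have "(\<integral>t. F \<zeta> t \<partial>lborel) = B * w \<zeta>" for \<zeta>
      using kw[of \<zeta> 1] unfolding F_def by (simp only: mult_1_right)
    thus ?thesis using wval by simp
  qed
  also have "(\<lambda>t. (\<integral>\<zeta>. F \<zeta> t \<partial>lborel)) = (\<lambda>t. - l * Gamma (1-\<alpha>) * (if 0 < t \<and> t < T then (T - t) powr (\<alpha>-1) * u t else 0))"
  proof
    fix t
    show "(\<integral>\<zeta>. F \<zeta> t \<partial>lborel) = - l * Gamma (1-\<alpha>) * (if 0 < t \<and> t < T then (T - t) powr (\<alpha>-1) * u t else 0)"
    proof (cases "0 < t \<and> t < T")
      case True
      have "(\<lambda>\<zeta>. F \<zeta> t) = (\<lambda>\<zeta>. (T - t) powr (\<alpha>-1) * (indicator {0<..<t} \<zeta> *\<^sub>R ((t - \<zeta>) powr (-\<alpha>) * v \<zeta>)))"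
        using True by (auto simp: F_def k_def w_def indicator_def)
      hence "(\<integral>\<zeta>. F \<zeta> t \<partial>lborel) = (T - t) powr (\<alpha>-1) * (LINT \<zeta>:{0<..<t}|lborel. (t - \<zeta>) powr (-\<alpha>) * v \<zeta>)"
        by (simp add: set_lebesgue_integral_def)
      also have "(LINT \<zeta>:{0<..<t}|lborel. (t - \<zeta>) powr (-\<alpha>) * v \<zeta>) = Gamma (1-\<alpha>) * (- l * u t)"
        using eq[of t] True G unfolding caputo_def v_def by (simp add: field_simps)
      finally show ?thesis using True by simp
    next
      case False
      hence "(\<lambda>\<zeta>. F \<zeta> t) = (\<lambda>_. 0)" by (auto simp: F_def k_def w_def)
      thus ?thesis using False by auto
    qed
  qed
  finally have "- l * Gamma (1-\<alpha>) * (\<integral>t. (if 0 < t \<and> t < T then (T - t) powr (\<alpha>-1) * u t else 0) \<partial>lborel) = B * (u T - u 0)"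
    by simp
  moreover have "- l * I = g * d" if "- l * g1 * I = (g1 * g) * d" "0 < g1" for I g g1 d :: real
  proof -
    have "g1 * (- l * I) = g1 * (g * d)" using that(1) by (simp add: mult_ac)
    thus ?thesis using that(2) by (simp only: mult_left_cancel)
  qed
  ultimately have "- l * (\<integral>t. (if 0 < t \<and> t < T then (T - t) powr (\<alpha>-1) * u t else 0) \<partial>lborel) = Gamma \<alpha> * (u T - u 0)"
    unfolding B_def using G by blast
  thus ?thesis using G by (simp add: field_simps)
qed

section \<open>Laplace transform of the Volterra equation and injectivity of the transform\<close>

lemma Gamma_kernel_integral:
  assumes "0 < \<alpha>" "0 < (s::real)"
  shows "has_bochner_integral lborel (\<lambda>x. if 0 < x then x powr (\<alpha>-1) * exp (- (s * x)) else 0) (Gamma \<alpha> / s powr \<alpha>)"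
proof -
  define f where "f = (\<lambda>x. if 0 < x then x powr (\<alpha>-1) * exp (- (s * x)) else 0)"
  define g where "g = (\<lambda>x::real. if 0 < x then x powr (\<alpha>-1) * exp (- x) else 0)"
  have i: "((\<lambda>t. t powr (\<alpha> - 1) / exp t) has_integral Gamma \<alpha>) {0..}" by (rule Gamma_integral_real[OF assms(1)])
  have "((\<lambda>t. g t) has_integral Gamma \<alpha>) {0..}"
    by (rule has_integral_spike[of "{0}", OF _ _ i]) (auto simp: g_def exp_minus field_simps)
  hence gi: "(g has_integral Gamma \<alpha>) UNIV"
    by (rule has_integral_on_superset) (auto simp: g_def)
  have gm: "g \<in> borel_measurable borel" unfolding g_def by measurable
  have g: "has_bochner_integral lborel g (Gamma \<alpha>)"
  proof -
    have "integral\<^sup>N lborel g = Gamma \<alpha>"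
      using nn_integral_has_integral_lborel[OF gm _ gi] by (auto simp: g_def)
    thus ?thesis using gm assms by (intro has_bochner_integral_nn_integral) (auto simp: g_def Gamma_real_pos less_imp_le)
  qed
  have "inverse s powr (\<alpha>-1) = s powr (1-\<alpha>)" using assms by (simp add: powr_def ln_inverse algebra_simps)
  hence "f (0 + inverse s * x) = s powr (1-\<alpha>) * g x" for x
    using assms by (auto simp: f_def g_def powr_mult zero_less_mult_iff)
  hence "has_bochner_integral lborel (\<lambda>x. f (0 + inverse s * x)) (s powr (1-\<alpha>) * Gamma \<alpha>)"
    using has_bochner_integral_mult_right[OF g, of "s powr (1-\<alpha>)"] by simp
  hence "has_bochner_integral lborel f (Gamma \<alpha> / s powr \<alpha>)"
    using lborel_has_bochner_integral_real_affine_iff[of "inverse s" f "Gamma \<alpha> / s powr \<alpha>" 0] assms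
    by (simp add: powr_diff field_simps)
  thus ?thesis unfolding f_def .
qed

lemma convolution_integral:
  fixes f g :: "real \<Rightarrow> real"
  assumes f: "integrable lborel f" and g: "integrable lborel g"
  shows "has_bochner_integral lborel (\<lambda>t. \<integral>s. f (t - s) * g s \<partial>lborel) (integral\<^sup>L lborel f * integral\<^sup>L lborel g)"
proof -
  have [measurable]: "f \<in> borel_measurable borel" "g \<in> borel_measurable borel"
    using f g by auto
  define F where "F = (\<lambda>s t. f (t - s) * g s)"
  have sh: "has_bochner_integral lborel (\<lambda>t. h (t - s)) (integral\<^sup>L lborel h)" if "integrable lborel h" for s and h :: "real \<Rightarrow> real"
    using lborel_has_bochner_integral_real_affine_iff[of 1 h "integral\<^sup>L lborel h" "-s"] that
    by (simp add: has_bochner_integral_iff)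
  have Fm: "case_prod F \<in> borel_measurable (lborel \<Otimes>\<^sub>M lborel)"
    unfolding F_def by measurable
  have Fi: "integrable (lborel \<Otimes>\<^sub>M lborel) (case_prod F)"
  proof (rule lborel_pair.Fubini_integrable[OF Fm])
    have "(\<integral>t. norm (case_prod F (s, t)) \<partial>lborel) = integral\<^sup>L lborel (\<lambda>x. \<bar>f x\<bar>) * \<bar>g s\<bar>" for s
      using sh[of "\<lambda>x. \<bar>f x\<bar>" s] f by (simp add: F_def abs_mult has_bochner_integral_iff)
    thus "integrable lborel (\<lambda>x. \<integral>y. norm (case_prod F (x, y)) \<partial>lborel)"
      using g by simp
    show "AE x in lborel. integrable lborel (\<lambda>y. case_prod F (x, y))"
      using sh[OF f] by (intro AE_I2) (auto simp: F_def has_bochner_integral_iff)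
  qed
  have "(\<integral>t. (\<integral>s. F s t \<partial>lborel) \<partial>lborel) = (\<integral>s. (\<integral>t. F s t \<partial>lborel) \<partial>lborel)"
    by (rule lborel_pair.Fubini_integral[OF Fi])
  also have "\<dots> = integral\<^sup>L lborel f * integral\<^sup>L lborel g"
    using sh[OF f] by (simp add: F_def has_bochner_integral_iff)
  finally show ?thesis using lborel_pair.integrable_snd[OF Fi] by (simp add: has_bochner_integral_iff F_def)
qed

lemma exp_integral:
  assumes "0 < (s::real)"
  shows "has_bochner_integral lborel (\<lambda>t. if 0 < t then exp (- (s * t)) else 0) (1 / s)"
proof -
  have "(\<lambda>x::real. if 0 < x then x powr (1 - 1) * exp (- (s * x)) else 0) = (\<lambda>t. if 0 < t then exp (- (s * t)) else 0)" by auto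
  thus ?thesis using Gamma_kernel_integral[of 1 s] assms by simp
qed

lemma continuous_on_if_measurable:
  fixes u :: "real \<Rightarrow> real"
  assumes "continuous_on {0..} u"
  shows "(\<lambda>t. if 0 < t then u t else 0) \<in> borel_measurable borel"
proof -
  have "(\<lambda>x. indicator {0<..} x *\<^sub>R u x) \<in> borel_measurable borel"
    using assms by (intro borel_measurable_continuous_on_indicator continuous_on_subset[OF assms]) auto
  also have "(\<lambda>x. indicator {0<..} x *\<^sub>R u x) = (\<lambda>t. if 0 < t then u t else 0)" by (auto simp: indicator_def)
  finally show ?thesis .
qed

text \<open>Measured against \<open>exp (\<sigma> * t)\<close> the kernel has mass at most
  \<open>Gamma \<alpha> / \<sigma> powr \<alpha>\<close>, so the choice of \<open>\<sigma>\<close>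
  makes the integral operator a contraction by \<open>1/2\<close>. The weighted maximum is attained
  at some \<open>t0\<close>, and the equation is used at that point.\<close>

lemma volterra_growth:
  fixes u :: "real \<Rightarrow> real"
  assumes \<alpha>: "0 < \<alpha>" and l: "0 \<le> l" and \<sigma>: "0 < \<sigma>" "l \<le> \<sigma> powr \<alpha> / 2" and cont: "continuous_on {0..} u"
    and vol: "\<And>T. 0 < T \<Longrightarrow> u T = u 0 - l / Gamma \<alpha> * (\<integral>t. (if 0 < t \<and> t < T then (T - t) powr (\<alpha>-1) * u t else 0) \<partial>lborel)"
    and T: "0 \<le> T"
  shows "\<bar>u T\<bar> \<le> 2 * \<bar>u 0\<bar> * exp (\<sigma> * T)"
proof -
  define m where "m = (\<lambda>t. \<bar>u t\<bar> * exp (- (\<sigma> * t)))"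
  have "continuous_on {0..T} m" unfolding m_def
    by (intro continuous_intros continuous_on_subset[OF cont]) auto
  from continuous_attains_sup[OF compact_Icc _ this] T
  obtain t0 where t0: "t0 \<in> {0..T}" "\<And>t. t \<in> {0..T} \<Longrightarrow> m t \<le> m t0" by auto
  have G: "0 < Gamma \<alpha>" using \<alpha> by (rule Gamma_real_pos)
  have sa: "0 < \<sigma> powr \<alpha>" using \<sigma> by simp
  have "m t0 \<le> 2 * \<bar>u 0\<bar>"
  proof (cases "t0 = 0")
    case True
    thus ?thesis by (simp add: m_def)
  next
    case False
    hence p: "0 < t0" using t0 by simp
    define f where "f = (\<lambda>x. if 0 < x then x powr (\<alpha>-1) * exp (- (\<sigma> * x)) else 0)"
    have f: "has_bochner_integral lborel f (Gamma \<alpha> / \<sigma> powr \<alpha>)"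
      unfolding f_def by (rule Gamma_kernel_integral[OF \<alpha> \<sigma>(1)])
    define A where "A = m t0 * exp (\<sigma> * t0)"
    have m0: "0 \<le> m t0" by (simp add: m_def)
    have h: "has_bochner_integral lborel (\<lambda>t. A * f (t0 - t)) (A * (Gamma \<alpha> / \<sigma> powr \<alpha>))"
      using lborel_has_bochner_integral_real_affine_iff[of "-1" f "Gamma \<alpha> / \<sigma> powr \<alpha>" t0] f
      by (intro has_bochner_integral_mult_right) simp
    define \<psi> where "\<psi> = (\<lambda>t. if 0 < t \<and> t < t0 then (t0 - t) powr (\<alpha>-1) * u t else 0)"
    have "\<bar>integral\<^sup>L lborel \<psi>\<bar> \<le> (\<integral>t. \<bar>\<psi> t\<bar> \<partial>lborel)"
      using integral_norm_bound[of lborel \<psi>] by simp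
    also have "\<dots> \<le> (\<integral>t. A * f (t0 - t) \<partial>lborel)"
    proof (rule integral_mono')
      show "integrable lborel (\<lambda>t. A * f (t0 - t))" using h by (simp add: has_bochner_integral_iff)
      fix t :: real
      show "0 \<le> A * f (t0 - t)" using m0 by (simp add: A_def f_def)
      show "\<bar>\<psi> t\<bar> \<le> A * f (t0 - t)"
      proof (cases "0 < t \<and> t < t0")
        case True
        have "\<bar>u t\<bar> = m t * exp (\<sigma> * t)" by (simp add: m_def exp_minus)
        also have "\<dots> \<le> m t0 * exp (\<sigma> * t)" using t0 True by (intro mult_right_mono) auto
        also have "\<dots> = A * exp (- (\<sigma> * (t0 - t)))" by (simp add: A_def algebra_simps flip: exp_add)
        finally have "(t0 - t) powr (\<alpha>-1) * \<bar>u t\<bar> \<le> (t0 - t) powr (\<alpha>-1) * (A * exp (- (\<sigma> * (t0 - t))))"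
          by (intro mult_left_mono) auto
        thus ?thesis using True by (simp add: \<psi>_def f_def abs_mult mult_ac)
      next
        case False
        hence "\<psi> t = 0" by (auto simp: \<psi>_def)
        thus ?thesis using \<open>0 \<le> A * f (t0 - t)\<close> by simp
      qed
    qed
    also have "\<dots> = A * (Gamma \<alpha> / \<sigma> powr \<alpha>)" using h by (rule has_bochner_integral_integral_eq)
    finally have "l / Gamma \<alpha> * \<bar>integral\<^sup>L lborel \<psi>\<bar> \<le> l / Gamma \<alpha> * (A * (Gamma \<alpha> / \<sigma> powr \<alpha>))"
      using l G by (intro mult_left_mono) auto
    also have "\<dots> = A * (l / \<sigma> powr \<alpha>)" using G by simp
    also have "\<dots> \<le> A * (1/2)" using \<sigma> sa m0 by (intro mult_left_mono) (auto simp: A_def field_simps)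
    finally have i: "l / Gamma \<alpha> * \<bar>integral\<^sup>L lborel \<psi>\<bar> \<le> A / 2" by simp
    have "\<bar>u t0\<bar> \<le> \<bar>u 0\<bar> + l / Gamma \<alpha> * \<bar>integral\<^sup>L lborel \<psi>\<bar>"
    proof -
      have "u t0 = u 0 - l / Gamma \<alpha> * integral\<^sup>L lborel \<psi>" using vol[OF p] unfolding \<psi>_def .
      hence "\<bar>u t0\<bar> \<le> \<bar>u 0\<bar> + \<bar>l / Gamma \<alpha> * integral\<^sup>L lborel \<psi>\<bar>" by (simp only: abs_triangle_ineq4)
      thus ?thesis using l G by (simp add: abs_mult)
    qed
    also have "\<bar>u t0\<bar> = A" by (simp add: A_def m_def exp_minus)
    finally have "A \<le> 2 * \<bar>u 0\<bar>" using i by linarith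
    moreover have "m t0 \<le> A" using m0 p \<sigma> by (simp add: A_def mult_le_cancel_left1)
    ultimately show ?thesis by simp
  qed
  hence "m T \<le> 2 * \<bar>u 0\<bar>" using t0(2)[of T] T by auto
  hence "m T * exp (\<sigma> * T) \<le> 2 * \<bar>u 0\<bar> * exp (\<sigma> * T)" by (intro mult_right_mono) auto
  moreover have "m T * exp (\<sigma> * T) = \<bar>u T\<bar>" by (simp add: m_def mult.assoc flip: exp_add)
  ultimately show ?thesis by simp
qed

lemma exp_bounded_integrable:
  fixes u :: "real \<Rightarrow> real"
  assumes cont: "continuous_on {0..} u" and b: "\<And>t. 0 \<le> t \<Longrightarrow> \<bar>u t\<bar> \<le> C * exp (\<sigma> * t)" and s: "\<sigma> < s"
  shows "integrable lborel (\<lambda>t. if 0 < t then exp (- (s * t)) * u t else 0)"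
proof (rule Bochner_Integration.integrable_bound)
  show "integrable lborel (\<lambda>t. C * (if 0 < t then exp (- ((s - \<sigma>) * t)) else 0))"
    using exp_integral[of "s - \<sigma>"] s by (simp add: has_bochner_integral_iff)
  have "(\<lambda>t. exp (- (s * t)) * (if 0 < t then u t else 0)) \<in> borel_measurable borel"
    using continuous_on_if_measurable[OF cont] by measurable
  also have "(\<lambda>t. exp (- (s * t)) * (if 0 < t then u t else 0)) = (\<lambda>t. if 0 < t then exp (- (s * t)) * u t else 0)" by auto
  finally show "(\<lambda>t. if 0 < t then exp (- (s * t)) * u t else 0) \<in> borel_measurable lborel" by simp
  show "AE t in lborel. norm (if 0 < t then exp (- (s * t)) * u t else 0) \<le> norm (C * (if 0 < t then exp (- ((s - \<sigma>) * t)) else 0))"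
  proof (rule AE_I2)
    fix t :: real
    show "norm (if 0 < t then exp (- (s * t)) * u t else 0) \<le> norm (C * (if 0 < t then exp (- ((s - \<sigma>) * t)) else 0))"
    proof (cases "0 < t")
      case True
      have "exp (- (s * t)) * \<bar>u t\<bar> \<le> exp (- (s * t)) * (C * exp (\<sigma> * t))" using b[of t] True by (intro mult_left_mono) auto
      also have "\<dots> = C * exp (- ((s - \<sigma>) * t))" by (simp add: algebra_simps flip: exp_add)
      also have "\<dots> \<le> \<bar>C * exp (- ((s - \<sigma>) * t))\<bar>" by simp
      finally show ?thesis using True by (simp add: abs_mult)
    qed simp
  qed
qed

text \<open>The Volterra integral is a convolution, and the weight \<open>exp (- (s * t))\<close>
  factors through it. So the transform \<open>L\<close> satisfies
  \<open>l / s powr \<alpha> * L = u 0 / s - L\<close>.\<close>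

lemma volterra_laplace:
  fixes u :: "real \<Rightarrow> real"
  assumes \<alpha>: "0 < \<alpha>" and l: "0 \<le> l" and cont: "continuous_on {0..} u"
    and vol: "\<And>T. 0 < T \<Longrightarrow> u T = u 0 - l / Gamma \<alpha> * (\<integral>t. (if 0 < t \<and> t < T then (T - t) powr (\<alpha>-1) * u t else 0) \<partial>lborel)"
    and b: "\<And>t. 0 \<le> t \<Longrightarrow> \<bar>u t\<bar> \<le> C * exp (\<sigma> * t)" and s: "\<sigma> < s" "0 < s"
  shows "(\<integral>t. (if 0 < t then exp (- (s * t)) * u t else 0) \<partial>lborel) = u 0 * s powr (\<alpha>-1) / (s powr \<alpha> + l)"
proof -
  define f where "f = (\<lambda>x. if 0 < x then x powr (\<alpha>-1) * exp (- (s * x)) else 0)"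
  define g where "g = (\<lambda>t. if 0 < t then exp (- (s * t)) * u t else 0)"
  have f: "has_bochner_integral lborel f (Gamma \<alpha> / s powr \<alpha>)"
    unfolding f_def by (rule Gamma_kernel_integral[OF \<alpha> s(2)])
  have g: "integrable lborel g" unfolding g_def by (rule exp_bounded_integrable[OF cont b s(1)])
  have G: "0 < Gamma \<alpha>" using \<alpha> by (rule Gamma_real_pos)
  have sa: "0 < s powr \<alpha>" using s by simp
  define L where "L = integral\<^sup>L lborel g"
  have C: "has_bochner_integral lborel (\<lambda>t. \<integral>y. f (t - y) * g y \<partial>lborel) (Gamma \<alpha> / s powr \<alpha> * L)"
    using convolution_integral[of f g] f g by (simp add: has_bochner_integral_iff L_def)
  have conv: "l / Gamma \<alpha> * (\<integral>y. f (t - y) * g y \<partial>lborel) = u 0 * (if 0 < t then exp (- (s * t)) else 0) - g t" for t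
  proof (cases "0 < t")
    case True
    have "(\<lambda>y. f (t - y) * g y) = (\<lambda>y. exp (- (s * t)) * (if 0 < y \<and> y < t then (t - y) powr (\<alpha>-1) * u y else 0))"
    proof
      fix y
      have "exp (- (s * (t - y))) * exp (- (s * y)) = exp (- (s * t))" by (simp add: algebra_simps flip: exp_add)
      thus "f (t - y) * g y = exp (- (s * t)) * (if 0 < y \<and> y < t then (t - y) powr (\<alpha>-1) * u y else 0)"
        by (auto simp: f_def g_def)
    qed
    hence "l / Gamma \<alpha> * (\<integral>y. f (t - y) * g y \<partial>lborel) = exp (- (s * t)) * (l / Gamma \<alpha> * (\<integral>y. (if 0 < y \<and> y < t then (t - y) powr (\<alpha>-1) * u y else 0) \<partial>lborel))"
      by simp
    also have "l / Gamma \<alpha> * (\<integral>y. (if 0 < y \<and> y < t then (t - y) powr (\<alpha>-1) * u y else 0) \<partial>lborel) = u 0 - u t"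
      using vol[OF True] by linarith
    finally show ?thesis using True by (simp add: g_def algebra_simps)
  next
    case False
    hence "(\<lambda>y. f (t - y) * g y) = (\<lambda>_. 0)" by (auto simp: f_def g_def)
    thus ?thesis using False by (simp add: g_def)
  qed
  have "has_bochner_integral lborel (\<lambda>t. l / Gamma \<alpha> * (\<integral>y. f (t - y) * g y \<partial>lborel)) (l / Gamma \<alpha> * (Gamma \<alpha> / s powr \<alpha> * L))"
    by (rule has_bochner_integral_mult_right[OF C])
  moreover have "has_bochner_integral lborel (\<lambda>t. u 0 * (if 0 < t then exp (- (s * t)) else 0) - g t) (u 0 * (1 / s) - L)"
    using g by (intro has_bochner_integral_diff has_bochner_integral_mult_right exp_integral s) (auto simp: has_bochner_integral_iff L_def)
  ultimately have "l / Gamma \<alpha> * (Gamma \<alpha> / s powr \<alpha> * L) = u 0 * (1 / s) - L"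
    unfolding conv by (rule has_bochner_integral_eq)
  hence "l / s powr \<alpha> * L = u 0 / s - L" using G by simp
  hence "L * (s powr \<alpha> + l) = u 0 * (s powr \<alpha> / s)" using sa s by (simp add: field_simps)
  also have "s powr \<alpha> / s = s powr (\<alpha>-1)" using s by (simp add: powr_diff)
  finally have "L = u 0 * s powr (\<alpha>-1) / (s powr \<alpha> + l)" using sa l by (simp add: eq_divide_eq add_pos_nonneg less_imp_neq[symmetric])
  thus ?thesis by (simp add: L_def g_def)
qed

text \<open>Lerch's theorem. At the points \<open>s = \<sigma> + 2 + k\<close> the hypothesis says
  that \<open>w\<close> integrates to \<open>0\<close> against every polynomial in
  \<open>x = exp (- t)\<close>. By Weierstrass the same holds against \<open>\<phi>\<close>, and
  that integral is the one of the nonnegative function \<open>exp (- t) * (H t)^2\<close>.\<close>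

lemma laplace_unique:
  fixes h :: "real \<Rightarrow> real"
  assumes cont: "continuous_on {0..} h" and b: "\<And>t. 0 \<le> t \<Longrightarrow> \<bar>h t\<bar> \<le> C * exp (\<sigma> * t)"
    and zero: "\<And>s. \<sigma> < s \<Longrightarrow> (\<integral>t. (if 0 < t then exp (- (s * t)) * h t else 0) \<partial>lborel) = 0"
    and T: "0 \<le> T"
  shows "h T = 0"
proof -
  \<comment> \<open>The extra \<open>1\<close> in the exponent makes \<open>H\<close> decay, so that
    \<open>\<phi>\<close> extends continuously by \<open>0\<close> to \<open>x = 0\<close>; the
    further factor \<open>exp (- t)\<close> in \<open>w\<close> is the weight.\<close>
  define H where "H = (\<lambda>t. exp (- ((\<sigma> + 1) * t)) * h t)"
  define w where "w = (\<lambda>t. if 0 < t then exp (- t) * H t else (0::real))"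
  have C0: "0 \<le> C" using b[of 0] by simp
  have Hb: "\<bar>H t\<bar> \<le> C * exp (- t)" if "0 \<le> t" for t
  proof -
    have "\<bar>H t\<bar> \<le> exp (- ((\<sigma> + 1) * t)) * (C * exp (\<sigma> * t))"
      unfolding H_def abs_mult using b[OF that] by (simp add: mult_left_mono)
    also have "\<dots> = C * exp (- t)" by (simp add: algebra_simps flip: exp_add)
    finally show ?thesis .
  qed
  have Hcont: "continuous_on {0..} H" unfolding H_def by (intro continuous_intros cont)
  have w_pow: "(\<lambda>t. w t * exp (- t) ^ k) = (\<lambda>t. if 0 < t then exp (- ((\<sigma> + 2 + real k) * t)) * h t else 0)" for k
    by (auto simp: w_def H_def algebra_simps simp flip: exp_add exp_of_nat_mult)
  have wk: "integrable lborel (\<lambda>t. w t * exp (- t) ^ k)" "(\<integral>t. w t * exp (- t) ^ k \<partial>lborel) = 0" for k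
    unfolding w_pow using exp_bounded_integrable[OF cont b, of "\<sigma> + 2 + real k"] zero[of "\<sigma> + 2 + real k"] by auto
  \<comment> \<open>The exponent \<open>k\<close> is generalized because splitting off a coefficient
    of the polynomial multiplies the rest by one more \<open>exp (- t)\<close>.\<close>
  have poly0: "integrable lborel (\<lambda>t. w t * exp (- t) ^ k * poly p (exp (- t))) \<and> (\<integral>t. w t * exp (- t) ^ k * poly p (exp (- t)) \<partial>lborel) = 0" for p k
  proof (induction p arbitrary: k)
    case (pCons a p)
    have "(\<lambda>t. w t * exp (- t) ^ k * poly (pCons a p) (exp (- t))) = (\<lambda>t. a * (w t * exp (- t) ^ k) + w t * exp (- t) ^ Suc k * poly p (exp (- t)))"
      by (auto simp: algebra_simps)
    thus ?case using wk[of k] pCons(2)[of "Suc k"] by simp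
  qed simp
  have wi: "integrable lborel w" using wk(1)[of 0] by simp
  define \<phi> where "\<phi> = (\<lambda>x. if x = 0 then 0 else H (- ln x))"
  have \<phi>cont: "continuous_on {0..1} \<phi>"
    unfolding continuous_on_def
  proof
    fix x :: real assume x: "x \<in> {0..1}"
    show "(\<phi> \<longlongrightarrow> \<phi> x) (at x within {0..1})"
    proof (cases "x = 0")
      case True
      have "((\<lambda>x. C * x) \<longlongrightarrow> C * 0) (at 0 within {0..1})" by (intro tendsto_intros)
      hence z: "((\<lambda>x. C * x) \<longlongrightarrow> 0) (at 0 within {0..1})" by simp
      have "(\<phi> \<longlongrightarrow> 0) (at 0 within {0..1})"
      proof (rule Lim_null_comparison[OF _ z])
        show "\<forall>\<^sub>F x in at 0 within {0..1}. norm (\<phi> x) \<le> C * x"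
          unfolding eventually_at_filter
        proof (intro always_eventually allI impI)
          fix y :: real assume "y \<noteq> 0" "y \<in> {0..1}"
          thus "norm (\<phi> y) \<le> C * y" using Hb[of "- ln y"] by (auto simp: \<phi>_def)
        qed
      qed
      thus ?thesis using True by (simp add: \<phi>_def)
    next
      case False
      have "continuous_on {0<..1} (\<lambda>x. H (- ln x))"
        by (intro continuous_on_compose2[OF Hcont] continuous_intros) auto
      hence "continuous_on {0<..1} \<phi>" by (rule continuous_on_eq) (auto simp: \<phi>_def)
      hence "(\<phi> \<longlongrightarrow> \<phi> x) (at x within {0<..1})" using x False by (auto simp: continuous_on_def)
      moreover have "at x within {0<..1} = at x within {0..1}"
        using x False by (intro at_within_nhd[of _ "{0<..}"]) auto
      ultimately show ?thesis by simp
    qed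
  qed
  define Q where "Q = (\<integral>t. w t * H t \<partial>lborel)"
  have Hw: "w t * \<phi> (exp (- t)) = w t * H t" for t by (simp add: \<phi>_def)
  have Hm: "(\<lambda>t. w t * H t) \<in> borel_measurable lborel"
  proof -
    have "(\<lambda>t. w t * (if 0 < t then H t else 0)) \<in> borel_measurable lborel"
      using continuous_on_if_measurable[OF Hcont] wi by measurable
    also have "(\<lambda>t. w t * (if 0 < t then H t else 0)) = (\<lambda>t. w t * H t)" by (auto simp: w_def)
    finally show ?thesis .
  qed
  have Qi: "integrable lborel (\<lambda>t. w t * H t)"
  proof (rule Bochner_Integration.integrable_bound[OF integrable_mult_right[OF wi, of C] Hm], rule AE_I2)
    fix t :: real
    show "norm (w t * H t) \<le> norm (C * w t)"
    proof (cases "0 < t")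
      case True
      have "C * exp (- t) \<le> C * 1" using True C0 by (intro mult_left_mono) auto
      hence "\<bar>H t\<bar> \<le> C" using Hb[of t] True by simp
      thus ?thesis using C0 mult_right_mono[of "\<bar>H t\<bar>" C "\<bar>w t\<bar>"] by (simp add: abs_mult mult.commute)
    qed (simp add: w_def)
  qed
  have Qle: "Q \<le> e * (\<integral>t. \<bar>w t\<bar> \<partial>lborel)" if e: "0 < e" for e
  proof -
    have "\<exists>g. (\<exists>p. g = poly p) \<and> (\<forall>x\<in>{0..1}. \<bar>\<phi> x - g x\<bar> < e)"
    proof (rule Stone_Weierstrass_HOL[OF compact_Icc _ _ _ _ _ \<phi>cont e])
      show "\<exists>p. (\<lambda>x. c) = poly p" for c :: real by (rule exI[of _ "[:c:]"]) auto
      show "continuous_on {0..1} f" if "\<exists>p. f = poly p" for f :: "real \<Rightarrow> real"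
        using that by (auto intro: continuous_intros)
      show "\<exists>p. (\<lambda>x. f x + g x) = poly p" if "(\<exists>p. f = poly p) \<and> (\<exists>p. g = poly p)" for f g :: "real \<Rightarrow> real"
      proof -
        from that obtain p q where "f = poly p" "g = poly q" by auto
        thus ?thesis by (intro exI[of _ "p + q"]) auto
      qed
      show "\<exists>p. (\<lambda>x. f x * g x) = poly p" if "(\<exists>p. f = poly p) \<and> (\<exists>p. g = poly p)" for f g :: "real \<Rightarrow> real"
      proof -
        from that obtain p q where "f = poly p" "g = poly q" by auto
        thus ?thesis by (intro exI[of _ "p * q"]) auto
      qed
      show "\<exists>f. (\<exists>p. f = poly p) \<and> f x \<noteq> f y" if "x \<in> {0..1} \<and> y \<in> {0..1} \<and> x \<noteq> y" for x y :: real
        by (rule exI[of _ "poly [:0, 1:]"]) (use that in auto)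
    qed
    then obtain p where "\<forall>x\<in>{0..1}. \<bar>\<phi> x - poly p x\<bar> < e" by auto
    hence p: "\<bar>\<phi> x - poly p x\<bar> < e" if "x \<in> {0..1}" for x using that by blast
    have pi: "integrable lborel (\<lambda>t. w t * poly p (exp (- t)))" "(\<integral>t. w t * poly p (exp (- t)) \<partial>lborel) = 0"
      using poly0[of 0 p] by simp_all
    have "Q = (\<integral>t. w t * H t - w t * poly p (exp (- t)) \<partial>lborel)"
      unfolding Q_def using Qi pi by simp
    also have "\<dots> \<le> (\<integral>t. e * \<bar>w t\<bar> \<partial>lborel)"
    proof (rule integral_mono)
      fix t :: real
      show "w t * H t - w t * poly p (exp (- t)) \<le> e * \<bar>w t\<bar>"
      proof (cases "0 < t")
        case True
        have "w t * H t - w t * poly p (exp (- t)) = w t * (\<phi> (exp (- t)) - poly p (exp (- t)))"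
          unfolding Hw[symmetric] by (simp add: algebra_simps)
        also have "\<dots> \<le> \<bar>w t\<bar> * \<bar>\<phi> (exp (- t)) - poly p (exp (- t))\<bar>" by (simp flip: abs_mult)
        also have "\<dots> \<le> \<bar>w t\<bar> * e" using p[of "exp (- t)"] True by (intro mult_left_mono) auto
        finally show ?thesis by (simp add: mult.commute)
      qed (simp add: w_def)
    qed (use Qi pi wi in auto)
    finally show ?thesis by simp
  qed
  have Q0: "Q \<le> 0"
  proof (rule field_le_epsilon)
    fix e :: real assume e: "0 < e"
    define W where "W = (\<integral>t. \<bar>w t\<bar> \<partial>lborel)"
    have W: "0 \<le> W" unfolding W_def by simp
    have "Q \<le> e / (W + 1) * W" using Qle[of "e / (W + 1)"] e W unfolding W_def by simp
    also have "\<dots> \<le> 0 + e" using e W by (simp add: field_simps)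
    finally show "Q \<le> 0 + e" .
  qed
  define G where "G = (\<lambda>t. exp (- t) * (H t)^2)"
  have "H t = 0" if t: "0 \<le> t" for t
  proof -
    define S where "S = t + 1"
    have wH: "w x * H x = (if 0 < x then G x else 0)" for x by (simp add: w_def G_def power2_eq_square)
    have Gc: "continuous_on {0..S} G" unfolding G_def
      by (intro continuous_intros continuous_on_subset[OF Hcont]) auto
    have si: "set_integrable lborel {0..S} G" by (rule borel_integrable_compact[OF compact_Icc Gc, folded set_integrable_def])
    have "(LINT x:{0..S}|lborel. G x) \<le> Q"
      unfolding Q_def set_lebesgue_integral_def
    proof (rule integral_mono_AE)
      show "AE x in lborel. indicator {0..S} x *\<^sub>R G x \<le> w x * H x"
        using AE_lborel_singleton[of "0::real"] by eventually_elim (auto simp: wH G_def indicator_def)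
    qed (use si Qi in \<open>auto simp: set_integrable_def\<close>)
    hence "integral {0..S} G \<le> 0" using set_borel_integral_eq_integral(2)[OF si] Q0 by simp
    moreover have "0 \<le> integral {0..S} G" by (intro integral_nonneg set_borel_integral_eq_integral(1)[OF si]) (auto simp: G_def)
    ultimately have "integral {0..S} G = 0" by simp
    hence "(G has_integral 0) (cbox 0 S)" using set_borel_integral_eq_integral(1)[OF si] by (simp add: has_integral_iff)
    hence "G t = 0" using Gc t by (intro has_integral_0_cbox_imp_0[of 0 S G]) (auto simp: G_def S_def)
    thus ?thesis by (simp add: G_def)
  qed
  from this[OF T] show ?thesis by (simp add: H_def)
qed

section \<open>Laplace transform of the Mittag-Leffler function\<close>

text \<open>This is \<open>z powr \<alpha> / (z powr \<alpha> + l)\<close> in the variable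
  \<open>v = ln z\<close>, including both edges of the cut. Rotation by half the argument of
  \<open>E\<close> shows that \<open>E\<close> and \<open>l\<close> cannot cancel. The last bound
  gives the decay for \<open>z\<close> near \<open>0\<close>.\<close>

lemma ml_quotient_bounds:
  fixes \<alpha> l :: real and v :: complex
  assumes \<alpha>: "0 < \<alpha>" "\<alpha> < 1" and l: "0 < l" and v: "\<bar>Im v\<bar> \<le> pi"
  defines "E \<equiv> exp (of_real \<alpha> * v)"
  shows "E + of_real l \<noteq> 0" 
    and "cmod (E / (E + of_real l)) \<le> 1 / cos (\<alpha> * pi / 2)"
    and "cmod (E / (E + of_real l)) \<le> exp (\<alpha> * Re v) / (cos (\<alpha> * pi / 2) * l)"
proof -
  define k where "k = cos (\<alpha> * pi / 2)"
  define r where "r = exp (\<alpha> * Re v)"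
  have k: "0 < k" unfolding k_def by (rule cos_half_pos[OF \<alpha>])
  have r: "0 < r" by (simp add: r_def)
  have E: "E = of_real r * cis (\<alpha> * Im v)"
    unfolding E_def r_def by (simp add: complex_eq_iff Re_exp Im_exp)
  have "\<bar>\<alpha> * Im v\<bar> \<le> \<alpha> * pi" using v \<alpha> by (simp add: abs_mult)
  moreover have "\<alpha> * pi \<le> pi" using \<alpha> by simp
  ultimately have "cos (\<alpha> * pi / 2) \<le> cos \<bar>\<alpha> * Im v / 2\<bar>" by (intro cos_monotone_0_pi_le) auto
  hence kc: "k \<le> cos (\<alpha> * Im v / 2)" by (simp only: k_def cos_abs_real)
  have "k * (r + l) \<le> cmod (of_real r * cis (\<alpha> * Im v) + of_real l * 1)"
    by (rule rotation_bound[where \<omega> = "\<alpha> * Im v / 2"]) (use kc r l in auto)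
  hence b: "k * (r + l) \<le> cmod (E + of_real l)" by (simp add: E)
  have pos: "0 < k * (r + l)" using k r l by (intro mult_pos_pos add_pos_pos)
  show "E + of_real l \<noteq> 0" using b pos by auto
  have nE: "cmod E = r" using r by (simp add: E norm_mult)
  have *: "cmod (E / (E + of_real l)) \<le> r / (k * d)" if d: "0 < d" "d \<le> r + l" for d
  proof -
    have "k * d \<le> cmod (E + of_real l)" using b mult_left_mono[OF d(2), of k] k by linarith
    thus ?thesis unfolding norm_divide nE using k d r by (intro frac_le) auto
  qed
  show "cmod (E / (E + of_real l)) \<le> 1 / cos (\<alpha> * pi / 2)"
    using *[of r] r l k unfolding k_def by (simp add: field_simps)
  show "cmod (E / (E + of_real l)) \<le> exp (\<alpha> * Re v) / (cos (\<alpha> * pi / 2) * l)"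
    using *[of l] r l unfolding k_def r_def by simp
qed

text \<open>Cauchy's theorem on the rectangle with corners \<open>\<plusminus> X \<plusminus> i \<pi>\<close> in the variable \<open>ln z\<close>;
  subtracting the value at \<open>ln s\<close> removes the pole, and the residue reappears on the left side.\<close>

lemma ml_density_stieltjes:
  assumes \<alpha>: "0 < \<alpha>" "\<alpha> < 1" and l: "0 < l" and s: "0 < s"
  shows "(LINT r:{0..}|lborel. ml_density \<alpha> l r / (s + r)) = s powr (\<alpha>-1) / (s powr \<alpha> + l)"
proof -
  define k where "k = cos (\<alpha> * pi / 2)"
  have k: "0 < k" unfolding k_def by (rule cos_half_pos[OF \<alpha>])
  define A where "A = (\<lambda>v::complex. exp (of_real \<alpha> * v) / (exp (of_real \<alpha> * v) + of_real l))"
  define v0 where "v0 = (of_real (ln s) :: complex)"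
  define a where "a = s powr \<alpha> / (s powr \<alpha> + l)"
  have a: "0 \<le> a" "a \<le> 1" using l add_nonneg_pos[of "s powr \<alpha>" l] by (simp_all add: a_def divide_le_eq_1)
  have Av0: "A v0 = of_real a"
  proof -
    have "of_real \<alpha> * v0 = of_real (\<alpha> * ln s)" by (simp add: v0_def)
    hence "exp (of_real \<alpha> * v0) = of_real (s powr \<alpha>)" using s by (simp only: exp_of_real) (simp add: powr_def)
    thus ?thesis by (simp add: A_def a_def)
  qed
  have ev0: "exp v0 = of_real s" using s by (simp only: v0_def exp_of_real) simp
  define B where "B = (\<lambda>v. if v = v0 then deriv A v0 / of_real s else (A v - of_real a) / (exp v - of_real s))"
  have Ad: "A field_differentiable at v" if "\<bar>Im v\<bar> \<le> pi" for v
  proof -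
    have "A analytic_on {v}" unfolding A_def
      using ml_quotient_bounds(1)[OF \<alpha> l that] by (intro analytic_intros) auto
    thus ?thesis by (rule analytic_on_imp_differentiable_at) auto
  qed
  have exp_ne: "exp v \<noteq> of_real s" if "\<bar>Im v\<bar> \<le> pi" "v \<noteq> v0" for v
  proof
    assume "exp v = of_real s"
    hence "exp v = exp v0" using ev0 by simp
    then obtain n :: int where n: "v = v0 + (of_int (2 * n) * pi) * \<i>" by (auto simp: exp_eq)
    hence "\<bar>2 * real_of_int n * pi\<bar> \<le> pi" using that(1) by (simp add: v0_def)
    hence "\<bar>2 * real_of_int n\<bar> * pi \<le> 1 * pi" by (simp only: abs_mult abs_of_pos[OF pi_gt_zero])
    hence "\<bar>2 * real_of_int n\<bar> \<le> 1" by (simp only: mult_le_cancel_right_pos pi_gt_zero)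
    hence "n = 0" by linarith
    thus False using n that by simp
  qed
  have Bd: "B field_differentiable at v" if "\<bar>Im v\<bar> \<le> pi" "v \<noteq> v0" for v
  proof (rule field_differentiable_transform_within[of "norm (v - v0)" v UNIV])
    show "(\<lambda>v. (A v - of_real a) / (exp v - of_real s)) field_differentiable at v within UNIV"
      using exp_ne[OF that] Ad[OF that(1)] 
      by (intro field_differentiable_divide field_differentiable_diff field_differentiable_const field_differentiable_within_exp) auto
    show "(A x - of_real a) / (exp x - of_real s) = B x" if "dist x v < norm (v - v0)" for x
      using that by (auto simp: B_def dist_norm norm_minus_commute)
  qed (use that in auto)
  have Bc: "isCont B v" if "\<bar>Im v\<bar> \<le> pi" for v
  proof (cases "v = v0")
    case True
    have Im0: "\<bar>Im v0\<bar> \<le> pi" by (simp add: v0_def)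
    have "(A has_field_derivative deriv A v0) (at v0)" using Ad[OF Im0] by (simp add: field_differentiable_derivI)
    hence 1: "((\<lambda>v. (A v - A v0) / (v - v0)) \<longlongrightarrow> deriv A v0) (at v0)" by (simp add: has_field_derivative_iff)
    have "(exp has_field_derivative of_real s) (at v0)" using DERIV_exp[of v0] ev0 by simp
    hence 2: "((\<lambda>v. (exp v - of_real s) / (v - v0)) \<longlongrightarrow> of_real s) (at v0)" by (simp add: has_field_derivative_iff ev0)
    have "((\<lambda>v. ((A v - A v0) / (v - v0)) / ((exp v - of_real s) / (v - v0))) \<longlongrightarrow> deriv A v0 / of_real s) (at v0)"
      using s by (intro tendsto_divide 1 2) auto
    hence "(B \<longlongrightarrow> deriv A v0 / of_real s) (at v0)"
    proof (rule Lim_transform_eventually)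
      show "\<forall>\<^sub>F v in at v0. (A v - A v0) / (v - v0) / ((exp v - of_real s) / (v - v0)) = B v"
        unfolding eventually_at_filter by (intro always_eventually) (auto simp: B_def Av0)
    qed
    thus ?thesis using True by (simp add: isCont_def B_def)
  qed (use Bd[OF that] in \<open>auto intro: field_differentiable_imp_continuous_at\<close>)
  have Bcont: "continuous_on S B" if "\<And>v. v \<in> S \<Longrightarrow> \<bar>Im v\<bar> \<le> pi" for S
    using Bc that by (intro continuous_at_imp_continuous_on) auto
  have rect: "integral {-X..X} (\<lambda>x. B (Complex x (-pi))) + \<i> * integral {-pi..pi} (\<lambda>y. B (Complex X y))
       = integral {-X..X} (\<lambda>x. B (Complex x pi)) + \<i> * integral {-pi..pi} (\<lambda>y. B (Complex (-X) y))" if "0 \<le> X" for X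
    using that by (intro rectangle_cauchy[of _ _ _ _ "{v0}"] Bcont Bd) auto
  define J where "J = (\<lambda>r. ml_density \<alpha> l r / (s + r))"
  have A_cnj: "A (Complex x (-pi)) = cnj (A (Complex x pi))" for x
  proof -
    have "Complex x (-pi) = cnj (Complex x pi)" by (simp add: complex_eq_iff)
    thus ?thesis by (simp add: A_def exp_cnj)
  qed
  have ImA: "Im (A (Complex x pi)) = pi * exp x * ml_density \<alpha> l (exp x)" for x
  proof -
    have "exp (of_real \<alpha> * Complex x pi) = of_real (exp x powr \<alpha>) * cis (pi * \<alpha>)"
      by (simp add: complex_eq_iff Re_exp Im_exp powr_def mult.commute)
    hence "A (Complex x pi) = - of_real (exp x) * ml_symbol \<alpha> l (exp x)"
      unfolding A_def ml_symbol_def by (simp add: powr_diff)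
    thus ?thesis unfolding ml_density_symbol by simp
  qed
  have exp_pi: "exp (Complex x (-pi)) = - of_real (exp x)" "exp (Complex x pi) = - of_real (exp x)" for x
    by (simp_all add: complex_eq_iff Re_exp Im_exp)
  \<comment> \<open>The subtracted constant drops out between the two edges of the cut, and the jump
    of \<open>A\<close> is twice its imaginary part times \<open>\<i>\<close>, which is the
    density.\<close>
  have Bdiff: "B (Complex x (-pi)) - B (Complex x pi) = 2 * pi * \<i> * of_real (exp x * J (exp x))" for x
  proof -
    have ne: "Complex x (-pi) \<noteq> v0" "Complex x pi \<noteq> v0" by (auto simp: v0_def complex_eq_iff)
    have d: "of_real (exp x + s) \<noteq> (0 :: complex)" using s by (simp only: of_real_eq_0_iff) (smt (verit) exp_gt_zero)
    have "B (Complex x (-pi)) - B (Complex x pi) = (A (Complex x pi) - cnj (A (Complex x pi))) / of_real (exp x + s)"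
    proof -
      have e: "- of_real (exp x) - of_real s = - (of_real (exp x + s) :: complex)" by simp
      have "(q - b) / (- d) - (p - b) / (- d) = (p - q) / d" for p q b d :: complex by (simp add: diff_divide_distrib)
      thus ?thesis using ne unfolding B_def by (simp only: if_False exp_pi A_cnj e)
    qed
    also have "A (Complex x pi) - cnj (A (Complex x pi)) = of_real (2 * Im (A (Complex x pi))) * \<i>"
      by (simp add: complex_eq_iff)
    finally show ?thesis unfolding ImA J_def using s by (simp add: field_simps)
  qed
  have cI: "(\<lambda>x. B (Complex x y)) integrable_on {-X..X}" if "\<bar>y\<bar> \<le> pi" for X y
    using that by (intro integrable_continuous_interval continuous_on_compose2[OF Bcont[of "{v. \<bar>Im v\<bar> \<le> pi}"]]) 
      (auto simp: Complex_eq intro!: continuous_intros)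
  have cV: "(\<lambda>y. B (Complex x y)) integrable_on {-pi..pi}" for x
    by (intro integrable_continuous_interval continuous_on_compose2[OF Bcont[of "{v. \<bar>Im v\<bar> \<le> pi}"]]) 
      (auto simp: Complex_eq intro!: continuous_intros)
  have subst0: "((\<lambda>x. exp x * J (exp x)) has_integral (integral {exp (-X)..exp X} J)) {-X..X}" if "0 \<le> X" for X
  proof -
    have den: "r powr (2 * \<alpha>) + 2 * l * r powr \<alpha> * cos (pi * \<alpha>) + l\<^sup>2 \<noteq> 0" if "0 < r" for r
    proof -
      have "0 < k * (r powr \<alpha> + l)" using k l that by (intro mult_pos_pos add_pos_pos) auto
      also have "\<dots> \<le> cmod (of_real (r powr \<alpha>) * cis (pi * \<alpha>) + of_real l)"
        unfolding k_def using \<alpha> l that by (intro ml_den_bound) auto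
      finally show ?thesis unfolding ml_den_norm[symmetric] by simp
    qed
    have Jc: "continuous_on {exp (-X)..exp X} J"
    proof -
      have "0 < r" if "r \<in> {exp (-X)..exp X}" for r using that by (auto intro: less_le_trans[OF exp_gt_zero])
      thus ?thesis unfolding J_def ml_density_def using den s
        by (intro continuous_intros) (force simp: add_pos_pos less_imp_neq[symmetric])+
    qed
    have "((\<lambda>x. exp x *\<^sub>R J (exp x)) has_integral (integral {exp (-X)..exp X} J)) {-X..X}"
      using that by (intro has_integral_substitution[of _ _ exp "exp (-X)" "exp X"] Jc)
        (auto intro!: derivative_eq_intros simp flip: has_real_derivative_iff_has_vector_derivative)
    thus ?thesis by simp
  qed
  note subst = integral_unique[OF subst0]
  have main: "2 * pi * \<i> * of_real (integral {-X..X} (\<lambda>x. exp x * J (exp x)))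
      = \<i> * (integral {-pi..pi} (\<lambda>y. B (Complex (-X) y)) - integral {-pi..pi} (\<lambda>y. B (Complex X y)))" if X: "0 \<le> X" for X
  proof -
    have "integral {-X..X} (\<lambda>x. 2 * pi * \<i> * of_real (exp x * J (exp x))) = 
        integral {-X..X} (\<lambda>x. B (Complex x (-pi))) - integral {-X..X} (\<lambda>x. B (Complex x pi))"
      unfolding Bdiff[symmetric] by (intro Henstock_Kurzweil_Integration.integral_diff cI) auto
    also have "\<dots> = \<i> * (integral {-pi..pi} (\<lambda>y. B (Complex (-X) y)) - integral {-pi..pi} (\<lambda>y. B (Complex X y)))"
      using rect[OF X] by (simp add: algebra_simps)
    also have "integral {-X..X} (\<lambda>x. 2 * pi * \<i> * of_real (exp x * J (exp x))) = 2 * pi * \<i> * integral {-X..X} (\<lambda>x. of_real (exp x * J (exp x)))"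
      by (rule integral_mult_right)
    also have "integral {-X..X} (\<lambda>x. of_real (exp x * J (exp x)) :: complex) = of_real (integral {-X..X} (\<lambda>x. exp x * J (exp x)))"
      using integral_linear[OF has_integral_integrable[OF subst0[OF X]] bounded_linear_of_real] by (simp add: o_def)
    finally show ?thesis by simp
  qed
  have Jb: "norm (J r) \<le> norm (ml_density \<alpha> l r / s)" if "0 \<le> r" for r
    using that s by (auto simp: J_def intro!: divide_left_mono)
  have Ji: "set_integrable lborel {0..} J"
  proof (rule set_integrable_bound[OF set_integrable_divide[OF ml_density_integrable[OF \<alpha> l]]])
    show "AE x in lborel. x \<in> {0..} \<longrightarrow> norm (J x) \<le> norm (ml_density \<alpha> l x / s)" using Jb by (intro AE_I2) auto
  qed (use s in \<open>auto simp: set_borel_measurable_def J_def\<close>)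
  \<comment> \<open>From here on \<open>exp v\<close> stays away from \<open>s\<close> on both
    vertical sides, so \<open>B\<close> is given by its quotient there.\<close>
  obtain N :: nat where N: "2 * s \<le> exp (real N)" "exp (- real N) \<le> s / 2"
  proof -
    have "\<forall>\<^sub>F n :: nat in sequentially. 2 * s \<le> exp (real n)" "\<forall>\<^sub>F n :: nat in sequentially. exp (- real n) \<le> s / 2"
      using s by real_asymp+
    from eventually_conj[OF this] obtain n where "2 * s \<le> exp (real n) \<and> exp (- real n) \<le> s / 2"
      by (auto simp: eventually_sequentially)
    thus ?thesis using that by blast
  qed
  define X where "X = (\<lambda>n. real (n + N))"
  have lim1: "(\<lambda>n. integral {exp (- X n)..exp (X n)} J) \<longlonglongrightarrow> (LINT r:{0..}|lborel. J r)"
  proof -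
    have eq: "integral {exp (- X n)..exp (X n)} J = (LINT r:{exp (- X n)..exp (X n)}|lborel. J r)" for n
    proof -
      have "{exp (- X n)..exp (X n)} \<subseteq> {0..}" using exp_gt_zero[of "- X n"] by (auto intro: order_trans[OF less_imp_le])
      hence "set_integrable lborel {exp (- X n)..exp (X n)} J" by (intro set_integrable_subset[OF Ji]) auto
      thus ?thesis by (rule set_borel_integral_eq_integral(2)[symmetric])
    qed
    show ?thesis unfolding eq set_lebesgue_integral_def
    proof (rule integral_dominated_convergence[where w = "\<lambda>r. norm (indicator {0..} r *\<^sub>R J r)"])
      show "(\<lambda>r. indicator {0..} r *\<^sub>R J r) \<in> borel_measurable lborel" using Ji by (auto simp: set_integrable_def)
      show "(\<lambda>r. indicator {exp (- X n)..exp (X n)} r *\<^sub>R J r) \<in> borel_measurable lborel" for n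
        unfolding J_def using s by measurable
      show "integrable lborel (\<lambda>r. norm (indicator {0..} r *\<^sub>R J r))" using Ji unfolding set_integrable_def by (rule integrable_norm)
      show "AE r in lborel. (\<lambda>n. indicator {exp (- X n)..exp (X n)} r *\<^sub>R J r) \<longlonglongrightarrow> indicator {0..} r *\<^sub>R J r"
      proof (rule AE_I2)
        fix r :: real
        consider "r < 0" | "r = 0" | "0 < r" by linarith
        thus "(\<lambda>n. indicator {exp (- X n)..exp (X n)} r *\<^sub>R J r) \<longlonglongrightarrow> indicator {0..} r *\<^sub>R J r"
        proof cases
          case 3
          have "\<forall>\<^sub>F n in sequentially. exp (- X n) \<le> r" "\<forall>\<^sub>F n in sequentially. r \<le> exp (X n)"
            unfolding X_def using 3 by real_asymp+
          hence "\<forall>\<^sub>F n in sequentially. indicator {exp (- X n)..exp (X n)} r *\<^sub>R J r = indicator {0..} r *\<^sub>R J r"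
            by eventually_elim (use 3 in auto)
          thus ?thesis by (rule tendsto_eventually)
        next
          case 1
          hence "\<not> exp (- X n) \<le> r" for n using exp_gt_zero[of "- X n"] by linarith
          hence "indicator {exp (- X n)..exp (X n)} r = (0::real)" for n by (simp add: indicator_def)
          thus ?thesis using 1 by simp
        qed (simp add: J_def ml_density_def)
      qed
      show "AE r in lborel. norm (indicator {exp (- X n)..exp (X n)} r *\<^sub>R J r) \<le> norm (indicator {0..} r *\<^sub>R J r)" for n
      proof (rule AE_I2)
        fix r :: real
        show "norm (indicator {exp (- X n)..exp (X n)} r *\<^sub>R J r) \<le> norm (indicator {0..} r *\<^sub>R J r)"
        proof (cases "0 \<le> r")
          case False
          hence "\<not> exp (- X n) \<le> r" using exp_gt_zero[of "- X n"] by linarith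
          thus ?thesis by (simp add: indicator_def)
        qed (simp add: indicator_def)
      qed
    qed
  qed
  define M where "M = (1 / k + 1)"
  have num: "cmod (A v - of_real a) \<le> M" if "\<bar>Im v\<bar> \<le> pi" for v
  proof -
    have "cmod (A v - of_real a) \<le> cmod (A v) + cmod (of_real a)" by (rule norm_triangle_ineq4)
    thus ?thesis using ml_quotient_bounds(2)[OF \<alpha> l that] a unfolding A_def M_def k_def by simp
  qed
  have M: "0 \<le> M" using k by (simp add: M_def)
  have XN: "real N \<le> X n" "0 \<le> X n" for n by (auto simp: X_def)
  have Bright: "cmod (B (Complex (X n) y)) \<le> M / s * (2 * s / exp (X n))" if "\<bar>y\<bar> \<le> pi" for n y
  proof -
    have eX: "2 * s \<le> exp (X n)" using N(1) XN(1)[of n] by (meson exp_le_cancel_iff order_trans)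
    have "exp (X n) / 2 \<le> cmod (exp (Complex (X n) y)) - cmod (of_real s)" using eX s by simp
    also have "\<dots> \<le> cmod (exp (Complex (X n) y) - of_real s)" by (rule norm_triangle_ineq2)
    finally have d: "exp (X n) / 2 \<le> cmod (exp (Complex (X n) y) - of_real s)" .
    hence "exp (Complex (X n) y) \<noteq> exp v0" unfolding ev0 using exp_gt_zero[of "X n"] by auto
    hence B: "B (Complex (X n) y) = (A (Complex (X n) y) - of_real a) / (exp (Complex (X n) y) - of_real s)" by (auto simp: B_def)
    have "cmod (B (Complex (X n) y)) \<le> M / (exp (X n) / 2)"
      unfolding B norm_divide using num[of "Complex (X n) y"] that d M by (intro frac_le) simp_all
    thus ?thesis using s by simp
  qed
  have Bleft: "cmod (B (Complex (- X n) y)) \<le> M / (s / 2)" 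
    "B (Complex (- X n) y) = (A (Complex (- X n) y) - of_real a) / (exp (Complex (- X n) y) - of_real s)" if "\<bar>y\<bar> \<le> pi" for n y
  proof -
    have eX: "exp (- X n) \<le> s / 2" using N(2) XN(1)[of n] by (meson exp_le_cancel_iff neg_le_iff_le order_trans)
    have "s / 2 \<le> cmod (of_real s) - cmod (exp (Complex (- X n) y))" using eX s by simp
    also have "\<dots> \<le> cmod (of_real s - exp (Complex (- X n) y))" by (rule norm_triangle_ineq2)
    finally have d: "s / 2 \<le> cmod (exp (Complex (- X n) y) - of_real s)" by (simp add: norm_minus_commute)
    hence "exp (Complex (- X n) y) \<noteq> exp v0" unfolding ev0 using s by auto
    thus B: "B (Complex (- X n) y) = (A (Complex (- X n) y) - of_real a) / (exp (Complex (- X n) y) - of_real s)" by (auto simp: B_def)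
    show "cmod (B (Complex (- X n) y)) \<le> M / (s / 2)"
      unfolding B norm_divide using num[of "Complex (- X n) y"] that d M s by (intro frac_le) auto
  qed
  have lim2: "(\<lambda>n. integral {-pi..pi} (\<lambda>y. B (Complex (X n) y))) \<longlonglongrightarrow> integral {-pi..pi} (\<lambda>y. 0)"
  proof (rule dominated_convergence(2)[where h = "\<lambda>_. M / s"])
    show "(\<lambda>y. B (Complex (X n) y)) integrable_on {-pi..pi}" for n by (rule cV)
    show "norm (B (Complex (X n) y)) \<le> M / s" if "y \<in> {-pi..pi}" for n y
    proof -
      have eX: "2 * s \<le> exp (X n)" using N(1) XN(1)[of n] by (meson exp_le_cancel_iff order_trans)
      have "norm (B (Complex (X n) y)) \<le> M / s * (2 * s / exp (X n))" by (rule Bright) (use that in auto)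
      also have "\<dots> \<le> M / s * 1" using M s eX by (intro mult_left_mono) auto
      finally show ?thesis by simp
    qed
    show "(\<lambda>n. B (Complex (X n) y)) \<longlonglongrightarrow> 0" if "y \<in> {-pi..pi}" for y
    proof (rule Lim_null_comparison)
      show "\<forall>\<^sub>F n in sequentially. norm (B (Complex (X n) y)) \<le> M / s * (2 * s / exp (X n))"
        by (intro always_eventually allI Bright) (use that in auto)
      have "(\<lambda>n. 2 * s / exp (X n)) \<longlonglongrightarrow> 0" unfolding X_def by real_asymp
      thus "(\<lambda>n. M / s * (2 * s / exp (X n))) \<longlonglongrightarrow> 0" by (rule tendsto_mult_right_zero)
    qed
  qed auto
  \<comment> \<open>Far to the left both \<open>A\<close> and \<open>exp\<close> tend to
    \<open>0\<close>, so \<open>B\<close> tends to \<open>(0 - a) / (0 - s) = a / s\<close>; this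
    limit is the residue in disguise.\<close>
  have lim3: "(\<lambda>n. integral {-pi..pi} (\<lambda>y. B (Complex (- X n) y))) \<longlonglongrightarrow> integral {-pi..pi} (\<lambda>y. of_real (a / s))"
  proof (rule dominated_convergence(2)[where h = "\<lambda>_. M / (s / 2)"])
    show "(\<lambda>y. B (Complex (- X n) y)) integrable_on {-pi..pi}" for n by (rule cV)
    show "norm (B (Complex (- X n) y)) \<le> M / (s / 2)" if "y \<in> {-pi..pi}" for n y using Bleft(1)[of y n] that by auto
    show "(\<lambda>n. B (Complex (- X n) y)) \<longlonglongrightarrow> of_real (a / s)" if y: "y \<in> {-pi..pi}" for y
    proof -
      have "(\<lambda>n. A (Complex (- X n) y)) \<longlonglongrightarrow> 0"
      proof (rule Lim_null_comparison)
        show "\<forall>\<^sub>F n in sequentially. norm (A (Complex (- X n) y)) \<le> exp (\<alpha> * (- X n)) / (k * l)"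
          using ml_quotient_bounds(3)[OF \<alpha> l, of "Complex (- X _) y"] y unfolding A_def k_def by auto
        show "(\<lambda>n. exp (\<alpha> * (- X n)) / (k * l)) \<longlonglongrightarrow> 0"
        proof -
          have "(\<lambda>n. exp (\<alpha> * (- X n))) \<longlonglongrightarrow> 0" unfolding X_def using \<alpha> by real_asymp
          from tendsto_divide_zero[OF this] show ?thesis .
        qed
      qed
      moreover have "(\<lambda>n. exp (Complex (- X n) y)) \<longlonglongrightarrow> 0"
      proof (rule Lim_null_comparison)
        show "\<forall>\<^sub>F n in sequentially. norm (exp (Complex (- X n) y)) \<le> exp (- X n)" by simp
        show "(\<lambda>n. exp (- X n)) \<longlonglongrightarrow> 0" unfolding X_def by real_asymp
      qed
      ultimately have "(\<lambda>n. (A (Complex (- X n) y) - of_real a) / (exp (Complex (- X n) y) - of_real s)) \<longlonglongrightarrow> (0 - of_real a) / (0 - of_real s)"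
        using s by (intro tendsto_intros) auto
      moreover have "\<bar>y\<bar> \<le> pi" using y by auto
      ultimately show ?thesis unfolding Bleft(2)[OF \<open>\<bar>y\<bar> \<le> pi\<close>] by simp
    qed
  qed auto
  have "(\<lambda>n. 2 * pi * \<i> * of_real (integral {exp (- X n)..exp (X n)} J)) \<longlonglongrightarrow> 2 * pi * \<i> * of_real (LINT r:{0..}|lborel. J r)"
    by (intro tendsto_intros lim1)
  moreover have "(\<lambda>n. 2 * pi * \<i> * of_real (integral {exp (- X n)..exp (X n)} J)) \<longlonglongrightarrow> 
     \<i> * (integral {-pi..pi} (\<lambda>y. of_real (a / s)) - integral {-pi..pi} (\<lambda>y. 0))"
    unfolding subst[OF XN(2), symmetric] main[OF XN(2)] by (intro tendsto_intros lim2 lim3)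
  ultimately have "2 * pi * \<i> * of_real (LINT r:{0..}|lborel. J r) = \<i> * (integral {-pi..pi} (\<lambda>y. of_real (a / s)) - integral {-pi..pi} (\<lambda>y. 0))"
    by (rule LIMSEQ_unique)
  hence "2 * pi * \<i> * of_real (LINT r:{0..}|lborel. J r) = 2 * pi * \<i> * of_real (a / s)"
    by (simp add: scaleR_conv_of_real)
  moreover have "2 * pi * \<i> \<noteq> (0 :: complex)" by simp
  ultimately have "of_real (LINT r:{0..}|lborel. J r) = (of_real (a / s) :: complex)" using mult_left_cancel by blast
  hence "(LINT r:{0..}|lborel. J r) = a / s" by (simp only: of_real_eq_iff)
  also have "a / s = s powr (\<alpha>-1) / (s powr \<alpha> + l)" using s by (simp add: a_def powr_diff)
  finally show ?thesis unfolding J_def .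
qed

lemma ml_fun_continuous:
  assumes "0 < \<alpha>" "\<alpha> < 1" "0 < l"
  shows "continuous_on {0..} (ml_fun \<alpha> l)"
  unfolding continuous_on_sequentially
proof (intro allI ballI impI)
  fix x t assume t: "t \<in> {0::real..}" and x: "(\<forall>n. x n \<in> {0..}) \<and> x \<longlonglongrightarrow> t"
  note I = ml_density_integrable[OF assms]
  have "(\<lambda>n. ml_fun \<alpha> l (x n)) \<longlonglongrightarrow> ml_fun \<alpha> l t"
    unfolding ml_fun_def set_lebesgue_integral_def
  proof (rule integral_dominated_convergence[where w = "\<lambda>r. norm (indicator {0..} r *\<^sub>R ml_density \<alpha> l r)"])
    show "integrable lborel (\<lambda>r. norm (indicator {0..} r *\<^sub>R ml_density \<alpha> l r))"
      using I unfolding set_integrable_def by (rule integrable_norm)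
    show "AE r in lborel. (\<lambda>n. indicator {0..} r *\<^sub>R (exp (- (r * x n)) * ml_density \<alpha> l r)) \<longlonglongrightarrow> indicator {0..} r *\<^sub>R (exp (- (r * t)) * ml_density \<alpha> l r)"
      using x by (intro AE_I2 tendsto_intros) auto
    show "AE r in lborel. norm (indicator {0..} r *\<^sub>R (exp (- (r * x n)) * ml_density \<alpha> l r)) \<le> norm (indicator {0..} r *\<^sub>R ml_density \<alpha> l r)" for n
    proof (rule AE_I2)
      fix r :: real
      have "0 \<le> x n" using x by auto
      thus "norm (indicator {0..} r *\<^sub>R (exp (- (r * x n)) * ml_density \<alpha> l r)) \<le> norm (indicator {0..} r *\<^sub>R ml_density \<alpha> l r)"
        by (auto simp: indicator_def abs_mult intro!: mult_left_le_one_le)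
    qed
  qed measurable
  thus "(ml_fun \<alpha> l \<circ> x) \<longlonglongrightarrow> ml_fun \<alpha> l t" by (simp add: o_def)
qed

lemma ml_fun_bounded:
  assumes a: "0 < \<alpha>" "\<alpha> < 1" "0 < l" and t: "0 \<le> t"
  shows "\<bar>ml_fun \<alpha> l t\<bar> \<le> (LINT r:{0..}|lborel. ml_density \<alpha> l r)"
proof -
  have nn: "0 \<le> ml_density \<alpha> l r" if "0 \<le> r" for r
    using ml_density_bounds(1)[OF a(1,2) _ a(3), of r] that by (cases "r = 0") (auto simp: ml_density_def)
  have "\<bar>ml_fun \<alpha> l t\<bar> = ml_fun \<alpha> l t"
    unfolding ml_fun_def set_lebesgue_integral_def using nn
    by (intro abs_of_nonneg Bochner_Integration.integral_nonneg) (auto simp: indicator_def)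
  also have "\<dots> \<le> (LINT r:{0..}|lborel. ml_density \<alpha> l r)"
    unfolding ml_fun_def
  proof (intro set_integral_mono ml_fun_integrable ml_density_integrable a t)
    fix r :: real assume r: "r \<in> {0..}"
    hence "exp (- (r * t)) \<le> 1" using t by simp
    from mult_right_mono[OF this nn[of r]] r show "exp (- (r * t)) * ml_density \<alpha> l r \<le> ml_density \<alpha> l r" by simp
  qed
  finally show ?thesis .
qed

text \<open>By Fubini the time integral can be taken first; it equals \<open>1 / (s + r)\<close> and
  leaves the Stieltjes transform of the density.\<close>

lemma ml_fun_laplace:
  assumes a: "0 < \<alpha>" "\<alpha> < 1" "0 < l" and s: "0 < s"
  shows "(\<integral>t. (if 0 < t then exp (- (s * t)) * ml_fun \<alpha> l t else 0) \<partial>lborel) = s powr (\<alpha>-1) / (s powr \<alpha> + l)"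
proof -
  define k where "k = (\<lambda>r. indicator {0..} r * ml_density \<alpha> l r)"
  have km: "k \<in> borel_measurable borel" unfolding k_def by measurable
  have ki: "integrable lborel k" using ml_density_integrable[OF a] by (simp add: set_integrable_def k_def)
  have kneg: "k r = 0" if "r < 0" for r using that by (simp add: k_def)
  define e where "e = (\<lambda>c t. if 0 < t then exp (- (c * t)) else (0::real))"
  have e: "has_bochner_integral lborel (e (s + r)) (1 / (s + r))" if "0 \<le> r" for r
    unfolding e_def using s that by (intro exp_integral) simp
  define F where "F = (\<lambda>r t. k r * e (s + r) t)"
  have Fm: "case_prod F \<in> borel_measurable (lborel \<Otimes>\<^sub>M lborel)"
    unfolding F_def e_def using km by measurable
  have kr: "(\<integral>t. c * k r * e (s + r) t \<partial>lborel) = c * k r * (1 / (s + r))" for r c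
  proof (cases "0 \<le> r")
    case True
    from has_bochner_integral_integral_eq[OF has_bochner_integral_mult_right[OF e[OF True], of "c * k r"]] show ?thesis .
  qed (simp add: kneg)
  have quot: "integrable lborel (\<lambda>r. \<bar>k r\<bar> * (1 / (s + r)))"
  proof (rule Bochner_Integration.integrable_bound[OF integrable_mult_right[OF ki, of "1/s"]])
    show "AE r in lborel. norm (\<bar>k r\<bar> * (1 / (s + r))) \<le> norm (1 / s * k r)"
    proof (rule AE_I2)
      fix r :: real
      show "norm (\<bar>k r\<bar> * (1 / (s + r))) \<le> norm (1 / s * k r)"
        using s by (cases "0 \<le> r") (auto simp: kneg abs_mult intro!: divide_left_mono)
    qed
  qed (use km in measurable)
  have Fi: "integrable (lborel \<Otimes>\<^sub>M lborel) (case_prod F)"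
  proof (rule lborel_pair.Fubini_integrable[OF Fm])
    have "(\<integral>t. norm (case_prod F (r, t)) \<partial>lborel) = \<bar>k r\<bar> * (1 / (s + r))" for r
    proof -
      have "norm (case_prod F (r, t)) = sgn (k r) * k r * e (s + r) t" for t
        by (auto simp: F_def abs_mult e_def abs_sgn sgn_mult)
      thus ?thesis using kr[of "sgn (k r)" r] by (simp add: abs_sgn mult.commute)
    qed
    thus "integrable lborel (\<lambda>r. \<integral>t. norm (case_prod F (r, t)) \<partial>lborel)" using quot by simp
    show "AE r in lborel. integrable lborel (\<lambda>t. case_prod F (r, t))"
    proof (rule AE_I2)
      fix r :: real
      show "integrable lborel (\<lambda>t. case_prod F (r, t))"
        using e[of r] by (cases "0 \<le> r") (auto simp: F_def kneg has_bochner_integral_iff)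
    qed
  qed
  have "(\<integral>t. (\<integral>r. F r t \<partial>lborel) \<partial>lborel) = (\<integral>r. (\<integral>t. F r t \<partial>lborel) \<partial>lborel)"
    by (rule lborel_pair.Fubini_integral[OF Fi])
  also have "(\<lambda>t. \<integral>r. F r t \<partial>lborel) = (\<lambda>t. if 0 < t then exp (- (s * t)) * ml_fun \<alpha> l t else 0)"
  proof
    fix t
    show "(\<integral>r. F r t \<partial>lborel) = (if 0 < t then exp (- (s * t)) * ml_fun \<alpha> l t else 0)"
    proof (cases "0 < t")
      case True
      have "(\<lambda>r. F r t) = (\<lambda>r. exp (- (s * t)) * (indicator {0..} r *\<^sub>R (exp (- (r * t)) * ml_density \<alpha> l r)))"
        using True by (auto simp: F_def e_def k_def algebra_simps simp flip: exp_add)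
      thus ?thesis using True by (simp add: ml_fun_def set_lebesgue_integral_def)
    qed (simp add: F_def e_def)
  qed
  also have "(\<integral>r. (\<integral>t. F r t \<partial>lborel) \<partial>lborel) = (LINT r:{0..}|lborel. ml_density \<alpha> l r / (s + r))"
    using kr[of 1] unfolding F_def set_lebesgue_integral_def by (simp add: k_def)
  also have "\<dots> = s powr (\<alpha>-1) / (s powr \<alpha> + l)" by (rule ml_density_stieltjes[OF a s])
  finally show ?thesis .
qed

text \<open>Both sides have the same Laplace transform for \<open>s > \<sigma>\<close>, the left one
  by its Volterra equation and the right one by \<open>ml_fun_laplace\<close>; both are continuous
  and grow at most like \<open>exp (\<sigma> * t)\<close>.\<close>

lemma caputo_solution_unique:
  fixes u :: "real \<Rightarrow> real"
  assumes \<alpha>: "0 < \<alpha>" "\<alpha> < 1" and l: "0 < l" and cont: "continuous_on {0..} u"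
    and diff: "\<And>t. 0 < t \<Longrightarrow> u differentiable (at t)"
    and ex: "\<And>t. 0 < t \<Longrightarrow> caputo_exists \<alpha> u t"
    and eq: "\<And>t. 0 < t \<Longrightarrow> caputo \<alpha> u t = - l * u t" and t: "0 \<le> t"
  shows "u t = u 0 * ml_fun \<alpha> l t"
proof -
  note vol = caputo_volterra[OF \<alpha> cont diff ex eq]
  \<comment> \<open>Chosen so that \<open>\<sigma> powr \<alpha> = 2 * l\<close>, the contraction
    threshold of \<open>volterra_growth\<close>.\<close>
  define \<sigma> where "\<sigma> = (2 * l) powr (1 / \<alpha>)"
  have \<sigma>: "0 < \<sigma>" "l \<le> \<sigma> powr \<alpha> / 2" using l \<alpha> by (auto simp: \<sigma>_def powr_powr)
  have l0: "0 \<le> l" using l by simp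
  have ub: "\<bar>u t\<bar> \<le> 2 * \<bar>u 0\<bar> * exp (\<sigma> * t)" if "0 \<le> t" for t
    by (rule volterra_growth[OF \<alpha>(1) l0 \<sigma> cont vol that])
  define K where "K = (LINT r:{0..}|lborel. ml_density \<alpha> l r)"
  have K: "\<bar>ml_fun \<alpha> l t\<bar> \<le> K" if "0 \<le> t" for t unfolding K_def by (rule ml_fun_bounded[OF \<alpha> l that])
  have K0: "0 \<le> K" using K[of 0] by simp
  have mb: "\<bar>ml_fun \<alpha> l t\<bar> \<le> K * exp (\<sigma> * t)" if "0 \<le> t" for t
    using K[OF that] mult_left_mono[OF one_le_exp_iff[THEN iffD2, of "\<sigma> * t"] K0] \<sigma> that by simp
  define h where "h = (\<lambda>t. u t - u 0 * ml_fun \<alpha> l t)"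
  have "h t = 0"
  proof (rule laplace_unique[of h "2 * \<bar>u 0\<bar> + \<bar>u 0\<bar> * K" \<sigma>, OF _ _ _ t])
    show "continuous_on {0..} h" unfolding h_def by (intro continuous_intros cont ml_fun_continuous \<alpha> l)
    show "\<bar>h t\<bar> \<le> (2 * \<bar>u 0\<bar> + \<bar>u 0\<bar> * K) * exp (\<sigma> * t)" if "0 \<le> t" for t
    proof -
      have "\<bar>h t\<bar> \<le> \<bar>u t\<bar> + \<bar>u 0\<bar> * \<bar>ml_fun \<alpha> l t\<bar>" unfolding h_def by (simp add: abs_triangle_ineq4 flip: abs_mult)
      also have "\<dots> \<le> 2 * \<bar>u 0\<bar> * exp (\<sigma> * t) + \<bar>u 0\<bar> * (K * exp (\<sigma> * t))"
        using ub[OF that] mb[OF that] by (intro add_mono mult_left_mono) auto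
      finally show ?thesis by (simp add: algebra_simps)
    qed
    fix s assume s: "\<sigma> < s"
    hence s0: "0 < s" using \<sigma> by simp
    have i1: "integrable lborel (\<lambda>t. if 0 < t then exp (- (s * t)) * u t else 0)"
      by (rule exp_bounded_integrable[OF cont ub s])
    have i2: "integrable lborel (\<lambda>t. if 0 < t then exp (- (s * t)) * ml_fun \<alpha> l t else 0)"
      by (rule exp_bounded_integrable[OF ml_fun_continuous[OF \<alpha> l] mb s])
    have "(\<integral>t. (if 0 < t then exp (- (s * t)) * h t else 0) \<partial>lborel) = 
        (\<integral>t. (if 0 < t then exp (- (s * t)) * u t else 0) - u 0 * (if 0 < t then exp (- (s * t)) * ml_fun \<alpha> l t else 0) \<partial>lborel)"
      by (rule Bochner_Integration.integral_cong) (auto simp: h_def algebra_simps)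
    also have "\<dots> = (\<integral>t. (if 0 < t then exp (- (s * t)) * u t else 0) \<partial>lborel) - u 0 * (\<integral>t. (if 0 < t then exp (- (s * t)) * ml_fun \<alpha> l t else 0) \<partial>lborel)"
      using i1 i2 by simp
    also have "(\<integral>t. (if 0 < t then exp (- (s * t)) * u t else 0) \<partial>lborel) = u 0 * s powr (\<alpha>-1) / (s powr \<alpha> + l)"
      by (rule volterra_laplace[OF \<alpha>(1) l0 cont vol ub s s0])
    also have "u 0 * s powr (\<alpha>-1) / (s powr \<alpha> + l) - u 0 * (\<integral>t. (if 0 < t then exp (- (s * t)) * ml_fun \<alpha> l t else 0) \<partial>lborel) = 0"
      unfolding ml_fun_laplace[OF \<alpha> l s0] by simp
    finally show "(\<integral>t. (if 0 < t then exp (- (s * t)) * h t else 0) \<partial>lborel) = 0" .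
  qed
  thus ?thesis by (simp add: h_def)
qed

text \<open>The density is homogeneous: \<open>\<tau> * ml_density \<alpha> (l * \<tau> powr
  \<alpha>) (\<tau> * r) = ml_density \<alpha> l r\<close>. This reduces every step size to
  \<open>1\<close>.\<close>

lemma ml_fun_scale:
  assumes "0 < \<tau>" "0 < l" 
  shows "ml_fun \<alpha> l (\<tau> * t) = ml_fun \<alpha> (l * \<tau> powr \<alpha>) t"
proof -
  define f where "f = (\<lambda>r. indicator {0..} r * (exp (- (r * t)) * ml_density \<alpha> (l * \<tau> powr \<alpha>) r))"
  have "\<tau> * f (0 + \<tau> * r) = indicator {0..} r * (exp (- (r * (\<tau> * t))) * ml_density \<alpha> l r)" for r
  proof (cases "0 < r")
    case True
    define x where "x = \<tau> powr \<alpha>"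
    have x: "0 < x" using assms by (simp add: x_def)
    have "\<tau> * ml_density \<alpha> (l * x) (\<tau> * r) = sin (pi * \<alpha>) / pi * (x^2 * (l * r powr (\<alpha>-1))) / (x^2 * (r powr (2 * \<alpha>) + 2 * l * r powr \<alpha> * cos (pi * \<alpha>) + l\<^sup>2))"
    proof -
      have "(\<tau> * r) powr (\<alpha>-1) = x / \<tau> * r powr (\<alpha>-1)" "(\<tau> * r) powr (2 * \<alpha>) = x^2 * r powr (2 * \<alpha>)" "(\<tau> * r) powr \<alpha> = x * r powr \<alpha>"
        using assms True by (simp_all add: x_def powr_mult powr_diff power2_eq_square flip: powr_add)
      note pw = this
      have n: "\<tau> * (c * ((l * x) * (x / \<tau> * y))) = c * (x^2 * (l * y))" for c y
        using assms by (simp add: power2_eq_square)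
      have d: "x^2 * a + 2 * (l * x) * (x * b) * c + (l * x)^2 = x^2 * (a + 2 * l * b * c + l^2)" for a b c
        by (simp add: power2_eq_square algebra_simps)
      show ?thesis unfolding ml_density_def pw d times_divide_eq_right[of \<tau>] n ..
    qed
    also have "\<dots> = ml_density \<alpha> l r" unfolding ml_density_def using x by simp
    finally have "\<tau> * ml_density \<alpha> (l * x) (\<tau> * r) = ml_density \<alpha> l r" .
    thus ?thesis using True assms by (simp add: f_def x_def mult_ac)
  next
    case False
    thus ?thesis using assms by (cases "r = 0") (auto simp: f_def indicator_def zero_le_mult_iff ml_density_def)
  qed
  hence "ml_fun \<alpha> l (\<tau> * t) = (\<integral>r. \<tau> * f (0 + \<tau> * r) \<partial>lborel)"
    unfolding ml_fun_def set_lebesgue_integral_def by simp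
  also have "\<dots> = integral\<^sup>L lborel f"
    using lborel_integral_real_affine[of \<tau> f 0] assms by simp
  also have "\<dots> = ml_fun \<alpha> (l * \<tau> powr \<alpha>) t"
    unfolding ml_fun_def set_lebesgue_integral_def f_def by simp
  finally show ?thesis .
qed

section \<open>Finite-dimensional spaces of functions\<close>

text \<open>Finite dimension is encoded by a finite set \<open>P\<close> of points whose values determine an element.\<close>

locale fin_inner =
  fixes V :: "('a \<Rightarrow> real) set" and ip :: "('a \<Rightarrow> real) \<Rightarrow> ('a \<Rightarrow> real) \<Rightarrow> real" and P :: "'a set"
  assumes zero: "(\<lambda>x. 0) \<in> V"
    and add: "\<And>u v. u \<in> V \<Longrightarrow> v \<in> V \<Longrightarrow> (\<lambda>x. u x + v x) \<in> V"
    and scale: "\<And>c u. u \<in> V \<Longrightarrow> (\<lambda>x. c * u x) \<in> V"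
    and ip_add: "\<And>u v w. u \<in> V \<Longrightarrow> v \<in> V \<Longrightarrow> w \<in> V \<Longrightarrow> ip (\<lambda>x. u x + v x) w = ip u w + ip v w"
    and ip_scale: "\<And>c u w. u \<in> V \<Longrightarrow> w \<in> V \<Longrightarrow> ip (\<lambda>x. c * u x) w = c * ip u w"
    and ip_sym: "\<And>u v. u \<in> V \<Longrightarrow> v \<in> V \<Longrightarrow> ip u v = ip v u"
    and ip_pos: "\<And>u. u \<in> V \<Longrightarrow> u \<noteq> (\<lambda>x. 0) \<Longrightarrow> 0 < ip u u"
    and finP: "finite P"
    and det: "\<And>u. u \<in> V \<Longrightarrow> (\<forall>p\<in>P. u p = 0) \<Longrightarrow> u = (\<lambda>x. 0)"

text \<open>Gaussian elimination: an unknown \<open>k\<close> with a nonzero entry at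
  \<open>p\<close> is solved for in that equation and removed from the others.\<close>

lemma homogeneous_system:
  fixes e :: "'i \<Rightarrow> 'a \<Rightarrow> real"
  assumes "finite P" "finite I" "card P < card I"
  shows "\<exists>c. (\<exists>i\<in>I. c i \<noteq> 0) \<and> (\<forall>p\<in>P. (\<Sum>i\<in>I. c i * e i p) = 0)"
  using assms
proof (induction P arbitrary: I e rule: finite_induct)
  case empty
  then obtain i where "i \<in> I" by fastforce
  thus ?case by (intro exI[of _ "\<lambda>_. 1"]) auto
next
  case (insert p P)
  show ?case
  proof (cases "\<forall>i\<in>I. e i p = 0")
    case True
    have "card P < card I" using insert by simp
    from insert.IH[OF insert.prems(1) this, of e] True show ?thesis by auto
  next
    case False
    then obtain k where k: "k \<in> I" "e k p \<noteq> 0" by blast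
    have "card P < card (I - {k})" using insert k by simp
    from insert.IH[OF _ this, of "\<lambda>i q. e i q - e i p / e k p * e k q"] insert.prems
    obtain c where c: "\<exists>i\<in>I - {k}. c i \<noteq> 0" "\<And>q. q \<in> P \<Longrightarrow> (\<Sum>i\<in>I - {k}. c i * (e i q - e i p / e k p * e k q)) = 0"
      by auto
    define d where "d = (\<lambda>i. if i = k then - (\<Sum>i\<in>I - {k}. c i * e i p / e k p) else c i)"
    have s: "(\<Sum>i\<in>I. d i * e i q) = (\<Sum>i\<in>I - {k}. c i * (e i q - e i p / e k p * e k q))" for q
    proof -
      have "(\<Sum>i\<in>I. d i * e i q) = d k * e k q + (\<Sum>i\<in>I - {k}. d i * e i q)"
        using k insert.prems by (simp add: sum.remove)
      also have "(\<Sum>i\<in>I - {k}. d i * e i q) = (\<Sum>i\<in>I - {k}. c i * e i q)" by (intro sum.cong) (auto simp: d_def)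
      also have "d k * e k q = - (\<Sum>i\<in>I - {k}. c i * e i p / e k p * e k q)" by (simp add: d_def sum_distrib_right)
      finally show ?thesis by (simp add: sum_subtractf right_diff_distrib mult.assoc)
    qed
    have "(\<Sum>i\<in>I. d i * e i q) = 0" if "q \<in> insert p P" for q
    proof (cases "q = p")
      case True
      have "(\<Sum>i\<in>I. d i * e i q) = (\<Sum>i\<in>I - {k}. c i * (e i p - e i p / e k p * e k p))" unfolding s True ..
      also have "\<dots> = 0" using k by simp
      finally show ?thesis .
    next
      case False
      thus ?thesis unfolding s using c that by auto
    qed
    moreover have "\<exists>i\<in>I. d i \<noteq> 0" using c(1) by (auto simp: d_def)
    ultimately show ?thesis by (intro exI[of _ d]) auto
  qed
qed

lemma greatest_nat_exists:
  fixes R :: "nat \<Rightarrow> bool"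
  assumes "R 0" "\<And>m. R m \<Longrightarrow> m \<le> b"
  shows "\<exists>n. R n \<and> (\<forall>m. R m \<longrightarrow> m \<le> n)"
  using GreatestI_nat[of R 0 b] Greatest_le_nat[of R _ b] assms by blast

text \<open>The first-order condition at a maximum in algebraic form: at
  \<open>t = a / (\<bar>b\<bar> + 1)\<close> the linear term outweighs the quadratic one.\<close>

lemma quadratic_nonpos_linear_zero:
  fixes a b :: real
  assumes "\<And>t. 2 * t * a + t^2 * b \<le> 0"
  shows "a = 0"
proof (rule ccontr)
  assume a: "a \<noteq> 0"
  define t where "t = a / (\<bar>b\<bar> + 1)"
  have "t^2 * \<bar>b\<bar> \<le> t^2 * (\<bar>b\<bar> + 1)" by (intro mult_left_mono) auto
  also have "\<dots> = t * a" by (simp add: t_def power2_eq_square)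
  finally have "t^2 * \<bar>b\<bar> \<le> t * a" .
  moreover have "- (t^2 * b) \<le> t^2 * \<bar>b\<bar>" using abs_ge_minus_self[of "t^2 * b"] by (simp add: abs_mult)
  ultimately have "t^2 * b \<ge> - (t * a)" by linarith
  hence "t * a \<le> 0" using assms[of t] by linarith
  moreover have "t * a = a^2 / (\<bar>b\<bar> + 1)" by (simp add: t_def power2_eq_square)
  moreover have "0 < a^2 / (\<bar>b\<bar> + 1)" using a by (intro divide_pos_pos) auto
  ultimately show False by simp
qed

context fin_inner
begin

definition onb :: "nat \<Rightarrow> (nat \<Rightarrow> 'a \<Rightarrow> real) \<Rightarrow> bool" where
  "onb n e \<longleftrightarrow> (\<forall>i<n. e i \<in> V) \<and> (\<forall>i<n. \<forall>j<n. ip (e i) (e j) = (if i = j then 1 else 0))"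

lemma diff: "u \<in> V \<Longrightarrow> v \<in> V \<Longrightarrow> (\<lambda>x. u x - v x) \<in> V"
  using add[of u "\<lambda>x. -1 * v x"] scale[of v "-1"] by simp

lemma ip_diff: "u \<in> V \<Longrightarrow> v \<in> V \<Longrightarrow> w \<in> V \<Longrightarrow> ip (\<lambda>x. u x - v x) w = ip u w - ip v w"
  using ip_add[of u "\<lambda>x. -1 * v x" w] scale[of v "-1"] ip_scale[of v w "-1"] by simp

lemma ip_zero: "w \<in> V \<Longrightarrow> ip (\<lambda>x. 0) w = 0"
  using ip_scale[OF zero, of w 0] by simp

lemma lincomb:
  fixes n :: nat
  assumes "\<And>i. i < n \<Longrightarrow> e i \<in> V"
  shows "(\<lambda>x. \<Sum>i<n. c i * e i x) \<in> V"
  using assms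
proof (induction n)
  case (Suc n)
  thus ?case using add[OF Suc.IH scale[of "e n" "c n"]] by simp
qed (simp add: zero)

lemma linear_lincomb:
  fixes n :: nat
  assumes L: "\<And>u v. u \<in> V \<Longrightarrow> v \<in> V \<Longrightarrow> L (\<lambda>x. u x + v x) = L u + L v" "\<And>c u. u \<in> V \<Longrightarrow> L (\<lambda>x. c * u x) = c * L u"
    and e: "\<And>i. i < n \<Longrightarrow> e i \<in> V"
  shows "L (\<lambda>x. \<Sum>i<n. c i * e i x) = (\<Sum>i<n. c i * (L (e i) :: real))"
  using e
proof (induction n)
  case 0
  thus ?case using L(2)[OF zero, of 0] by simp
next
  case (Suc n)
  have "L (\<lambda>x. \<Sum>i<Suc n. c i * e i x) = L (\<lambda>x. (\<Sum>i<n. c i * e i x) + c n * e n x)" by simp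
  also have "\<dots> = L (\<lambda>x. \<Sum>i<n. c i * e i x) + L (\<lambda>x. c n * e n x)"
    by (rule L(1)) (use Suc.prems lincomb scale in auto)
  finally show ?case using Suc L(2)[of "e n" "c n"] by simp
qed

lemma ip_lincomb:
  fixes n :: nat
  assumes "\<And>i. i < n \<Longrightarrow> e i \<in> V" "w \<in> V"
  shows "ip (\<lambda>x. \<Sum>i<n. c i * e i x) w = (\<Sum>i<n. c i * ip (e i) w)"
  by (rule linear_lincomb[of "\<lambda>u. ip u w"]) (use assms ip_add ip_scale in auto)

text \<open>A linear relation that holds at all points of \<open>P\<close> holds everywhere by
  \<open>det\<close>, and testing it against each \<open>e j\<close> kills its coefficients. The
  bound makes maximal families exist.\<close>

lemma onb_card: 
  assumes "onb n e"
  shows "n \<le> card P"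
proof (rule ccontr)
  assume "\<not> n \<le> card P"
  hence "card P < card {..<n}" by simp
  from homogeneous_system[OF finP _ this, of e]
  obtain c where c: "\<exists>i<n. c i \<noteq> 0" "\<forall>p\<in>P. (\<Sum>i<n. c i * e i p) = 0" by auto
  have eV: "\<And>i. i < n \<Longrightarrow> e i \<in> V" using assms by (auto simp: onb_def)
  have "(\<lambda>x. \<Sum>i<n. c i * e i x) = (\<lambda>x. 0)" using lincomb[OF eV] c by (intro det) auto
  note z = this
  have "(\<Sum>i<n. c i * ip (e i) (e j)) = 0" if "j < n" for j
  proof -
    have "ip (\<lambda>x. \<Sum>i<n. c i * e i x) (e j) = (\<Sum>i<n. c i * ip (e i) (e j))"
      by (rule ip_lincomb) (use eV that in auto)
    thus ?thesis unfolding z using ip_zero[OF eV[OF that]] by simp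
  qed
  moreover have "(\<Sum>i<n. c i * ip (e i) (e j)) = c j" if "j < n" for j
  proof -
    have "(\<Sum>i<n. c i * ip (e i) (e j)) = (\<Sum>i<n. if i = j then c j else 0)"
      using assms that by (intro sum.cong) (auto simp: onb_def)
    thus ?thesis using that by simp
  qed
  ultimately show False using c by auto
qed

lemma onb_residual:
  assumes "onb n e" "v \<in> V"
  defines "r \<equiv> (\<lambda>x. v x - (\<Sum>i<n. ip v (e i) * e i x))"
  shows "r \<in> V" "\<And>j. j < n \<Longrightarrow> ip r (e j) = 0"
proof -
  have eV: "\<And>i. i < n \<Longrightarrow> e i \<in> V" using assms by (auto simp: onb_def)
  note l = lincomb[of n e "\<lambda>i. ip v (e i)", OF eV]
  show "r \<in> V" unfolding r_def by (intro diff assms l)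
  fix j assume j: "j < n"
  have "ip r (e j) = ip v (e j) - (\<Sum>i<n. ip v (e i) * ip (e i) (e j))"
    unfolding r_def using ip_diff[OF assms(2) l eV[OF j]] ip_lincomb[OF eV eV[OF j]] by simp
  also have "(\<Sum>i<n. ip v (e i) * ip (e i) (e j)) = (\<Sum>i<n. if i = j then ip v (e j) else 0)"
    using assms(1) j by (intro sum.cong) (auto simp: onb_def)
  finally show "ip r (e j) = 0" using j by simp
qed

lemma onb_extend:
  assumes "onb n e" "f \<in> V" "ip f f = 1" "\<And>j. j < n \<Longrightarrow> ip f (e j) = 0"
  shows "onb (Suc n) (e(n := f))"
  unfolding onb_def
proof (intro conjI allI impI)
  fix i j assume ij: "i < Suc n" "j < Suc n"
  show "(e(n := f)) i \<in> V" using ij assms by (auto simp: onb_def)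
  have "ip (e i) f = 0" if "i < n" for i using that assms ip_sym[of "e i" f] by (auto simp: onb_def)
  thus "ip ((e(n := f)) i) ((e(n := f)) j) = (if i = j then 1 else 0)"
    using ij assms by (auto simp: onb_def less_Suc_eq)
qed

lemma normalize:
  assumes "r \<in> V" "r \<noteq> (\<lambda>x. 0)"
  obtains f c where "f \<in> V" "f = (\<lambda>x. c * r x)" "ip f f = 1"
proof -
  define c where "c = 1 / sqrt (ip r r)"
  have p: "0 < ip r r" using ip_pos assms by auto
  have cV: "(\<lambda>x. c * r x) \<in> V" using scale assms by auto
  have "ip (\<lambda>x. c * r x) (\<lambda>x. c * r x) = c * (c * ip r r)"
    using ip_scale[OF assms(1) cV, of c] ip_sym[OF assms(1) cV] ip_scale[OF assms(1) assms(1), of c] by simp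
  also have "\<dots> = 1" using p by (simp add: c_def)
  finally show ?thesis using that cV by blast
qed

text \<open>An orthonormal family of maximal length spans the space, for otherwise the normalized
  residual of some \<open>v\<close> would prolong it.\<close>

lemma onb_exists:
  obtains n e where "onb n e" "\<And>v. v \<in> V \<Longrightarrow> v = (\<lambda>x. \<Sum>i<n. ip v (e i) * e i x)"
proof -
  have "\<exists>e. onb 0 e" by (simp add: onb_def)
  from greatest_nat_exists[of "\<lambda>n. \<exists>e. onb n e", OF this, of "card P"] onb_card
  obtain n where n: "\<exists>e. onb n e" "\<And>m. \<exists>e. onb m e \<Longrightarrow> m \<le> n" by auto
  then obtain e where e: "onb n e" by blast
  have "v = (\<lambda>x. \<Sum>i<n. ip v (e i) * e i x)" if v: "v \<in> V" for v
  proof (rule ccontr)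
    assume ne: "v \<noteq> (\<lambda>x. \<Sum>i<n. ip v (e i) * e i x)"
    define r where "r = (\<lambda>x. v x - (\<Sum>i<n. ip v (e i) * e i x))"
    note R = onb_residual[OF e v, folded r_def]
    have "r \<noteq> (\<lambda>x. 0)" using ne by (auto simp: r_def fun_eq_iff)
    then obtain f c where f: "f \<in> V" "f = (\<lambda>x. c * r x)" "ip f f = 1" using normalize[OF R(1)] by metis
    have "ip f (e j) = 0" if "j < n" for j
      using ip_scale[OF R(1), of "e j" c] R(2)[OF that] e that by (auto simp: f(2) onb_def)
    hence "onb (Suc n) (e(n := f))" by (intro onb_extend e f) auto
    thus False using n(2) by fastforce
  qed
  thus ?thesis using that e by blast
qed

text \<open>\<open>onb_exists\<close> is applied to a second inner product on the same space, the
  sum over \<open>P\<close> of products of values. Written through point values, a coordinate passes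
  through every operation performed pointwise in \<open>x\<close>, in particular the Caputo
  derivative.\<close>

lemma functional_pointwise:
  assumes L: "\<And>u v. u \<in> V \<Longrightarrow> v \<in> V \<Longrightarrow> L (\<lambda>x. u x + v x) = L u + L v" "\<And>c u. u \<in> V \<Longrightarrow> L (\<lambda>x. c * u x) = c * L u"
  obtains d where "\<And>v. v \<in> V \<Longrightarrow> (L v :: real) = (\<Sum>p\<in>P. d p * v p)"
proof -
  define ipP where "ipP = (\<lambda>u v. \<Sum>p\<in>P. u p * v p :: real)"
  interpret P: fin_inner V ipP P
  proof
    show "0 < ipP u u" if uV: "u \<in> V" and u0: "u \<noteq> (\<lambda>x. 0)" for u
    proof -
      obtain p where p: "p \<in> P" "u p \<noteq> 0" using det[OF uV] u0 by blast
      thus ?thesis unfolding ipP_def using finP by (intro sum_pos2[of _ p]) (auto simp: zero_less_mult_iff)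
    qed
  qed (auto simp: ipP_def zero add scale finP det sum.distrib distrib_right distrib_left sum_distrib_left mult_ac)
  obtain n e where e: "P.onb n e" "\<And>v. v \<in> V \<Longrightarrow> v = (\<lambda>x. \<Sum>i<n. ipP v (e i) * e i x)"
    using P.onb_exists by blast
  have eV: "\<And>i. i < n \<Longrightarrow> e i \<in> V" using e by (auto simp: P.onb_def)
  have "L v = (\<Sum>p\<in>P. (\<Sum>i<n. e i p * L (e i)) * v p)" if v: "v \<in> V" for v
  proof -
    have "L v = L (\<lambda>x. \<Sum>i<n. ipP v (e i) * e i x)" using e(2)[OF v] by simp
    also have "\<dots> = (\<Sum>i<n. ipP v (e i) * L (e i))" by (rule linear_lincomb[OF L eV])
    also have "\<dots> = (\<Sum>p\<in>P. (\<Sum>i<n. e i p * L (e i)) * v p)"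
      unfolding ipP_def sum_distrib_right by (subst sum.swap) (simp add: mult_ac)
    finally show ?thesis .
  qed
  thus ?thesis by (rule that)
qed

text \<open>The Rayleigh quotient attains its maximum \<open>M\<close> on the unit sphere, which is
  compact in coordinates. The quadratic form of \<open>A - M * ip\<close> is then nonpositive and
  vanishes at the maximizer, so its first variation there is zero; that is the eigenvalue
  equation.\<close>

lemma eigenvector_exists:
  assumes nontriv: "v0 \<in> V" "v0 \<noteq> (\<lambda>x. 0)"
    and A_add: "\<And>u v w. u \<in> V \<Longrightarrow> v \<in> V \<Longrightarrow> w \<in> V \<Longrightarrow> A (\<lambda>x. u x + v x) w = A u w + A v w"
    and A_scale: "\<And>c u w. u \<in> V \<Longrightarrow> w \<in> V \<Longrightarrow> A (\<lambda>x. c * u x) w = c * A u w"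
    and A_sym: "\<And>u v. u \<in> V \<Longrightarrow> v \<in> V \<Longrightarrow> A u v = (A v u :: real)"
  obtains f M where "f \<in> V" "ip f f = 1" "\<And>v. v \<in> V \<Longrightarrow> A f v = M * ip f v"
proof -
  obtain n e where e: "onb n e" "\<And>v. v \<in> V \<Longrightarrow> v = (\<lambda>x. \<Sum>i<n. ip v (e i) * e i x)"
    using onb_exists by blast
  have eV: "\<And>i. i < n \<Longrightarrow> e i \<in> V" using e by (auto simp: onb_def)
  have n: "0 < n" using e(2)[OF nontriv(1)] nontriv(2) by (cases n) auto
  define lc where "lc = (\<lambda>c x. \<Sum>i<n. c i * e i x)"
  have lcV: "lc c \<in> V" for c unfolding lc_def by (rule lincomb[OF eV])
  have A_lc: "A (lc c) (lc c) = (\<Sum>i<n. \<Sum>j<n. c i * c j * A (e i) (e j))" for c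
  proof -
    have 1: "A (lc c) w = (\<Sum>i<n. c i * A (e i) w)" if "w \<in> V" for w
      unfolding lc_def using that by (intro linear_lincomb[of "\<lambda>u. A u w"] A_add A_scale eV)
    have "A (e i) (lc c) = (\<Sum>j<n. c j * A (e i) (e j))" if "i < n" for i
      using 1[OF eV[OF that]] A_sym[OF lcV eV[OF that]] A_sym[OF eV eV[OF that]] by simp
    thus ?thesis unfolding 1[OF lcV] by (simp add: sum_distrib_left mult_ac)
  qed
  have ip_lc: "ip (lc c) (lc c) = (\<Sum>i<n. (c i)^2)" for c
  proof -
    have 1: "ip (lc c) w = (\<Sum>i<n. c i * ip (e i) w)" if "w \<in> V" for w
      unfolding lc_def using that by (intro ip_lincomb eV)
    have "ip (e i) (lc c) = c i" if "i < n" for i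
    proof -
      have "ip (e i) (lc c) = (\<Sum>j<n. c j * ip (e j) (e i))" using 1[OF eV[OF that]] ip_sym[OF lcV eV[OF that]] by simp
      also have "\<dots> = (\<Sum>j<n. if j = i then c i else 0)" using e(1) that by (intro sum.cong) (auto simp: onb_def)
      finally show ?thesis using that by simp
    qed
    thus ?thesis unfolding 1[OF lcV] by (simp add: power2_eq_square)
  qed
  \<comment> \<open>Coordinates from \<open>n\<close> on are pinned to \<open>0\<close>, so that the
    sphere becomes a compact subset of the product space of all real sequences.\<close>
  define box where "box = (PiE UNIV (\<lambda>i. if i < n then {-1..1} else {0}) :: (nat \<Rightarrow> real) set)"
  define K where "K = {c. (\<Sum>i<n. (c i)^2) = 1} \<inter> box"
  have "compact box"
  proof -
    have "compactin (product_topology (\<lambda>i. euclidean) UNIV) box"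
      unfolding box_def by (subst compactin_PiE) auto
    thus ?thesis by (simp add: euclidean_product_topology)
  qed
  moreover have cc: "continuous_on S (\<lambda>c::nat \<Rightarrow> real. c i)" for S i
    by (rule continuous_on_subset[OF continuous_on_product_coordinates]) simp
  have "closed {c :: nat \<Rightarrow> real. (\<Sum>i<n. (c i)^2) = 1}"
    by (intro closed_Collect_eq continuous_intros cc)
  ultimately have "compact K" unfolding K_def by (rule closed_Int_compact[rotated])
  moreover have "(\<lambda>i. if i = 0 then 1 else 0) \<in> K"
  proof -
    have "(\<Sum>i<n. (if i = 0 then 1 else 0 :: real)^2) = (\<Sum>i<n. if i = 0 then 1 else 0)" by (intro sum.cong) auto
    thus ?thesis using n by (auto simp: K_def box_def)
  qed
  moreover have "continuous_on K (\<lambda>c. \<Sum>i<n. \<Sum>j<n. c i * c j * A (e i) (e j))"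
    by (intro continuous_intros cc)
  ultimately obtain m where m: "m \<in> K" "\<And>c. c \<in> K \<Longrightarrow> A (lc c) (lc c) \<le> A (lc m) (lc m)"
    using continuous_attains_sup[of K "\<lambda>c. \<Sum>i<n. \<Sum>j<n. c i * c j * A (e i) (e j)"] unfolding A_lc by blast
  define f where "f = lc m"
  define M where "M = A f f"
  have f1: "ip f f = 1" using m(1) by (simp add: f_def ip_lc K_def)
  have fV: "f \<in> V" by (simp add: f_def lcV)
  have le: "A v v \<le> M * ip v v" if v: "v \<in> V" for v
  proof (cases "v = (\<lambda>x. 0)")
    case True
    thus ?thesis using A_scale[OF zero zero, of 0] ip_zero[OF zero] by simp
  next
    case False
    then obtain g c where g: "g \<in> V" "g = (\<lambda>x. c * v x)" "ip g g = 1" using normalize[OF v] by metis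
    define b where "b = (\<lambda>i. if i < n then ip g (e i) else 0)"
    have gb: "g = lc b" using e(2)[OF g(1)] by (simp add: lc_def b_def)
    have s: "(\<Sum>i<n. (b i)^2) = 1" using g(3) unfolding gb ip_lc .
    have "b i \<in> (if i < n then {-1..1} else {0})" for i
    proof (cases "i < n")
      case True
      have "(b i)^2 \<le> (\<Sum>i<n. (b i)^2)" using True by (intro member_le_sum) auto
      hence "\<bar>b i\<bar> \<le> 1" using s by (simp add: abs_square_le_1)
      thus ?thesis using True by auto
    qed (simp add: b_def)
    hence "b \<in> K" using s by (auto simp: K_def box_def)
    from m(2)[OF this] have "A g g \<le> M" by (simp add: gb M_def f_def)
    moreover have "A g g = c * (c * A v v)"
      unfolding g(2) using A_scale[OF v g(1)[unfolded g(2)], of c] A_sym[OF v g(1)[unfolded g(2)]] A_scale[OF v v, of c] by simp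
    moreover have "1 = c * (c * ip v v)"
      using g(3) unfolding g(2) using ip_scale[OF v g(1)[unfolded g(2)], of c] ip_sym[OF v g(1)[unfolded g(2)]] ip_scale[OF v v, of c] by simp
    ultimately have "c^2 * A v v \<le> c^2 * (M * ip v v)" by (simp add: power2_eq_square mult_ac)
    moreover have "0 < c^2" using \<open>1 = c * (c * ip v v)\<close> by (cases "c = 0") auto
    ultimately show ?thesis by simp
  qed
  have "A f v = M * ip f v" if v: "v \<in> V" for v
  proof -
    \<comment> \<open>Stated for a generic symmetric form \<open>B\<close>, since it is applied to
      \<open>A\<close> and to \<open>ip\<close>.\<close>
    have expand: "B (\<lambda>x. f x + t * v x) (\<lambda>x. f x + t * v x) = B f f + 2 * t * B f v + t^2 * B v v"
      if B: "\<And>u v w. u \<in> V \<Longrightarrow> v \<in> V \<Longrightarrow> w \<in> V \<Longrightarrow> B (\<lambda>x. u x + v x) w = B u w + B v w"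
         "\<And>c u w. u \<in> V \<Longrightarrow> w \<in> V \<Longrightarrow> B (\<lambda>x. c * u x) w = c * B u w"
         "\<And>u v. u \<in> V \<Longrightarrow> v \<in> V \<Longrightarrow> B u v = (B v u :: real)" for B and t :: real
    proof -
      define w where "w = (\<lambda>x. f x + t * v x)"
      have tv: "(\<lambda>x. t * v x) \<in> V" using scale v by auto
      have w: "w \<in> V" unfolding w_def using add fV tv by auto
      have Bw: "B w u = B f u + t * B v u" if "u \<in> V" for u
        unfolding w_def using B(1)[OF fV tv that] B(2)[OF v that] by simp
      have "B w w = B f w + t * B v w" by (rule Bw[OF w])
      also have "B f w = B f f + t * B v f" using Bw[OF fV] B(3)[OF fV w] by simp
      also have "B v w = B f v + t * B v v" using Bw[OF v] B(3)[OF v w] by simp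
      finally show ?thesis unfolding w_def[symmetric] using B(3)[OF v fV] by (simp add: power2_eq_square algebra_simps)
    qed
    have "A f v - M * ip f v = 0"
    proof (rule quadratic_nonpos_linear_zero)
      fix t :: real
      have eA: "A (\<lambda>x. f x + t * v x) (\<lambda>x. f x + t * v x) = A f f + 2 * t * A f v + t^2 * A v v"
        by (rule expand, fact A_add, fact A_scale, fact A_sym)
      have eI: "ip (\<lambda>x. f x + t * v x) (\<lambda>x. f x + t * v x) = ip f f + 2 * t * ip f v + t^2 * ip v v"
        by (rule expand, fact ip_add, fact ip_scale, fact ip_sym)
      have "A (\<lambda>x. f x + t * v x) (\<lambda>x. f x + t * v x) \<le> M * ip (\<lambda>x. f x + t * v x) (\<lambda>x. f x + t * v x)"
        using add[OF fV scale[OF v, of t]] by (rule le)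
      hence "A f f + 2 * t * A f v + t^2 * A v v \<le> M * (ip f f + 2 * t * ip f v + t^2 * ip v v)"
        unfolding eA eI .
      thus "2 * t * (A f v - M * ip f v) + t^2 * (A v v - M * ip v v) \<le> 0"
        unfolding f1 M_def[symmetric] by (simp add: algebra_simps)
    qed
    thus ?thesis by simp
  qed
  thus ?thesis by (rule that[OF fV f1])
qed

text \<open>The orthogonal complement of a family of eigenvectors is again a
  \<open>fin_inner\<close> space with the same points \<open>P\<close>. An eigenvector found there
  is one on all of \<open>V\<close>, since both \<open>ip\<close> and \<open>A\<close> vanish
  between it and the earlier eigenvectors; so a maximal family spans.\<close>

lemma eigenbasis_exists:
  assumes A_add: "\<And>u v w. u \<in> V \<Longrightarrow> v \<in> V \<Longrightarrow> w \<in> V \<Longrightarrow> A (\<lambda>x. u x + v x) w = A u w + A v w"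
    and A_scale: "\<And>c u w. u \<in> V \<Longrightarrow> w \<in> V \<Longrightarrow> A (\<lambda>x. c * u x) w = c * A u w"
    and A_sym: "\<And>u v. u \<in> V \<Longrightarrow> v \<in> V \<Longrightarrow> A u v = (A v u :: real)"
  obtains n e l where "onb n e" "\<And>v. v \<in> V \<Longrightarrow> v = (\<lambda>x. \<Sum>i<n. ip v (e i) * e i x)"
    "\<And>i v. i < n \<Longrightarrow> v \<in> V \<Longrightarrow> A (e i) v = l i * ip (e i) v"
proof -
  define Q where "Q = (\<lambda>n e. onb n e \<and> (\<exists>l. \<forall>i<n. \<forall>v\<in>V. A (e i) v = l i * ip (e i) v))"
  have "\<exists>e. Q 0 e" by (simp add: Q_def onb_def)
  moreover have "m \<le> card P" if "\<exists>e. Q m e" for m using that onb_card by (auto simp: Q_def)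
  ultimately obtain n where n: "\<exists>e. Q n e" "\<And>m. \<exists>e. Q m e \<Longrightarrow> m \<le> n"
    using greatest_nat_exists[of "\<lambda>n. \<exists>e. Q n e" "card P"] by auto
  then obtain e l where e: "onb n e" and l: "\<And>i v. i < n \<Longrightarrow> v \<in> V \<Longrightarrow> A (e i) v = l i * ip (e i) v"
    unfolding Q_def by blast
  have eV: "\<And>i. i < n \<Longrightarrow> e i \<in> V" using e by (auto simp: onb_def)
  have "v = (\<lambda>x. \<Sum>i<n. ip v (e i) * e i x)" if v: "v \<in> V" for v
  proof (rule ccontr)
    assume ne: "v \<noteq> (\<lambda>x. \<Sum>i<n. ip v (e i) * e i x)"
    define V' where "V' = {v\<in>V. \<forall>i<n. ip v (e i) = 0}"
    interpret S: fin_inner V' ip P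
      by unfold_locales (auto simp: V'_def zero add scale ip_add ip_scale ip_sym ip_pos finP det ip_zero eV)
    define r where "r = (\<lambda>w x. w x - (\<Sum>i<n. ip w (e i) * e i x))"
    have r: "r w \<in> V'" if "w \<in> V" for w using onb_residual[OF e that] by (auto simp: V'_def r_def)
    have "r v \<noteq> (\<lambda>x. 0)" using ne by (auto simp: r_def fun_eq_iff)
    then obtain f M where f: "f \<in> V'" "ip f f = 1" "\<And>w. w \<in> V' \<Longrightarrow> A f w = M * ip f w"
      using S.eigenvector_exists[OF r[OF v], of A] A_add A_scale A_sym unfolding V'_def by blast
    have fV: "f \<in> V" and f0: "\<And>i. i < n \<Longrightarrow> ip f (e i) = 0" using f by (auto simp: V'_def)
    have "A f w = M * ip f w" if w: "w \<in> V" for w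
    proof -
      \<comment> \<open>Projecting \<open>w\<close> to the complement changes neither
        \<open>A w f\<close> nor \<open>ip w f\<close>; again one argument for both forms.\<close>
      have split: "B w f = B (r w) f" 
        if "\<And>u v w. u \<in> V \<Longrightarrow> v \<in> V \<Longrightarrow> w \<in> V \<Longrightarrow> B (\<lambda>x. u x + v x) w = B u w + B v w"
         "\<And>c u w. u \<in> V \<Longrightarrow> w \<in> V \<Longrightarrow> B (\<lambda>x. c * u x) w = c * B u w" and z: "\<And>i. i < n \<Longrightarrow> B (e i) f = (0::real)" for B
      proof -
        have "w = (\<lambda>x. r w x + (\<Sum>i<n. ip w (e i) * e i x))" by (simp add: r_def)
        hence "B w f = B (\<lambda>x. r w x + (\<Sum>i<n. ip w (e i) * e i x)) f" by simp
        also have "\<dots> = B (r w) f + B (\<lambda>x. \<Sum>i<n. ip w (e i) * e i x) f"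
          using r[OF w] lincomb[OF eV] fV by (intro that) (auto simp: V'_def)
        also have "B (\<lambda>x. \<Sum>i<n. ip w (e i) * e i x) f = (\<Sum>i<n. ip w (e i) * B (e i) f)"
          using that fV by (intro linear_lincomb[of "\<lambda>u. B u f"] eV) auto
        finally show ?thesis using z by simp
      qed
      have rV: "r w \<in> V" using r[OF w] by (simp add: V'_def)
      have z1: "ip (e i) f = 0" if "i < n" for i using f0[OF that] ip_sym[OF eV[OF that] fV] by simp
      have z2: "A (e i) f = 0" if "i < n" for i using l[OF that fV] z1[OF that] by simp
      have "A w f = A (r w) f" by (rule split, fact A_add, fact A_scale, fact z2)
      moreover have "ip w f = ip (r w) f" by (rule split, fact ip_add, fact ip_scale, fact z1)
      ultimately show ?thesis using f(3)[OF r[OF w]] A_sym[OF w fV] A_sym[OF rV fV] ip_sym[OF w fV] ip_sym[OF rV fV] by simp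
    qed
    hence "Q (Suc n) (e(n := f))"
      unfolding Q_def using onb_extend[OF e fV f(2) f0] l
      by (intro conjI exI[of _ "l(n := M)"]) (auto simp: less_Suc_eq)
    thus False using n(2) by fastforce
  qed
  thus ?thesis using that e l by blast
qed

text \<open>Evaluates the definite descriptions in \<open>l2_proj\<close> and
  \<open>discrete_op\<close>: the basis expansion provides a representing element, and its
  coordinates are forced.\<close>

lemma riesz_the:
  assumes L: "\<And>u v. u \<in> V \<Longrightarrow> v \<in> V \<Longrightarrow> L (\<lambda>x. u x + v x) = L u + L v" "\<And>c u. u \<in> V \<Longrightarrow> L (\<lambda>x. c * u x) = c * L u"
    and e: "onb n e" "\<And>v. v \<in> V \<Longrightarrow> v = (\<lambda>x. \<Sum>i<n. ip v (e i) * e i x)"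
  shows "(THE w. w \<in> V \<and> (\<forall>\<psi>\<in>V. ip w \<psi> = L \<psi>)) = (\<lambda>x. \<Sum>i<n. (L (e i) :: real) * e i x)"
proof (rule the_equality)
  have eV: "\<And>i. i < n \<Longrightarrow> e i \<in> V" using e by (auto simp: onb_def)
  show "(\<lambda>x. \<Sum>i<n. L (e i) * e i x) \<in> V \<and> (\<forall>\<psi>\<in>V. ip (\<lambda>x. \<Sum>i<n. L (e i) * e i x) \<psi> = L \<psi>)"
  proof (intro conjI ballI lincomb eV)
    fix \<psi> assume p: "\<psi> \<in> V"
    have "L \<psi> = L (\<lambda>x. \<Sum>i<n. ip \<psi> (e i) * e i x)" using e(2)[OF p] by simp
    also have "\<dots> = (\<Sum>i<n. ip \<psi> (e i) * L (e i))" by (rule linear_lincomb[OF L eV])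
    also have "\<dots> = (\<Sum>i<n. L (e i) * ip (e i) \<psi>)" by (intro sum.cong) (use ip_sym eV p in \<open>auto simp: mult.commute\<close>)
    also have "\<dots> = ip (\<lambda>x. \<Sum>i<n. L (e i) * e i x) \<psi>" by (rule ip_lincomb[OF eV p, symmetric])
    finally show "ip (\<lambda>x. \<Sum>i<n. L (e i) * e i x) \<psi> = L \<psi>" by simp
  qed
  fix w assume w: "w \<in> V \<and> (\<forall>\<psi>\<in>V. ip w \<psi> = L \<psi>)"
  have "w = (\<lambda>x. \<Sum>i<n. ip w (e i) * e i x)" using e(2) w by blast
  also have "\<dots> = (\<lambda>x. \<Sum>i<n. L (e i) * e i x)" using w eV by (intro ext sum.cong) auto
  finally show "w = (\<lambda>x. \<Sum>i<n. L (e i) * e i x)" .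
qed

lemma parseval:
  assumes e: "onb n e" "\<And>v. v \<in> V \<Longrightarrow> v = (\<lambda>x. \<Sum>i<n. ip v (e i) * e i x)" and v: "v \<in> V"
  shows "ip v v = (\<Sum>i<n. (ip v (e i))\<^sup>2)"
proof -
  have eV: "\<And>i. i < n \<Longrightarrow> e i \<in> V" using e by (auto simp: onb_def)
  have "ip v v = ip (\<lambda>x. \<Sum>i<n. ip v (e i) * e i x) v" using e(2)[OF v] by simp
  also have "\<dots> = (\<Sum>i<n. ip v (e i) * ip (e i) v)" by (rule ip_lincomb[OF eV v])
  also have "\<dots> = (\<Sum>i<n. (ip v (e i))\<^sup>2)"
    by (intro sum.cong) (use ip_sym eV v in \<open>auto simp: power2_eq_square\<close>)
  finally show ?thesis .
qed

end

section \<open>Test functions and weak gradients\<close>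

lemma partial_deriv_eq:
  "(\<phi> has_derivative D) (at x) \<Longrightarrow> partial_deriv i \<phi> x = D (axis i 1)"
  unfolding partial_deriv_def using frechet_derivative_at by metis

lemma C_k_Suc_imp: "C_k (Suc k) f \<Longrightarrow> C_k k f"
proof (induction k arbitrary: f)
  case 0
  thus ?case by (auto intro!: continuous_at_imp_continuous_on differentiable_imp_continuous_within)
next
  case (Suc k)
  show ?case unfolding C_k.simps(2)[of k]
  proof (intro conjI allI)
    show "f differentiable at x" for x using Suc.prems by simp
    fix i
    have "C_k (Suc k) (partial_deriv i f)" using Suc.prems C_k.simps(2)[of "Suc k" f] by blast
    thus "C_k k (partial_deriv i f)" by (rule Suc.IH)
  qed
qed

lemma C_k_const: "C_k k (\<lambda>x. c)"
proof (induction k arbitrary: c)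
  case (Suc k)
  have "partial_deriv i (\<lambda>x::real^'a. c) = (\<lambda>x. 0)" for i
    by (rule ext) (simp add: partial_deriv_eq[OF has_derivative_const])
  thus ?case using Suc by simp
qed simp

lemma partial_deriv_add:
  assumes "\<And>x. f differentiable (at x)" "\<And>x. g differentiable (at x)"
  shows "partial_deriv i (\<lambda>x. f x + g x) = (\<lambda>x. partial_deriv i f x + partial_deriv i g x)"
proof
  fix x
  have "((\<lambda>x. f x + g x) has_derivative (\<lambda>h. frechet_derivative f (at x) h + frechet_derivative g (at x) h)) (at x)"
    using assms by (intro has_derivative_add) (auto simp: frechet_derivative_works)
  from partial_deriv_eq[OF this] show "partial_deriv i (\<lambda>x. f x + g x) x = partial_deriv i f x + partial_deriv i g x"
    by (simp add: partial_deriv_def)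
qed

lemma partial_deriv_mult:
  assumes "\<And>x. f differentiable (at x)" "\<And>x. g differentiable (at x)"
  shows "partial_deriv i (\<lambda>x. f x * g x) = (\<lambda>x. f x * partial_deriv i g x + partial_deriv i f x * g x)"
proof
  fix x
  have "((\<lambda>x. f x * g x) has_derivative (\<lambda>h. f x * frechet_derivative g (at x) h + frechet_derivative f (at x) h * g x)) (at x)"
    using assms by (intro has_derivative_mult) (auto simp: frechet_derivative_works)
  from partial_deriv_eq[OF this] show "partial_deriv i (\<lambda>x. f x * g x) x = f x * partial_deriv i g x + partial_deriv i f x * g x"
    by (simp add: partial_deriv_def)
qed

lemma C_k_add: "C_k k f \<Longrightarrow> C_k k g \<Longrightarrow> C_k k (\<lambda>x. f x + g x)"
proof (induction k arbitrary: f g)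
  case (Suc k)
  thus ?case by (simp add: partial_deriv_add)
qed (simp add: continuous_on_add)

lemma C_k_mult: "C_k k f \<Longrightarrow> C_k k g \<Longrightarrow> C_k k (\<lambda>x. f x * g x)"
proof (induction k arbitrary: f g)
  case (Suc k)
  have "C_k k f" "C_k k g" using Suc.prems C_k_Suc_imp by auto
  thus ?case using Suc by (simp add: partial_deriv_mult C_k_add)
qed (simp add: continuous_on_mult)

lemma C_k_cmult: "C_k k f \<Longrightarrow> C_k k (\<lambda>x. c * f x)"
  by (intro C_k_mult C_k_const)

lemma C_k_diff: "C_k k f \<Longrightarrow> C_k k g \<Longrightarrow> C_k k (\<lambda>x. f x - g x)"
  using C_k_add[OF _ C_k_cmult[of k g "-1"]] by simp

lemma C_k_prod: "finite I \<Longrightarrow> (\<And>j. j \<in> I \<Longrightarrow> C_k k (f j)) \<Longrightarrow> C_k k (\<lambda>x. \<Prod>j\<in>I. f j x)"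
  by (induction I rule: finite_induct) (simp_all add: C_k_const C_k_mult)

text \<open>The induction over \<open>k\<close> runs for all members of the chain at once, since a
  partial derivative leads from \<open>H m\<close> to \<open>H (Suc m)\<close>.\<close>

lemma C_k_ridge:
  fixes H :: "nat \<Rightarrow> real \<Rightarrow> real"
  assumes H: "\<And>m t. (H m has_real_derivative H (Suc m) t) (at t)"
  shows "C_k k (\<lambda>x::real^'n. H m (c * x $ j + d))"
proof (induction k arbitrary: m)
  have der: "((\<lambda>x::real^'n. H m (c * x $ j + d)) has_derivative (\<lambda>h. H (Suc m) (c * x $ j + d) * (c * h $ j))) (at x)" for m x
  proof -
    have "((\<lambda>x::real^'n. c * x $ j + d) has_derivative (\<lambda>h. c * h $ j)) (at x)"
    proof -
      have "((\<lambda>x::real^'n. x $ j) has_derivative (\<lambda>h. h $ j)) (at x)"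
        by (rule bounded_linear_imp_has_derivative[OF bounded_linear_vec_nth])
      from has_derivative_add[OF has_derivative_mult_right[OF this, of c] has_derivative_const[of d]] show ?thesis by simp
    qed
    thus ?thesis
      using has_derivative_compose[of "\<lambda>x::real^'n. c * x $ j + d" "\<lambda>h. c * h $ j" x UNIV "H m" "\<lambda>h. H (Suc m) (c * x $ j + d) * h"]
        H[of m "c * x $ j + d"] by (simp add: has_field_derivative_def)
  qed
  {
    case 0
    show ?case using der by (auto intro!: continuous_at_imp_continuous_on has_derivative_continuous)
  next
    case (Suc k)
    have "partial_deriv i (\<lambda>x::real^'n. H m (c * x $ j + d)) = (\<lambda>x. (c * axis i 1 $ j) * H (Suc m) (c * x $ j + d))" for i
      by (rule ext) (simp add: partial_deriv_eq[OF der])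
    moreover have "(\<lambda>x::real^'n. H m (c * x $ j + d)) differentiable at x" for x using der differentiable_def by blast
    ultimately show ?case using Suc by (simp add: C_k_cmult)
  }
qed

section \<open>Smooth bump functions and the fundamental lemma of the calculus of variations\<close>

text \<open>The flat function \<open>exp (- (1/t))\<close> with a polynomial in \<open>1/t\<close>
  in front: this family, unlike the single function, is closed under differentiation.\<close>

definition flat :: "real poly \<Rightarrow> real \<Rightarrow> real" where
  "flat p t = (if 0 < t then poly p (1 / t) * exp (- (1 / t)) else 0)"

lemma poly_exp_decay: "((\<lambda>u. u ^ k * poly p u * exp (- u)) \<longlongrightarrow> 0) at_top" for p :: "real poly"
proof (induction p arbitrary: k)
  case (pCons a p)
  have "((\<lambda>u::real. u ^ k / exp u) \<longlongrightarrow> 0) at_top" by (rule tendsto_power_div_exp_0)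
  hence "((\<lambda>u::real. a * (u ^ k / exp u) + u ^ Suc k * poly p u * exp (- u)) \<longlongrightarrow> a * 0 + 0) at_top"
    by (intro tendsto_intros pCons)
  moreover have "(\<lambda>u::real. a * (u ^ k / exp u) + u ^ Suc k * poly p u * exp (- u)) = (\<lambda>u. u ^ k * poly (pCons a p) u * exp (- u))"
    by (auto simp: exp_minus field_simps)
  ultimately show ?case by simp
qed simp

lemma flat_deriv: "(flat p has_real_derivative flat ([:0, 0, 1:] * (p - pderiv p)) t) (at t)"
proof -
  consider "0 < t" | "t < 0" | "t = 0" by linarith
  thus ?thesis
  proof cases
    case 1
    have "((\<lambda>t. poly p (1 / t) * exp (- (1 / t))) has_real_derivative flat ([:0, 0, 1:] * (p - pderiv p)) t) (at t)"
      using 1 by (auto intro!: derivative_eq_intros DERIV_chain2[OF poly_DERIV] simp: flat_def power2_eq_square field_simps)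
    thus ?thesis
      by (rule has_field_derivative_transform_within[of _ _ _ _ t]) (use 1 in \<open>auto simp: flat_def dist_real_def\<close>)
  next
    case 2
    have "((\<lambda>t. 0) has_real_derivative 0) (at t)" by simp
    hence "(flat p has_real_derivative 0) (at t)"
      by (rule has_field_derivative_transform_within[of _ _ _ _ "-t"]) (use 2 in \<open>auto simp: flat_def dist_real_def\<close>)
    thus ?thesis using 2 by (simp add: flat_def)
  next
    case 3
    have "((\<lambda>t::real. (1 / t) ^ 1 * poly p (1 / t) * exp (- (1 / t))) \<longlongrightarrow> 0) (at_right 0)"
      by (rule filterlim_compose[OF poly_exp_decay]) (simp add: filterlim_inverse_at_top_right flip: inverse_eq_divide)
    hence "((\<lambda>t. (flat p t - flat p 0) / (t - 0)) \<longlongrightarrow> 0) (at_right 0)"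
      by (rule Lim_transform_eventually) (auto simp: eventually_at_filter flat_def)
    moreover have "((\<lambda>t. (flat p t - flat p 0) / (t - 0)) \<longlongrightarrow> 0) (at_left 0)"
      by (rule tendsto_eventually) (auto simp: eventually_at_filter flat_def)
    ultimately have "((\<lambda>t. (flat p t - flat p 0) / (t - 0)) \<longlongrightarrow> 0) (at 0)"
      by (simp add: filterlim_split_at)
    thus ?thesis using 3 by (simp add: has_field_derivative_iff flat_def)
  qed
qed

definition bump1 :: "real \<Rightarrow> real" where "bump1 t = flat 1 t"

lemma bump1_C_k: "C_k k (\<lambda>x::real^'n. bump1 (c * x $ j + d))"
proof -
  define q where "q = (\<lambda>m. ((\<lambda>p. [:0, 0, 1:] * (p - pderiv p)) ^^ m) (1 :: real poly))"
  have "(flat (q m) has_real_derivative flat (q (Suc m)) t) (at t)" for m t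
    unfolding q_def by (simp add: flat_deriv del: mult_pCons_left)
  from C_k_ridge[of "\<lambda>m. flat (q m)", OF this, where m = 0] show ?thesis by (simp add: q_def bump1_def)
qed

lemma bump1_bounds: "0 \<le> bump1 t" "bump1 t \<le> 1" "t \<le> 0 \<Longrightarrow> bump1 t = 0"
  by (auto simp: bump1_def flat_def)

text \<open>The shift by \<open>- 1\<close> leaves a margin \<open>1/n\<close> inside the box, so
  the support is compact within the open box; as \<open>n\<close> grows the values on the box tend
  to \<open>1\<close>.\<close>

definition box_bump :: "nat \<Rightarrow> real^'n \<Rightarrow> real^'n \<Rightarrow> real^'n \<Rightarrow> real" where
  "box_bump n a b x = (\<Prod>j\<in>UNIV. bump1 (real n * (x $ j - a $ j) - 1) * bump1 (real n * (b $ j - x $ j) - 1))"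

lemma box_bump_C_k: "C_k k (box_bump n a b)"
proof -
  have "C_k k (\<lambda>x. \<Prod>j\<in>UNIV. bump1 (real n * x $ j + (- real n * a $ j - 1)) * bump1 ((- real n) * x $ j + (real n * b $ j - 1)))"
    by (intro C_k_prod C_k_mult bump1_C_k) auto
  thus ?thesis by (simp add: box_bump_def[abs_def] algebra_simps)
qed

lemma box_bump_bounds: "0 \<le> box_bump n a b x" "box_bump n a b x \<le> 1"
  by (auto simp: box_bump_def bump1_bounds intro!: prod_nonneg prod_le_1 mult_le_one)

lemma test_function_intro:
  assumes "\<And>k. C_k k \<phi>" "{x. \<phi> x \<noteq> 0} \<subseteq> K" "compact K" "K \<subseteq> \<Omega>"
  shows "test_function \<Omega> \<phi>"
proof -
  have "closure {x. \<phi> x \<noteq> 0} \<subseteq> K" using assms closure_minimal compact_imp_closed by blast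
  moreover have "compact (closure {x. \<phi> x \<noteq> 0})"
    unfolding compact_closure by (rule bounded_subset[OF compact_imp_bounded[OF assms(3)] assms(2)])
  ultimately show ?thesis unfolding test_function_def using assms by blast
qed

lemma box_bump_test:
  assumes "box a b \<subseteq> \<Omega>"
  shows "test_function \<Omega> (box_bump n a b)"
proof (cases "n = 0")
  case True
  have "box_bump n a b = (\<lambda>x. 0)" using True by (auto simp: box_bump_def bump1_bounds)
  thus ?thesis by (intro test_function_intro[of _ "{}"]) (auto simp: C_k_const)
next
  case False
  define a' b' where "a' = a + (\<chi> i. 1 / real n)" and "b' = b - (\<chi> i. 1 / real n)"
  show ?thesis
  proof (rule test_function_intro[of _ "cbox a' b'"])
    show "{x. box_bump n a b x \<noteq> 0} \<subseteq> cbox a' b'"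
    proof
      fix x assume "x \<in> {x. box_bump n a b x \<noteq> 0}"
      hence "bump1 (real n * (x $ j - a $ j) - 1) \<noteq> 0" "bump1 (real n * (b $ j - x $ j) - 1) \<noteq> 0" for j
        by (auto simp: box_bump_def)
      hence "0 < real n * (x $ j - a $ j) - 1" "0 < real n * (b $ j - x $ j) - 1" for j
        using bump1_bounds(3) not_le by metis+
      thus "x \<in> cbox a' b'" using False by (auto simp: mem_box_cart a'_def b'_def field_simps less_imp_le)
    qed
    have "cbox a' b' \<subseteq> box a b"
    proof
      fix x assume x: "x \<in> cbox a' b'"
      have "a $ j < x $ j \<and> x $ j < b $ j" for j
      proof -
        have "a $ j + 1 / real n \<le> x $ j" "x $ j \<le> b $ j - 1 / real n" using x by (auto simp: mem_box_cart a'_def b'_def)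
        moreover have "0 < 1 / real n" using False by simp
        ultimately show ?thesis by linarith
      qed
      thus "x \<in> box a b" by (simp add: mem_box_cart)
    qed
    thus "cbox a' b' \<subseteq> \<Omega>" using assms by auto
  qed (auto simp: box_bump_C_k)
qed

lemma box_bump_lim:
  assumes "x \<in> box a b"
  shows "(\<lambda>n. box_bump n a b x) \<longlonglongrightarrow> 1"
proof -
  have l: "(\<lambda>n. bump1 (real n * d - 1)) \<longlonglongrightarrow> 1" if "0 < d" for d
  proof -
    have f: "filterlim (\<lambda>n. real n * d - 1) at_top sequentially"
      using that by (intro filterlim_tendsto_add_at_top[of "\<lambda>_. -1" "-1", simplified] filterlim_at_top_mult_tendsto_pos[of _ d] filterlim_real_sequentially tendsto_const)
    have "((\<lambda>t::real. exp (- (1 / t))) \<longlongrightarrow> exp (- 0)) at_top"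
      by (intro tendsto_intros tendsto_divide_0[OF tendsto_const] filterlim_at_top_imp_at_infinity filterlim_ident)
    hence "((\<lambda>t. bump1 t) \<longlongrightarrow> 1) at_top"
      by (simp, elim Lim_transform_eventually) (auto intro!: eventually_mono[OF eventually_gt_at_top[of 0]] simp: bump1_def flat_def)
    from filterlim_compose[OF this f] show ?thesis .
  qed
  have "(\<lambda>n. \<Prod>j\<in>UNIV. bump1 (real n * (x $ j - a $ j) - 1) * bump1 (real n * (b $ j - x $ j) - 1)) \<longlonglongrightarrow> (\<Prod>j\<in>(UNIV::'a set). 1 * 1)"
    using assms by (intro tendsto_prod tendsto_mult l) (auto simp: mem_box_cart)
  thus ?thesis by (simp add: box_bump_def)
qed

lemma test_function_add:
  assumes f: "test_function \<Omega> f" and g: "test_function \<Omega> g"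
  shows "test_function \<Omega> (\<lambda>x. f x + g x)"
proof (rule test_function_intro[of _ "closure {x. f x \<noteq> 0} \<union> closure {x. g x \<noteq> 0}"])
  have "f x \<noteq> 0 \<or> g x \<noteq> 0" if "f x + g x \<noteq> 0" for x using that by auto
  thus "{x. f x + g x \<noteq> 0} \<subseteq> closure {x. f x \<noteq> 0} \<union> closure {x. g x \<noteq> 0}"
    using closure_subset[of "{x. f x \<noteq> 0}"] closure_subset[of "{x. g x \<noteq> 0}"] by blast
qed (use f g in \<open>auto simp: test_function_def C_k_add\<close>)

lemma test_function_mult:
  assumes "test_function \<Omega> f" "\<And>k. C_k k g"
  shows "test_function \<Omega> (\<lambda>x. f x * g x)"
  by (rule test_function_intro[of _ "closure {x. f x \<noteq> 0}"])
     (use assms closure_subset[of "{x. f x \<noteq> 0}"] in \<open>auto simp: test_function_def C_k_mult\<close>)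

lemma test_function_cmult:
  assumes "test_function \<Omega> f"
  shows "test_function \<Omega> (\<lambda>x. c * f x)"
  using test_function_mult[OF assms C_k_const[of _ c]] by (simp add: mult.commute)

lemma test_function_zero: "test_function \<Omega> (\<lambda>x. 0)"
  by (rule test_function_intro[of _ "{}"]) (auto simp: C_k_const)

text \<open>A smooth substitute for the maximum of the bumps: \<open>1 - union_bump\<close> is the
  product of the factors \<open>1 - box_bump\<close>.\<close>

fun union_bump :: "(nat \<Rightarrow> real^'n) \<Rightarrow> (nat \<Rightarrow> real^'n) \<Rightarrow> nat \<Rightarrow> nat \<Rightarrow> real^'n \<Rightarrow> real" where
  "union_bump a b n 0 x = 0"
| "union_bump a b n (Suc m) x = union_bump a b n m x + box_bump n (a m) (b m) x * (1 - union_bump a b n m x)"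

lemma union_bump_test:
  assumes "\<And>m. box (a m) (b m) \<subseteq> \<Omega>"
  shows "test_function \<Omega> (union_bump a b n m)"
proof (induction m)
  case (Suc m)
  have "C_k k (\<lambda>x. 1 - union_bump a b n m x)" for k using Suc by (intro C_k_diff C_k_const) (auto simp: test_function_def)
  thus ?case using Suc assms by (simp add: test_function_add test_function_mult box_bump_test)
qed (simp add: test_function_zero)

lemma union_bump_bounds: "0 \<le> union_bump a b n m x" "union_bump a b n m x \<le> 1"
proof -
  have "0 \<le> union_bump a b n m x \<and> union_bump a b n m x \<le> 1"
  proof (induction m)
    case (Suc m)
    let ?u = "union_bump a b n m x" and ?p = "box_bump n (a m) (b m) x"
    have "?p * (1 - ?u) \<le> 1 * (1 - ?u)" using Suc box_bump_bounds by (intro mult_right_mono) auto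
    thus ?case using Suc box_bump_bounds[of n "a m" "b m" x] by simp
  qed simp
  thus "0 \<le> union_bump a b n m x" "union_bump a b n m x \<le> 1" by auto
qed

lemma union_bump_ge: "m < M \<Longrightarrow> box_bump n (a m) (b m) x \<le> union_bump a b n M x"
proof (induction M)
  case (Suc M)
  let ?u = "union_bump a b n M x" and ?p = "box_bump n (a M) (b M) x"
  have u: "0 \<le> ?u" "?u \<le> 1" and p: "0 \<le> ?p" by (auto simp: union_bump_bounds box_bump_bounds)
  show ?case
  proof (cases "m = M")
    case True
    have "?p * ?u \<le> 1 * ?u" using u box_bump_bounds by (intro mult_right_mono) auto
    thus ?thesis using True by (simp add: algebra_simps)
  next
    case False
    hence "box_bump n (a m) (b m) x \<le> ?u" using Suc by simp
    moreover have "0 \<le> ?p * (1 - ?u)" using u p by simp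
    ultimately show ?thesis by simp
  qed
qed simp

lemma open_as_boxes:
  assumes "open (U :: (real^'n) set)"
  obtains a b :: "nat \<Rightarrow> real^'n" where "U = (\<Union>m. box (a m) (b m))"
proof -
  define A where "A f = (\<Sum>i\<in>Basis. fst (f i) *\<^sub>R i)" for f :: "real^'n \<Rightarrow> real \<times> real"
  define B where "B f = (\<Sum>i\<in>Basis. snd (f i) *\<^sub>R i)" for f :: "real^'n \<Rightarrow> real \<times> real"
  define I where "I = {f \<in> Basis \<rightarrow>\<^sub>E \<rat> \<times> \<rat>. box (A f) (B f) \<subseteq> U}"
  have U: "U = (\<Union>f\<in>I. box (A f) (B f))" unfolding A_def B_def I_def by (rule open_UNION_box[OF assms])
  have "countable I" unfolding I_def
    by (rule countable_subset[of _ "Basis \<rightarrow>\<^sub>E \<rat> \<times> \<rat>"]) (auto intro!: countable_PiE countable_rat)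
  \<comment> \<open>The pair \<open>(0, 0)\<close> stands for an empty box and keeps the index set
    nonempty, so that it can be enumerated by all natural numbers.\<close>
  define J where "J = insert (0, 0) ((\<lambda>f. (A f, B f)) ` I)"
  have J: "countable J" "J \<noteq> {}" using \<open>countable I\<close> by (auto simp: J_def)
  define g where "g = from_nat_into J"
  have "range g = J" unfolding g_def by (rule range_from_nat_into[OF J(2) J(1)])
  hence "(\<Union>m. box (fst (g m)) (snd (g m))) = (\<Union>p\<in>J. box (fst p) (snd p))" by auto
  also have "\<dots> = U" unfolding J_def by (subst U) auto
  finally show ?thesis using that[of "\<lambda>m. fst (g m)" "\<lambda>m. snd (g m)"] by simp
qed

text \<open>The integral of \<open>g\<close> vanishes over open sets, as limits of bumps over more
  and more boxes, then over measurable sets, by open approximation from outside, and finally over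
  the sets where \<open>g\<close> is positive or negative.\<close>

lemma fundamental_lemma:
  fixes g :: "real^'n \<Rightarrow> real"
  assumes \<Omega>: "open \<Omega>" and g: "integrable (lebesgue_on \<Omega>) g"
    and z: "\<And>\<phi>. test_function \<Omega> \<phi> \<Longrightarrow> (\<integral>x. g x * \<phi> x \<partial>lebesgue_on \<Omega>) = 0"
  shows "AE x in lebesgue_on \<Omega>. g x = 0"
proof -
  have \<Omega>m: "\<Omega> \<in> sets lebesgue" using \<Omega> by auto
  have meas: "indicator U \<in> borel_measurable (lebesgue_on \<Omega>)" if "U \<in> sets lebesgue" for U
    using that by (intro measurable_restrict_space1 borel_measurable_indicator)
  have opn: "(\<integral>x. g x * indicator U x \<partial>lebesgue_on \<Omega>) = 0" if U: "open U" "U \<subseteq> \<Omega>" for U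
  proof -
    obtain a b :: "nat \<Rightarrow> real^'n" where ab: "U = (\<Union>m. box (a m) (b m))" by (rule open_as_boxes[OF U(1)])
    define \<Phi> where "\<Phi> = (\<lambda>n. union_bump a b n n)"
    have t: "test_function \<Omega> (\<Phi> n)" for n unfolding \<Phi>_def using ab U by (intro union_bump_test) auto
    have "(\<lambda>n. \<integral>x. g x * \<Phi> n x \<partial>lebesgue_on \<Omega>) \<longlonglongrightarrow> (\<integral>x. g x * indicator U x \<partial>lebesgue_on \<Omega>)"
    proof (rule integral_dominated_convergence[where w = "\<lambda>x. norm (g x)"])
      show "(\<lambda>x. g x * indicator U x) \<in> borel_measurable (lebesgue_on \<Omega>)"
        using g meas[of U] U by (intro borel_measurable_times) auto
      have "continuous_on \<Omega> (\<Phi> n)" for n using t[of n] C_k.simps(1) unfolding test_function_def by (metis continuous_on_subset subset_UNIV)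
      thus "(\<lambda>x. g x * \<Phi> n x) \<in> borel_measurable (lebesgue_on \<Omega>)" for n
        using borel_measurable_times[OF borel_measurable_integrable[OF g] continuous_imp_measurable_on_sets_lebesgue[OF _ \<Omega>m]] by blast
      show "AE x in lebesgue_on \<Omega>. norm (g x * \<Phi> n x) \<le> norm (g x)" for n
        by (intro AE_I2) (auto simp: abs_mult \<Phi>_def union_bump_bounds intro!: mult_left_le)
      show "AE x in lebesgue_on \<Omega>. (\<lambda>n. g x * \<Phi> n x) \<longlonglongrightarrow> g x * indicator U x"
      proof (intro AE_I2 tendsto_mult tendsto_const)
        fix x
        show "(\<lambda>n. \<Phi> n x) \<longlonglongrightarrow> indicator U x"
        proof (cases "x \<in> U")
          case True
          then obtain m where m: "x \<in> box (a m) (b m)" using ab by auto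
          have "(\<lambda>n. \<Phi> n x) \<longlonglongrightarrow> 1"
          proof (rule tendsto_sandwich[OF _ _ box_bump_lim[OF m] tendsto_const])
            show "\<forall>\<^sub>F n in sequentially. box_bump n (a m) (b m) x \<le> \<Phi> n x"
              unfolding \<Phi>_def by (rule eventually_at_top_linorderI[of "Suc m"]) (auto intro: union_bump_ge)
          qed (simp add: \<Phi>_def union_bump_bounds)
          thus ?thesis using True by simp
        next
          case False
          have "closure {y. \<Phi> n y \<noteq> 0} \<subseteq> U" for n
          proof -
            have "test_function U (\<Phi> n)" unfolding \<Phi>_def using ab by (intro union_bump_test) auto
            thus ?thesis by (simp add: test_function_def)
          qed
          note sub = this
          have "\<Phi> n x = 0" for n
          proof (rule ccontr)
            assume "\<Phi> n x \<noteq> 0"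
            hence "x \<in> {y. \<Phi> n y \<noteq> 0}" by simp
            hence "x \<in> closure {y. \<Phi> n y \<noteq> 0}" by (rule subsetD[OF closure_subset])
            thus False using subsetD[OF sub] False by blast
          qed
          thus ?thesis using False by simp
        qed
      qed
    qed (use g in auto)
    moreover have "(\<integral>x. g x * \<Phi> n x \<partial>lebesgue_on \<Omega>) = 0" for n by (rule z[OF t])
    ultimately show ?thesis by (simp add: LIMSEQ_const_iff)
  qed
  have mset: "(\<integral>x. g x * indicator S x \<partial>lebesgue_on \<Omega>) = 0" if S: "S \<in> sets lebesgue" "S \<subseteq> \<Omega>" for S
  proof -
    have "\<exists>T. open T \<and> S \<subseteq> T \<and> T - S \<in> lmeasurable \<and> emeasure lebesgue (T - S) < ennreal (1 / real (Suc k))" for k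
      using sets_lebesgue_outer_open[OF S(1), of "1 / real (Suc k)"] by force
    then obtain T where T: "\<And>k. open (T k)" "\<And>k. S \<subseteq> T k" "\<And>k. emeasure lebesgue (T k - S) < ennreal (1 / real (Suc k))" "\<And>k. T k - S \<in> lmeasurable"
      by metis
    \<comment> \<open>Finite intersections keep the approximating sets open and make them decrease;
      their limit \<open>G\<close> exceeds \<open>S\<close> by a null set.\<close>
    define V where "V = (\<lambda>n. \<Omega> \<inter> (\<Inter>k\<in>{..n}. T k))"
    define G where "G = \<Omega> \<inter> (\<Inter>k. T k)"
    have Vo: "open (V n)" "V n \<subseteq> \<Omega>" for n using \<Omega> T(1) by (auto simp: V_def intro!: open_Int open_INT)
    have Gm: "G \<in> sets lebesgue" unfolding G_def using \<Omega> T(1) by (intro sets.Int sets.countable_INT) (auto)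
    have null: "G - S \<in> null_sets lebesgue"
    proof -
      have "emeasure lebesgue (G - S) \<le> ennreal (1 / real (Suc k))" for k
        proof -
        have "emeasure lebesgue (G - S) \<le> emeasure lebesgue (T k - S)"
          using T(4)[of k] by (intro emeasure_mono) (auto simp: G_def fmeasurableD)
        thus ?thesis using T(3)[of k] by (meson le_less_trans less_imp_le)
      qed
      moreover have "(\<lambda>k. ennreal (1 / real (Suc k))) \<longlonglongrightarrow> ennreal 0"
        by (intro tendsto_ennrealI LIMSEQ_Suc lim_1_over_n)
      ultimately have "emeasure lebesgue (G - S) \<le> ennreal 0"
        by (intro LIMSEQ_le_const[of _ "ennreal 0"]) auto
      thus ?thesis using Gm S by (auto simp: null_sets_def)
    qed
    have "(\<lambda>n. \<integral>x. g x * indicator (V n) x \<partial>lebesgue_on \<Omega>) \<longlonglongrightarrow> (\<integral>x. g x * indicator S x \<partial>lebesgue_on \<Omega>)"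
    proof (rule integral_dominated_convergence[where w = "\<lambda>x. norm (g x)"])
      show "(\<lambda>x. g x * indicator S x) \<in> borel_measurable (lebesgue_on \<Omega>)" 
        using g meas[OF S(1)] by (intro borel_measurable_times) auto
      show "(\<lambda>x. g x * indicator (V n) x) \<in> borel_measurable (lebesgue_on \<Omega>)" for n
        using g meas[of "V n"] Vo(1)[of n] by (intro borel_measurable_times) auto
      show "AE x in lebesgue_on \<Omega>. norm (g x * indicator (V n) x) \<le> norm (g x)" for n
        by (intro AE_I2) (auto simp: indicator_def)
      have "AE x in lebesgue. x \<notin> G - S" using null by (rule AE_not_in)
      hence "AE x in lebesgue. x \<in> \<Omega> \<longrightarrow> (\<lambda>n. g x * indicator (V n) x) \<longlonglongrightarrow> g x * indicator S x"
      proof eventually_elim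
        case (elim x)
        show ?case
        proof
          assume x: "x \<in> \<Omega>"
          show "(\<lambda>n. g x * indicator (V n) x) \<longlonglongrightarrow> g x * indicator S x"
          proof (cases "x \<in> S")
            case True
            hence "x \<in> V n" for n using T(2) x by (auto simp: V_def)
            thus ?thesis using True by simp
          next
            case False
            then obtain k where "x \<notin> T k" using elim x by (auto simp: G_def)
            hence "\<forall>\<^sub>F n in sequentially. g x * indicator (V n) x = 0"
              by (intro eventually_at_top_linorderI[of k]) (auto simp: V_def indicator_def)
            thus ?thesis using False by (auto intro: tendsto_eventually)
          qed
        qed
      qed
      thus "AE x in lebesgue_on \<Omega>. (\<lambda>n. g x * indicator (V n) x) \<longlonglongrightarrow> g x * indicator S x"
        using \<Omega>m by (subst AE_restrict_space_iff) auto
    qed (use g in auto)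
    thus ?thesis using opn[OF Vo] by (simp add: LIMSEQ_const_iff)
  qed
  have half: "AE x in lebesgue_on \<Omega>. s * g x \<le> 0" if "s = 1 \<or> s = -1" for s :: real
  proof -
    define S where "S = {x \<in> \<Omega>. 0 < s * g x}"
    have "{x \<in> space (lebesgue_on \<Omega>). 0 < s * g x} \<in> sets (lebesgue_on \<Omega>)"
      using g by measurable
    hence S: "S \<in> sets lebesgue" "S \<subseteq> \<Omega>" using \<Omega>m by (auto simp: S_def sets_restrict_space_iff)
    have i: "integrable (lebesgue_on \<Omega>) (\<lambda>x. s * (g x * indicator S x))"
    proof (intro integrable_mult_right Bochner_Integration.integrable_bound[OF g])
      show "(\<lambda>x. g x * indicator S x) \<in> borel_measurable (lebesgue_on \<Omega>)"
        using g meas[OF S(1)] by (intro borel_measurable_times) auto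
      show "AE x in lebesgue_on \<Omega>. norm (g x * indicator S x) \<le> norm (g x)"
        by (intro AE_I2) (auto simp: indicator_def)
    qed
    have "(\<integral>x. s * (g x * indicator S x) \<partial>lebesgue_on \<Omega>) = 0" using mset[OF S] by simp
    hence "AE x in lebesgue_on \<Omega>. s * (g x * indicator S x) = 0"
      by (subst (asm) integral_nonneg_eq_0_iff_AE[OF i]) (auto simp: S_def indicator_def)
    thus ?thesis
    proof (rule AE_mp, intro AE_I2 impI)
      fix x assume "x \<in> space (lebesgue_on \<Omega>)" "s * (g x * indicator S x) = 0"
      thus "s * g x \<le> 0" by (cases "x \<in> S") (auto simp: S_def)
    qed
  qed
  from half[of 1, simplified] half[of "-1", simplified] show ?thesis by eventually_elim auto
qed

section \<open>Integration by parts for test functions\<close>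

lemma integral_lebesgue_on_support:
  fixes f :: "real^'n \<Rightarrow> real"
  assumes \<Omega>: "\<Omega> \<in> sets lebesgue" and f: "continuous_on UNIV f" and supp: "\<And>x. x \<notin> \<Omega> \<Longrightarrow> f x = 0"
  shows "(\<integral>x. f x \<partial>lebesgue_on \<Omega>) = integral\<^sup>L lborel f"
proof -
  have m: "f \<in> borel_measurable lborel" using borel_measurable_continuous_onI[OF f] by simp
  have "(\<integral>x. f x \<partial>lebesgue_on \<Omega>) = integral\<^sup>L lebesgue (\<lambda>x. indicator \<Omega> x *\<^sub>R f x)"
    using \<Omega> by (subst integral_restrict_space) auto
  also have "(\<lambda>x. indicator \<Omega> x *\<^sub>R f x) = f"
  proof
    fix x show "indicator \<Omega> x *\<^sub>R f x = f x" using supp[of x] by (cases "x \<in> \<Omega>") auto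
  qed
  also have "integral\<^sup>L lebesgue f = integral\<^sup>L lborel f" by (rule integral_completion[OF m])
  finally show ?thesis .
qed

lemma partial_deriv_line:
  assumes "\<And>x. f differentiable (at x)"
  shows "((\<lambda>s. f (x + s *\<^sub>R axis i 1)) has_real_derivative partial_deriv i f (x + t *\<^sub>R axis i 1)) (at t)"
proof -
  define D where "D = frechet_derivative f (at (x + t *\<^sub>R axis i 1))"
  have D: "(f has_derivative D) (at (x + t *\<^sub>R axis i 1))"
    unfolding D_def using assms frechet_derivative_works by blast
  have "((\<lambda>s. x + s *\<^sub>R axis i 1) has_derivative (\<lambda>h. h *\<^sub>R axis i 1)) (at t)"
    by (auto intro!: derivative_eq_intros)
  from has_derivative_compose[OF this D]
  have "((\<lambda>s. f (x + s *\<^sub>R axis i 1)) has_derivative (\<lambda>h. D (h *\<^sub>R axis i 1))) (at t)" .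
  also have "(\<lambda>h. D (h *\<^sub>R axis i 1)) = (\<lambda>h. partial_deriv i f (x + t *\<^sub>R axis i 1) * h)"
    using linear_cmul[OF has_derivative_linear[OF D]] by (simp add: partial_deriv_def D_def mult.commute)
  finally show ?thesis by (simp add: has_field_derivative_def)
qed

text \<open>The difference quotients have integral zero by translation invariance.\<close>

lemma integral_partial_deriv_zero:
  fixes f :: "real^'n \<Rightarrow> real"
  assumes f: "C_k 1 f" and supp: "compact (closure {x. f x \<noteq> 0})"
  shows "integral\<^sup>L lborel (partial_deriv i f) = 0"
proof -
  have d: "f differentiable (at x)" for x using f by simp
  have c: "continuous_on UNIV (partial_deriv i f)" using f by simp
  have fc: "continuous_on UNIV f" using C_k_Suc_imp[of 0 f] f by simp
  have fm: "f \<in> borel_measurable borel" by (rule borel_measurable_continuous_onI[OF fc])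
  obtain R where R: "0 < R" "\<And>x. f x \<noteq> 0 \<Longrightarrow> norm x \<le> R"
  proof -
    have "bounded {x. f x \<noteq> 0}" using supp by (simp add: compact_closure)
    thus ?thesis using that by (auto simp: bounded_pos)
  qed
  \<comment> \<open>Increments of length at most \<open>1\<close> make the difference quotients
    vanish beyond radius \<open>R + 1\<close>, and the intermediate points of the mean value theorem
    then stay within \<open>R + 2\<close>.\<close>
  have "compact (partial_deriv i f ` cball 0 (R + 2))"
    by (intro compact_continuous_image continuous_on_subset[OF c]) auto
  then obtain B where B: "0 < B" "\<And>x. norm x \<le> R + 2 \<Longrightarrow> \<bar>partial_deriv i f x\<bar> \<le> B"
    using compact_imp_bounded[of "partial_deriv i f ` cball 0 (R + 2)"] by (auto simp: bounded_pos)
  define h where "h = (\<lambda>n. 1 / real (Suc n))"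
  have h: "0 < h n" "h n \<le> 1" for n by (auto simp: h_def field_simps)
  have h0: "h \<longlonglongrightarrow> 0" unfolding h_def by (rule LIMSEQ_Suc[OF lim_1_over_n])
  define F where "F = (\<lambda>n x. (f (x + h n *\<^sub>R axis i 1) - f x) / h n)"
  have fi: "integrable lborel f"
  proof -
    have "integrable lborel (\<lambda>x. indicator (cball 0 R) x *\<^sub>R f x)"
      using borel_integrable_compact[OF compact_cball continuous_on_subset[OF fc]] by simp
    also have "(\<lambda>x. indicator (cball 0 R) x *\<^sub>R f x) = f" using R(2) by (auto simp: indicator_def fun_eq_iff)
    finally show ?thesis .
  qed
  have tr: "integrable lborel (\<lambda>x. f (x + v))" "integral\<^sup>L lborel (\<lambda>x. f (x + v)) = integral\<^sup>L lborel f" for v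
  proof -
    have "integrable (distr lborel borel ((+) v)) f" using fi by (simp add: lborel_distr_plus)
    thus "integrable lborel (\<lambda>x. f (x + v))" using fm by (subst (asm) integrable_distr_eq) (auto simp: add.commute)
    have "integral\<^sup>L lborel f = integral\<^sup>L (distr lborel borel ((+) v)) f" by (simp add: lborel_distr_plus)
    also have "\<dots> = integral\<^sup>L lborel (\<lambda>x. f (x + v))" using fm by (subst integral_distr) (auto simp: add.commute)
    finally show "integral\<^sup>L lborel (\<lambda>x. f (x + v)) = integral\<^sup>L lborel f" by simp
  qed
  have F0: "integral\<^sup>L lborel (F n) = 0" for n
    unfolding F_def using tr[of "h n *\<^sub>R axis i 1"] fi by simp
  have "(\<lambda>n. integral\<^sup>L lborel (F n)) \<longlonglongrightarrow> integral\<^sup>L lborel (partial_deriv i f)"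
  proof (rule integral_dominated_convergence[where w = "\<lambda>x. indicator (cball 0 (R + 1)) x *\<^sub>R B"])
    show "partial_deriv i f \<in> borel_measurable lborel" using borel_measurable_continuous_onI[OF c] by simp
    show "F n \<in> borel_measurable lborel" for n unfolding F_def using tr(1)[of "h n *\<^sub>R axis i 1"] fi by auto
    show "integrable lborel (\<lambda>x::real^'n. indicator (cball 0 (R + 1)) x *\<^sub>R B)"
      using borel_integrable_compact[OF compact_cball, of "0::real^'n" "R+1" "\<lambda>_. B"] by simp
    show "AE x in lborel. (\<lambda>n. F n x) \<longlonglongrightarrow> partial_deriv i f x"
    proof (rule AE_I2)
      fix x
      have "((\<lambda>s. (f (x + s *\<^sub>R axis i 1) - f x) / s) \<longlongrightarrow> partial_deriv i f x) (at 0)"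
        using partial_deriv_line[OF d, of x i 0] by (simp add: has_field_derivative_iff)
      moreover have "filterlim h (at 0) sequentially"
        using h0 h by (simp add: filterlim_at less_imp_neq[symmetric])
      ultimately show "(\<lambda>n. F n x) \<longlonglongrightarrow> partial_deriv i f x"
        unfolding F_def by (rule filterlim_compose)
    qed
    show "AE x in lborel. norm (F n x) \<le> indicator (cball 0 (R + 1)) x *\<^sub>R B" for n
    proof (rule AE_I2)
      fix x
      show "norm (F n x) \<le> indicator (cball 0 (R + 1)) x *\<^sub>R B"
      proof (cases "norm x \<le> R + 1")
        case True
        obtain z where z: "0 < z" "z < h n" "f (x + h n *\<^sub>R axis i 1) - f (x + 0 *\<^sub>R axis i 1) = (h n - 0) * partial_deriv i f (x + z *\<^sub>R axis i 1)"
          using MVT2[OF h(1)[of n], of "\<lambda>s. f (x + s *\<^sub>R axis i 1)" "\<lambda>s. partial_deriv i f (x + s *\<^sub>R axis i 1)"] partial_deriv_line[OF d] by blast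
        have "norm (x + z *\<^sub>R axis i 1) \<le> norm x + norm (z *\<^sub>R axis i 1 :: real^'n)" by (rule norm_triangle_ineq)
        also have "\<dots> \<le> R + 2" using True z h(2)[of n] by (simp add: norm_axis_1)
        finally have "\<bar>partial_deriv i f (x + z *\<^sub>R axis i 1)\<bar> \<le> B" by (rule B(2))
        moreover have "F n x = partial_deriv i f (x + z *\<^sub>R axis i 1)" using z h(1)[of n] by (simp add: F_def)
        ultimately show ?thesis using True by simp
      next
        case False
        have "f x = 0" using R(2)[of x] False by fastforce
        moreover have "f (x + h n *\<^sub>R axis i 1) = 0"
        proof (rule ccontr)
          assume "f (x + h n *\<^sub>R axis i 1) \<noteq> 0"
          hence "norm (x + h n *\<^sub>R axis i 1) \<le> R" by (rule R(2))
          moreover have "norm x \<le> norm (x + h n *\<^sub>R axis i 1) + norm (h n *\<^sub>R axis i 1 :: real^'n)"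
            using norm_triangle_ineq4[of "x + h n *\<^sub>R axis i 1" "h n *\<^sub>R axis i 1"] by simp
          ultimately show False using False h[of n] by (simp add: norm_axis_1)
        qed
        ultimately show ?thesis using B(1) by (simp add: F_def)
      qed
    qed
  qed
  thus ?thesis using F0 by (simp add: LIMSEQ_const_iff)
qed

section \<open>Square-integrable functions and the spaces \<open>H1\<close> and \<open>H1_0\<close>
  on a bounded open set\<close>

locale bounded_open =
  fixes \<Omega> :: "(real^'n) set"
  assumes \<Omega>: "open \<Omega>" "bounded \<Omega>"
begin

lemma \<Omega>_sets: "\<Omega> \<in> sets lebesgue" using \<Omega> by auto

lemma finite_measure_\<Omega>: "finite_measure (lebesgue_on \<Omega>)"
proof
  have "\<Omega> \<in> lmeasurable" using \<Omega> by (intro bounded_set_imp_lmeasurable) auto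
  hence "emeasure lebesgue \<Omega> \<noteq> \<infinity>" by (metis fmeasurableD2 infinity_ennreal_def)
  moreover have "emeasure (lebesgue_on \<Omega>) \<Omega> = emeasure lebesgue \<Omega>" using \<Omega>_sets by (intro emeasure_restrict_space) auto
  ultimately show "emeasure (lebesgue_on \<Omega>) (space (lebesgue_on \<Omega>)) \<noteq> \<infinity>" by simp
qed

lemma L2_product: 
  assumes "u \<in> L2 \<Omega>" "v \<in> L2 \<Omega>"
  shows "integrable (lebesgue_on \<Omega>) (\<lambda>x. u x * v x)"
proof (rule Bochner_Integration.integrable_bound)
  show "integrable (lebesgue_on \<Omega>) (\<lambda>x. (u x)\<^sup>2 + (v x)\<^sup>2)" using assms by (auto simp: L2_def)
  show "(\<lambda>x. u x * v x) \<in> borel_measurable (lebesgue_on \<Omega>)" using assms by (auto simp: L2_def)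
  have "\<bar>a * b\<bar> \<le> a\<^sup>2 + b\<^sup>2" for a b :: real
  proof -
    have "2 * (\<bar>a\<bar> * \<bar>b\<bar>) \<le> a\<^sup>2 + b\<^sup>2" using sum_squares_bound[of "\<bar>a\<bar>" "\<bar>b\<bar>"] by (simp add: mult.assoc)
    moreover have "0 \<le> \<bar>a\<bar> * \<bar>b\<bar>" by simp
    ultimately show ?thesis unfolding abs_mult by linarith
  qed
  thus "AE x in lebesgue_on \<Omega>. norm (u x * v x) \<le> norm ((u x)\<^sup>2 + (v x)\<^sup>2)" by (intro AE_I2) simp
qed

lemma L2_add: 
  assumes "u \<in> L2 \<Omega>" "v \<in> L2 \<Omega>"
  shows "(\<lambda>x. u x + v x) \<in> L2 \<Omega>"
proof -
  have "integrable (lebesgue_on \<Omega>) (\<lambda>x. (u x)\<^sup>2 + 2 * (u x * v x) + (v x)\<^sup>2)"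
    using assms L2_product[OF assms] by (auto simp: L2_def)
  thus ?thesis using assms by (auto simp: L2_def power2_sum add_ac mult_ac)
qed

lemma L2_scale: "u \<in> L2 \<Omega> \<Longrightarrow> (\<lambda>x. c * u x) \<in> L2 \<Omega>"
  by (auto simp: L2_def power_mult_distrib)

lemma L2_diff: "u \<in> L2 \<Omega> \<Longrightarrow> v \<in> L2 \<Omega> \<Longrightarrow> (\<lambda>x. u x - v x) \<in> L2 \<Omega>"
  using L2_add[of u "\<lambda>x. -1 * v x"] L2_scale[of v "-1"] by simp

lemma L2_bounded:
  assumes "u \<in> borel_measurable (lebesgue_on \<Omega>)" "\<And>x. x \<in> \<Omega> \<Longrightarrow> \<bar>u x\<bar> \<le> B"
  shows "u \<in> L2 \<Omega>"
proof -
  have B: "(u x)\<^sup>2 \<le> B\<^sup>2" if "x \<in> \<Omega>" for x using power_mono[OF assms(2)[OF that], of 2] by simp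
  have "integrable (lebesgue_on \<Omega>) (\<lambda>x. (u x)\<^sup>2)"
    by (rule finite_measure.integrable_const_bound[OF finite_measure_\<Omega>, of _ "B\<^sup>2"])
       (use assms B in \<open>auto intro!: AE_I2\<close>)
  thus ?thesis using assms by (simp add: L2_def)
qed

lemma L2_one: "(\<lambda>x. 1) \<in> L2 \<Omega>"
  by (rule L2_bounded[of _ 1]) auto

lemma L2_integrable: "u \<in> L2 \<Omega> \<Longrightarrow> integrable (lebesgue_on \<Omega>) u"
  using L2_product[OF _ L2_one, of u] by simp

lemma l2_inner_add: "u \<in> L2 \<Omega> \<Longrightarrow> v \<in> L2 \<Omega> \<Longrightarrow> w \<in> L2 \<Omega> \<Longrightarrow> l2_inner \<Omega> (\<lambda>x. u x + v x) w = l2_inner \<Omega> u w + l2_inner \<Omega> v w"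
  by (simp add: l2_inner_def distrib_right L2_product)

lemma l2_inner_scale: "l2_inner \<Omega> (\<lambda>x. c * u x) w = c * l2_inner \<Omega> u w"
  by (simp add: l2_inner_def mult.assoc)

lemma l2_inner_sym: "l2_inner \<Omega> u v = l2_inner \<Omega> v u"
  by (simp add: l2_inner_def mult.commute)

lemma l2_inner_nonneg: "0 \<le> l2_inner \<Omega> u u"
  by (simp add: l2_inner_def)

lemma continuous_compact_L2:
  assumes "continuous_on UNIV u"
  shows "u \<in> L2 \<Omega>"
proof -
  have "bounded (u ` closure \<Omega>)"
    using \<Omega> assms by (intro compact_imp_bounded compact_continuous_image continuous_on_subset[OF assms]) (auto simp: compact_closure)
  then obtain B where "\<And>x. x \<in> closure \<Omega> \<Longrightarrow> \<bar>u x\<bar> \<le> B" by (auto simp: bounded_iff)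
  hence B: "\<bar>u x\<bar> \<le> B" if "x \<in> \<Omega>" for x using closure_subset that by blast
  show ?thesis
    by (rule L2_bounded[OF continuous_imp_measurable_on_sets_lebesgue[OF continuous_on_subset[OF assms] \<Omega>_sets] B]) auto
qed

lemma test_function_L2: "test_function \<Omega> \<phi> \<Longrightarrow> \<phi> \<in> L2 \<Omega>"
  by (intro continuous_compact_L2) (auto simp: test_function_def dest: spec[of _ 0])

lemma test_function_partial: 
  assumes "test_function \<Omega> \<phi>" 
  shows "partial_deriv i \<phi> \<in> L2 \<Omega>"
proof -
  have "C_k 1 \<phi>" using assms by (simp add: test_function_def del: C_k.simps One_nat_def)
  hence "continuous_on UNIV (partial_deriv i \<phi>)" by simp
  thus ?thesis by (rule continuous_compact_L2)
qed

lemma partial_deriv_support: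
  assumes "x \<notin> closure {x. \<phi> x \<noteq> 0}"
  shows "partial_deriv i \<phi> x = 0"
proof -
  have "((\<lambda>x. 0) has_derivative (\<lambda>h. 0)) (at x)" by simp
  hence "(\<phi> has_derivative (\<lambda>h. 0)) (at x)"
    by (rule has_derivative_transform_within_open[of _ _ _ _ "- closure {x. \<phi> x \<noteq> 0}"])
       (use assms closure_subset[of "{x. \<phi> x \<noteq> 0}"] in auto)
  thus ?thesis by (simp add: partial_deriv_eq)
qed

text \<open>The derivative of the compactly supported product of \<open>\<phi>\<close> and
  \<open>\<psi>\<close> has integral zero, so the product rule becomes integration by parts. This
  places test functions in \<open>H1\<close>, where the quadratic bounds for \<open>h1sq\<close>
  apply to them.\<close>

lemma test_function_weak_gradient:
  assumes \<phi>: "test_function \<Omega> \<phi>"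
  shows "has_weak_gradient \<Omega> \<phi> (\<lambda>x. \<chi> i. partial_deriv i \<phi> x)"
  unfolding has_weak_gradient_def
proof (intro conjI allI impI)
  fix i
  show "(\<lambda>x. (\<chi> i. partial_deriv i \<phi> x) $ i) \<in> L2 \<Omega>" using test_function_partial[OF \<phi>] by simp
next
  fix \<psi> and i assume \<psi>: "test_function \<Omega> \<psi>"
  have C1: "C_k 1 \<phi>" "C_k 1 \<psi>" using \<phi> \<psi> by (simp_all add: test_function_def del: C_k.simps One_nat_def)
  have d: "\<phi> differentiable (at x)" "\<psi> differentiable (at x)" for x using C1 by auto
  have t: "test_function \<Omega> (\<lambda>x. \<phi> x * \<psi> x)" using \<phi> \<psi> by (intro test_function_mult) (auto simp: test_function_def)
  have C1t: "C_k 1 (\<lambda>x. \<phi> x * \<psi> x)" using t by (simp add: test_function_def del: C_k.simps One_nat_def)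
  have "(\<integral>x. partial_deriv i (\<lambda>x. \<phi> x * \<psi> x) x \<partial>lebesgue_on \<Omega>) = integral\<^sup>L lborel (partial_deriv i (\<lambda>x. \<phi> x * \<psi> x))"
  proof (rule integral_lebesgue_on_support[OF \<Omega>_sets])
    show "continuous_on UNIV (partial_deriv i (\<lambda>x. \<phi> x * \<psi> x))" using C1t by simp
    show "partial_deriv i (\<lambda>x. \<phi> x * \<psi> x) x = 0" if "x \<notin> \<Omega>" for x
      using t that by (intro partial_deriv_support) (auto simp: test_function_def)
  qed
  also have "\<dots> = 0" using t by (intro integral_partial_deriv_zero C1t) (simp add: test_function_def)
  finally have "(\<integral>x. \<phi> x * partial_deriv i \<psi> x + partial_deriv i \<phi> x * \<psi> x \<partial>lebesgue_on \<Omega>) = 0"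
    unfolding partial_deriv_mult[OF d] .
  moreover have "integrable (lebesgue_on \<Omega>) (\<lambda>x. \<phi> x * partial_deriv i \<psi> x)" "integrable (lebesgue_on \<Omega>) (\<lambda>x. partial_deriv i \<phi> x * \<psi> x)"
    using \<phi> \<psi> by (auto intro!: L2_product test_function_L2 test_function_partial)
  ultimately show "l2_inner \<Omega> \<phi> (partial_deriv i \<psi>) = - l2_inner \<Omega> (\<lambda>x. (\<chi> i. partial_deriv i \<phi> x) $ i) \<psi>"
    unfolding l2_inner_def by simp
qed

text \<open>\<open>weak_grad\<close> is an arbitrary choice, so identities for gradients of sums and
  multiples can only hold almost everywhere; they are derived from this uniqueness.\<close>

lemma has_weak_gradient_unique:
  assumes "has_weak_gradient \<Omega> v G" "has_weak_gradient \<Omega> v G'"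
  shows "AE x in lebesgue_on \<Omega>. G x = G' x"
proof -
  have "AE x in lebesgue_on \<Omega>. G x $ i - G' x $ i = 0" for i
  proof (rule fundamental_lemma[OF \<Omega>(1)])
    have L: "(\<lambda>x. G x $ i) \<in> L2 \<Omega>" "(\<lambda>x. G' x $ i) \<in> L2 \<Omega>" using assms by (auto simp: has_weak_gradient_def)
    thus "integrable (lebesgue_on \<Omega>) (\<lambda>x. G x $ i - G' x $ i)" by (intro L2_integrable L2_diff)
    fix \<phi> assume \<phi>: "test_function \<Omega> \<phi>"
    have "l2_inner \<Omega> (\<lambda>x. G x $ i) \<phi> = l2_inner \<Omega> (\<lambda>x. G' x $ i) \<phi>"
      using assms \<phi> unfolding has_weak_gradient_def by (metis neg_equal_iff_equal)
    thus "(\<integral>x. (G x $ i - G' x $ i) * \<phi> x \<partial>lebesgue_on \<Omega>) = 0"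
      using L2_product[OF L(1) test_function_L2[OF \<phi>]] L2_product[OF L(2) test_function_L2[OF \<phi>]]
      by (simp add: l2_inner_def left_diff_distrib)
  qed
  hence "AE x in lebesgue_on \<Omega>. \<forall>i. G x $ i - G' x $ i = 0" by (simp add: AE_all_countable)
  thus ?thesis by eventually_elim (auto simp: vec_eq_iff)
qed

lemma weak_grad: "v \<in> H1 \<Omega> \<Longrightarrow> has_weak_gradient \<Omega> v (weak_grad \<Omega> v)"
  unfolding weak_grad_def H1_def using someI_ex[of "has_weak_gradient \<Omega> v"] by simp

lemma weak_grad_L2: "v \<in> H1 \<Omega> \<Longrightarrow> (\<lambda>x. weak_grad \<Omega> v x $ i) \<in> L2 \<Omega>"
  using weak_grad[of v] by (simp add: has_weak_gradient_def)

lemma H1_L2: "v \<in> H1 \<Omega> \<Longrightarrow> v \<in> L2 \<Omega>" by (simp add: H1_def)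

lemma has_weak_gradient_add:
  assumes "u \<in> L2 \<Omega>" "v \<in> L2 \<Omega>" "has_weak_gradient \<Omega> u G" "has_weak_gradient \<Omega> v H"
  shows "has_weak_gradient \<Omega> (\<lambda>x. u x + v x) (\<lambda>x. G x + H x)"
proof -
  have GH: "(\<lambda>x. G x $ i) \<in> L2 \<Omega>" "(\<lambda>x. H x $ i) \<in> L2 \<Omega>" for i using assms by (auto simp: has_weak_gradient_def)
  show ?thesis unfolding has_weak_gradient_def
  proof (intro conjI allI impI)
    show "(\<lambda>x. (G x + H x) $ i) \<in> L2 \<Omega>" for i using L2_add[OF GH] by simp
    fix \<phi> and i assume \<phi>: "test_function \<Omega> \<phi>"
    have "l2_inner \<Omega> (\<lambda>x. u x + v x) (partial_deriv i \<phi>) = l2_inner \<Omega> u (partial_deriv i \<phi>) + l2_inner \<Omega> v (partial_deriv i \<phi>)"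
      by (intro l2_inner_add assms test_function_partial \<phi>)
    also have "\<dots> = - (l2_inner \<Omega> (\<lambda>x. G x $ i) \<phi> + l2_inner \<Omega> (\<lambda>x. H x $ i) \<phi>)"
      using assms \<phi> by (simp add: has_weak_gradient_def)
    also have "l2_inner \<Omega> (\<lambda>x. G x $ i) \<phi> + l2_inner \<Omega> (\<lambda>x. H x $ i) \<phi> = l2_inner \<Omega> (\<lambda>x. G x $ i + H x $ i) \<phi>"
      by (intro l2_inner_add[symmetric] GH test_function_L2 \<phi>)
    finally show "l2_inner \<Omega> (\<lambda>x. u x + v x) (partial_deriv i \<phi>) = - l2_inner \<Omega> (\<lambda>x. (G x + H x) $ i) \<phi>" by simp
  qed
qed

lemma has_weak_gradient_scale:
  assumes "has_weak_gradient \<Omega> u G"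
  shows "has_weak_gradient \<Omega> (\<lambda>x. c * u x) (\<lambda>x. c *\<^sub>R G x)"
  using assms unfolding has_weak_gradient_def by (auto simp: l2_inner_scale intro!: L2_scale)

lemma H1_add: "u \<in> H1 \<Omega> \<Longrightarrow> v \<in> H1 \<Omega> \<Longrightarrow> (\<lambda>x. u x + v x) \<in> H1 \<Omega>"
  using has_weak_gradient_add unfolding H1_def by (blast intro: L2_add)

lemma H1_scale: "u \<in> H1 \<Omega> \<Longrightarrow> (\<lambda>x. c * u x) \<in> H1 \<Omega>"
  using has_weak_gradient_scale unfolding H1_def by (blast intro: L2_scale)

lemma H1_test: "test_function \<Omega> \<phi> \<Longrightarrow> \<phi> \<in> H1 \<Omega>"
  using test_function_weak_gradient test_function_L2 unfolding H1_def by blast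

lemma weak_grad_add:
  assumes "u \<in> H1 \<Omega>" "v \<in> H1 \<Omega>"
  shows "AE x in lebesgue_on \<Omega>. weak_grad \<Omega> (\<lambda>x. u x + v x) x = weak_grad \<Omega> u x + weak_grad \<Omega> v x"
  by (rule has_weak_gradient_unique[OF weak_grad[OF H1_add[OF assms]]])
     (intro has_weak_gradient_add H1_L2 weak_grad assms)

lemma weak_grad_scale:
  assumes "u \<in> H1 \<Omega>"
  shows "AE x in lebesgue_on \<Omega>. weak_grad \<Omega> (\<lambda>x. c * u x) x = c *\<^sub>R weak_grad \<Omega> u x"
  by (rule has_weak_gradient_unique[OF weak_grad[OF H1_scale[OF assms]]])
     (intro has_weak_gradient_scale weak_grad assms)

text \<open>The square of \<open>h1_norm\<close>. Bounds with a factor \<open>2\<close> on squares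
  take the place of the triangle inequality, which is enough for approximation arguments.\<close>

definition h1sq :: "(real^'n \<Rightarrow> real) \<Rightarrow> real" where
  "h1sq v = l2_inner \<Omega> v v + (\<Sum>i\<in>UNIV. l2_inner \<Omega> (\<lambda>x. weak_grad \<Omega> v x $ i) (\<lambda>x. weak_grad \<Omega> v x $ i))"

lemma h1_norm_sq: "h1_norm \<Omega> v = sqrt (h1sq v)"
  unfolding h1_norm_def h1sq_def l2_norm_def by (simp add: l2_inner_nonneg)

lemma h1sq_nonneg: "0 \<le> h1sq v"
  unfolding h1sq_def by (intro add_nonneg_nonneg sum_nonneg l2_inner_nonneg)

lemma l2_inner_add_le:
  assumes "u \<in> L2 \<Omega>" "v \<in> L2 \<Omega>"
  shows "l2_inner \<Omega> (\<lambda>x. u x + v x) (\<lambda>x. u x + v x) \<le> 2 * l2_inner \<Omega> u u + 2 * l2_inner \<Omega> v v"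
proof -
  have "l2_inner \<Omega> (\<lambda>x. u x + v x) (\<lambda>x. u x + v x) \<le> (\<integral>x. 2 * (u x * u x) + 2 * (v x * v x) \<partial>lebesgue_on \<Omega>)"
    unfolding l2_inner_def
  proof (rule integral_mono)
    show "integrable (lebesgue_on \<Omega>) (\<lambda>x. (u x + v x) * (u x + v x))" by (intro L2_product L2_add assms)
    show "integrable (lebesgue_on \<Omega>) (\<lambda>x. 2 * (u x * u x) + 2 * (v x * v x))"
      by (intro Bochner_Integration.integrable_add integrable_mult_right L2_product assms)
    fix x show "(u x + v x) * (u x + v x) \<le> 2 * (u x * u x) + 2 * (v x * v x)"
      using zero_le_power2[of "u x - v x"] by (simp add: power2_eq_square algebra_simps)
  qed
  also have "\<dots> = 2 * l2_inner \<Omega> u u + 2 * l2_inner \<Omega> v v" using assms by (simp add: l2_inner_def L2_product)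
  finally show ?thesis .
qed

lemma l2_inner_cong_AE:
  assumes "AE x in lebesgue_on \<Omega>. u x = v x" "u \<in> L2 \<Omega>" "v \<in> L2 \<Omega>"
  shows "l2_inner \<Omega> u u = l2_inner \<Omega> v v"
  unfolding l2_inner_def
  by (rule integral_cong_AE) (use assms in \<open>auto simp: L2_def\<close>)

lemma h1sq_add_le:
  assumes "u \<in> H1 \<Omega>" "v \<in> H1 \<Omega>"
  shows "h1sq (\<lambda>x. u x + v x) \<le> 2 * h1sq u + 2 * h1sq v"
proof -
  let ?g = "\<lambda>w i x. weak_grad \<Omega> w x $ i"
  have "l2_inner \<Omega> (?g (\<lambda>x. u x + v x) i) (?g (\<lambda>x. u x + v x) i) \<le> 2 * l2_inner \<Omega> (?g u i) (?g u i) + 2 * l2_inner \<Omega> (?g v i) (?g v i)" for i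
  proof -
    have "AE x in lebesgue_on \<Omega>. ?g (\<lambda>x. u x + v x) i x = ?g u i x + ?g v i x"
      using weak_grad_add[OF assms] by eventually_elim simp
    hence "l2_inner \<Omega> (?g (\<lambda>x. u x + v x) i) (?g (\<lambda>x. u x + v x) i) = l2_inner \<Omega> (\<lambda>x. ?g u i x + ?g v i x) (\<lambda>x. ?g u i x + ?g v i x)"
      by (intro l2_inner_cong_AE weak_grad_L2 H1_add L2_add assms)
    thus ?thesis using l2_inner_add_le[OF weak_grad_L2[OF assms(1)] weak_grad_L2[OF assms(2)]] by simp
  qed
  hence "(\<Sum>i\<in>UNIV. l2_inner \<Omega> (?g (\<lambda>x. u x + v x) i) (?g (\<lambda>x. u x + v x) i)) \<le> (\<Sum>i\<in>UNIV. 2 * l2_inner \<Omega> (?g u i) (?g u i) + 2 * l2_inner \<Omega> (?g v i) (?g v i))"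
    by (intro sum_mono)
  also have "\<dots> = 2 * (\<Sum>i\<in>UNIV. l2_inner \<Omega> (?g u i) (?g u i)) + 2 * (\<Sum>i\<in>UNIV. l2_inner \<Omega> (?g v i) (?g v i))"
    by (simp add: sum.distrib sum_distrib_left)
  finally show ?thesis using l2_inner_add_le[OF H1_L2[OF assms(1)] H1_L2[OF assms(2)]] unfolding h1sq_def distrib_left by linarith
qed

lemma h1sq_scale:
  assumes "u \<in> H1 \<Omega>"
  shows "h1sq (\<lambda>x. c * u x) = c\<^sup>2 * h1sq u"
proof -
  let ?g = "\<lambda>w i x. weak_grad \<Omega> w x $ i"
  have sq: "l2_inner \<Omega> (\<lambda>x. c * w x) (\<lambda>x. c * w x) = c\<^sup>2 * l2_inner \<Omega> w w" for w
  proof -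
    have "(\<lambda>x. c * w x * (c * w x)) = (\<lambda>x. c\<^sup>2 * (w x * w x))" by (simp add: power2_eq_square mult_ac)
    thus ?thesis unfolding l2_inner_def by simp
  qed
  have "l2_inner \<Omega> (?g (\<lambda>x. c * u x) i) (?g (\<lambda>x. c * u x) i) = c\<^sup>2 * l2_inner \<Omega> (?g u i) (?g u i)" for i
  proof -
    have "AE x in lebesgue_on \<Omega>. ?g (\<lambda>x. c * u x) i x = c * ?g u i x"
      using weak_grad_scale[OF assms, of c] by eventually_elim simp
    hence "l2_inner \<Omega> (?g (\<lambda>x. c * u x) i) (?g (\<lambda>x. c * u x) i) = l2_inner \<Omega> (\<lambda>x. c * ?g u i x) (\<lambda>x. c * ?g u i x)"
      by (intro l2_inner_cong_AE weak_grad_L2 H1_scale L2_scale assms)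
    thus ?thesis by (simp add: sq)
  qed
  thus ?thesis unfolding h1sq_def sq by (simp add: sum_distrib_left distrib_left)
qed

lemma H1_diff: "u \<in> H1 \<Omega> \<Longrightarrow> v \<in> H1 \<Omega> \<Longrightarrow> (\<lambda>x. u x - v x) \<in> H1 \<Omega>"
  using H1_add[of u "\<lambda>x. -1 * v x"] H1_scale[of v "-1"] by simp

lemma H1_0_iff: "v \<in> H1_0 \<Omega> \<longleftrightarrow> v \<in> H1 \<Omega> \<and> (\<forall>\<epsilon>>0. \<exists>\<phi>. test_function \<Omega> \<phi> \<and> h1sq (\<lambda>x. v x - \<phi> x) < \<epsilon>)"
proof -
  have "(\<forall>\<epsilon>>0. \<exists>\<phi>. test_function \<Omega> \<phi> \<and> sqrt (h1sq (\<lambda>x. v x - \<phi> x)) < \<epsilon>) \<longleftrightarrow> (\<forall>\<epsilon>>0. \<exists>\<phi>. test_function \<Omega> \<phi> \<and> h1sq (\<lambda>x. v x - \<phi> x) < \<epsilon>)"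
    (is "?A \<longleftrightarrow> ?B")
  proof
    assume A: ?A
    show ?B
    proof (intro allI impI)
      fix \<epsilon> :: real assume e: "0 < \<epsilon>"
      then obtain \<phi> where "test_function \<Omega> \<phi>" "sqrt (h1sq (\<lambda>x. v x - \<phi> x)) < sqrt \<epsilon>" using A by (metis real_sqrt_gt_zero)
      thus "\<exists>\<phi>. test_function \<Omega> \<phi> \<and> h1sq (\<lambda>x. v x - \<phi> x) < \<epsilon>" by auto
    qed
  next
    assume B: ?B
    show ?A
    proof (intro allI impI)
      fix \<epsilon> :: real assume e: "0 < \<epsilon>"
      then obtain \<phi> where p: "test_function \<Omega> \<phi>" "h1sq (\<lambda>x. v x - \<phi> x) < \<epsilon>\<^sup>2" using B by (metis zero_less_power)
      have "sqrt (h1sq (\<lambda>x. v x - \<phi> x)) < sqrt (\<epsilon>\<^sup>2)" using p(2) by (rule real_sqrt_less_mono)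
      thus "\<exists>\<phi>. test_function \<Omega> \<phi> \<and> sqrt (h1sq (\<lambda>x. v x - \<phi> x)) < \<epsilon>" using p(1) e by auto
    qed
  qed
  thus ?thesis by (simp add: H1_0_def h1_norm_sq)
qed

lemma H1_0_add:
  assumes "u \<in> H1_0 \<Omega>" "v \<in> H1_0 \<Omega>"
  shows "(\<lambda>x. u x + v x) \<in> H1_0 \<Omega>"
  unfolding H1_0_iff
proof (intro conjI allI impI)
  have uv: "u \<in> H1 \<Omega>" "v \<in> H1 \<Omega>" using assms by (auto simp: H1_0_iff)
  show "(\<lambda>x. u x + v x) \<in> H1 \<Omega>" by (rule H1_add[OF uv])
  fix \<epsilon> :: real assume e: "0 < \<epsilon>"
  \<comment> \<open>Two errors, each doubled by \<open>h1sq_add_le\<close>.\<close>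
  have "0 < \<epsilon> / 4" using e by simp
  then obtain \<phi> \<psi> where p: "test_function \<Omega> \<phi>" "h1sq (\<lambda>x. u x - \<phi> x) < \<epsilon> / 4" "test_function \<Omega> \<psi>" "h1sq (\<lambda>x. v x - \<psi> x) < \<epsilon> / 4"
    using assms unfolding H1_0_iff by blast
  have "h1sq (\<lambda>x. (u x - \<phi> x) + (v x - \<psi> x)) \<le> 2 * h1sq (\<lambda>x. u x - \<phi> x) + 2 * h1sq (\<lambda>x. v x - \<psi> x)"
    by (intro h1sq_add_le H1_diff uv H1_test p)
  hence "h1sq (\<lambda>x. (u x - \<phi> x) + (v x - \<psi> x)) < \<epsilon>" using p by linarith
  moreover have "(\<lambda>x. (u x - \<phi> x) + (v x - \<psi> x)) = (\<lambda>x. (u x + v x) - (\<phi> x + \<psi> x))" by auto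
  ultimately show "\<exists>\<phi>. test_function \<Omega> \<phi> \<and> h1sq (\<lambda>x. u x + v x - \<phi> x) < \<epsilon>"
    using test_function_add[OF p(1) p(3)] by (intro exI[of _ "\<lambda>x. \<phi> x + \<psi> x"]) simp
qed

lemma H1_0_scale:
  assumes "u \<in> H1_0 \<Omega>"
  shows "(\<lambda>x. c * u x) \<in> H1_0 \<Omega>"
  unfolding H1_0_iff
proof (intro conjI allI impI)
  have u: "u \<in> H1 \<Omega>" using assms by (auto simp: H1_0_iff)
  show "(\<lambda>x. c * u x) \<in> H1 \<Omega>" by (rule H1_scale[OF u])
  fix \<epsilon> :: real assume e: "0 < \<epsilon>"
  \<comment> \<open>The added \<open>1\<close> admits \<open>c = 0\<close>.\<close>
  have "0 < \<epsilon> / (c\<^sup>2 + 1)" using e by (simp add: add_nonneg_pos)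
  then obtain \<phi> where p: "test_function \<Omega> \<phi>" "h1sq (\<lambda>x. u x - \<phi> x) < \<epsilon> / (c\<^sup>2 + 1)"
    using assms unfolding H1_0_iff by blast
  have "h1sq (\<lambda>x. c * (u x - \<phi> x)) = c\<^sup>2 * h1sq (\<lambda>x. u x - \<phi> x)" by (intro h1sq_scale H1_diff u H1_test p)
  also have "\<dots> \<le> (c\<^sup>2 + 1) * h1sq (\<lambda>x. u x - \<phi> x)" using h1sq_nonneg by (intro mult_right_mono) auto
  also have "\<dots> < (c\<^sup>2 + 1) * (\<epsilon> / (c\<^sup>2 + 1))" using p(2) by (intro mult_strict_left_mono) (auto simp: add_nonneg_pos)
  also have "\<dots> = \<epsilon>" using add_nonneg_pos[of "c\<^sup>2" 1] by simp
  finally have "h1sq (\<lambda>x. c * u x - c * \<phi> x) < \<epsilon>" by (simp add: right_diff_distrib)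
  thus "\<exists>\<phi>. test_function \<Omega> \<phi> \<and> h1sq (\<lambda>x. c * u x - \<phi> x) < \<epsilon>"
    using test_function_cmult[OF p(1), of c] by (intro exI[of _ "\<lambda>x. c * \<phi> x"]) simp
qed

lemma H1_0_zero: "(\<lambda>x. 0) \<in> H1_0 \<Omega>"
proof -
  have t: "test_function \<Omega> (\<lambda>x. 0)" by (rule test_function_zero)
  have "h1sq (\<lambda>x::real^'n. 0 * 0) = 0\<^sup>2 * h1sq (\<lambda>x. 0)" by (rule h1sq_scale[OF H1_test[OF t]])
  hence "h1sq (\<lambda>x. 0) = 0" by simp
  thus ?thesis unfolding H1_0_iff using H1_test[OF t] t by (intro conjI allI impI exI[of _ "\<lambda>x. 0"]) auto
qed

end

section \<open>The finite element space\<close>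

lemma integrable_bounded_mult:
  fixes f b :: "'a \<Rightarrow> real"
  assumes f: "integrable M f" and b: "b \<in> borel_measurable M" "\<And>x. x \<in> space M \<Longrightarrow> \<bar>b x\<bar> \<le> B"
  shows "integrable M (\<lambda>x. b x * f x)"
proof (rule Bochner_Integration.integrable_bound)
  show "integrable M (\<lambda>x. B * f x)" using f by simp
  show "(\<lambda>x. b x * f x) \<in> borel_measurable M" by (intro borel_measurable_times b borel_measurable_integrable[OF f])
  have "\<bar>b x * f x\<bar> \<le> \<bar>B * f x\<bar>" if "x \<in> space M" for x
    using b(2)[OF that] unfolding abs_mult by (intro mult_right_mono) auto
  thus "AE x in M. norm (b x * f x) \<le> norm (B * f x)" by (intro AE_I2) simp
qed

locale elliptic = bounded_open \<Omega> for \<Omega> :: "(real^'n) set" +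
  fixes a :: "real^'n \<Rightarrow> real^'n^'n" and q :: "real^'n \<Rightarrow> real"
  assumes elliptic: "elliptic_operator \<Omega> a q"
begin

abbreviation "integrand u v \<equiv> (\<lambda>x. (a x *v weak_grad \<Omega> u x) \<bullet> weak_grad \<Omega> v x + q x * u x * v x)"

text \<open>In components the integrand is a sum of bounded coefficients times products of
  square-integrable functions.\<close>

lemma integrand_integrable:
  assumes u: "u \<in> H1 \<Omega>" and v: "v \<in> H1 \<Omega>"
  shows "integrable (lebesgue_on \<Omega>) (integrand u v)"
proof -
  obtain B where B: "\<And>x. x \<in> \<Omega> \<Longrightarrow> norm (a x) \<le> B" using elliptic by (auto simp: elliptic_operator_def bounded_iff)
  obtain B' where B': "\<And>x. x \<in> \<Omega> \<Longrightarrow> \<bar>q x\<bar> \<le> B'" using elliptic by (auto simp: elliptic_operator_def bounded_iff)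
  have ij: "integrable (lebesgue_on \<Omega>) (\<lambda>x. a x $ i $ j * (weak_grad \<Omega> u x $ j * weak_grad \<Omega> v x $ i))" for i j
  proof (rule integrable_bounded_mult)
    show "integrable (lebesgue_on \<Omega>) (\<lambda>x. weak_grad \<Omega> u x $ j * weak_grad \<Omega> v x $ i)" by (intro L2_product weak_grad_L2 u v)
    have am: "a \<in> borel_measurable (lebesgue_on \<Omega>)" using elliptic by (simp add: elliptic_operator_def)
    have "continuous_on UNIV (\<lambda>A::real^'n^'n. A $ i $ j)" by (intro continuous_intros)
    from borel_measurable_continuous_on[OF this am] show "(\<lambda>x. a x $ i $ j) \<in> borel_measurable (lebesgue_on \<Omega>)" .
    fix x assume "x \<in> space (lebesgue_on \<Omega>)"
    hence "norm (a x) \<le> B" using B by simp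
    thus "\<bar>a x $ i $ j\<bar> \<le> B" using component_le_norm_cart[of "a x $ i" j] Finite_Cartesian_Product.norm_nth_le[of "a x" i] by simp
  qed
  have "integrable (lebesgue_on \<Omega>) (\<lambda>x. q x * (u x * v x))"
    by (rule integrable_bounded_mult[where B = B']) (use elliptic B' in \<open>auto simp: elliptic_operator_def intro!: L2_product H1_L2 u v\<close>)
  moreover have "integrable (lebesgue_on \<Omega>) (\<lambda>x. \<Sum>i\<in>UNIV. \<Sum>j\<in>UNIV. a x $ i $ j * (weak_grad \<Omega> u x $ j * weak_grad \<Omega> v x $ i))"
    by (intro Bochner_Integration.integrable_sum ij)
  moreover have "integrand u v = (\<lambda>x. (\<Sum>i\<in>UNIV. \<Sum>j\<in>UNIV. a x $ i $ j * (weak_grad \<Omega> u x $ j * weak_grad \<Omega> v x $ i)) + q x * (u x * v x))"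
    by (simp add: inner_vec_def matrix_vector_mult_def sum_distrib_right mult.assoc)
  ultimately show ?thesis by simp
qed

lemma form_add:
  assumes "u \<in> H1 \<Omega>" "v \<in> H1 \<Omega>" "w \<in> H1 \<Omega>"
  shows "elliptic_form \<Omega> a q (\<lambda>x. u x + v x) w = elliptic_form \<Omega> a q u w + elliptic_form \<Omega> a q v w"
proof -
  have "AE x in lebesgue_on \<Omega>. integrand (\<lambda>x. u x + v x) w x = integrand u w x + integrand v w x"
    using weak_grad_add[OF assms(1,2)]
    by eventually_elim (simp add: matrix_vector_right_distrib inner_add_left algebra_simps)
  hence "(\<integral>x. integrand (\<lambda>x. u x + v x) w x \<partial>lebesgue_on \<Omega>) = (\<integral>x. integrand u w x + integrand v w x \<partial>lebesgue_on \<Omega>)"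
    by (intro integral_cong_AE borel_measurable_integrable Bochner_Integration.integrable_add integrand_integrable H1_add assms)
  also have "\<dots> = (\<integral>x. integrand u w x \<partial>lebesgue_on \<Omega>) + (\<integral>x. integrand v w x \<partial>lebesgue_on \<Omega>)"
    by (intro Bochner_Integration.integral_add integrand_integrable assms)
  finally show ?thesis by (simp add: elliptic_form_def)
qed

lemma form_scale:
  assumes "u \<in> H1 \<Omega>" "w \<in> H1 \<Omega>"
  shows "elliptic_form \<Omega> a q (\<lambda>x. c * u x) w = c * elliptic_form \<Omega> a q u w"
proof -
  have "AE x in lebesgue_on \<Omega>. integrand (\<lambda>x. c * u x) w x = c * integrand u w x"
    using weak_grad_scale[OF assms(1), of c]
    by eventually_elim (simp add: matrix_vector_mult_scaleR algebra_simps)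
  hence "(\<integral>x. integrand (\<lambda>x. c * u x) w x \<partial>lebesgue_on \<Omega>) = (\<integral>x. c * integrand u w x \<partial>lebesgue_on \<Omega>)"
    by (intro integral_cong_AE borel_measurable_integrable integrable_mult_right integrand_integrable H1_scale assms)
  also have "\<dots> = c * (\<integral>x. integrand u w x \<partial>lebesgue_on \<Omega>)" by (rule integral_mult_right_zero)
  finally show ?thesis by (simp add: elliptic_form_def)
qed

lemma form_sym: "elliptic_form \<Omega> a q u v = elliptic_form \<Omega> a q v u"
  unfolding elliptic_form_def
proof (rule Bochner_Integration.integral_cong[OF refl])
  fix x assume "x \<in> space (lebesgue_on \<Omega>)"
  hence t: "transpose (a x) = a x" using elliptic by (simp add: elliptic_operator_def)
  have "(a x *v weak_grad \<Omega> u x) \<bullet> weak_grad \<Omega> v x = (weak_grad \<Omega> u x v* a x) \<bullet> weak_grad \<Omega> v x"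
    using t transpose_matrix_vector[of "a x"] by metis
  also have "\<dots> = weak_grad \<Omega> u x \<bullet> (a x *v weak_grad \<Omega> v x)" by (rule dot_lmul_matrix)
  finally show "integrand u v x = integrand v u x" by (simp add: inner_commute mult_ac)
qed

end

context bounded_open
begin

text \<open>The points are the vertices of all simplices: an affine function vanishing at the
  vertices vanishes on their hull. Definiteness uses that the elements are continuous and zero
  outside \<open>\<Omega>\<close>, so that a nonzero value persists on an open subset of
  \<open>\<Omega>\<close>, which is not negligible.\<close>

lemma fe_fin_inner:
  assumes "regular_triangulation \<Omega> \<kappa> h \<T>"
  obtains P where "fin_inner (fe_space \<Omega> \<T>) (l2_inner \<Omega>) P"
proof -
  have fin: "finite \<T>" and simp: "\<And>K. K \<in> \<T> \<Longrightarrow> int CARD('n) simplex K"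
    using assms by (auto simp: regular_triangulation_def triangulation_def)
  have "\<forall>K\<in>\<T>. \<exists>C. finite C \<and> K = convex hull C" using simp unfolding simplex by blast
  from bchoice[OF this] obtain C where "\<forall>K\<in>\<T>. finite (C K) \<and> K = convex hull (C K)" by (elim exE)
  hence CK: "finite (C K) \<and> K = convex hull (C K)" if "K \<in> \<T>" for K using that by (rule bspec)
  note C = CK[THEN conjunct1] CK[THEN conjunct2]
  have VL: "v \<in> L2 \<Omega>" if "v \<in> fe_space \<Omega> \<T>" for v using that by (auto simp: fe_space_def H1_0_def H1_def)
  have aff: "\<exists>g b. \<forall>x\<in>K. v x = g \<bullet> x + b" if "v \<in> fe_space \<Omega> \<T>" "K \<in> \<T>" for v K
    using that by (simp add: fe_space_def affine_fun_on_def)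
  have "fin_inner (fe_space \<Omega> \<T>) (l2_inner \<Omega>) (\<Union>K\<in>\<T>. C K)"
  proof
    show "(\<lambda>x. 0) \<in> fe_space \<Omega> \<T>"
      by (auto simp: fe_space_def H1_0_zero affine_fun_on_def intro!: exI[of _ 0])
    show "(\<lambda>x. u x + v x) \<in> fe_space \<Omega> \<T>" if u: "u \<in> fe_space \<Omega> \<T>" and v: "v \<in> fe_space \<Omega> \<T>" for u v
    proof -
      have "affine_fun_on K (\<lambda>x. u x + v x)" if K: "K \<in> \<T>" for K
      proof -
        obtain g b where "\<forall>x\<in>K. u x = g \<bullet> x + b" using aff[OF u K] by (elim exE)
        moreover obtain g' b' where "\<forall>x\<in>K. v x = g' \<bullet> x + b'" using aff[OF v K] by (elim exE)
        ultimately show ?thesis unfolding affine_fun_on_def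
          by (intro exI[of _ "g + g'"] exI[of _ "b + b'"]) (auto simp: inner_add_left)
      qed
      thus ?thesis using u v unfolding fe_space_def by (auto intro: H1_0_add continuous_intros)
    qed
    show "(\<lambda>x. c * u x) \<in> fe_space \<Omega> \<T>" if u: "u \<in> fe_space \<Omega> \<T>" for c u
    proof -
      have "affine_fun_on K (\<lambda>x. c * u x)" if K: "K \<in> \<T>" for K
      proof -
        obtain g b where "\<forall>x\<in>K. u x = g \<bullet> x + b" using aff[OF u K] by (elim exE)
        thus ?thesis unfolding affine_fun_on_def
          by (intro exI[of _ "c *\<^sub>R g"] exI[of _ "c * b"]) (auto simp: distrib_left)
      qed
      thus ?thesis using u unfolding fe_space_def by (auto intro: H1_0_scale continuous_intros)
    qed
    show "l2_inner \<Omega> (\<lambda>x. u x + v x) w = l2_inner \<Omega> u w + l2_inner \<Omega> v w"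
      if "u \<in> fe_space \<Omega> \<T>" "v \<in> fe_space \<Omega> \<T>" "w \<in> fe_space \<Omega> \<T>" for u v w
      using that by (intro l2_inner_add VL)
    show "l2_inner \<Omega> (\<lambda>x. c * u x) w = c * l2_inner \<Omega> u w" for c u w by (rule l2_inner_scale)
    show "l2_inner \<Omega> u v = l2_inner \<Omega> v u" for u v by (rule l2_inner_sym)
    show "finite (\<Union>K\<in>\<T>. C K)" using fin C by auto
    show "0 < l2_inner \<Omega> u u" if u: "u \<in> fe_space \<Omega> \<T>" and u0: "u \<noteq> (\<lambda>x. 0)" for u
    proof (rule ccontr)
      assume "\<not> 0 < l2_inner \<Omega> u u"
      hence "l2_inner \<Omega> u u = 0" using l2_inner_nonneg[of u] by simp
      hence "AE x in lebesgue_on \<Omega>. u x * u x = 0"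
        unfolding l2_inner_def
        by (subst (asm) integral_nonneg_eq_0_iff_AE) (auto intro!: L2_product VL u)
      hence ae: "AE x in lebesgue. x \<in> \<Omega> \<longrightarrow> u x = 0"
        using \<Omega>_sets by (subst (asm) AE_restrict_space_iff) auto
      define S where "S = {x \<in> \<Omega>. u x \<noteq> 0}"
      have c: "continuous_on UNIV u" using u by (simp add: fe_space_def)
      have "S = \<Omega> \<inter> (u -` (- {0}))" by (auto simp: S_def)
      moreover have "open (u -` (- {0}))" using c by (intro open_vimage) auto
      ultimately have S: "open S" using \<Omega> by auto
      obtain x where "u x \<noteq> 0" using u0 by auto
      hence "x \<in> S" using u by (auto simp: S_def fe_space_def)
      hence "\<not> negligible S" using S open_not_negligible by blast
      moreover have "S \<in> null_sets lebesgue"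
      proof -
        have "AE x in lebesgue. x \<notin> S" using ae by eventually_elim (auto simp: S_def)
        moreover have "S \<in> sets lebesgue" using S by auto
        ultimately show ?thesis by (simp add: AE_iff_null_sets)
      qed
      ultimately show False by (simp add: negligible_iff_null_sets)
    qed
    show "u = (\<lambda>x. 0)" if u: "u \<in> fe_space \<Omega> \<T>" and z: "\<forall>p\<in>\<Union>K\<in>\<T>. C K. u p = 0" for u
    proof
      fix x
      show "u x = 0"
      proof (cases "x \<in> \<Union>\<T>")
        case True
        then obtain K where K: "K \<in> \<T>" "x \<in> K" by blast
        obtain g b where gb: "\<forall>x\<in>K. u x = g \<bullet> x + b" using aff[OF u K(1)] by (elim exE)
        have "C K \<subseteq> {y. g \<bullet> y = - b}"
        proof
          fix p assume p: "p \<in> C K"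
          hence "p \<in> K" using C(2)[OF K(1)] hull_subset[of "C K" convex] by blast
          moreover have "u p = 0" using z p K by blast
          ultimately show "p \<in> {y. g \<bullet> y = - b}" using bspec[OF gb, of p] by simp
        qed
        hence "convex hull (C K) \<subseteq> {y. g \<bullet> y = - b}" by (rule hull_minimal) (rule convex_hyperplane)
        moreover have "x \<in> convex hull (C K)" using K(2) C(2)[OF K(1)] by metis
        ultimately have "g \<bullet> x = - b" by blast
        thus ?thesis using bspec[OF gb K(2)] by simp
      qed (use u in \<open>auto simp: fe_space_def\<close>)
    qed
  qed
  thus ?thesis by (rule that)
qed

text \<open>The initial value belongs to \<open>L2\<close> and in general not to the span of the
  \<open>e i\<close>, so the argument runs in \<open>L2\<close> itself: the components of
  \<open>w\<close> are subtracted one at a time, each lowering the squared norm by its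
  square.\<close>

lemma bessel:
  fixes e :: "nat \<Rightarrow> real^'n \<Rightarrow> real"
  assumes w: "w \<in> L2 \<Omega>" and e: "\<And>i. i < n \<Longrightarrow> e i \<in> L2 \<Omega>"
    and on: "\<And>i j. i < n \<Longrightarrow> j < n \<Longrightarrow> l2_inner \<Omega> (e i) (e j) = (if i = j then 1 else 0)"
  shows "(\<Sum>i<n. (l2_inner \<Omega> w (e i))\<^sup>2) \<le> l2_inner \<Omega> w w"
proof -
  have "\<exists>r\<in>L2 \<Omega>. (\<forall>i<m. l2_inner \<Omega> r (e i) = 0) \<and> (\<forall>i<n. m \<le> i \<longrightarrow> l2_inner \<Omega> r (e i) = l2_inner \<Omega> w (e i)) \<and>
    l2_inner \<Omega> w w = l2_inner \<Omega> r r + (\<Sum>i<m. (l2_inner \<Omega> w (e i))\<^sup>2)" if "m \<le> n" for m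
    using that
  proof (induction m)
    case 0
    thus ?case using w by (intro bexI[of _ w]) auto
  next
    case (Suc m)
    then obtain r where r: "r \<in> L2 \<Omega>" "\<And>i. i < m \<Longrightarrow> l2_inner \<Omega> r (e i) = 0"
      "\<And>i. i < n \<Longrightarrow> m \<le> i \<Longrightarrow> l2_inner \<Omega> r (e i) = l2_inner \<Omega> w (e i)"
      "l2_inner \<Omega> w w = l2_inner \<Omega> r r + (\<Sum>i<m. (l2_inner \<Omega> w (e i))\<^sup>2)" by auto
    define c where "c = l2_inner \<Omega> w (e m)"
    define s where "s = (\<lambda>x. r x + (- c) * e m x)"
    have em: "(\<lambda>x. (- c) * e m x) \<in> L2 \<Omega>" using e Suc.prems by (intro L2_scale) auto
    have s: "s \<in> L2 \<Omega>" unfolding s_def by (intro L2_add r em)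
    have ip: "l2_inner \<Omega> s v = l2_inner \<Omega> r v - c * l2_inner \<Omega> (e m) v" if "v \<in> L2 \<Omega>" for v
      unfolding s_def using l2_inner_add[OF r(1) em that] l2_inner_scale[of "- c" "e m" v] by simp
    have rm: "l2_inner \<Omega> r (e m) = c" using r(3)[of m] Suc.prems by (simp add: c_def)
    have "l2_inner \<Omega> s s = l2_inner \<Omega> r s - c * l2_inner \<Omega> (e m) s" by (rule ip[OF s])
    also have "\<dots> = l2_inner \<Omega> s r - c * l2_inner \<Omega> s (e m)" by (simp only: l2_inner_sym)
    also have "\<dots> = l2_inner \<Omega> r r - c * l2_inner \<Omega> r (e m)"
      using ip[OF r(1)] ip[of "e m"] rm on[of m m] e[of m] Suc.prems l2_inner_sym[of "e m" r] by simp
    also have "\<dots> = l2_inner \<Omega> r r - c\<^sup>2" using rm by (simp add: power2_eq_square)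
    finally have "l2_inner \<Omega> r r = l2_inner \<Omega> s s + c\<^sup>2" by simp
    moreover have "l2_inner \<Omega> s (e i) = 0" if "i < Suc m" for i
      using ip[of "e i"] rm r(2)[of i] on[of m i] e[of i] Suc.prems that by (auto simp: less_Suc_eq)
    moreover have "l2_inner \<Omega> s (e i) = l2_inner \<Omega> w (e i)" if "i < n" "Suc m \<le> i" for i
      using ip[of "e i"] r(3)[of i] on[of m i] e[of i] Suc.prems that by simp
    ultimately show ?case using s r(4) by (intro bexI[of _ s]) (auto simp: c_def)
  qed
  from this[of n] obtain r where "l2_inner \<Omega> w w = l2_inner \<Omega> r r + (\<Sum>i<n. (l2_inner \<Omega> w (e i))\<^sup>2)" by auto
  thus ?thesis using l2_inner_nonneg[of r] by simp
qed

end

section \<open>The error estimate\<close>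

text \<open>Packages the eigenbasis as functionals \<open>\<Sum>p\<in>P. d i p * v p\<close> that
  read off the \<open>i\<close>-th coordinate from point values. They diagonalize
  \<open>discrete_op\<close>, satisfy Parseval on the space, and obey Bessel's inequality for
  projections; positive definiteness of the form makes the eigenvalues positive.\<close>

lemma (in elliptic) spectral_functionals:
  assumes tri: "regular_triangulation \<Omega> \<kappa> h \<T>" and pos: "positive_definite_operator \<Omega> a q"
  obtains m :: nat and P d l where
    "finite P" "\<And>i. i < m \<Longrightarrow> 0 < l i"
    "\<And>i v. i < m \<Longrightarrow> v \<in> fe_space \<Omega> \<T> \<Longrightarrow> (\<Sum>p\<in>P. d i p * discrete_op \<Omega> a q \<T> v p) = l i * (\<Sum>p\<in>P. d i p * v p)"
    "\<And>w. w \<in> L2 \<Omega> \<Longrightarrow> (\<Sum>i<m. (\<Sum>p\<in>P. d i p * l2_proj \<Omega> \<T> w p)\<^sup>2) \<le> l2_inner \<Omega> w w"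
    "\<And>v. v \<in> fe_space \<Omega> \<T> \<Longrightarrow> l2_inner \<Omega> v v = (\<Sum>i<m. (\<Sum>p\<in>P. d i p * v p)\<^sup>2)"
    "l2_proj \<Omega> \<T> (\<lambda>x. 0) = (\<lambda>x. 0)"
    "\<And>u v. u \<in> fe_space \<Omega> \<T> \<Longrightarrow> v \<in> fe_space \<Omega> \<T> \<Longrightarrow> (\<lambda>x. u x - v x) \<in> fe_space \<Omega> \<T>"
proof -
  let ?V = "fe_space \<Omega> \<T>" and ?ip = "l2_inner \<Omega>" and ?A = "elliptic_form \<Omega> a q"
  obtain P where "fin_inner ?V ?ip P" by (rule fe_fin_inner[OF tri])
  then interpret V: fin_inner ?V ?ip P .
  have VH0: "v \<in> H1_0 \<Omega>" if "v \<in> ?V" for v using that by (simp add: fe_space_def)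
  have VH: "v \<in> H1 \<Omega>" if "v \<in> ?V" for v using VH0[OF that] by (simp add: H1_0_def)
  have VL: "v \<in> L2 \<Omega>" if "v \<in> ?V" for v using VH[OF that] by (rule H1_L2)
  obtain m e l where e: "V.onb m e" and ex: "\<And>v. v \<in> ?V \<Longrightarrow> v = (\<lambda>x. \<Sum>i<m. ?ip v (e i) * e i x)"
    and l: "\<And>i v. i < m \<Longrightarrow> v \<in> ?V \<Longrightarrow> ?A (e i) v = l i * ?ip (e i) v"
    by (rule V.eigenbasis_exists[of ?A]) (use VH in \<open>auto intro: form_add form_scale form_sym\<close>)
  have eV: "e i \<in> ?V" if "i < m" for i using e that by (auto simp: V.onb_def)
  have on: "?ip (e i) (e j) = (if i = j then 1 else 0)" if "i < m" "j < m" for i j using e that by (auto simp: V.onb_def)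
  have coord: "?ip (\<lambda>x. \<Sum>i<m. c i * e i x) (e j) = c j" if j: "j < m" for c j
  proof -
    have "?ip (\<lambda>x. \<Sum>i<m. c i * e i x) (e j) = (\<Sum>i<m. c i * ?ip (e i) (e j))" by (rule V.ip_lincomb[OF eV eV[OF j]])
    also have "\<dots> = (\<Sum>i<m. if i = j then c j else 0)" using on j by (intro sum.cong) auto
    also have "\<dots> = c j" using j by simp
    finally show ?thesis .
  qed
  have "\<exists>d. \<forall>v\<in>?V. ?ip v (e i) = (\<Sum>p\<in>P. d p * v p)" if i: "i < m" for i
  proof -
    obtain d where "\<And>v. v \<in> ?V \<Longrightarrow> ?ip v (e i) = (\<Sum>p\<in>P. d p * v p)"
      by (rule V.functional_pointwise[of "\<lambda>v. ?ip v (e i)"]) (use V.ip_add V.ip_scale eV[OF i] in auto)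
    thus ?thesis by blast
  qed
  then obtain d where d: "\<And>i v. i < m \<Longrightarrow> v \<in> ?V \<Longrightarrow> (\<Sum>p\<in>P. d i p * v p) = ?ip v (e i)" by metis
  have proj: "l2_proj \<Omega> \<T> w = (\<lambda>x. \<Sum>i<m. ?ip w (e i) * e i x)" if w: "w \<in> L2 \<Omega>" for w
    unfolding l2_proj_def
    by (rule V.riesz_the[of "?ip w", OF _ _ e ex])
       (simp_all add: l2_inner_sym[of w] l2_inner_add l2_inner_scale VL w)
  have disc: "discrete_op \<Omega> a q \<T> v = (\<lambda>x. \<Sum>i<m. ?A v (e i) * e i x)" if v: "v \<in> ?V" for v
    unfolding discrete_op_def
    by (rule V.riesz_the[of "?A v", OF _ _ e ex])
       (simp_all add: form_sym[of v] form_add form_scale VH v)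
  have lin: "(\<lambda>x. \<Sum>i<m. c i * e i x) \<in> ?V" for c by (rule V.lincomb[OF eV])
  have c_proj: "(\<Sum>p\<in>P. d i p * l2_proj \<Omega> \<T> w p) = ?ip w (e i)" if "i < m" "w \<in> L2 \<Omega>" for i w
    unfolding proj[OF that(2)] d[OF that(1) lin] by (rule coord[OF that(1)])
  show ?thesis
  proof (rule that[of P m l d])
    show "finite P" by (rule V.finP)
    show "0 < l i" if i: "i < m" for i
    proof -
      have "?A (e i) (e i) = l i" using l[OF i eV[OF i]] on[OF i i] by simp
      moreover have "l2_norm \<Omega> (e i) \<noteq> 0" using on[OF i i] by (simp add: l2_norm_def)
      ultimately show ?thesis using pos VH0[OF eV[OF i]] by (auto simp: positive_definite_operator_def)
    qed
    show "(\<Sum>p\<in>P. d i p * discrete_op \<Omega> a q \<T> v p) = l i * (\<Sum>p\<in>P. d i p * v p)" if i: "i < m" and v: "v \<in> ?V" for i v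
    proof -
      have "(\<Sum>p\<in>P. d i p * discrete_op \<Omega> a q \<T> v p) = ?A v (e i)"
        unfolding disc[OF v] d[OF i lin] by (rule coord[OF i])
      also have "\<dots> = l i * ?ip v (e i)" using l[OF i v] form_sym[of v] l2_inner_sym[of v] by simp
      finally show ?thesis using d[OF i v] by simp
    qed
    show "(\<Sum>i<m. (\<Sum>p\<in>P. d i p * l2_proj \<Omega> \<T> w p)\<^sup>2) \<le> ?ip w w" if w: "w \<in> L2 \<Omega>" for w
    proof -
      have "(\<Sum>i<m. (\<Sum>p\<in>P. d i p * l2_proj \<Omega> \<T> w p)\<^sup>2) = (\<Sum>i<m. (?ip w (e i))\<^sup>2)" using c_proj w by simp
      also have "\<dots> \<le> ?ip w w" by (rule bessel) (use w VL eV on in auto)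
      finally show ?thesis .
    qed
    show "?ip v v = (\<Sum>i<m. (\<Sum>p\<in>P. d i p * v p)\<^sup>2)" if v: "v \<in> ?V" for v
      using V.parseval[OF e ex v] d v by simp
    have z: "?ip (\<lambda>x. 0) v = 0" for v by (simp add: l2_inner_def)
    show "l2_proj \<Omega> \<T> (\<lambda>x. 0) = (\<lambda>x. 0)" using proj[OF VL[OF V.zero]] by (simp add: z)
    show "(\<lambda>x. u x - v x) \<in> ?V" if "u \<in> ?V" "v \<in> ?V" for u v using that by (rule V.diff)
  qed
qed

text \<open>A finite combination of point values commutes with \<open>deriv\<close> and with the
  Caputo integral, so each coordinate solves the scalar equation with its eigenvalue.\<close>

lemma semidiscrete_coordinate:
  assumes \<alpha>: "0 < \<alpha>" "\<alpha> < 1"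
    and sol: "semidiscrete_solution \<alpha> \<Omega> a q \<T> (\<lambda>t x. 0) u0 u"
    and proj0: "l2_proj \<Omega> \<T> (\<lambda>x. 0) = (\<lambda>x. 0)" and l: "0 < l"
    and disc: "\<And>v. v \<in> fe_space \<Omega> \<T> \<Longrightarrow> (\<Sum>p\<in>P. d p * discrete_op \<Omega> a q \<T> v p) = l * (\<Sum>p\<in>P. d p * v p)"
    and t: "0 \<le> t"
  shows "(\<Sum>p\<in>P. d p * u t p) = (\<Sum>p\<in>P. d p * l2_proj \<Omega> \<T> u0 p) * ml_fun \<alpha> l t"
proof -
  define c where "c = (\<lambda>t. \<Sum>p\<in>P. d p * u t p)"
  have fe: "\<And>t. 0 \<le> t \<Longrightarrow> u t \<in> fe_space \<Omega> \<T>" and u0: "u 0 = l2_proj \<Omega> \<T> u0"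
    and cont: "\<And>x. continuous_on {0..} (\<lambda>t. u t x)"
    and diff: "\<And>x t. 0 < t \<Longrightarrow> (\<lambda>s. u s x) differentiable (at t)"
    and cex: "\<And>x t. 0 < t \<Longrightarrow> caputo_exists \<alpha> (\<lambda>s. u s x) t"
    and eq: "\<And>x t. 0 < t \<Longrightarrow> caputo \<alpha> (\<lambda>s. u s x) t = - discrete_op \<Omega> a q \<T> (u t) x"
    using sol by (auto simp: semidiscrete_solution_def proj0 eq_neg_iff_add_eq_0)
  have der: "(c has_real_derivative (\<Sum>p\<in>P. d p * deriv (\<lambda>s. u s p) t)) (at t)" if "0 < t" for t
    unfolding c_def
  proof (rule DERIV_sum)
    fix p
    have "((\<lambda>s. u s p) has_real_derivative deriv (\<lambda>s. u s p) t) (at t)"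
      using diff[OF that, of p] by (simp add: DERIV_deriv_iff_real_differentiable)
    thus "((\<lambda>s. d p * u s p) has_real_derivative d p * deriv (\<lambda>s. u s p) t) (at t)" by (rule DERIV_cmult)
  qed
  define K where "K = (\<lambda>t p \<zeta>. indicator {0<..<t} \<zeta> *\<^sub>R ((t - \<zeta>) powr - \<alpha> * deriv (\<lambda>s. u s p) \<zeta>))"
  have kern: "indicator {0<..<t} \<zeta> *\<^sub>R ((t - \<zeta>) powr - \<alpha> * deriv c \<zeta>)
    = (\<Sum>p\<in>P. d p * K t p \<zeta>)" for t \<zeta>
  proof (cases "\<zeta> \<in> {0<..<t}")
    case True
    thus ?thesis using DERIV_imp_deriv[OF der[of \<zeta>]] by (simp add: K_def sum_distrib_left mult_ac)
  qed (simp add: K_def)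
  have int: "integrable lborel (K t p)" if "0 < t" for t p
    using cex[OF that, of p] by (simp add: caputo_exists_def set_integrable_def K_def)
  have "c t = c 0 * ml_fun \<alpha> l t"
  proof (rule caputo_solution_unique[OF \<alpha> l])
    show "continuous_on {0..} c" unfolding c_def by (intro continuous_intros cont)
    fix t :: real assume t: "0 < t"
    show "c differentiable (at t)" using der[OF t] real_differentiable_def by blast
    show "caputo_exists \<alpha> c t"
      unfolding caputo_exists_def set_integrable_def kern
      by (intro Bochner_Integration.integrable_sum integrable_mult_right int t)
    have "caputo \<alpha> c t = 1 / Gamma (1 - \<alpha>) * (\<Sum>p\<in>P. d p * (LINT \<zeta>|lborel. K t p \<zeta>))"
      unfolding caputo_def set_lebesgue_integral_def kern
      using int[OF t] by (simp add: Bochner_Integration.integral_sum)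
    also have "\<dots> = (\<Sum>p\<in>P. d p * caputo \<alpha> (\<lambda>s. u s p) t)"
      by (simp add: caputo_def set_lebesgue_integral_def K_def sum_distrib_left mult_ac)
    also have "\<dots> = - (\<Sum>p\<in>P. d p * discrete_op \<Omega> a q \<T> (u t) p)" using eq[OF t] by (simp add: sum_negf)
    also have "\<dots> = - l * c t" using disc[OF fe] t by (simp add: c_def)
    finally show "caputo \<alpha> c t = - l * c t" .
  qed (rule t)
  thus ?thesis by (simp add: c_def u0)
qed

text \<open>The monomial is homogeneous of degree \<open>2-\<alpha>\<close>, and the difference
  quotient costs one power of \<open>\<tau>\<close>. The value \<open>0\<close> of the monomial at
  nonpositive times agrees with the power series, which has no coefficients of negative
  index.\<close>

lemma bdf2_frac_monomial:
  assumes "0 < \<tau>"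
  shows "bdf2 \<tau> (frac_monomial \<alpha>) (real k * \<tau>) =
    \<tau> powr (1 - \<alpha>) * fps_nth (bdf_fps * Abs_fps (frac_grid \<alpha>)) k"
proof -
  define g where "g = frac_grid \<alpha>"
  have f: "frac_monomial \<alpha> (real j * \<tau>) = \<tau> powr (2 - \<alpha>) * g j" for j
    using assms by (simp add: frac_monomial_def frac_grid_def g_def mult_le_0_iff powr_mult)
  have p: "\<tau> powr (2 - \<alpha>) = \<tau> * \<tau> powr (1 - \<alpha>)"
    using assms powr_add[of \<tau> 1 "1 - \<alpha>"] by simp
  have f1: "frac_monomial \<alpha> (real k * \<tau> - \<tau>) = \<tau> powr (2 - \<alpha>) * (if k \<ge> 1 then g (k - 1) else 0)"
  proof (cases "k \<ge> 1")
    case True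
    hence "real k * \<tau> - \<tau> = real (k - 1) * \<tau>" by (simp add: of_nat_diff algebra_simps)
    thus ?thesis using True by (simp only: f if_True)
  qed (use assms in \<open>auto simp: frac_monomial_def not_le\<close>)
  have f2: "frac_monomial \<alpha> (real k * \<tau> - 2 * \<tau>) = \<tau> powr (2 - \<alpha>) * (if k \<ge> 2 then g (k - 2) else 0)"
  proof (cases "k \<ge> 2")
    case True
    hence "real k * \<tau> - 2 * \<tau> = real (k - 2) * \<tau>" by (simp add: of_nat_diff algebra_simps)
    thus ?thesis using True by (simp only: f if_True)
  next
    case False
    hence "real k * \<tau> \<le> 2 * \<tau>" using assms by (intro mult_right_mono) auto
    thus ?thesis using False by (simp add: frac_monomial_def)
  qed
  show ?thesis unfolding bdf2_def f f1 f2 g_def[symmetric] bdf_fps_nth p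
    using assms by (auto simp: field_simps)
qed

text \<open>Multiplying the scheme by \<open>\<tau> powr \<alpha>\<close> and dividing the
  coordinate by \<open>\<tau> * c\<close> normalizes step size and initial value to \<open>1\<close>
  and turns the eigenvalue into \<open>l * \<tau> powr \<alpha>\<close>. When \<open>c = 0\<close>
  this normalization is impossible, and the coordinate is shown to vanish instead.\<close>

lemma CN_coordinate:
  assumes \<alpha>: "0 < \<alpha>" "\<alpha> < 1" and \<tau>: "0 < \<tau>"
    and sol: "CN_I_solution \<alpha> \<Omega> a q \<T> (\<lambda>t x. 0) u0 \<tau> N U u"
    and proj0: "l2_proj \<Omega> \<T> (\<lambda>x. 0) = (\<lambda>x. 0)" and l: "0 < l" and zero: "(\<lambda>x. 0) \<in> fe_space \<Omega> \<T>"
    and disc: "\<And>v. v \<in> fe_space \<Omega> \<T> \<Longrightarrow> (\<Sum>p\<in>P. d p * discrete_op \<Omega> a q \<T> v p) = l * (\<Sum>p\<in>P. d p * v p)"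
    and n: "1 \<le> n" "n \<le> N"
  defines "c \<equiv> \<Sum>p\<in>P. d p * l2_proj \<Omega> \<T> u0 p"
  obtains V where "c \<noteq> 0 \<longrightarrow> scalar_CN \<alpha> (l * \<tau> powr \<alpha>) N V"
    "(\<Sum>p\<in>P. d p * u (int n) p) = c * fps_nth (bdf_fps * Abs_fps V) n"
proof -
  define y where "y = (\<lambda>j::nat. \<Sum>p\<in>P. d p * U (int j) p)"
  have U0: "U k = (\<lambda>x. 0)" if "k \<le> 0" for k using sol that by (simp add: CN_I_solution_def)
  have y0: "y 0 = 0" by (simp add: y_def U0)
  have fe: "U (int j) \<in> fe_space \<Omega> \<T>" if "j \<le> N" for j
  proof (cases "j = 0")
    case False
    thus ?thesis using sol that by (auto simp: CN_I_solution_def)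
  qed (use zero U0[of 0] in simp)
  have load: "load_integral \<Omega> \<T> (\<lambda>t x. 0) t x = 0" for t x
    by (simp add: load_integral_def proj0 set_lebesgue_integral_def)
  define B where "B = (\<lambda>m. fps_nth (bdf_fps * Abs_fps (frac_grid \<alpha>)) m)"
  have bd: "bdf2 \<tau> (frac_monomial \<alpha>) (real k * \<tau>) = \<tau> powr (1 - \<alpha>) * B k" for k
    unfolding B_def by (rule bdf2_frac_monomial[OF \<tau>])
  have eq: "\<tau> powr (- \<alpha>) * (\<Sum>j=0..m. cq_weight \<alpha> j * y (m - j)) + l * ((1 - \<alpha> / 2) * y m + \<alpha> / 2 * y (m - 1))
    = \<tau> powr (1 - \<alpha>) * ((1 - \<alpha> / 2) * B m + \<alpha> / 2 * B (m - 1)) * c" if m: "1 \<le> m" "m \<le> N" for m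
  proof -
    have i1: "int m - 1 = int (m - 1)" using m by simp
    have "\<tau> powr (- \<alpha>) * (\<Sum>j=0..m. cq_weight \<alpha> j * U (int (m - j)) x)
       + (1 - \<alpha> / 2) * discrete_op \<Omega> a q \<T> (U (int m)) x + \<alpha> / 2 * discrete_op \<Omega> a q \<T> (U (int (m - 1))) x
      = (1 - \<alpha> / 2) * (\<tau> powr (1 - \<alpha>) * B m) * l2_proj \<Omega> \<T> u0 x
        + \<alpha> / 2 * (\<tau> powr (1 - \<alpha>) * B (m - 1)) * l2_proj \<Omega> \<T> u0 x" for x
    proof -
      have "(\<Sum>j=0..m. cq_weight \<alpha> j * U (int m - int j) x) = (\<Sum>j=0..m. cq_weight \<alpha> j * U (int (m - j)) x)"
        by (intro sum.cong) (auto simp: of_nat_diff)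
      note s = this
      have "int m \<in> {1..int N}" using m by auto
      note E = bspec[OF conjunct2[OF sol[unfolded CN_I_solution_def]] this, THEN conjunct2, THEN conjunct2, THEN conjunct1, rule_format, of x]
      show ?thesis using E unfolding load i1 of_int_of_nat_eq bd nat_int s by simp
    qed
    hence "(\<Sum>p\<in>P. d p * (\<tau> powr (- \<alpha>) * (\<Sum>j=0..m. cq_weight \<alpha> j * U (int (m - j)) p)
       + (1 - \<alpha> / 2) * discrete_op \<Omega> a q \<T> (U (int m)) p + \<alpha> / 2 * discrete_op \<Omega> a q \<T> (U (int (m - 1))) p))
      = (\<Sum>p\<in>P. d p * ((1 - \<alpha> / 2) * (\<tau> powr (1 - \<alpha>) * B m) * l2_proj \<Omega> \<T> u0 p
        + \<alpha> / 2 * (\<tau> powr (1 - \<alpha>) * B (m - 1)) * l2_proj \<Omega> \<T> u0 p))" by simp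
    also have "\<dots> = \<tau> powr (1 - \<alpha>) * ((1 - \<alpha> / 2) * B m + \<alpha> / 2 * B (m - 1)) * c"
      unfolding c_def sum_distrib_left by (intro sum.cong) (auto simp: algebra_simps)
    also have "(\<Sum>p\<in>P. d p * (\<tau> powr (- \<alpha>) * (\<Sum>j=0..m. cq_weight \<alpha> j * U (int (m - j)) p)
       + (1 - \<alpha> / 2) * discrete_op \<Omega> a q \<T> (U (int m)) p + \<alpha> / 2 * discrete_op \<Omega> a q \<T> (U (int (m - 1))) p))
      = \<tau> powr (- \<alpha>) * (\<Sum>p\<in>P. \<Sum>j=0..m. cq_weight \<alpha> j * (d p * U (int (m - j)) p))
        + (1 - \<alpha> / 2) * (\<Sum>p\<in>P. d p * discrete_op \<Omega> a q \<T> (U (int m)) p) + \<alpha> / 2 * (\<Sum>p\<in>P. d p * discrete_op \<Omega> a q \<T> (U (int (m - 1))) p)"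
      by (simp add: distrib_left sum.distrib sum_distrib_left mult.left_commute)
    also have "(\<Sum>p\<in>P. \<Sum>j=0..m. cq_weight \<alpha> j * (d p * U (int (m - j)) p)) = (\<Sum>j=0..m. cq_weight \<alpha> j * y (m - j))"
      unfolding y_def sum_distrib_left by (rule sum.swap)
    also have "(\<Sum>p\<in>P. d p * discrete_op \<Omega> a q \<T> (U (int m)) p) = l * y m"
      unfolding y_def by (intro disc fe m)
    also have "(\<Sum>p\<in>P. d p * discrete_op \<Omega> a q \<T> (U (int (m - 1))) p) = l * y (m - 1)"
      unfolding y_def by (intro disc fe) (use m in simp)
    finally show ?thesis by (simp add: algebra_simps)
  qed
  have "int n \<in> {1..int N}" using n by auto
  hence un: "u (int n) x = 1 / \<tau> * (3 / 2 * U (int n) x - 2 * U (int n - 1) x + 1 / 2 * U (int n - 2) x)" for x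
    using sol unfolding CN_I_solution_def by blast
  have y1: "(\<Sum>p\<in>P. d p * U (int n - 1) p) = (if n \<ge> 1 then y (n - 1) else 0)" using n by (simp add: y_def of_nat_diff)
  have y2: "(\<Sum>p\<in>P. d p * U (int n - 2) p) = (if n \<ge> 2 then y (n - 2) else 0)"
    by (simp add: y_def of_nat_diff U0)
  have "(\<Sum>p\<in>P. d p * u (int n) p) = (\<Sum>p\<in>P. 1 / \<tau> * (3 / 2 * (d p * U (int n) p) - 2 * (d p * U (int n - 1) p) + 1 / 2 * (d p * U (int n - 2) p)))"
    unfolding un by (intro sum.cong) (auto simp: algebra_simps)
  also have "\<dots> = 1 / \<tau> * (3 / 2 * (\<Sum>p\<in>P. d p * U (int n) p) - 2 * (\<Sum>p\<in>P. d p * U (int n - 1) p) + 1 / 2 * (\<Sum>p\<in>P. d p * U (int n - 2) p))"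
    by (simp only: sum_distrib_left[symmetric] sum.distrib sum_subtractf)
  also have "\<dots> = 1 / \<tau> * fps_nth (bdf_fps * Abs_fps y) n"
    unfolding bdf_fps_nth y1 y2 by (simp add: y_def)
  finally have uy: "(\<Sum>p\<in>P. d p * u (int n) p) = 1 / \<tau> * fps_nth (bdf_fps * Abs_fps y) n" .
  show ?thesis
  proof (cases "c = 0")
    case True
    have "m \<le> N \<Longrightarrow> y m = 0" for m
    proof (induction m rule: less_induct)
      case (less m)
      show ?case
      proof (cases "m = 0")
        case False
        \<comment> \<open>All earlier values vanish, so only the term \<open>j = 0\<close> remains,
          and the total factor in front of \<open>y m\<close> is positive.\<close>
        have "(\<Sum>j=0..m. cq_weight \<alpha> j * y (m - j)) = (\<Sum>j=0..m. if j = 0 then y m else 0)"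
          using less False by (intro sum.cong) auto
        also have "\<dots> = y m" by simp
        finally have "(\<tau> powr (- \<alpha>) + l * (1 - \<alpha> / 2)) * y m = 0"
          using eq[of m] less False True by (simp add: algebra_simps)
        moreover have "0 < \<tau> powr (- \<alpha>) + l * (1 - \<alpha> / 2)" using \<tau> \<alpha> l by (intro add_pos_pos) auto
        ultimately show ?thesis by simp
      qed (simp add: y0)
    qed
    hence "fps_nth (bdf_fps * Abs_fps y) n = 0" using n by (simp add: bdf_fps_nth)
    \<comment> \<open>Both sides are \<open>0\<close>, so any sequence serves as
      \<open>V\<close>.\<close>
    thus ?thesis using True uy by (intro that[of "\<lambda>_. 0"]) auto
  next
    case False
    define V where "V = (\<lambda>j. y j / (\<tau> * c))"
    have yV: "y j = \<tau> * c * V j" for j using False \<tau> by (simp add: V_def)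
    have pw: "\<tau> powr \<alpha> * \<tau> powr (- \<alpha>) = 1" "\<tau> powr \<alpha> * \<tau> powr (1 - \<alpha>) = \<tau>"
      using \<tau> by (simp_all flip: powr_add)
    show ?thesis
    proof (rule that[of V])
      show "(\<Sum>p\<in>P. d p * u (int n) p) = c * fps_nth (bdf_fps * Abs_fps V) n"
        unfolding uy bdf_fps_nth using \<tau> by (simp add: yV field_simps)
      have key: "\<tau> * c * (S + l * \<tau> powr \<alpha> * X) = \<tau> powr \<alpha> * (\<tau> powr (- \<alpha>) * (\<tau> * c * S) + l * (\<tau> * c * X))" for S X
      proof -
        have "\<tau> powr \<alpha> * (\<tau> powr (- \<alpha>) * (\<tau> * c * S)) = \<tau> * c * S" using pw(1) by (simp add: mult.assoc[symmetric])
        thus ?thesis by (simp only: distrib_left) (simp only: mult_ac)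
      qed
      have "(\<Sum>j=0..m. cq_weight \<alpha> j * V (m - j)) + l * \<tau> powr \<alpha> * ((1 - \<alpha> / 2) * V m + \<alpha> / 2 * V (m - 1))
        = (1 - \<alpha> / 2) * B m + \<alpha> / 2 * B (m - 1)" (is "?L = ?R") if m: "1 \<le> m" "m \<le> N" for m
      proof -
        have s: "\<tau> * c * (\<Sum>j=0..m. cq_weight \<alpha> j * V (m - j)) = (\<Sum>j=0..m. cq_weight \<alpha> j * y (m - j))"
          unfolding sum_distrib_left yV by (intro sum.cong) auto
        have x: "\<tau> * c * ((1 - \<alpha> / 2) * V m + \<alpha> / 2 * V (m - 1)) = (1 - \<alpha> / 2) * y m + \<alpha> / 2 * y (m - 1)"
          unfolding yV by (simp add: algebra_simps)
        have "\<tau> * c * ?L = \<tau> powr \<alpha> * (\<tau> powr (1 - \<alpha>) * ?R * c)" unfolding key s x eq[OF m] ..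
        also have "\<dots> = (\<tau> powr \<alpha> * \<tau> powr (1 - \<alpha>)) * ?R * c" by (simp only: mult.assoc)
        also have "\<dots> = \<tau> * c * ?R" unfolding pw(2) by simp
        finally show ?thesis using False \<tau> by simp
      qed
      thus "c \<noteq> 0 \<longrightarrow> scalar_CN \<alpha> (l * \<tau> powr \<alpha>) N V" by (simp add: scalar_CN_def V_def y0 B_def)
    qed
  qed
qed

text \<open>Each eigencoordinate of the error is at most \<open>C / n^2\<close> times that of the
  projected initial value; Parseval on the left and Bessel on the right reassemble the norms. The
  stated form follows since \<open>\<tau>^2 * t_n^(-2) = 1 / n^2\<close>.\<close>

theorem theorem3p1:
  fixes \<alpha> T \<kappa> :: real
    and \<Omega> :: "(real ^ 'n) set"
    and a :: "real ^ 'n \<Rightarrow> real ^ 'n ^ 'n"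
    and q :: "real ^ 'n \<Rightarrow> real"
  assumes "CARD('n) = 1 \<or> CARD('n) = 2"
    and "0 < \<alpha>" and "\<alpha> < 1" and "0 < T"
    and "bounded_domain \<Omega>"
    and "elliptic_operator \<Omega> a q"
    and "positive_definite_operator \<Omega> a q"
  shows "\<exists>c>0. \<forall>h \<T> u0 N \<tau> u\<^sub>h U u n.
           regular_triangulation \<Omega> \<kappa> h \<T> \<longrightarrow>
           u0 \<in> L2 \<Omega> \<longrightarrow>
           1 \<le> N \<longrightarrow> \<tau> = T / real N \<longrightarrow>
           semidiscrete_solution \<alpha> \<Omega> a q \<T> (\<lambda>t x. 0) u0 u\<^sub>h \<longrightarrow>
           CN_I_solution \<alpha> \<Omega> a q \<T> (\<lambda>t x. 0) u0 \<tau> N U u \<longrightarrow>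
           n \<in> {1..N} \<longrightarrow>
           l2_norm \<Omega> (\<lambda>x. u\<^sub>h (real n * \<tau>) x - u (int n) x)
             \<le> c * \<tau>\<^sup>2 * (real n * \<tau>) powi (-2) * l2_norm \<Omega> u0"
proof -
  \<comment> \<open>The constant is fixed before mesh, step size and data are introduced; it comes
    from the scalar estimate and depends on \<open>\<alpha>\<close> only.\<close>
  obtain C where C: "0 < C" and est: "\<And>\<mu> N U n. 0 < \<mu> \<Longrightarrow> scalar_CN \<alpha> \<mu> N U \<Longrightarrow> 1 \<le> n \<Longrightarrow> n \<le> N \<Longrightarrow>
      \<bar>fps_nth (bdf_fps * Abs_fps U) n - ml_fun \<alpha> \<mu> (real n)\<bar> \<le> C / (real n)\<^sup>2"
    by (rule scalar_CN_estimate[OF assms(2,3)]) blast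
  interpret elliptic \<Omega> a q
    by unfold_locales (use assms in \<open>auto simp: bounded_domain_def\<close>)
  show ?thesis
  proof (intro exI[of _ C] conjI allI impI)
    fix h \<T> u0 N \<tau> u\<^sub>h U u n
    assume tri: "regular_triangulation \<Omega> \<kappa> h \<T>" and u0: "u0 \<in> L2 \<Omega>" and N: "1 \<le> N" and \<tau>_def: "\<tau> = T / real N"
      and semi: "semidiscrete_solution \<alpha> \<Omega> a q \<T> (\<lambda>t x. 0) u0 u\<^sub>h"
      and cn: "CN_I_solution \<alpha> \<Omega> a q \<T> (\<lambda>t x. 0) u0 \<tau> N U u" and n: "n \<in> {1..N}"
    have \<tau>: "0 < \<tau>" using assms N by (simp add: \<tau>_def)
    obtain m :: nat and P d l where fin: "finite P" and l: "\<And>i. i < m \<Longrightarrow> 0 < l i"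
      and disc: "\<And>i v. i < m \<Longrightarrow> v \<in> fe_space \<Omega> \<T> \<Longrightarrow> (\<Sum>p\<in>P. d i p * discrete_op \<Omega> a q \<T> v p) = l i * (\<Sum>p\<in>P. d i p * v p)"
      and bess: "\<And>w. w \<in> L2 \<Omega> \<Longrightarrow> (\<Sum>i<m. (\<Sum>p\<in>P. d i p * l2_proj \<Omega> \<T> w p)\<^sup>2) \<le> l2_inner \<Omega> w w"
      and pars: "\<And>v. v \<in> fe_space \<Omega> \<T> \<Longrightarrow> l2_inner \<Omega> v v = (\<Sum>i<m. (\<Sum>p\<in>P. d i p * v p)\<^sup>2)"
      and proj0: "l2_proj \<Omega> \<T> (\<lambda>x. 0) = (\<lambda>x. 0)"
      and diffV: "\<And>u v. u \<in> fe_space \<Omega> \<T> \<Longrightarrow> v \<in> fe_space \<Omega> \<T> \<Longrightarrow> (\<lambda>x. u x - v x) \<in> fe_space \<Omega> \<T>"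
      by (rule spectral_functionals[OF tri assms(7)]) blast
    define r where "r = (\<lambda>x. u\<^sub>h (real n * \<tau>) x - u (int n) x)"
    have uV: "u\<^sub>h (real n * \<tau>) \<in> fe_space \<Omega> \<T>" using semi \<tau> by (simp add: semidiscrete_solution_def)
    have "int n \<in> {1..int N}" using n by auto
    hence cV: "u (int n) \<in> fe_space \<Omega> \<T>" using cn unfolding CN_I_solution_def by blast
    have zV: "(\<lambda>x. 0) \<in> fe_space \<Omega> \<T>" using diffV[OF uV uV] by simp
    have rV: "r \<in> fe_space \<Omega> \<T>" unfolding r_def by (rule diffV[OF uV cV])
    define c where "c = (\<lambda>i. \<Sum>p\<in>P. d i p * l2_proj \<Omega> \<T> u0 p)"
    have coord: "(\<Sum>p\<in>P. d i p * r p)\<^sup>2 \<le> (C / (real n)\<^sup>2)\<^sup>2 * (c i)\<^sup>2" if i: "i < m" for i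
    proof -
      define \<mu> where "\<mu> = l i * \<tau> powr \<alpha>"
      have \<mu>: "0 < \<mu>" using l[OF i] \<tau> by (simp add: \<mu>_def)
      have n': "1 \<le> n" "n \<le> N" using n by auto
      have "(\<Sum>p\<in>P. d i p * u\<^sub>h (real n * \<tau>) p) = c i * ml_fun \<alpha> (l i) (real n * \<tau>)"
        unfolding c_def by (rule semidiscrete_coordinate[OF assms(2,3) semi proj0 l[OF i] disc[OF i]]) (use \<tau> in auto)
      also have "ml_fun \<alpha> (l i) (real n * \<tau>) = ml_fun \<alpha> \<mu> (real n)"
        using ml_fun_scale[OF \<tau> l[OF i], where \<alpha>=\<alpha> and t="real n"] by (simp add: \<mu>_def mult.commute)
      finally have h: "(\<Sum>p\<in>P. d i p * u\<^sub>h (real n * \<tau>) p) = c i * ml_fun \<alpha> \<mu> (real n)" .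
      obtain V where V: "c i \<noteq> 0 \<longrightarrow> scalar_CN \<alpha> \<mu> N V"
        "(\<Sum>p\<in>P. d i p * u (int n) p) = c i * fps_nth (bdf_fps * Abs_fps V) n"
        unfolding c_def \<mu>_def
        by (rule CN_coordinate[OF assms(2,3) \<tau> cn proj0 l[OF i] zV disc[OF i] n'])
      have "(\<Sum>p\<in>P. d i p * r p) = c i * (ml_fun \<alpha> \<mu> (real n) - fps_nth (bdf_fps * Abs_fps V) n)"
        using h V(2) by (simp add: r_def right_diff_distrib sum_subtractf)
      hence "\<bar>\<Sum>p\<in>P. d i p * r p\<bar> = \<bar>fps_nth (bdf_fps * Abs_fps V) n - ml_fun \<alpha> \<mu> (real n)\<bar> * \<bar>c i\<bar>"
        by (simp add: abs_mult abs_minus_commute)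
      also have "\<dots> \<le> C / (real n)\<^sup>2 * \<bar>c i\<bar>"
      proof (cases "c i = 0")
        case False
        show ?thesis by (intro mult_right_mono est[OF \<mu> V(1)[rule_format, OF False] n']) auto
      qed simp
      finally have "\<bar>\<Sum>p\<in>P. d i p * r p\<bar>\<^sup>2 \<le> (C / (real n)\<^sup>2 * \<bar>c i\<bar>)\<^sup>2" by (intro power_mono) auto
      thus ?thesis unfolding power_mult_distrib power2_abs .
    qed
    have "l2_inner \<Omega> r r \<le> (\<Sum>i<m. (C / (real n)\<^sup>2)\<^sup>2 * (c i)\<^sup>2)"
      unfolding pars[OF rV] by (intro sum_mono coord) auto
    also have "\<dots> \<le> (C / (real n)\<^sup>2)\<^sup>2 * l2_inner \<Omega> u0 u0"
      unfolding sum_distrib_left[symmetric] c_def by (intro mult_left_mono bess u0) auto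
    finally have "l2_norm \<Omega> r \<le> sqrt ((C / (real n)\<^sup>2)\<^sup>2 * l2_inner \<Omega> u0 u0)"
      unfolding l2_norm_def by (rule real_sqrt_le_mono)
    also have "\<dots> = C / (real n)\<^sup>2 * l2_norm \<Omega> u0" using C by (simp add: l2_norm_def real_sqrt_mult)
    also have "C / (real n)\<^sup>2 = C * \<tau>\<^sup>2 * (real n * \<tau>) powi (-2)"
      using \<tau> n by (simp add: power_int_minus power_mult_distrib field_simps)
    finally show "l2_norm \<Omega> (\<lambda>x. u\<^sub>h (real n * \<tau>) x - u (int n) x) \<le> C * \<tau>\<^sup>2 * (real n * \<tau>) powi (-2) * l2_norm \<Omega> u0"
      by (simp add: r_def)
  qed (rule C)
qed

end
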